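(* For $\tau\in\mathcal H$ let $u_\tau(x,y)=\dfrac{\theta_1(x,\tau)}{\theta_4(x,\tau)}\,\dfrac{\theta_1(y,\tau)}{\theta_4(y,\tau)}$, a meromorphic function on $\mathbb C^2$. (1) For every $\tau\in\mathcal H$ and every point $(x_0,y_0)\in\mathbb C^2$ at which $u_\tau$ is holomorphic and satisfies the transversality condition (T), the germ at $(x_0,y_0)$ of the 5-web $\mathcal T[u_\tau]$ is exceptional. (2) For $\tau,\tau'\in\mathcal H$, the webs associated with $\tau$ and $\tau'$ are equivalent if and only if $\tau$ and $\tau'$ are congruent modulo the group $G$ of automorphisms of $\mathcal H$ generated by $\tau\mapsto\tau+2$, $\tau\mapsto \tau/(\tau+1)$ and $\tau\mapsto -2/\tau$. Precisely: (a) if $\tau$ and $\tau'$ lie in the same $G$-orbit, there is $\phi\in\mathrm{Sym}(\mathcal T_0)$ such that $du_\tau\wedge d(u_{\tau'}\circ\phi)\equiv 0$, i.e. $\phi$ maps the (singular) web $\mathcal T[u_\tau]$ onto the (singular) web $\mathcal T[u_{\tau'}]$; (b) if some germ of $\mathcal T[u_\tau]$ and some germ of $\mathcal T[u_{\tau'}]$, at points where the respective functions are holomorphic and satisfy (T), are equivalent, then $\tau$ and $\tau'$ lie in the same $G$-orbit.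
   Context: Everything is local and complex-analytic: function means germ of holomorphic function at a base point $(x_0,y_0)\in\mathbb C^2$; local diffeomorphism means germ of biholomorphism. If $du(x_0,y_0)\ne0$, $\mathcal F(u)$ is the germ of foliation whose leaves are the level curves of $u$. For $d\ge 3$, a $d$-web $\mathcal T(u_1,\dots,u_d)$ at $(x_0,y_0)$ is an unordered family of $d$ foliations $\mathcal F(u_1),\dots,\mathcal F(u_d)$ with $du_j\wedge du_k\neq0$ at $(x_0,y_0)$ for $j\ne k$. Two germs of $d$-webs (at possibly different points) are equivalent if a local diffeomorphism sends one onto the other. The rank of the web is the dimension of the complex vector space of tuples of one-variable germs $(\phi_1,\dots,\phi_d)$ ($\phi_j$ at $u_j(x_0,y_0)$) with $\sum_j\phi_j(u_j)\,du_j=0$; it is at most $(d-1)(d-2)/2$, and the web has maximal rank if equality holds. Algebraic webs: let $C$ be a reduced algebraic curve of degree $d$ in the dual projective plane $\check{\mathbb P}\mathbb C^2$; a point $p\in\check{\mathbb P}\mathbb C^2$ represents a line $l(p)\subset\mathbb P\mathbb C^2$, and a point $z\in \mathbb P\mathbb C^2$ gives the line $l_z\subset\check{\mathbb P}\mathbb C^2$ of lines through $z$. If $l_{z_0}$ meets $C$ in $d$ distinct points, then for $z$ near $z_0$ the points $p_1(z),\dots,p_d(z)$ of $l_z\cap C$ give $d$ lines $l(p_j(z))$ through $z$, defining a germ of $d$-web at $z_0$ (leaves are pieces of lines). A web is algebraic if obtained in this way, algebraizable if equivalent to an algebraic web, and exceptional if it has maximal rank and is not algebraizable. $\mathcal T_0=\mathcal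 T(x,y,x+y,x-y)$ and $\mathcal T[u]=\mathcal T(x,y,x+y,x-y,u(x,y))$. Transversality condition (T) at $(x_0,y_0)$: $u_xu_y(u_x^2-u_y^2)\neq0$ at $(x_0,y_0)$. $\mathrm{Sym}(\mathcal T_0)$ is the group of projective transformations of $\mathbb P\mathbb C^2$ preserving $\mathcal T_0$ (i.e. permuting its four pencils of parallel lines); its elements are affine maps of $\mathbb C^2$. $\mathcal H=\{\tau\in\mathbb C:\operatorname{Im}\tau>0\}$, $q=e^{i\pi\tau}$ (and $q^s:=e^{i\pi\tau s}$), and $\theta_1(x,\tau)=-i\sum_{n\in\mathbb Z}(-1)^nq^{(n+1/2)^2}e^{i(2n+1)x}$, $\theta_4(x,\tau)=\sum_{n\in\mathbb Z}(-1)^nq^{n^2}e^{2inx}$. *)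

theory Defs
  imports
    "HOL-Complex_Analysis.Complex_Analysis"
    "HOL-Algebra.Bij"
    "HOL-Algebra.Generated_Groups"
    "HOL-Library.Function_Algebras"
begin

section \<open>Holomorphic functions and local diffeomorphisms on \<open>\<complex>\<^sup>2\<close>\<close>

type_synonym C2 = "complex \<times> complex"

text \<open>Germs at a point are represented by total functions, of which only the values near the
  point matter.  Holomorphic means complex differentiable on a neighbourhood.\<close>

definition holo2_on :: "(C2 \<Rightarrow> complex) \<Rightarrow> C2 set \<Rightarrow> bool" where
  "holo2_on u U \<longleftrightarrow>
     (\<forall>p\<in>U. \<exists>a b. (u has_derivative (\<lambda>h. a * fst h + b * snd h)) (at p))"

definition holo2_at :: "(C2 \<Rightarrow> complex) \<Rightarrow> C2 \<Rightarrow> bool" where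
  "holo2_at u p \<longleftrightarrow> (\<exists>U. open U \<and> p \<in> U \<and> holo2_on u U)"

definition dx :: "(C2 \<Rightarrow> complex) \<Rightarrow> C2 \<Rightarrow> complex" where
  "dx u p = deriv (\<lambda>t. u (t, snd p)) (fst p)"

definition dy :: "(C2 \<Rightarrow> complex) \<Rightarrow> C2 \<Rightarrow> complex" where
  "dy u p = deriv (\<lambda>t. u (fst p, t)) (snd p)"

text \<open>The coefficient of \<open>du \<and> dv\<close> with respect to \<open>dx \<and> dy\<close>.\<close>

definition wedge :: "(C2 \<Rightarrow> complex) \<Rightarrow> (C2 \<Rightarrow> complex) \<Rightarrow> C2 \<Rightarrow> complex" where
  "wedge u v p = dx u p * dy v p - dy u p * dx v p"

definition local_diffeo_at :: "(C2 \<Rightarrow> C2) \<Rightarrow> C2 \<Rightarrow> bool" where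
  "local_diffeo_at \<psi> p \<longleftrightarrow>
     (\<exists>U V \<xi>. open U \<and> open V \<and> p \<in> U \<and> \<psi> ` U = V \<and> (\<forall>z\<in>U. \<xi> (\<psi> z) = z) \<and>
        holo2_on (fst \<circ> \<psi>) U \<and> holo2_on (snd \<circ> \<psi>) U \<and>
        holo2_on (fst \<circ> \<xi>) V \<and> holo2_on (snd \<circ> \<xi>) V)"

section \<open>Webs\<close>

definition level_curves :: "(C2 \<Rightarrow> complex) \<Rightarrow> C2 set \<Rightarrow> C2 set set" where
  "level_curves u U = {{w \<in> U. u w = u z} | z. z \<in> U}"

text \<open>Equality of the germs at \<open>p\<close> of the foliations \<open>\<F>(u)\<close> and \<open>\<F>(v)\<close>, for functions whose
  differentials do not vanish at \<open>p\<close>.\<close>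

definition same_foliation_at :: "C2 \<Rightarrow> (C2 \<Rightarrow> complex) \<Rightarrow> (C2 \<Rightarrow> complex) \<Rightarrow> bool" where
  "same_foliation_at p u v \<longleftrightarrow>
     (\<exists>U. open U \<and> p \<in> U \<and> level_curves u U = level_curves v U)"

text \<open>The list \<open>[u\<^sub>1, \<dots>, u\<^sub>d]\<close> together with a point represents the germ of \<open>\<T>(u\<^sub>1, \<dots>, u\<^sub>d)\<close>; the
  order is forgotten when webs are compared, in \<open>maps_web_at\<close>.\<close>

definition is_web_at :: "(C2 \<Rightarrow> complex) list \<Rightarrow> C2 \<Rightarrow> bool" where
  "is_web_at us p \<longleftrightarrow> 3 \<le> length us \<and> (\<forall>u\<in>set us. holo2_at u p) \<and>
     (\<forall>j<length us. \<forall>k<length us. j \<noteq> k \<longrightarrow> wedge (us ! j) (us ! k) p \<noteq> 0)"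

text \<open>\<open>\<psi>\<close> sends the germ at \<open>p\<close> of the web \<open>us\<close> onto the germ at \<open>\<psi> p\<close> of the web \<open>vs\<close>.\<close>

definition maps_web_at ::
    "(C2 \<Rightarrow> C2) \<Rightarrow> C2 \<Rightarrow> (C2 \<Rightarrow> complex) list \<Rightarrow> (C2 \<Rightarrow> complex) list \<Rightarrow> bool" where
  "maps_web_at \<psi> p us vs \<longleftrightarrow> local_diffeo_at \<psi> p \<and> length us = length vs \<and>
     (\<exists>\<sigma>. bij_betw \<sigma> {..<length us} {..<length us} \<and>
        (\<forall>j<length us. same_foliation_at p (us ! j) (vs ! \<sigma> j \<circ> \<psi>)))"

definition equivalent_webs ::
    "(C2 \<Rightarrow> complex) list \<Rightarrow> C2 \<Rightarrow> (C2 \<Rightarrow> complex) list \<Rightarrow> C2 \<Rightarrow> bool" where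
  "equivalent_webs us p vs q \<longleftrightarrow> (\<exists>\<psi>. \<psi> p = q \<and> maps_web_at \<psi> p us vs)"

section \<open>Rank\<close>

text \<open>The type of germs at \<open>0\<close> of holomorphic functions of one variable.  A germ at another point
  \<open>c\<close> is transported to \<open>0\<close> by the translation \<open>w \<mapsto> c + w\<close>, see \<open>germ_at\<close> below.\<close>

quotient_type holo_germ = "complex \<Rightarrow> complex" / partial:
  "\<lambda>f g. f analytic_on {0} \<and> g analytic_on {0} \<and> (\<forall>\<^sub>F w in nhds 0. f w = g w)"
proof (rule part_equivpI)
  show "\<exists>f :: complex \<Rightarrow> complex. f analytic_on {0} \<and> f analytic_on {0} \<and> (\<forall>\<^sub>F w in nhds 0. f w = f w)"
    by (rule exI[of _ "\<lambda>_. 0"]) auto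
  show "symp (\<lambda>f g. f analytic_on {0} \<and> g analytic_on {0} \<and> (\<forall>\<^sub>F w in nhds (0::complex). f w = (g w :: complex)))"
    by (auto intro!: sympI elim: eventually_mono)
  show "transp (\<lambda>f g. f analytic_on {0} \<and> g analytic_on {0} \<and> (\<forall>\<^sub>F w in nhds (0::complex). f w = (g w :: complex)))"
    by (auto intro!: transpI elim: eventually_elim2)
qed

instantiation holo_germ :: ab_group_add
begin

lift_definition zero_holo_germ :: holo_germ is "\<lambda>_. 0"
  by auto

lift_definition plus_holo_germ :: "holo_germ \<Rightarrow> holo_germ \<Rightarrow> holo_germ" is "\<lambda>f g w. f w + g w"
  by (auto intro!: analytic_intros elim: eventually_elim2)

lift_definition uminus_holo_germ :: "holo_germ \<Rightarrow> holo_germ" is "\<lambda>f w. - f w"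
  by (auto intro!: analytic_intros elim: eventually_mono)

lift_definition minus_holo_germ :: "holo_germ \<Rightarrow> holo_germ \<Rightarrow> holo_germ" is "\<lambda>f g w. f w - g w"
  by (auto intro!: analytic_intros elim: eventually_elim2)

instance
  by standard (transfer; auto intro!: analytic_intros)+

end

lift_definition scale_germ :: "complex \<Rightarrow> holo_germ \<Rightarrow> holo_germ" is "\<lambda>c f w. c * f w"
  by (auto intro!: analytic_intros elim: eventually_mono)

definition germ_at :: "complex \<Rightarrow> (complex \<Rightarrow> complex) \<Rightarrow> holo_germ" where
  "germ_at c f = abs_holo_germ (\<lambda>w. f (c + w))"

definition scale_tuple :: "complex \<Rightarrow> (nat \<Rightarrow> holo_germ) \<Rightarrow> (nat \<Rightarrow> holo_germ)" where
  "scale_tuple c \<Phi> = (\<lambda>j. scale_germ c (\<Phi> j))"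

interpretation germ_tuples: vector_space scale_tuple
proof -
  have r: "scale_germ a (x + y) = scale_germ a x + scale_germ a y"
    "scale_germ (a + b) x = scale_germ a x + scale_germ b x"
    "scale_germ a (scale_germ b x) = scale_germ (a * b) x" "scale_germ 1 x = x" for a b x y
    by (transfer; auto intro!: analytic_intros simp: algebra_simps)+
  show "vector_space scale_tuple"
    by standard (auto simp: scale_tuple_def fun_eq_iff r)
qed

text \<open>\<open>\<Sum> \<phi>\<^sub>j(u\<^sub>j) du\<^sub>j = 0\<close> near \<open>p\<close>; \<open>d\<close>-tuples are extended by \<open>0\<close> to functions on all of \<open>nat\<close>.\<close>

definition abelian_relations :: "(C2 \<Rightarrow> complex) list \<Rightarrow> C2 \<Rightarrow> (nat \<Rightarrow> holo_germ) set" where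
  "abelian_relations us p =
     {\<Phi>. (\<forall>j\<ge>length us. \<Phi> j = 0) \<and>
          (\<exists>\<phi>. (\<forall>j<length us. \<phi> j analytic_on {(us ! j) p} \<and> \<Phi> j = germ_at ((us ! j) p) (\<phi> j)) \<and>
               (\<forall>\<^sub>F z in nhds p. (\<Sum>j<length us. \<phi> j ((us ! j) z) * dx (us ! j) z) = 0 \<and>
                                (\<Sum>j<length us. \<phi> j ((us ! j) z) * dy (us ! j) z) = 0))}"

definition web_rank :: "(C2 \<Rightarrow> complex) list \<Rightarrow> C2 \<Rightarrow> nat" where
  "web_rank us p = germ_tuples.dim (abelian_relations us p)"

definition maximal_rank :: "(C2 \<Rightarrow> complex) list \<Rightarrow> C2 \<Rightarrow> bool" where
  "maximal_rank us p \<longleftrightarrow> web_rank us p = (length us - 1) * (length us - 2) div 2"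

section \<open>Algebraic and exceptional webs\<close>

text \<open>Points of both projective planes are given by non-zero vectors of homogeneous coordinates, up
  to \<open>proj\<close>; \<open>incidence p z = 0\<close> says that the line \<open>l(p)\<close> passes through \<open>z\<close>, equivalently that
  \<open>p\<close> lies on the dual line \<open>l\<^sub>z\<close>.\<close>

definition proj :: "complex^3 \<Rightarrow> (complex^3) set" where
  "proj p = {c *s p | c. c \<noteq> 0}"

definition incidence :: "complex^3 \<Rightarrow> complex^3 \<Rightarrow> complex" where
  "incidence p z = (\<Sum>i\<in>UNIV. p $ i * z $ i)"

text \<open>Homogeneous polynomials of degree \<open>d\<close> in three variables, identified with the polynomial
  functions they define.\<close>

definition homogeneous_form :: "nat \<Rightarrow> (complex^3 \<Rightarrow> complex) \<Rightarrow> bool" where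
  "homogeneous_form d F \<longleftrightarrow>
     (\<exists>c. \<forall>p. F p = (\<Sum>i\<le>d. \<Sum>j\<le>d - i. c i j * (p $ 1) ^ i * (p $ 2) ^ j * (p $ 3) ^ (d - i - j)))"

text \<open>\<open>F\<close> is the equation of a reduced curve of degree \<open>d\<close>: it is non-zero and squarefree.  All
  factors of a non-zero form are forms.\<close>

definition reduced_curve :: "nat \<Rightarrow> (complex^3 \<Rightarrow> complex) \<Rightarrow> bool" where
  "reduced_curve d F \<longleftrightarrow> homogeneous_form d F \<and> (\<exists>p. F p \<noteq> 0) \<and>
     \<not> (\<exists>m G H. 1 \<le> m \<and> 2 * m \<le> d \<and> homogeneous_form m G \<and> homogeneous_form (d - 2 * m) H \<and>
          (\<forall>p. F p = (G p)\<^sup>2 * H p))"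

text \<open>The set \<open>l\<^sub>z \<inter> C\<close>, where \<open>C\<close> is the curve with equation \<open>F = 0\<close>.\<close>

definition dual_line_meets :: "(complex^3 \<Rightarrow> complex) \<Rightarrow> complex^3 \<Rightarrow> (complex^3) set set" where
  "dual_line_meets F z = {proj p | p. p \<noteq> 0 \<and> F p = 0 \<and> incidence p z = 0}"

definition affine_charts :: "(C2 \<Rightarrow> complex^3) set" where
  "affine_charts = {\<lambda>(x, y). vector [x, y, 1], \<lambda>(x, y). vector [x, 1, y], \<lambda>(x, y). vector [1, x, y]}"

text \<open>The germ at \<open>z0\<close> of the web \<open>vs\<close> is the web defined by a reduced curve, read in one of the
  three standard charts \<open>\<kappa>\<close> of the projective plane.  The last condition says that the leaf through
  \<open>z\<close> of the \<open>j\<close>-th foliation is a piece of the line \<open>l(p\<^sub>j(z))\<close>; as \<open>l(p\<^sub>j(z))\<close> is the tangent to that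
  leaf, it also forces the point \<open>p\<^sub>j(z)\<close> to depend holomorphically on \<open>z\<close>.\<close>

definition algebraic_web_at :: "(C2 \<Rightarrow> complex) list \<Rightarrow> C2 \<Rightarrow> bool" where
  "algebraic_web_at vs z0 \<longleftrightarrow> is_web_at vs z0 \<and>
     (\<exists>F. reduced_curve (length vs) F \<and>
       (\<exists>\<kappa>\<in>affine_charts. \<exists>U p. open U \<and> z0 \<in> U \<and>
         (\<forall>z\<in>U. bij_betw (\<lambda>j. proj (p j z)) {..<length vs} (dual_line_meets F (\<kappa> z)) \<and>
           (\<forall>j<length vs. p j z \<noteq> 0 \<and>
              {w \<in> U. (vs ! j) w = (vs ! j) z} = {w \<in> U. incidence (p j z) (\<kappa> w) = 0}))))"

definition algebraizable_at :: "(C2 \<Rightarrow> complex) list \<Rightarrow> C2 \<Rightarrow> bool" where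
  "algebraizable_at us p \<longleftrightarrow> (\<exists>vs q. algebraic_web_at vs q \<and> equivalent_webs us p vs q)"

definition exceptional_at :: "(C2 \<Rightarrow> complex) list \<Rightarrow> C2 \<Rightarrow> bool" where
  "exceptional_at us p \<longleftrightarrow> is_web_at us p \<and> maximal_rank us p \<and> \<not> algebraizable_at us p"

section \<open>The webs \<open>\<T>[u]\<close>\<close>

definition T0 :: "(C2 \<Rightarrow> complex) list" where
  "T0 = [\<lambda>(x, y). x, \<lambda>(x, y). y, \<lambda>(x, y). x + y, \<lambda>(x, y). x - y]"

definition T_web :: "(C2 \<Rightarrow> complex) \<Rightarrow> (C2 \<Rightarrow> complex) list" where
  "T_web u = T0 @ [u]"

definition cond_T :: "(C2 \<Rightarrow> complex) \<Rightarrow> C2 \<Rightarrow> bool" where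
  "cond_T u p \<longleftrightarrow> dx u p * dy u p * ((dx u p)\<^sup>2 - (dy u p)\<^sup>2) \<noteq> 0"

definition regular_at :: "(C2 \<Rightarrow> complex) \<Rightarrow> C2 \<Rightarrow> bool" where
  "regular_at u p \<longleftrightarrow> holo2_at u p \<and> cond_T u p"

definition T0_pencils :: "C2 set set set" where
  "T0_pencils = (\<lambda>t. level_curves t UNIV) ` set T0"

text \<open>The projective transformations preserving \<open>\<T>\<^sub>0\<close> fix the line at infinity, so they are
  represented by the self-maps of \<open>\<complex>\<^sup>2\<close> that they induce through \<open>(x, y) \<mapsto> [x : y : 1]\<close>.\<close>

definition Sym_T0 :: "(C2 \<Rightarrow> C2) set" where
  "Sym_T0 =
     {\<phi>. (\<exists>M :: complex^3^3. invertible M \<and>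
             (\<forall>z. \<exists>c. c \<noteq> 0 \<and> M *v vector [fst z, snd z, 1] = c *s vector [fst (\<phi> z), snd (\<phi> z), 1])) \<and>
          (\<lambda>P. (\<lambda>L. \<phi> ` L) ` P) ` T0_pencils = T0_pencils}"

section \<open>Theta functions and the group \<open>G\<close>\<close>

definition upper_half_plane :: "complex set" where
  "upper_half_plane = {\<tau>. Im \<tau> > 0}"

definition q_pow :: "complex \<Rightarrow> complex \<Rightarrow> complex" where
  "q_pow \<tau> s = exp (\<i> * of_real pi * \<tau> * s)"

definition theta1 :: "complex \<Rightarrow> complex \<Rightarrow> complex" where
  "theta1 x \<tau> = - \<i> * (\<Sum>\<^sub>\<infinity>n::int. (-1) powi n * q_pow \<tau> ((of_int n + 1/2)\<^sup>2) * exp (\<i> * (2 * of_int n + 1) * x))"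

definition theta4 :: "complex \<Rightarrow> complex \<Rightarrow> complex" where
  "theta4 x \<tau> = (\<Sum>\<^sub>\<infinity>n::int. (-1) powi n * q_pow \<tau> ((of_int n)\<^sup>2) * exp (2 * \<i> * of_int n * x))"

text \<open>Division by zero makes this function \<open>0\<close> on its polar set.  No point of the polar set satisfies
  \<open>holo2_at\<close>, the function being unbounded near each of them.\<close>

definition u_theta :: "complex \<Rightarrow> C2 \<Rightarrow> complex" where
  "u_theta \<tau> = (\<lambda>(x, y). theta1 x \<tau> / theta4 x \<tau> * (theta1 y \<tau> / theta4 y \<tau>))"

definition G_mod :: "(complex \<Rightarrow> complex) set" where
  "G_mod = generate (BijGroup upper_half_plane)
     {\<lambda>\<tau>\<in>upper_half_plane. \<tau> + 2, \<lambda>\<tau>\<in>upper_half_plane. \<tau> / (\<tau> + 1), \<lambda>\<tau>\<in>upper_half_plane. - 2 / \<tau>}"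

definition G_congruent :: "complex \<Rightarrow> complex \<Rightarrow> bool" where
  "G_congruent \<tau> \<tau>' \<longleftrightarrow> (\<exists>g\<in>G_mod. \<tau>' = g \<tau>)"

end

theory Submission
  imports Defs
begin


text \<open>
  Let \<open>D\<close> be the logarithmic derivative of \<open>f = \<theta>\<^sub>1 / \<theta>\<^sub>4\<close>, so that \<open>u = f(x) f(y)\<close> satisfies
  \<open>du / u = D(x) dx + D(y) dy\<close>.  The product formulas
  \<open>\<theta>\<^sub>4(x) \<theta>\<^sub>4(y) + \<theta>\<^sub>1(x) \<theta>\<^sub>1(y) = P(x + y) Q(x - y)\<close> and \<open>\<theta>\<^sub>4(x) \<theta>\<^sub>4(y) - \<theta>\<^sub>1(x) \<theta>\<^sub>1(y) = Q(x + y) P(x - y)\<close>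
  turn \<open>u\<close>, \<open>1 + u\<close> and \<open>1 - u\<close> into products of functions constant along the leaves of \<open>\<T>\<^sub>0\<close>, which gives three abelian
  relations besides the three polynomial ones of \<open>\<T>\<^sub>0\<close>.  They span: if \<open>\<phi>\<close> is the last component of an abelian relation,
  \<open>w(1 - w\<^sup>2)\<phi>\<close> has third derivative \<open>0\<close>.  To see this at a given point, one subtracts an explicit relation so that
  the \<open>2\<close>-jet of \<open>\<phi>\<close> vanishes there.

  A local diffeomorphism straightening the leaves of the four pencils of \<open>\<T>\<^sub>0\<close> sends lines to lines to second order, so if
  the web were algebraizable the level curves of \<open>u\<close> would be lines, and \<open>D\<close> would be constant.

  By the description of the abelian relations, an equivalence between two of the webs preserves \<open>\<T>\<^sub>0\<close>.  Hence it is affine, and it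
  makes \<open>D\<^sub>\<tau>\<^sub>'\<close> proportional to \<open>D\<^sub>\<tau>\<close> or to the logarithmic derivative of \<open>P / Q\<close>, which is \<open>D\<^sub>-\<^sub>2\<^sub>/\<^sub>\<tau>\<close> up to an
  affine change of variable.  Periods and zeros then determine \<open>\<tau>'\<close> up to the matrices with even upper right entry.
  Conversely, these transformations of \<open>D\<close> follow from Liouville's theorem.
\<close>

text \<open>The bound on the relations comes from a wave equation. After one differentiation, the
  only other terms are functions of x + y and of x - y, on which the second derivatives in x and in
  y agree. For a function of u with a double zero, their difference is governed by the leading
  coefficient times u_x^2 - u_y^2, and the latter is non-zero by (T). The weight w(1 - w^2) collects
  the denominators of the relations coming from u, 1 + u and 1 - u.

  The four directions of \<open>T0\<close> split in exactly one way into harmonic pairs, {x, y} and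
  {x + y, x - y}, and an equivalence respects the splitting. Keeping each pair leads to the matrices
  with even upper right entry, exchanging the pairs to -2/\<tau>, which normalises them.

  Logarithmic derivatives are compared by means of one order common to all zeros, weighted so that
  the poles cancel. Since x / 0 = 0, identities between meromorphic functions are proved for entire
  functions, with denominators cleared.\<close>

abbreviation cpi :: complex where "cpi \<equiv> of_real pi"

abbreviation theta_web :: "complex \<Rightarrow> (C2 \<Rightarrow> complex) list" where "theta_web \<tau> \<equiv> T_web (u_theta \<tau>)"

section \<open>Entire functions\<close>

lemma entire_eq_0:
  assumes "F holomorphic_on UNIV" "\<forall>\<^sub>F x in nhds a. F x = (0 :: complex)"
  shows "F z = 0"
proof -
  obtain S where S: "open S" "a \<in> S" "\<And>x. x \<in> S \<Longrightarrow> F x = 0"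
    using assms(2) unfolding eventually_nhds by blast
  show ?thesis
    by (rule analytic_continuation_open[of S UNIV F "\<lambda>_. 0"]) (use S assms in auto)
qed

lemma entire_eventually_nonzero:
  assumes "F holomorphic_on UNIV" "F b \<noteq> (0 :: complex)"
  shows "\<forall>\<^sub>F x in at a. F x \<noteq> 0"
  using non_zero_neighbour_alt[of F UNIV a b] assms by auto

lemma entire_eq_0_at:
  assumes "F holomorphic_on UNIV" "\<forall>\<^sub>F x in at a. F x = (0 :: complex)"
  shows "F z = 0"
proof (rule ccontr)
  assume "F z \<noteq> 0"
  from entire_eventually_nonzero[OF assms(1) this, of a] assms(2)
  have "\<forall>\<^sub>F x in at a. False" by eventually_elim simp
  thus False by simp
qed

lemma entire_mult_eq_0:
  assumes "F holomorphic_on UNIV" "G holomorphic_on UNIV"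
    "\<And>x. F x * G x = (0 :: complex)" "F b \<noteq> 0"
  shows "G z = 0"
  by (rule entire_eq_0_at[of _ b])
    (use assms entire_eventually_nonzero[OF assms(1,4), of b] in \<open>auto elim!: eventually_mono\<close>)

lemma lattice_coordinates:
  fixes \<omega>1 \<omega>2 z :: complex
  assumes "Im (\<omega>2 / \<omega>1) \<noteq> 0"
  obtains s t :: real where "z = s * \<omega>1 + t * \<omega>2"
proof -
  have w1: "\<omega>1 \<noteq> 0" using assms by auto
  define t where "t = Im (z / \<omega>1) / Im (\<omega>2 / \<omega>1)"
  define s where "s = Re (z / \<omega>1 - t * (\<omega>2 / \<omega>1))"
  have "Im (of_real t * (\<omega>2 / \<omega>1)) = Im (z / \<omega>1)"
    using assms unfolding t_def by (subst times_complex.sel(2)) (simp del: Im_divide)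
  hence "Im (z / \<omega>1 - t * (\<omega>2 / \<omega>1)) = 0" by simp
  hence "of_real s = z / \<omega>1 - t * (\<omega>2 / \<omega>1)"
    unfolding s_def by (simp add: complex_eq_iff)
  hence "z = s * \<omega>1 + t * \<omega>2" using w1 by (simp add: field_simps)
  thus ?thesis by (rule that)
qed

lemma periodic_int:
  fixes e :: "complex \<Rightarrow> complex"
  assumes "\<And>x. e (x + w) = e x"
  shows "e (x + of_int n * w) = e x"
proof (induction n rule: int_induct[of _ 0])
  case (step1 i)
  have "e (x + of_int (i + 1) * w) = e ((x + of_int i * w) + w)" by (simp add: algebra_simps)
  thus ?case using step1 assms by simp
next
  case (step2 i)
  have "e (x + of_int i * w) = e ((x + of_int (i - 1) * w) + w)" by (simp add: algebra_simps)
  thus ?case using step2 assms by simp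
qed auto

text \<open>Every value is attained on the compact parallelogram spanned by the two periods, so the
  function is bounded and Liouville's theorem applies.\<close>

lemma doubly_periodic_entire_constant:
  assumes hol: "e holomorphic_on UNIV" and per: "\<And>x. e (x + \<omega>1) = e x" "\<And>x. e (x + \<omega>2) = e x"
    and im: "Im (\<omega>2 / \<omega>1) \<noteq> 0"
  shows "e x = e y"
proof -
  define K where "K = (\<lambda>(s, t). of_real s * \<omega>1 + of_real t * \<omega>2) ` (cbox (0, 0) (1, 1 :: real))"
  have "compact (e ` K)"
    unfolding K_def
    by (intro compact_continuous_image holomorphic_on_imp_continuous_on holomorphic_on_subset[OF hol])
      (auto simp: case_prod_unfold intro!: continuous_intros)
  moreover have "range e \<subseteq> e ` K"
  proof safe
    fix z
    obtain s t :: real where z: "z = s * \<omega>1 + t * \<omega>2" using lattice_coordinates[OF im] by blast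
    have a: "e z = e (z + of_int (- \<lfloor>s\<rfloor>) * \<omega>1 + of_int (- \<lfloor>t\<rfloor>) * \<omega>2)"
      using periodic_int[of e \<omega>1] periodic_int[of e \<omega>2] per by metis
    have "z + of_int (- \<lfloor>s\<rfloor>) * \<omega>1 + of_int (- \<lfloor>t\<rfloor>) * \<omega>2 = of_real (frac s) * \<omega>1 + of_real (frac t) * \<omega>2"
      by (simp add: z frac_def algebra_simps)
    also have "\<dots> \<in> K"
      unfolding K_def using frac_lt_1[of s] frac_lt_1[of t]
      by (intro image_eqI[of _ _ "(frac s, frac t)"]) (auto simp: cbox_Pair_eq less_imp_le)
    finally have "\<exists>k\<in>K. e z = e k" using a by blast
    thus "e z \<in> e ` K" by blast
  qed
  ultimately have "bounded (range e)"
    using bounded_subset compact_imp_bounded by blast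
  thus ?thesis using Liouville_theorem[OF hol] unfolding constant_on_def by auto
qed

lemma entire_linear_ode:
  assumes "H holomorphic_on UNIV" "\<And>x. deriv H x = l * H x"
  shows "H x = H 0 * exp (l * x)"
proof -
  have d: "((\<lambda>x. H x * exp (- l * x)) has_field_derivative 0) (at x)" for x
  proof -
    have "(H has_field_derivative l * H x) (at x)"
      using assms holomorphic_derivI[of H UNIV x] by auto
    thus ?thesis by (auto intro!: derivative_eq_intros simp: algebra_simps)
  qed
  obtain c where "\<And>x. H x * exp (- l * x) = c"
    using has_field_derivative_zero_constant[of UNIV "\<lambda>x. H x * exp (- l * x)"] d by auto
  from this[of x] this[of 0] show ?thesis by (auto simp: exp_minus field_simps)
qed

lemma entire_field_derivative:
  "F holomorphic_on UNIV \<Longrightarrow> (F has_field_derivative deriv F x) (at x)"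
  using holomorphic_derivI[of F UNIV x] by auto

lemma entire_deriv: "F holomorphic_on UNIV \<Longrightarrow> deriv F holomorphic_on UNIV"
  by (rule holomorphic_deriv) auto

lemma deriv_shift: "deriv (\<lambda>x. F (x + w)) x = deriv F (x + w :: complex)"
  unfolding deriv_def by (subst DERIV_shift) auto

lemma entire_compose_affine:
  assumes "F holomorphic_on UNIV"
  shows "(\<lambda>x. F (a * x + b :: complex)) holomorphic_on UNIV"
proof -
  have "(F \<circ> (\<lambda>x. a * x + b)) holomorphic_on UNIV"
    by (rule holomorphic_on_compose_gen[OF _ assms]) (auto intro!: holomorphic_intros)
  thus ?thesis by (simp add: o_def)
qed

lemma deriv_affine:
  assumes "F holomorphic_on UNIV"
  shows "deriv (\<lambda>x. F (a * x + b)) x = a * deriv F (a * x + b :: complex)"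
proof -
  have "((\<lambda>x. F (a * x + b)) has_field_derivative deriv F (a * x + b) * (a * 1 + 0)) (at x)"
    by (rule DERIV_chain'[of "\<lambda>x. a * x + b", OF _ entire_field_derivative[OF assms]])
      (auto intro!: derivative_eq_intros)
  thus ?thesis by (auto intro!: DERIV_imp_deriv simp: algebra_simps)
qed

section \<open>The basic theta series\<close>

definition th_term :: "complex \<Rightarrow> complex \<Rightarrow> int \<Rightarrow> complex" where
  "th_term \<tau> x n = exp (\<i> * cpi * \<tau> * of_int n ^ 2 + 2 * \<i> * of_int n * x)"

text \<open>This is Jacobi's third theta function. \<open>theta4\<close> and \<open>theta1\<close>
  are its translates by pi/2 and by pi/2 + pi \<tau>/2, the second one up to an exponential factor,
  so that convergence, holomorphy and quasi-periodicity are proved once for all of them.\<close>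

definition th :: "complex \<Rightarrow> complex \<Rightarrow> complex" where
  "th \<tau> x = (\<Sum>\<^sub>\<infinity>n. th_term \<tau> x n)"

lemma summable_on_exp_abs_int: "(\<lambda>n::int. exp (- \<bar>of_int n\<bar>) :: real) summable_on UNIV"
proof -
  let ?f = "\<lambda>n::int. exp (- \<bar>of_int n\<bar>) :: real"
  have g: "(\<lambda>n::nat. exp (- 1 :: real) ^ n) summable_on UNIV"
    by (rule norm_summable_imp_summable_on) (auto intro!: summable_geometric)
  have "?f summable_on (range int)"
    using g by (subst summable_on_reindex) (auto simp: o_def exp_of_nat_mult[symmetric] inj_on_def)
  moreover have "?f summable_on (range (\<lambda>n. - int n))"
    using g by (subst summable_on_reindex) (auto simp: o_def exp_of_nat_mult[symmetric] inj_on_def)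
  hence "?f summable_on (range (\<lambda>n. - int n) - range int)"
    by (rule summable_on_subset) auto
  moreover have "UNIV = range int \<union> (range (\<lambda>n. - int n) - range int)"
  proof -
    have "n \<in> range int \<union> range (\<lambda>n. - int n)" for n :: int
      by (cases "n \<ge> 0") (auto intro: range_eqI[of _ _ "nat n"] range_eqI[of _ _ "nat (- n)"])
    thus ?thesis by auto
  qed
  ultimately show ?thesis
    by (metis Diff_disjoint summable_on_Un_disjoint)
qed

text \<open>Completing the square trades the Gaussian decay for exp(-|n|), at the price of a
  constant that depends on x only through R. This makes it a majorant for the Weierstrass test on
  discs.\<close>

lemma norm_th_term_le:
  assumes "Im \<tau> > 0" "\<bar>Im x\<bar> \<le> R"
  shows "norm (th_term \<tau> x n) \<le> exp ((2 * R + 1)^2 / (4 * pi * Im \<tau>)) * exp (- \<bar>of_int n\<bar>)"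
proof -
  define t where "t = pi * Im \<tau>"
  have t: "t > 0" using assms by (simp add: t_def)
  define k where "k = \<bar>real_of_int n\<bar>"
  have "- (2 * real_of_int n * Im x) \<le> 2 * k * R"
  proof -
    have "- (2 * real_of_int n * Im x) \<le> 2 * (k * \<bar>Im x\<bar>)"
      using abs_ge_minus_self[of "real_of_int n * Im x"] by (simp add: k_def abs_mult mult.commute)
    also have "\<dots> \<le> 2 * (k * R)" using assms by (intro mult_left_mono) (auto simp: k_def)
    finally show ?thesis by simp
  qed
  moreover have "0 \<le> (t * k - (2 * R + 1) / 2)\<^sup>2 / t" using t by simp
  hence "- t * k\<^sup>2 + (2 * R + 1) * k \<le> (2 * R + 1)\<^sup>2 / (4 * t)"
    using t by (simp add: field_simps power2_eq_square)
  moreover have "k\<^sup>2 = (real_of_int n)\<^sup>2" by (simp add: k_def)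
  ultimately have "- (t * (real_of_int n)\<^sup>2) - 2 * real_of_int n * Im x \<le> (2 * R + 1)\<^sup>2 / (4 * t) - k"
    by (simp add: algebra_simps)
  moreover have "Re (\<i> * cpi * \<tau> * of_int n ^ 2 + 2 * \<i> * of_int n * x) = - (t * (real_of_int n)\<^sup>2) - 2 * real_of_int n * Im x"
  proof -
    have "(of_int n :: complex)^2 = of_real ((real_of_int n)\<^sup>2)" by simp
    thus ?thesis by (simp only: t_def) (simp add: algebra_simps)
  qed
  ultimately show ?thesis
    by (simp add: th_term_def t_def k_def exp_add[symmetric] mult.assoc)
qed

lemma th_term_abs_summable:
  assumes "Im \<tau> > 0"
  shows "(\<lambda>n. norm (th_term \<tau> x n)) summable_on UNIV"
  by (rule Infinite_Sum.abs_summable_on_comparison_test'[OF _ norm_th_term_le[OF assms order.refl]])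
    (intro summable_on_cmult_right summable_on_exp_abs_int)

lemma th_term_summable: "Im \<tau> > 0 \<Longrightarrow> th_term \<tau> x summable_on A"
  by (metis abs_summable_summable summable_on_subset subset_UNIV th_term_abs_summable)

lemma th_holomorphic: 
  assumes "Im \<tau> > 0"
  shows "th \<tau> holomorphic_on UNIV"
proof -
  have "th \<tau> analytic_on UNIV"
    unfolding analytic_on_def
  proof safe
    fix z
    have ul: "uniform_limit (cball z 1) (\<lambda>X x. \<Sum>n\<in>X. th_term \<tau> x n) (\<lambda>x. \<Sum>\<^sub>\<infinity>n. th_term \<tau> x n) (finite_subsets_at_top UNIV)"
    proof (rule Weierstrass_m_test_general)
      fix n x assume "x \<in> cball z 1"
      hence "norm (x - z) \<le> 1" by (simp add: dist_norm norm_minus_commute)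
      hence "\<bar>Im x\<bar> \<le> \<bar>Im z\<bar> + 1" using abs_Im_le_cmod[of "x - z"] by simp
      thus "norm (th_term \<tau> x n) \<le> exp ((2 * (\<bar>Im z\<bar> + 1) + 1)^2 / (4 * pi * Im \<tau>)) * exp (- \<bar>of_int n\<bar>)"
        by (rule norm_th_term_le[OF assms])
    qed (intro summable_on_cmult_right summable_on_exp_abs_int)
    have "th \<tau> holomorphic_on ball z 1"
      unfolding th_def[abs_def]
      by (rule holomorphic_uniform_limit[OF _ ul])
        (simp_all add: th_term_def[abs_def] always_eventually holomorphic_on_imp_continuous_on holomorphic_intros)
    thus "\<exists>\<epsilon>>0. th \<tau> holomorphic_on ball z \<epsilon>" by (intro exI[of _ 1]) auto
  qed
  thus ?thesis by (rule analytic_imp_holomorphic)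
qed

lemma th_minus: "th \<tau> (- x) = th \<tau> x"
  unfolding th_def
  by (rule infsum_reindex_bij_witness[of _ uminus uminus]) (auto simp: th_term_def)

lemma exp_2pi_int: "exp (2 * cpi * \<i> * of_int n) = 1"
  by (subst exp_eq_1) auto

lemma th_plus_pi: "th \<tau> (x + cpi) = th \<tau> x"
proof -
  have "th_term \<tau> (x + cpi) n = th_term \<tau> x n" for n
    using exp_2pi_int[of n] by (simp add: th_term_def exp_add ring_distribs mult_ac)
  thus ?thesis by (simp add: th_def)
qed

lemma th_plus_tau: "th \<tau> (x + cpi * \<tau>) = exp (- (\<i> * cpi * \<tau>) - 2 * \<i> * x) * th \<tau> x"
proof -
  have "th \<tau> (x + cpi * \<tau>) = (\<Sum>\<^sub>\<infinity>n. exp (- (\<i> * cpi * \<tau>) - 2 * \<i> * x) * th_term \<tau> x n)"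
    unfolding th_def
    by (rule infsum_reindex_bij_witness[of _ "\<lambda>n. n - 1" "\<lambda>n. n + 1"])
      (auto simp: th_term_def exp_add[symmetric] power2_eq_square algebra_simps)
  also have "\<dots> = exp (- (\<i> * cpi * \<tau>) - 2 * \<i> * x) * th \<tau> x"
    by (simp add: th_def infsum_cmult_right')
  finally show ?thesis .
qed

lemma exp_pi_int: "exp (\<i> * cpi * of_int n) = (-1) powi n"
  using exp_power_int[of "\<i> * cpi" n] by (simp add: mult_ac)

lemma theta4_th: "theta4 x \<tau> = th \<tau> (x + cpi / 2)"
  unfolding theta4_def th_def th_term_def q_pow_def exp_pi_int[symmetric] exp_add[symmetric]
  by (intro infsum_cong arg_cong[of _ _ exp]) (simp add: algebra_simps)

lemma theta1_th:
  "theta1 x \<tau> = - \<i> * exp (\<i> * cpi * \<tau> / 4 + \<i> * x) * th \<tau> (x + cpi / 2 + cpi * \<tau> / 2)"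
proof -
  have "(\<Sum>\<^sub>\<infinity>n::int. (-1) powi n * q_pow \<tau> ((of_int n + 1/2)\<^sup>2) * exp (\<i> * (2 * of_int n + 1) * x))
    = (\<Sum>\<^sub>\<infinity>n. exp (\<i> * cpi * \<tau> / 4 + \<i> * x) * th_term \<tau> (x + cpi / 2 + cpi * \<tau> / 2) n)"
    unfolding th_term_def q_pow_def exp_pi_int[symmetric] exp_add[symmetric]
    by (intro infsum_cong arg_cong[of _ _ exp]) (simp add: algebra_simps power2_eq_square)
  thus ?thesis unfolding theta1_def th_def by (simp add: infsum_cmult_right' mult.assoc)
qed

text \<open>Translation by pi/2 multiplies the n-th term by (-1)^n, so the terms with odd n cancel;
  for n = 2m the exponent is the one of the m-th term for the parameter 4 \<tau> at 2x.\<close>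

lemma th_even_part:
  assumes "Im \<tau> > 0"
  shows "th \<tau> x + th \<tau> (x + cpi / 2) = 2 * th (4 * \<tau>) (2 * x)"
proof -
  have "th \<tau> x + th \<tau> (x + cpi / 2) = (\<Sum>\<^sub>\<infinity>n. th_term \<tau> x n + th_term \<tau> (x + cpi / 2) n)"
    unfolding th_def by (rule infsum_add[symmetric]) (rule th_term_summable[OF assms])+
  also have "\<dots> = (\<Sum>\<^sub>\<infinity>n\<in>range (\<lambda>m. 2 * m). 2 * th_term \<tau> x n)"
  proof (rule infsum_cong_neutral)
    fix n :: int
    have *: "th_term \<tau> (x + cpi / 2) n = th_term \<tau> x n * (-1) powi n"
      by (simp add: th_term_def exp_add ring_distribs exp_pi_int[symmetric] mult_ac)
    show "n \<in> UNIV - range (\<lambda>m. 2 * m) \<Longrightarrow> th_term \<tau> x n + th_term \<tau> (x + cpi / 2) n = 0"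
      unfolding * by (cases "even n") auto
    show "n \<in> UNIV \<inter> range (\<lambda>m. 2 * m) \<Longrightarrow> th_term \<tau> x n + th_term \<tau> (x + cpi / 2) n = 2 * th_term \<tau> x n"
      unfolding * by auto
  qed auto
  also have "\<dots> = (\<Sum>\<^sub>\<infinity>m. 2 * th_term \<tau> x (2 * m))"
    by (subst infsum_reindex) (auto simp: inj_on_def o_def)
  also have "\<dots> = 2 * th (4 * \<tau>) (2 * x)"
    unfolding th_def infsum_cmult_right'[symmetric] by (intro infsum_cong) (simp add: th_term_def power_mult_distrib mult_ac)
  finally show ?thesis .
qed

text \<open>The term with n = 0 is 1, and the others are dominated by 4^(-|n|), whose sum over n
  \<noteq> 0 is 2/3.\<close>

lemma th_nonzero_large:
  assumes "Im \<tau> \<ge> 1"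
  shows "th \<tau> 0 \<noteq> 0"
proof
  assume "th \<tau> 0 = 0"
  have pos: "Im \<tau> > 0" using assms by simp
  have le: "norm (th_term \<tau> 0 n) \<le> exp (- 2) ^ nat \<bar>n\<bar>" for n
  proof -
    have c: "(of_int n :: complex)^2 = of_real ((real_of_int n)\<^sup>2)" by simp
    have "\<bar>real_of_int n\<bar> * 1 \<le> \<bar>real_of_int n\<bar> * \<bar>real_of_int n\<bar>"
    proof (cases "n = 0")
      case False
      hence "1 \<le> \<bar>real_of_int n\<bar>" by simp
      thus ?thesis by (intro mult_left_mono) auto
    qed auto
    hence "2 * \<bar>real_of_int n\<bar> \<le> 2 * (real_of_int n)\<^sup>2" by (simp add: power2_eq_square)
    also have "\<dots> \<le> pi * Im \<tau> * (real_of_int n)\<^sup>2"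
      using mult_mono[of 2 pi 1 "Im \<tau>"] assms pi_gt3 by (intro mult_right_mono) auto
    finally have "norm (th_term \<tau> 0 n) \<le> exp (- (2 * \<bar>real_of_int n\<bar>))"
      unfolding th_term_def c by (simp add: algebra_simps)
    also have "\<dots> = exp (- 2) ^ nat \<bar>n\<bar>"
      by (simp add: exp_of_nat_mult[symmetric] mult.commute)
    finally show ?thesis .
  qed
  have e: "exp (- 2 :: real) \<le> 1/4"
  proof -
    have "(2::real) ^ 2 \<le> exp 1 ^ 2" using exp_ge_add_one_self[of 1] by (intro power_mono) auto
    thus ?thesis by (simp add: exp_of_nat_mult[symmetric] exp_minus field_simps power2_eq_square exp_add[symmetric])
  qed
  have gs: "((\<lambda>n. (1/4::real) ^ Suc n) has_sum 1/3) UNIV"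
    by (rule sums_nonneg_imp_has_sum) (use sums_mult[OF geometric_sums[of "1/4::real"], of "1/4"] in auto)
  have h1: "((\<lambda>n::int. (1/4::real) ^ nat \<bar>n\<bar>) has_sum 1/3) {0<..}"
    by (rule iffD2[OF has_sum_reindex_bij_witness[of _ "\<lambda>n. int (Suc n)" "\<lambda>n. nat n - 1" UNIV] gs]) (auto simp flip: power_Suc)
  have h2: "((\<lambda>n::int. (1/4::real) ^ nat \<bar>n\<bar>) has_sum 1/3) {..<0}"
    by (rule iffD2[OF has_sum_reindex_bij_witness[of _ uminus uminus] h1]) auto
  have "((\<lambda>n::int. (1/4::real) ^ nat \<bar>n\<bar>) has_sum (1/3 + 1/3)) ({0<..} \<union> {..<0})"
    by (rule has_sum_Un_disjoint[OF h1 h2]) auto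
  moreover have un: "{0<..} \<union> {..<0} = - {0::int}" by auto
  ultimately have h: "((\<lambda>n::int. (1/4::real) ^ nat \<bar>n\<bar>) has_sum (2/3)) (- {0})" by simp
  have "norm (th_term \<tau> 0 n) \<le> (1/4) ^ nat \<bar>n\<bar>" for n
    using le[of n] power_mono[OF e, of "nat \<bar>n\<bar>"] by simp
  hence nle: "norm (\<Sum>\<^sub>\<infinity>n\<in>-{0}. th_term \<tau> 0 n) \<le> 2/3"
    by (intro norm_infsum_le[OF has_sum_infsum h]) (auto intro!: th_term_summable pos)
  have "(\<Sum>\<^sub>\<infinity>n\<in>insert 0 (-{0}). th_term \<tau> 0 n) = th_term \<tau> 0 0 + (\<Sum>\<^sub>\<infinity>n\<in>-{0}. th_term \<tau> 0 n)"
    by (subst infsum_insert) (auto intro!: th_term_summable pos)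
  moreover have "insert 0 (-{0::int}) = UNIV" by auto
  ultimately have "1 + (\<Sum>\<^sub>\<infinity>n\<in>-{0}. th_term \<tau> 0 n) = 0" using \<open>th \<tau> 0 = 0\<close>
    by (simp add: th_def th_term_def[of _ _ 0])
  hence "(\<Sum>\<^sub>\<infinity>n\<in>-{0}. th_term \<tau> 0 n) = - 1" by (simp add: eq_neg_iff_add_eq_0 add.commute)
  with nle show False by simp
qed

text \<open>If the series vanished identically, so would it for every 4^k \<tau> by
  \<open>th_even_part\<close>; for large k the imaginary part reaches the range of
  \<open>th_nonzero_large\<close>.\<close>

lemma th_not_identically_0:
  assumes "Im \<tau> > 0"
  shows "\<exists>x. th \<tau> x \<noteq> 0"
proof (rule ccontr)
  assume "\<not> ?thesis"
  hence z: "\<And>x. th \<tau> x = 0" by auto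
  have "\<forall>x. th (4 ^ k * \<tau>) x = 0" for k
  proof (induction k)
    case (Suc k)
    have "th (4 ^ Suc k * \<tau>) x = 0" for x
      using th_even_part[of "4 ^ k * \<tau>" "x / 2"] Suc assms by (simp add: mult.assoc)
    thus ?case by blast
  qed (use z in auto)
  moreover obtain k where k: "1 / Im \<tau> < 4 ^ k" using real_arch_pow[of 4 "1 / Im \<tau>"] by auto
  have "th (4 ^ k * \<tau>) 0 \<noteq> 0"
  proof (rule th_nonzero_large)
    have "(4 :: complex) ^ k = of_real (4 ^ k)" by simp
    hence "Im (4 ^ k * \<tau>) = 4 ^ k * Im \<tau>" by (simp only: Im_complex_of_real Re_complex_of_real times_complex.sel)
    thus "Im (4 ^ k * \<tau>) \<ge> 1" using k assms by (simp add: field_simps)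
  qed
  ultimately show False by blast
qed


section \<open>The product formula and the zeros of the theta functions\<close>

definition t1 :: "complex \<Rightarrow> complex \<Rightarrow> complex" where "t1 \<tau> x = theta1 x \<tau>"
definition t4 :: "complex \<Rightarrow> complex \<Rightarrow> complex" where "t4 \<tau> x = theta4 x \<tau>"

text \<open>In the variables \<open>x + y\<close> and \<open>x - y\<close> these two functions play the role that \<open>\<theta>\<^sub>1\<close> and \<open>\<theta>\<^sub>4\<close>
  play in the variables \<open>x\<close> and \<open>y\<close>.\<close>

definition tp :: "complex \<Rightarrow> complex \<Rightarrow> complex" where "tp \<tau> t = t4 (\<tau> / 2) (t / 2)"
definition tq :: "complex \<Rightarrow> complex \<Rightarrow> complex" where "tq \<tau> t = t4 (\<tau> / 2) (t / 2 + cpi / 2)"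

lemma t4_eq_th: "t4 \<tau> x = th \<tau> (x + cpi / 2)"
  by (simp add: t4_def theta4_th)

lemma t1_eq_t4:
  "t1 \<tau> x = - \<i> * exp (\<i> * cpi * \<tau> / 4 + \<i> * x) * t4 \<tau> (x + cpi * \<tau> / 2)"
  by (simp add: t1_def theta1_th t4_eq_th algebra_simps)

lemma t4_holomorphic [holomorphic_intros]:
  assumes "Im \<tau> > 0" "g holomorphic_on A"
  shows "(\<lambda>x. t4 \<tau> (g x)) holomorphic_on A"
proof -
  have "(th \<tau> \<circ> (\<lambda>x. g x + cpi / 2)) holomorphic_on A"
    by (rule holomorphic_on_compose_gen[OF _ th_holomorphic[OF assms(1)]]) (auto intro!: holomorphic_intros assms)
  thus ?thesis by (simp add: o_def t4_eq_th)
qed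

lemma t1_holomorphic [holomorphic_intros]:
  assumes "Im \<tau> > 0" "g holomorphic_on A"
  shows "(\<lambda>x. t1 \<tau> (g x)) holomorphic_on A"
  unfolding t1_eq_t4 using assms by (intro holomorphic_intros) auto

lemma tp_holomorphic [holomorphic_intros]:
  assumes "Im \<tau> > 0" "g holomorphic_on A"
  shows "(\<lambda>x. tp \<tau> (g x)) holomorphic_on A"
  unfolding tp_def using assms by (intro holomorphic_intros) auto

lemma tq_holomorphic [holomorphic_intros]:
  assumes "Im \<tau> > 0" "g holomorphic_on A"
  shows "(\<lambda>x. tq \<tau> (g x)) holomorphic_on A"
  unfolding tq_def using assms by (intro holomorphic_intros) auto

lemma theta_entire:
  assumes "Im \<tau> > 0"
  shows "t1 \<tau> holomorphic_on UNIV" "t4 \<tau> holomorphic_on UNIV" "tp \<tau> holomorphic_on UNIV" "tq \<tau> holomorphic_on UNIV"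
  using assms t1_holomorphic[of \<tau> "\<lambda>x. x"] t4_holomorphic[of \<tau> "\<lambda>x. x"] tp_holomorphic[of \<tau> "\<lambda>x. x"] tq_holomorphic[of \<tau> "\<lambda>x. x"]
  by (auto simp: holomorphic_on_ident)

lemma t4_minus: "t4 \<tau> (- x) = t4 \<tau> x"
  using th_minus[of \<tau> "x - cpi / 2"] th_plus_pi[of \<tau> "x - cpi / 2"]
  by (simp add: t4_eq_th add.commute)

lemma t4_plus_pi: "t4 \<tau> (x + cpi) = t4 \<tau> x"
  using th_plus_pi[of \<tau> "x + cpi / 2"] by (simp add: t4_eq_th add_ac)

lemma t4_plus_tau: "t4 \<tau> (x + cpi * \<tau>) = - exp (- (\<i> * cpi * \<tau>) - 2 * \<i> * x) * t4 \<tau> x"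
proof -
  have "x + cpi * \<tau> + cpi / 2 = (x + cpi / 2) + cpi * \<tau>" by simp
  moreover have "exp (- (\<i> * cpi * \<tau>) - 2 * \<i> * (x + cpi / 2)) = - exp (- (\<i> * cpi * \<tau>) - 2 * \<i> * x)"
    by (simp add: ring_distribs exp_diff exp_add)
  ultimately show ?thesis by (simp only: t4_eq_th th_plus_tau)
qed

lemma t4_not_identically_0: "Im \<tau> > 0 \<Longrightarrow> \<exists>x. t4 \<tau> x \<noteq> 0"
  using th_not_identically_0[of \<tau>] unfolding t4_eq_th by (metis diff_add_cancel)

text \<open>The factor of automorphy of the half period pi \<tau>/2. Translation by it exchanges
  \<open>t1\<close> and \<open>t4\<close>, and the factor is the same in both directions. Hence the
  quotient of the two is inverted and its logarithmic derivative changes sign.\<close>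

definition hfac :: "complex \<Rightarrow> complex \<Rightarrow> complex" where
  "hfac \<tau> x = \<i> * exp (- (\<i> * cpi * \<tau> / 4) - \<i> * x)"

lemma hfac_nz [simp]: "hfac \<tau> x \<noteq> 0" by (simp add: hfac_def)

lemma t4_plus_half: "t4 \<tau> (x + cpi * \<tau> / 2) = hfac \<tau> x * t1 \<tau> x"
proof -
  have "exp (- (\<i> * cpi * \<tau> / 4) - \<i> * x) * exp (\<i> * cpi * \<tau> / 4 + \<i> * x) = 1"
    by (simp add: exp_add[symmetric])
  moreover have "\<i> * a * (- \<i> * b * c) = (a * b) * c" for a b c :: complex by (simp add: mult_ac)
  ultimately show ?thesis unfolding t1_eq_t4 hfac_def by (simp only: mult_1_left)
qed

lemma t1_plus_half: "t1 \<tau> (x + cpi * \<tau> / 2) = hfac \<tau> x * t4 \<tau> x"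
proof -
  have "t1 \<tau> (x + cpi * \<tau> / 2) = - \<i> * exp (\<i> * cpi * \<tau> / 4 + \<i> * (x + cpi * \<tau> / 2)) * t4 \<tau> (x + cpi * \<tau>)"
    unfolding t1_eq_t4 by (simp add: algebra_simps)
  also have "\<dots> = hfac \<tau> x * t4 \<tau> x"
  proof -
    have "exp (\<i> * cpi * \<tau> / 4 + \<i> * (x + cpi * \<tau> / 2)) * exp (- (\<i> * cpi * \<tau>) - 2 * \<i> * x)
        = exp (- (\<i> * cpi * \<tau> / 4) - \<i> * x)"
      unfolding exp_add[symmetric] by (intro arg_cong[of _ _ exp]) (simp add: field_simps)
    thus ?thesis unfolding t4_plus_tau hfac_def by simp
  qed
  finally show ?thesis .
qed

lemma t1_plus_pi: "t1 \<tau> (x + cpi) = - t1 \<tau> x"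
proof -
  have "x + cpi + cpi * \<tau> / 2 = (x + cpi * \<tau> / 2) + cpi" by simp
  thus ?thesis by (simp only: t1_eq_t4 t4_plus_pi) (simp add: exp_add ring_distribs)
qed

lemma hfac_hfac: "hfac \<tau> (x + cpi * \<tau> / 2) * hfac \<tau> x = - exp (- (\<i> * cpi * \<tau>) - 2 * \<i> * x)"
proof -
  have "exp (- (\<i> * cpi * \<tau> / 4) - \<i> * (x + cpi * \<tau> / 2)) * exp (- (\<i> * cpi * \<tau> / 4) - \<i> * x)
      = exp (- (\<i> * cpi * \<tau>) - 2 * \<i> * x)"
    (is "?a * ?b = ?c") unfolding exp_add[symmetric] by (intro arg_cong[of _ _ exp]) (simp add: field_simps)
  hence "\<i> * ?a * (\<i> * ?b) = - ?c" by (simp add: algebra_simps)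
  thus ?thesis unfolding hfac_def .
qed

lemma t1_plus_tau: "t1 \<tau> (x + cpi * \<tau>) = - exp (- (\<i> * cpi * \<tau>) - 2 * \<i> * x) * t1 \<tau> x"
proof -
  have "x + cpi * \<tau> = (x + cpi * \<tau> / 2) + cpi * \<tau> / 2" by (simp add: field_simps)
  hence "t1 \<tau> (x + cpi * \<tau>) = t1 \<tau> ((x + cpi * \<tau> / 2) + cpi * \<tau> / 2)" by (rule arg_cong)
  thus ?thesis by (simp only: t1_plus_half t4_plus_half mult.assoc[symmetric] hfac_hfac)
qed

lemma t1_minus: "t1 \<tau> (- x) = - t1 \<tau> x"
proof -
  have *: "t1 \<tau> (- x) = - \<i> * exp (\<i> * cpi * \<tau> / 4 - \<i> * x) * t4 \<tau> (x - cpi * \<tau> / 2)"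
    using t4_minus[of \<tau> "x - cpi * \<tau> / 2"] by (simp add: t1_eq_t4)
  have **: "t4 \<tau> (x + cpi * \<tau> / 2) = - exp (- (2 * \<i> * x)) * t4 \<tau> (x - cpi * \<tau> / 2)"
    using t4_plus_tau[of \<tau> "x - cpi * \<tau> / 2"] by (simp add: algebra_simps)
  show ?thesis
  proof -
    have "exp (\<i> * cpi * \<tau> / 4 + \<i> * x) * exp (- (2 * \<i> * x)) = exp (\<i> * cpi * \<tau> / 4 - \<i> * x)"
      by (simp add: exp_add[symmetric])
    thus ?thesis using * ** by (simp add: t1_eq_t4[of _ x])
  qed
qed

lemma t1_0 [simp]: "t1 \<tau> 0 = 0" using t1_minus[of \<tau> 0] by simp

lemma tq_plus_pi: "tq \<tau> (x + cpi) = tp \<tau> x"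
  using t4_plus_pi[of "\<tau>/2" "x/2"] by (simp add: tp_def tq_def add_divide_distrib add.commute)

lemma tp_plus_pi: "tp \<tau> (x + cpi) = tq \<tau> x"
  by (simp add: tp_def tq_def add_divide_distrib)

lemma tp_plus_2pi: "tp \<tau> (x + 2 * cpi) = tp \<tau> x"
  using tp_plus_pi[of \<tau> "x + cpi"] tq_plus_pi[of \<tau> x] by (simp add: algebra_simps)

lemma tq_plus_2pi: "tq \<tau> (x + 2 * cpi) = tq \<tau> x"
  using tq_plus_pi[of \<tau> "x + cpi"] tp_plus_pi[of \<tau> x] by (simp add: algebra_simps)

lemma tp_plus_tau: "tp \<tau> (x + cpi * \<tau>) = - exp (- (\<i> * cpi * \<tau> / 2) - \<i> * x) * tp \<tau> x"
  using t4_plus_tau[of "\<tau>/2" "x/2"] by (simp add: tp_def add_divide_distrib)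

lemma tq_plus_tau: "tq \<tau> (x + cpi * \<tau>) = exp (- (\<i> * cpi * \<tau> / 2) - \<i> * x) * tq \<tau> x"
  using t4_plus_tau[of "\<tau>/2" "x/2 + cpi / 2"]
  by (simp add: tq_def add_divide_distrib algebra_simps exp_diff exp_add)

lemma tp_not_identically_0: "Im \<tau> > 0 \<Longrightarrow> \<exists>x. tp \<tau> x \<noteq> 0"
  using t4_not_identically_0[of "\<tau>/2"] unfolding tp_def
  by (metis Im_divide_numeral half_gt_zero nonzero_mult_div_cancel_left zero_neq_numeral)

lemma tq_not_identically_0: "Im \<tau> > 0 \<Longrightarrow> \<exists>x. tq \<tau> x \<noteq> 0"
  using tp_not_identically_0[of \<tau>] tp_plus_pi[of \<tau>] by (metis diff_add_cancel)

lemma infsum_mult_abs: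
  fixes p q :: "int \<Rightarrow> complex"
  assumes "(\<lambda>n. norm (p n)) summable_on UNIV" "(\<lambda>n. norm (q n)) summable_on UNIV"
  shows "(\<lambda>(s, t). p s * q t) summable_on A"
    "(\<Sum>\<^sub>\<infinity>s. p s) * (\<Sum>\<^sub>\<infinity>t. q t) = (\<Sum>\<^sub>\<infinity>(s, t)\<in>UNIV. p s * q t)"
proof -
  let ?h = "\<lambda>(s, t). p s * q t"
  have "(\<lambda>z. norm (?h z)) summable_on (UNIV \<times> UNIV)"
  proof (rule iffD2[OF Infinite_Sum.abs_summable_on_Sigma_iff], intro conjI ballI)
    show "(\<lambda>y. norm (case (x, y) of (s, t) \<Rightarrow> p s * q t)) summable_on UNIV" for x
      using assms(2) by (simp add: norm_mult summable_on_cmult_right)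
    have "(\<lambda>x. norm (\<Sum>\<^sub>\<infinity>y. norm (case (x, y) of (s, t) \<Rightarrow> p s * q t))) = (\<lambda>x. norm (p x) * (\<Sum>\<^sub>\<infinity>y. norm (q y)))"
      by (auto simp: norm_mult infsum_cmult_right' abs_mult infsum_nonneg)
    thus "(\<lambda>x. norm (\<Sum>\<^sub>\<infinity>y. norm (case (x, y) of (s, t) \<Rightarrow> p s * q t))) summable_on UNIV"
      using assms(1) by (simp add: summable_on_cmult_left)
  qed
  hence *: "?h summable_on (UNIV \<times> UNIV)" by (rule abs_summable_summable)
  thus "?h summable_on A" by (rule summable_on_subset) auto
  have "infsum ?h (UNIV \<times> UNIV) = (\<Sum>\<^sub>\<infinity>s. \<Sum>\<^sub>\<infinity>t. p s * q t)"
    using infsum_Sigma_banach[OF *] by simp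
  also have "\<dots> = (\<Sum>\<^sub>\<infinity>s. p s) * (\<Sum>\<^sub>\<infinity>t. q t)"
    by (simp add: infsum_cmult_right' infsum_cmult_left')
  finally show "(\<Sum>\<^sub>\<infinity>s. p s) * (\<Sum>\<^sub>\<infinity>t. q t) = (\<Sum>\<^sub>\<infinity>(s, t)\<in>UNIV. p s * q t)" by simp
qed

text \<open>The right-hand side is a double series over all pairs (s, t). Putting s = n + m and t =
  n - m in the products on the left gives the pairs with s + t even for the \<open>t4\<close>
  product and, because of the half-integral exponents, the pairs with s + t odd for the
  \<open>t1\<close> product.\<close>

theorem theta_product:
  assumes "Im \<tau> > 0"
  shows "t4 \<tau> x * t4 \<tau> y + t1 \<tau> x * t1 \<tau> y = tp \<tau> (x + y) * tq \<tau> (x - y)"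
proof -
  define F where "F = (\<lambda>(s, t). exp (\<i> * cpi * \<tau> / 2 * (of_int s ^ 2 + of_int t ^ 2)
     + \<i> * of_int s * (x + y) + \<i> * of_int t * (x - y) + \<i> * cpi * of_int s))"
  have tau2: "Im (\<tau> / 2) > 0" using assms by simp
  have tq: "tq \<tau> (x - y) = th (\<tau> / 2) ((x - y) / 2)"
    using th_plus_pi[of "\<tau>/2" "(x - y) / 2"] by (simp add: tq_def t4_eq_th add.assoc)
  have F: "F = (\<lambda>(s, t). th_term (\<tau> / 2) ((x + y) / 2 + cpi / 2) s * th_term (\<tau> / 2) ((x - y) / 2) t)"
    unfolding F_def th_term_def exp_add[symmetric]
    by (intro ext) (auto intro!: arg_cong[of _ _ exp] simp: field_simps)
  note s2 = infsum_mult_abs[OF th_term_abs_summable th_term_abs_summable, OF tau2 tau2, of "(x + y) / 2 + cpi / 2" "(x - y) / 2"]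
  note s1 = infsum_mult_abs[OF th_term_abs_summable th_term_abs_summable, OF assms assms]
  have lhs: "tp \<tau> (x + y) * tq \<tau> (x - y) = infsum F UNIV"
    unfolding F tq tp_def t4_eq_th using s2(2) by (simp add: th_def)
  have sumF: "F summable_on A" for A using s2(1)[of A] by (simp add: F)
  define E where "E = {(s, t :: int). even (s + t)}"
  have "E \<union> - E = UNIV" by auto
  hence "infsum F UNIV = infsum F E + infsum F (- E)"
    using infsum_Un_disjoint[of F E "- E"] sumF by auto
  also have "infsum F E = t4 \<tau> x * t4 \<tau> y"
  proof -
    have "t4 \<tau> x * t4 \<tau> y = (\<Sum>\<^sub>\<infinity>(n, m)\<in>UNIV. th_term \<tau> (x + cpi / 2) n * th_term \<tau> (y + cpi / 2) m)"
      unfolding t4_eq_th th_def by (rule s1(2))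
    also have "\<dots> = infsum F E"
    proof (rule infsum_reindex_bij_witness[of _ "\<lambda>(s, t). ((s + t) div 2, (s - t) div 2)" "\<lambda>(n, m). (n + m, n - m)"])
      fix z :: "int \<times> int"
      show "F (case z of (n, m) \<Rightarrow> (n + m, n - m)) = (case z of (n, m) \<Rightarrow> th_term \<tau> (x + cpi / 2) n * th_term \<tau> (y + cpi / 2) m)"
        by (cases z) (auto simp: F_def th_term_def exp_add[symmetric] intro!: arg_cong[of _ _ exp],
          simp add: field_simps power2_eq_square)
    qed (auto simp: E_def; presburger)+
    finally show ?thesis by simp
  qed
  also have "infsum F (- E) = t1 \<tau> x * t1 \<tau> y"
  proof -
    define e where "e = (\<lambda>x. exp (\<i> * cpi * \<tau> / 4 + \<i> * x))"
    define x' where "x' = x + cpi / 2 + cpi * \<tau> / 2"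
    define y' where "y' = y + cpi / 2 + cpi * \<tau> / 2"
    have "t1 \<tau> x * t1 \<tau> y = - (e x * e y) * (th \<tau> x' * th \<tau> y')"
      by (simp add: t1_def theta1_th e_def x'_def y'_def algebra_simps)
    also have "th \<tau> x' * th \<tau> y' = (\<Sum>\<^sub>\<infinity>z. case z of (n, m) \<Rightarrow> th_term \<tau> x' n * th_term \<tau> y' m)"
      unfolding th_def by (rule s1(2))
    also have "- (e x * e y) * \<dots> = (\<Sum>\<^sub>\<infinity>z. - (e x * e y) * (case z of (n, m) \<Rightarrow> th_term \<tau> x' n * th_term \<tau> y' m))"
      by (rule infsum_cmult_right'[symmetric])
    also have "\<dots> = infsum F (- E)"
    \<comment> \<open>The exponents of \<open>theta1\<close> are n + 1/2 and m + 1/2; their sum is n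
      + m + 1 and their difference n - m.\<close>
    proof (rule infsum_reindex_bij_witness[of _ "\<lambda>(s, t). ((s + t - 1) div 2, (s - t - 1) div 2)" "\<lambda>(n, m). (n + m + 1, n - m)"])
      fix z :: "int \<times> int"
      obtain n m where z: "z = (n, m)" by (cases z)
      have "F (n + m + 1, n - m) = - (e x * e y * (th_term \<tau> x' n * th_term \<tau> y' m))"
      proof -
        have "F (n + m + 1, n - m) = exp (\<i> * cpi + ((\<i> * cpi * \<tau> / 4 + \<i> * x) + (\<i> * cpi * \<tau> / 4 + \<i> * y) + ((\<i> * cpi * \<tau> * of_int n ^ 2 + 2 * \<i> * of_int n * x') + (\<i> * cpi * \<tau> * of_int m ^ 2 + 2 * \<i> * of_int m * y'))))"
          unfolding F_def prod.case x'_def y'_def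
          by (intro arg_cong[of _ _ exp]) (simp add: field_simps power2_eq_square)
        thus ?thesis by (simp only: exp_add exp_pi_i' e_def th_term_def) simp
      qed
      thus "F (case z of (n, m) \<Rightarrow> (n + m + 1, n - m)) = - (e x * e y) * (case z of (n, m) \<Rightarrow> th_term \<tau> x' n * th_term \<tau> y' m)"
        by (simp add: z)
    qed (auto simp: E_def; presburger)+
    finally show ?thesis by simp
  qed
  finally show ?thesis using lhs by simp
qed

lemma theta_product':
  assumes "Im \<tau> > 0"
  shows "t4 \<tau> x * t4 \<tau> y - t1 \<tau> x * t1 \<tau> y = tq \<tau> (x + y) * tp \<tau> (x - y)"
  using theta_product[OF assms, of x "- y"] by (simp add: t1_minus t4_minus mult.commute)

text \<open>At a common zero z the product formula reads \<open>tp\<close> (z + y) \<open>tq\<close>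
  (z - y) = 0 for all y, which two entire functions that are not identically zero cannot
  satisfy.\<close>

lemma t1_t4_no_common_zero:
  assumes "Im \<tau> > 0" "t1 \<tau> z = 0"
  shows "t4 \<tau> z \<noteq> 0"
proof
  assume z: "t4 \<tau> z = 0"
  obtain a b where ab: "tp \<tau> a \<noteq> 0" "tq \<tau> b \<noteq> 0" using tp_not_identically_0 tq_not_identically_0 assms by blast
  have "(\<lambda>y. tq \<tau> (z - y)) (z - b) = 0"
    by (rule entire_mult_eq_0[of "\<lambda>y. tp \<tau> (z + y)" _ "a - z"])
      (use theta_product[OF assms(1), of z] assms z ab in \<open>auto intro!: holomorphic_intros\<close>)
  thus False using ab by simp
qed

text \<open>On the line x + y = z both product formulas have right-hand side 0. Their sum leaves
  \<open>t4\<close> x times \<open>t4\<close> (z - x), which is not identically zero.\<close>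

lemma tp_tq_no_common_zero:
  assumes "Im \<tau> > 0" "tp \<tau> z = 0"
  shows "tq \<tau> z \<noteq> 0"
proof
  assume z: "tq \<tau> z = 0"
  have *: "t4 \<tau> x * t4 \<tau> (z - x) = 0" for x
    using theta_product[OF assms(1), of x "z - x"] theta_product'[OF assms(1), of x "z - x"] assms z by auto
  obtain a where a: "t4 \<tau> a \<noteq> 0" using t4_not_identically_0 assms by blast
  have "(\<lambda>x. t4 \<tau> (z - x)) (z - a) = 0"
    by (rule entire_mult_eq_0[of "t4 \<tau>" _ a]) (use a * assms in \<open>auto intro!: holomorphic_intros theta_entire\<close>)
  thus False using a by simp
qed

section \<open>Zeros of the theta functions\<close>

definition lat :: "complex \<Rightarrow> complex \<Rightarrow> bool" where
  "lat \<tau> z \<longleftrightarrow> (\<exists>k n :: int. z = of_int k * (cpi * \<tau>) + of_int n * cpi)"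

text \<open>A period w of \<open>tp\<close> / \<open>tq\<close> yields an entire function H without
  zeros, the common multiplier of \<open>tp\<close> and \<open>tq\<close> under translation by w.
  Its logarithmic derivative is doubly periodic, hence constant, so H is an exponential; its
  behaviour under 2 pi and pi \<tau> then determines w.\<close>

lemma theta_ratio_period:
  assumes tau: "Im \<tau> > 0" and per: "\<And>t. tp \<tau> (t + w) * tq \<tau> t = tq \<tau> (t + w) * tp \<tau> t"
  shows "\<exists>k n :: int. w = of_int k * (cpi * \<tau>) + of_int n * (2 * cpi)"
proof -
  \<comment> \<open>The two quotients agree where both are defined, and at every point at least one
    of them is, since \<open>tp\<close> and \<open>tq\<close> have no common zero. A zero of H would
    make t + w a common zero.\<close>
  define H where "H = (\<lambda>t. if tp \<tau> t \<noteq> 0 then tp \<tau> (t + w) / tp \<tau> t else tq \<tau> (t + w) / tq \<tau> t)"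
  have H1: "H t * tp \<tau> t = tp \<tau> (t + w)" for t
    using per[of t] tp_tq_no_common_zero[OF tau, of t] by (auto simp: H_def)
  have H2: "H t * tq \<tau> t = tq \<tau> (t + w)" for t
    using per[of t] tp_tq_no_common_zero[OF tau, of t] by (auto simp: H_def field_simps)
  have Hnz: "H t \<noteq> 0" for t
    using H1[of t] H2[of t] tp_tq_no_common_zero[OF tau, of "t + w"] by auto
  have op: "open {t. tp \<tau> t \<noteq> 0}" "open {t. tq \<tau> t \<noteq> 0}"
    using theta_entire[OF tau] by (auto intro!: open_Collect_neq holomorphic_on_imp_continuous_on continuous_intros)
  have Hhol: "H holomorphic_on UNIV"
  proof -
    have "H holomorphic_on {t. tp \<tau> t \<noteq> 0}"
      by (rule holomorphic_transform[of "\<lambda>t. tp \<tau> (t + w) / tp \<tau> t"])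
        (use tau in \<open>auto simp: H_def intro!: holomorphic_intros\<close>)
    moreover have "H holomorphic_on {t. tq \<tau> t \<noteq> 0}"
      by (rule holomorphic_transform[of "\<lambda>t. tq \<tau> (t + w) / tq \<tau> t"])
        (use tau H2 in \<open>auto simp: field_simps intro!: holomorphic_intros\<close>)
    ultimately have "H holomorphic_on ({t. tp \<tau> t \<noteq> 0} \<union> {t. tq \<tau> t \<noteq> 0})"
      by (rule holomorphic_on_Un) (use op in auto)
    moreover have "{t. tp \<tau> t \<noteq> 0} \<union> {t. tq \<tau> t \<noteq> 0} = UNIV"
      using tp_tq_no_common_zero[OF tau] by auto
    ultimately show ?thesis by simp
  qed
  have p1: "H (t + 2 * cpi) = 1 * H t" for t
  proof -
    have "t + 2 * cpi + w = (t + w) + 2 * cpi" by simp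
    hence "H (t + 2 * cpi) * tp \<tau> t = H t * tp \<tau> t" "H (t + 2 * cpi) * tq \<tau> t = H t * tq \<tau> t"
      using H1[of "t + 2 * cpi"] H2[of "t + 2 * cpi"] H1[of t] H2[of t]
      by (simp_all only: tp_plus_2pi tq_plus_2pi)
    thus ?thesis using tp_tq_no_common_zero[OF tau, of t] by auto
  qed
  have p2: "H (t + cpi * \<tau>) = exp (- (\<i> * w)) * H t" for t
  proof -
    let ?k = "exp (- (\<i> * cpi * \<tau> / 2) - \<i> * t)"
    have "t + cpi * \<tau> + w = (t + w) + cpi * \<tau>" by simp
    moreover have "exp (- (\<i> * cpi * \<tau> / 2) - \<i> * (t + w)) = ?k * exp (- (\<i> * w))"
      unfolding exp_add[symmetric] by (intro arg_cong[of _ _ exp]) (simp add: algebra_simps)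
    ultimately have "H (t + cpi * \<tau>) * (?k * tp \<tau> t) = exp (- (\<i> * w)) * H t * (?k * tp \<tau> t)"
      "H (t + cpi * \<tau>) * (?k * tq \<tau> t) = exp (- (\<i> * w)) * H t * (?k * tq \<tau> t)"
      using H1[of "t + cpi * \<tau>"] H2[of "t + cpi * \<tau>"]
      by (simp_all only: tp_plus_tau tq_plus_tau H1[of t, symmetric] H2[of t, symmetric])
        (simp_all only: mult_minus_left mult_minus_right mult_ac neg_equal_iff_equal)
    thus ?thesis using tp_tq_no_common_zero[OF tau, of t] by auto
  qed
  define L where "L = (\<lambda>t. deriv H t / H t)"
  have Lper: "L (t + \<omega>) = L t" if "\<And>t. H (t + \<omega>) = c * H t" "c \<noteq> 0" for t \<omega> c
  proof -
    have "deriv H (t + \<omega>) = deriv (\<lambda>t. H (t + \<omega>)) t" by (simp add: deriv_shift)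
    also have "\<dots> = c * deriv H t"
      unfolding that(1) by (rule deriv_cmult) (use Hhol in \<open>auto intro: holomorphic_on_imp_differentiable_at\<close>)
    finally show ?thesis using that by (simp add: L_def)
  qed
  have Lc: "L t = L 0" for t
  proof (rule doubly_periodic_entire_constant[where e = L and ?\<omega>1.0 = "2 * cpi" and ?\<omega>2.0 = "cpi * \<tau>"])
    show "L holomorphic_on UNIV" unfolding L_def using Hhol Hnz by (intro holomorphic_intros) auto
    show "L (x + 2 * cpi) = L x" for x using Lper[OF p1] by simp
    show "L (x + cpi * \<tau>) = L x" for x using Lper[OF p2] by simp
    show "Im (cpi * \<tau> / (2 * cpi)) \<noteq> 0" using tau by simp
  qed
  have He: "H x = H 0 * exp (L 0 * x)" for x
  proof (rule entire_linear_ode[OF Hhol])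
    show "deriv H x = L 0 * H x" for x using Lc[of x] Hnz[of x] unfolding L_def by (simp add: field_simps)
  qed
  \<comment> \<open>Invariance under 2 pi makes the rate of the exponential i k with k an integer.
    The multiplier exp(-i w) under pi \<tau> then gives w up to multiples of 2 pi.\<close>
  from p1[of 0] He[of "2 * cpi"] Hnz[of 0] have "exp (L 0 * (2 * cpi)) = 1" by simp
  then obtain k where k: "Re (L 0) = 0" "Im (L 0) = of_int k"
    by (auto simp: exp_eq_1)
  hence L0: "L 0 = \<i> * of_int k" by (simp add: complex_eq_iff)
  from p2[of 0] He[of "cpi * \<tau>"] Hnz[of 0] have "exp (L 0 * (cpi * \<tau>)) = exp (- (\<i> * w))" by simp
  then obtain n where "L 0 * (cpi * \<tau>) = - (\<i> * w) + (of_int (2 * n) * cpi) * \<i>"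
    by (subst (asm) exp_eq) auto
  hence "\<i> * (of_int k * (cpi * \<tau>)) = \<i> * (- w + of_int (2 * n) * cpi)"
    by (simp add: L0 algebra_simps)
  hence "of_int k * (cpi * \<tau>) = - w + of_int (2 * n) * cpi" by simp
  hence "w = of_int (- k) * (cpi * \<tau>) + of_int n * (2 * cpi)"
    by (simp add: algebra_simps)
  thus ?thesis by blast
qed

lemma zero_set_int_translate:
  fixes F :: "complex \<Rightarrow> complex"
  assumes "\<And>x. F (x + w) = E x * F x" "\<And>x. E x \<noteq> 0"
  shows "F (x + of_int k * w) = 0 \<longleftrightarrow> F x = 0"
proof -
  have "(\<lambda>x. F x = 0) (x + of_int k * w) = (\<lambda>x. F x = 0) x"
  proof (induction k rule: int_induct[of _ 0])
    case (step1 i)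
    thus ?case using assms(1)[of "x + of_int i * w"] assms(2) by (simp add: algebra_simps)
  next
    case (step2 i)
    thus ?case using assms(1)[of "x + of_int (i - 1) * w"] assms(2) by (simp add: algebra_simps)
  qed auto
  thus ?thesis by simp
qed

lemma t1_zero_translate: "t1 \<tau> (x + (of_int k * (cpi * \<tau>) + of_int n * cpi)) = 0 \<longleftrightarrow> t1 \<tau> x = 0"
proof -
  have "t1 \<tau> (x + of_int k * (cpi * \<tau>) + of_int n * cpi) = 0 \<longleftrightarrow> t1 \<tau> (x + of_int k * (cpi * \<tau>)) = 0"
    by (rule zero_set_int_translate[of _ _ "\<lambda>_. - 1"]) (auto simp: t1_plus_pi)
  also have "\<dots> \<longleftrightarrow> t1 \<tau> x = 0"
    by (rule zero_set_int_translate[where F = "t1 \<tau>", OF t1_plus_tau]) auto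
  finally show ?thesis by (simp add: add.assoc)
qed

text \<open>For a zero z, both product formulas at (t + z, z) have left-hand side \<open>t4\<close>
  (t + z) times \<open>t4\<close> z. Equating the right-hand sides shows that 2z is a period of
  \<open>tp\<close> / \<open>tq\<close>, so that \<open>theta_ratio_period\<close> applies.\<close>

theorem t1_eq_0_iff:
  assumes tau: "Im \<tau> > 0"
  shows "t1 \<tau> z = 0 \<longleftrightarrow> lat \<tau> z"
proof
  assume "lat \<tau> z"
  thus "t1 \<tau> z = 0" using t1_zero_translate[of \<tau> 0] by (auto simp: lat_def)
next
  assume z: "t1 \<tau> z = 0"
  have "tp \<tau> (t + 2 * z) * tq \<tau> t = tq \<tau> (t + 2 * z) * tp \<tau> t" for t
    using theta_product[OF tau, of "t + z" z] theta_product'[OF tau, of "t + z" z] z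
    by (simp add: algebra_simps)
  then obtain k n where kn: "2 * z = of_int k * (cpi * \<tau>) + of_int n * (2 * cpi)"
    using theta_ratio_period[OF tau] by blast
  \<comment> \<open>For odd k the point z would be congruent to the half period pi \<tau>/2, where
    \<open>t4\<close> vanishes, and the two theta functions would have a common zero.\<close>
  have "even k"
  proof (rule ccontr)
    assume "odd k"
    then obtain l where l: "k = 2 * l + 1" by (elim oddE)
    have "z = cpi * \<tau> / 2 + (of_int l * (cpi * \<tau>) + of_int n * cpi)"
      using kn by (simp add: l algebra_simps) (simp add: field_simps)
    with z have "t1 \<tau> (cpi * \<tau> / 2) = 0" using t1_zero_translate by simp
    moreover have "t4 \<tau> (cpi * \<tau> / 2) = 0" using t4_plus_half[of \<tau> 0] by simp
    ultimately show False using t1_t4_no_common_zero[OF tau] by blast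
  qed
  then obtain l where l: "k = 2 * l" by (elim evenE)
  have "2 * z = 2 * (of_int l * (cpi * \<tau>) + of_int n * cpi)" using kn by (simp add: l algebra_simps)
  hence "z = of_int l * (cpi * \<tau>) + of_int n * cpi" by (simp only: mult_cancel_left) auto
  thus "lat \<tau> z" unfolding lat_def by blast
qed

lemma t4_eq_0_iff:
  assumes tau: "Im \<tau> > 0"
  shows "t4 \<tau> z = 0 \<longleftrightarrow> lat \<tau> (z + cpi * \<tau> / 2)"
  using t1_plus_half[of \<tau> z] t1_eq_0_iff[OF tau, of "z + cpi * \<tau> / 2"] by simp


section \<open>Logarithmic derivatives of quotients\<close>

text \<open>By the convention for division, the logarithmic derivative \<open>LD F G\<close> of \<open>F / G\<close> is \<open>0\<close> at its poles.\<close>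

definition LDnum :: "(complex \<Rightarrow> complex) \<Rightarrow> (complex \<Rightarrow> complex) \<Rightarrow> complex \<Rightarrow> complex" where
  "LDnum F G x = deriv F x * G x - F x * deriv G x"

definition LD :: "(complex \<Rightarrow> complex) \<Rightarrow> (complex \<Rightarrow> complex) \<Rightarrow> complex \<Rightarrow> complex" where
  "LD F G x = LDnum F G x / (F x * G x)"

lemma LDnum_holomorphic:
  "F holomorphic_on UNIV \<Longrightarrow> G holomorphic_on UNIV \<Longrightarrow> LDnum F G holomorphic_on UNIV"
  unfolding LDnum_def by (intro holomorphic_intros entire_deriv)

text \<open>The factor E is common to F and G and the constant c is lost in a logarithmic
  derivative. Numerator and denominator of \<open>LD\<close> are both multiplied by c E^2, so the
  identity also holds at zeros of F and G, where the quotient is 0 by convention.\<close>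

lemma LD_translate:
  assumes "F holomorphic_on UNIV" "G holomorphic_on UNIV" "E holomorphic_on UNIV" "E x \<noteq> 0" "c \<noteq> 0"
    and F: "\<And>x. F (x + w) = E x * F x" and G: "\<And>x. G (x + w) = c * E x * G x"
  shows "LD F G (x + w) = LD F G x"
proof -
  note d = assms(1-3)[THEN entire_field_derivative, of x]
  have "deriv F (x + w) = deriv E x * F x + E x * deriv F x"
    unfolding deriv_shift[symmetric] F by (rule DERIV_imp_deriv) (auto intro!: derivative_eq_intros d)
  moreover have "deriv G (x + w) = c * (deriv E x * G x + E x * deriv G x)"
    unfolding deriv_shift[symmetric] G by (rule DERIV_imp_deriv) (auto intro!: derivative_eq_intros d simp: algebra_simps)
  ultimately have "LDnum F G (x + w) = (c * E x ^ 2) * LDnum F G x"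
    unfolding LDnum_def F G by (simp add: algebra_simps power2_eq_square)
  moreover have "F (x + w) * G (x + w) = (c * E x ^ 2) * (F x * G x)"
    by (simp add: F G power2_eq_square)
  ultimately show ?thesis unfolding LD_def using assms(4,5) by simp
qed

lemma LD_translate_swap:
  assumes "F holomorphic_on UNIV" "G holomorphic_on UNIV" "E holomorphic_on UNIV" "E x \<noteq> 0"
    and F: "\<And>x. F (x + w) = E x * G x" and G: "\<And>x. G (x + w) = E x * F x"
  shows "LD F G (x + w) = - LD F G x"
proof -
  note d = assms(1-3)[THEN entire_field_derivative, of x]
  have "deriv F (x + w) = deriv E x * G x + E x * deriv G x"
    unfolding deriv_shift[symmetric] F by (rule DERIV_imp_deriv) (auto intro!: derivative_eq_intros d)
  moreover have "deriv G (x + w) = deriv E x * F x + E x * deriv F x"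
    unfolding deriv_shift[symmetric] G by (rule DERIV_imp_deriv) (auto intro!: derivative_eq_intros d simp: algebra_simps)
  ultimately have "LDnum F G (x + w) = (E x ^ 2) * (- LDnum F G x)"
    unfolding LDnum_def F G by (simp add: algebra_simps power2_eq_square)
  moreover have "F (x + w) * G (x + w) = (E x ^ 2) * (F x * G x)"
    by (simp add: F G power2_eq_square)
  ultimately have "LD F G (x + w) = (E x ^ 2 * (- LDnum F G x)) / (E x ^ 2 * (F x * G x))"
    unfolding LD_def by (simp only:)
  also have "\<dots> = (- LDnum F G x) / (F x * G x)"
    using assms(4) by (intro mult_divide_mult_cancel_left) simp
  finally show ?thesis unfolding LD_def by simp
qed

lemma LD_affine:
  assumes "F holomorphic_on UNIV" "G holomorphic_on UNIV"
  shows "LD (\<lambda>x. F (a * x + b)) (\<lambda>x. G (a * x + b)) x = a * LD F G (a * x + b)"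
  unfolding LD_def LDnum_def deriv_affine[OF assms(1)] deriv_affine[OF assms(2)]
  by (simp add: algebra_simps diff_divide_distrib)

text \<open>\<open>LDnum\<close> is a Wronskian: where G has no zero, its vanishing makes F / G
  locally constant, and the identity theorem extends the proportionality to the whole plane.\<close>

lemma LDnum_0_imp_proportional:
  assumes "F holomorphic_on UNIV" "G holomorphic_on UNIV" "G b \<noteq> 0" "\<And>x. LDnum F G x = 0"
  shows "\<exists>c. \<forall>x. F x = c * G x"
proof -
  have "open {x. G x \<noteq> 0}"
    by (intro open_Collect_neq holomorphic_on_imp_continuous_on assms continuous_on_const)
  then obtain r where r: "r > 0" "ball b r \<subseteq> {x. G x \<noteq> 0}"
    using assms(3) openE[of "{x. G x \<noteq> 0}" b] by blast
  have "((\<lambda>x. F x / G x) has_field_derivative 0) (at x within ball b r)" if "x \<in> ball b r" for x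
  proof -
    have "G x \<noteq> 0" using that r(2) by blast
    from DERIV_divide[OF assms(1,2)[THEN entire_field_derivative, of x] this]
    have "((\<lambda>x. F x / G x) has_field_derivative LDnum F G x / (G x * G x)) (at x)"
      by (simp only: LDnum_def)
    thus ?thesis unfolding assms(4) by (simp add: has_field_derivative_at_within)
  qed
  then obtain c where c: "\<And>x. x \<in> ball b r \<Longrightarrow> F x / G x = c"
    using has_field_derivative_zero_constant[of "ball b r" "\<lambda>x. F x / G x"] convex_ball by blast
  have eq: "F x - c * G x = 0" if "x \<in> ball b r" for x
  proof -
    have "G x \<noteq> 0" using that r(2) by blast
    thus ?thesis using c[OF that] by (simp add: divide_eq_eq)
  qed
  have "F z - c * G z = 0" for z
  proof (rule entire_eq_0[where F = "\<lambda>x. F x - c * G x" and a = b])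
    have "\<forall>\<^sub>F x in nhds b. x \<in> ball b r" using r by (intro eventually_nhds_in_open) auto
    thus "\<forall>\<^sub>F x in nhds b. F x - c * G x = 0" by (rule eventually_mono) (rule eq)
  qed (intro holomorphic_intros assms)
  thus ?thesis by (intro exI[of _ c]) simp
qed

section \<open>Orders of zeros and comparison of logarithmic derivatives\<close>

definition ord_at :: "nat \<Rightarrow> (complex \<Rightarrow> complex) \<Rightarrow> complex \<Rightarrow> bool" where
  "ord_at m F a \<longleftrightarrow> (\<exists>r>0. \<exists>g. g holomorphic_on ball a r \<and> (\<forall>x\<in>ball a r. g x \<noteq> 0 \<and> F x = (x - a) ^ m * g x))"

text \<open>The factor E and the power \<alpha>^m left by the substitution are absorbed into the
  non-vanishing factor.\<close>

lemma ord_at_unit_affine: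
  assumes ord: "ord_at m G (\<alpha> * a + \<beta>)" and "\<alpha> \<noteq> 0"
    and E: "E holomorphic_on UNIV" "\<And>x. E x \<noteq> 0" and F: "\<And>x. F x = E x * G (\<alpha> * x + \<beta>)"
  shows "ord_at m F a"
proof -
  obtain r g where r: "r > 0" and g: "g holomorphic_on ball (\<alpha> * a + \<beta>) r"
    "\<And>x. x \<in> ball (\<alpha> * a + \<beta>) r \<Longrightarrow> g x \<noteq> 0 \<and> G x = (x - (\<alpha> * a + \<beta>)) ^ m * g x"
    using ord unfolding ord_at_def by blast
  have in_ball: "\<alpha> * x + \<beta> \<in> ball (\<alpha> * a + \<beta>) r" if "x \<in> ball a (r / norm \<alpha>)" for x
  proof -
    have "\<alpha> * a + \<beta> - (\<alpha> * x + \<beta>) = \<alpha> * (a - x)" by (simp add: algebra_simps)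
    hence "dist (\<alpha> * a + \<beta>) (\<alpha> * x + \<beta>) = norm \<alpha> * dist a x"
      by (simp only: dist_norm norm_mult)
    thus ?thesis using that assms(2) by (simp add: pos_less_divide_eq mult.commute)
  qed
  define h where "h = (\<lambda>x. E x * \<alpha> ^ m * g (\<alpha> * x + \<beta>))"
  have "(g \<circ> (\<lambda>x. \<alpha> * x + \<beta>)) holomorphic_on ball a (r / norm \<alpha>)"
    by (rule holomorphic_on_compose_gen[OF _ g(1)]) (use in_ball in \<open>auto intro!: holomorphic_intros\<close>)
  hence "(\<lambda>x. g (\<alpha> * x + \<beta>)) holomorphic_on ball a (r / norm \<alpha>)" by (simp add: o_def)
  hence "h holomorphic_on ball a (r / norm \<alpha>)"
    unfolding h_def by (intro holomorphic_intros holomorphic_on_subset[OF E(1)]) auto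
  moreover have "h x \<noteq> 0 \<and> F x = (x - a) ^ m * h x" if "x \<in> ball a (r / norm \<alpha>)" for x
  proof -
    have "\<alpha> * x + \<beta> - (\<alpha> * a + \<beta>) = \<alpha> * (x - a)" by (simp add: algebra_simps)
    thus ?thesis using g(2)[OF in_ball[OF that]] E(2) assms(2) by (simp add: h_def F power_mult_distrib)
  qed
  ultimately show ?thesis unfolding ord_at_def using r assms(2)
    by (intro exI[of _ "r / norm \<alpha>"] conjI exI[of _ h]) auto
qed

lemma ord_at_translate:
  assumes E: "E holomorphic_on UNIV" "\<And>x. E x \<noteq> 0" and F: "\<And>x. F (x + w) = E x * F x"
  shows "ord_at m F (a + w) \<longleftrightarrow> ord_at m F a"
proof
  assume "ord_at m F (a + w)"
  thus "ord_at m F a"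
    by (intro ord_at_unit_affine[of m F 1 a w "\<lambda>x. inverse (E x)"]) (use E F in \<open>auto intro!: holomorphic_intros\<close>)
next
  assume a: "ord_at m F a"
  show "ord_at m F (a + w)"
  proof (rule ord_at_unit_affine[of m F 1 "a + w" "- w" "\<lambda>x. E (x - w)"])
    show "F x = E (x - w) * F (1 * x + - w)" for x using F[of "x - w"] by simp
    show "(\<lambda>x. E (x - w)) holomorphic_on UNIV"
      using entire_compose_affine[OF E(1), of 1 "- w"] by simp
  qed (use a E in auto)
qed

lemma ord_at_translate_int:
  assumes E: "E holomorphic_on UNIV" "\<And>x. E x \<noteq> 0" and F: "\<And>x. F (x + w) = E x * F x"
  shows "ord_at m F (a + of_int k * w) \<longleftrightarrow> ord_at m F a"
proof (induction k rule: int_induct[of _ 0])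
  case (step1 i)
  thus ?case using ord_at_translate[of E F w m "a + of_int i * w", OF E F] by (simp add: algebra_simps)
next
  case (step2 i)
  thus ?case using ord_at_translate[of E F w m "a + of_int (i - 1) * w", OF E F] by (simp add: algebra_simps)
qed auto

text \<open>At a common zero the two logarithmic derivatives have simple poles with residues m1 and
  m2. The weights m2 and m1 make the residues cancel, and the singularities can be removed.\<close>

lemma log_deriv_difference_entire:
  assumes F: "F1 holomorphic_on UNIV" "F2 holomorphic_on UNIV"
    and zeros: "\<And>x. F1 x = 0 \<longleftrightarrow> F2 x = 0"
    and ord: "\<And>a. F1 a = 0 \<Longrightarrow> ord_at m1 F1 a" "\<And>a. F2 a = 0 \<Longrightarrow> ord_at m2 F2 a"
  shows "\<exists>e. e holomorphic_on UNIV \<and>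
    (\<forall>x. F1 x \<noteq> 0 \<longrightarrow> e x = of_nat m2 * (deriv F1 x / F1 x) - of_nat m1 * (deriv F2 x / F2 x))"
proof -
  define L where "L = (\<lambda>x. of_nat m2 * (deriv F1 x / F1 x) - of_nat m1 * (deriv F2 x / F2 x))"
  have op: "open {x. F1 x \<noteq> 0}"
    by (intro open_Collect_neq holomorphic_on_imp_continuous_on F continuous_on_const)
  have Lhol: "L holomorphic_on {x. F1 x \<noteq> 0}"
  proof -
    have h: "H holomorphic_on A" if "H holomorphic_on UNIV" for H :: "complex \<Rightarrow> complex" and A
      using that by (rule holomorphic_on_subset) auto
    have "F1 holomorphic_on {x. F1 x \<noteq> 0}" "F2 holomorphic_on {x. F1 x \<noteq> 0}"
      "deriv F1 holomorphic_on {x. F1 x \<noteq> 0}" "deriv F2 holomorphic_on {x. F1 x \<noteq> 0}"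
      by (rule h[OF F(1)] h[OF F(2)] h[OF entire_deriv[OF F(1)]] h[OF entire_deriv[OF F(2)]])+
    moreover have "F2 x \<noteq> 0" if "x \<in> {x. F1 x \<noteq> 0}" for x using that zeros by simp
    ultimately show ?thesis unfolding L_def
      by (intro holomorphic_on_diff holomorphic_on_mult holomorphic_on_const holomorphic_on_divide) auto
  qed
  have an: "L analytic_on {a}" if "F1 a \<noteq> 0" for a
    unfolding analytic_at by (rule exI[of _ "{x. F1 x \<noteq> 0}"]) (use Lhol op that in simp)
  have "remove_sings L analytic_on {a}" for a
  proof (cases "F1 a = 0")
    case False
    thus ?thesis by (intro remove_sings_analytic_on an)
  next
    case True
    obtain r1 g1 where r1: "r1 > 0" and g1: "g1 holomorphic_on ball a r1" "\<And>x. x \<in> ball a r1 \<Longrightarrow> g1 x \<noteq> 0"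
      "\<And>x. x \<in> ball a r1 \<Longrightarrow> F1 x = (x - a) ^ m1 * g1 x"
      using ord(1)[OF True] unfolding ord_at_def by blast
    obtain r2 g2 where r2: "r2 > 0" and g2: "g2 holomorphic_on ball a r2" "\<And>x. x \<in> ball a r2 \<Longrightarrow> g2 x \<noteq> 0"
      "\<And>x. x \<in> ball a r2 \<Longrightarrow> F2 x = (x - a) ^ m2 * g2 x"
      using ord(2) True zeros unfolding ord_at_def by blast
    define r where "r = min r1 r2"
    have r: "r > 0" "ball a r \<subseteq> ball a r1" "ball a r \<subseteq> ball a r2" using r1 r2 by (auto simp: r_def)
    define k where "k = (\<lambda>x. of_nat m2 * (deriv g1 x / g1 x) - of_nat m1 * (deriv g2 x / g2 x))"
    have log: "deriv F x / F x = of_nat m / (x - a) + deriv g x / g x"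
      if F: "\<And>x. x \<in> ball a R \<Longrightarrow> F x = (x - a) ^ m * g x" and "g x \<noteq> 0" "x \<in> ball a R" "x \<noteq> a" "g holomorphic_on ball a R"
      for F g :: "complex \<Rightarrow> complex" and m R x
    proof -
      have ev: "\<forall>\<^sub>F y in nhds x. y \<in> ball a R" using that by (intro eventually_nhds_in_open) auto
      have "((\<lambda>x. (x - a) ^ m * g x) has_field_derivative of_nat m * (x - a) ^ (m - 1) * g x + deriv g x * (x - a) ^ m) (at x)"
      proof -
        have "((\<lambda>x. (x - a) ^ m) has_field_derivative of_nat m * (x - a) ^ (m - 1)) (at x)"
          by (auto intro!: derivative_eq_intros)
        from DERIV_mult[OF this holomorphic_derivI[OF that(5) open_ball that(3)]] show ?thesis
          by (simp add: mult.commute)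
      qed
      moreover have "deriv F x = deriv (\<lambda>x. (x - a) ^ m * g x) x"
        by (rule deriv_cong_ev[OF eventually_mono[OF ev F] refl])
      ultimately have dF: "deriv F x = of_nat m * (x - a) ^ (m - 1) * g x + deriv g x * (x - a) ^ m"
        by (simp add: DERIV_imp_deriv)
      have nz: "(x - a) ^ k \<noteq> 0" for k using that by simp
      show ?thesis
      proof (cases m)
        case 0
        thus ?thesis unfolding dF F[OF that(3)] by simp
      next
        case (Suc k)
        have "deriv F x / F x = (of_nat m * ((x - a) ^ k * g x) + (x - a) * deriv g x * (x - a) ^ k) / ((x - a) * (x - a) ^ k * g x)"
          unfolding dF F[OF that(3)] by (simp add: Suc mult_ac)
        also have "\<dots> = of_nat m / (x - a) + deriv g x / g x"
          using nz[of k] that(2,4) by (simp add: field_simps)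
        finally show ?thesis .
      qed
    qed
    have Lk: "L x = k x" if "x \<in> ball a r" "x \<noteq> a" for x
    proof -
      have "deriv F1 x / F1 x = of_nat m1 / (x - a) + deriv g1 x / g1 x"
        by (rule log[of r1]) (use g1 that r in auto)
      moreover have "deriv F2 x / F2 x = of_nat m2 / (x - a) + deriv g2 x / g2 x"
        by (rule log[of r2]) (use g2 that r in auto)
      ultimately show ?thesis unfolding L_def k_def by (simp add: ring_distribs mult.commute)
    qed
    have "k holomorphic_on ball a r"
    proof -
      have "g1 holomorphic_on ball a r" "g2 holomorphic_on ball a r"
        using holomorphic_on_subset[OF g1(1) r(2)] holomorphic_on_subset[OF g2(1) r(3)] .
      moreover have "g1 x \<noteq> 0 \<and> g2 x \<noteq> 0" if "x \<in> ball a r" for x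
        using that r g1(2) g2(2) by blast
      ultimately show ?thesis unfolding k_def
        by (intro holomorphic_intros holomorphic_deriv open_ball) blast+
    qed
    hence kan: "k analytic_on ball a r" by (simp add: analytic_on_open)
    have "\<forall>\<^sub>F x in at a. L x = k x"
      unfolding eventually_at_filter
    proof (rule eventually_mono)
      show "\<forall>\<^sub>F x in nhds a. x \<in> ball a r" using r(1) by (intro eventually_nhds_in_open) auto
      show "x \<noteq> a \<longrightarrow> x \<in> UNIV \<longrightarrow> L x = k x" if "x \<in> ball a r" for x using Lk that by blast
    qed
    moreover have "k \<midarrow>a\<rightarrow> k a"
    proof -
      have "k analytic_on {a}" by (rule analytic_on_subset[OF kan]) (use r(1) in simp)
      thus ?thesis by (intro isContD analytic_at_imp_isCont)
    qed
    ultimately have lim: "L \<midarrow>a\<rightarrow> k a" by (rule iffD2[OF tendsto_cong])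
    have "k holomorphic_on ball a r - {a}"
      using kan by (auto simp: analytic_on_open elim: holomorphic_on_subset)
    hence "L holomorphic_on ball a r - {a}"
      by (rule holomorphic_transform) (use Lk in auto)
    hence "L analytic_on ball a r - {a}" by (subst analytic_on_open) auto
    hence "isolated_singularity_at L a" unfolding isolated_singularity_at_def using r by blast
    thus ?thesis using lim by (rule remove_sings_analytic_at)
  qed
  hence "remove_sings L analytic_on UNIV" by (subst analytic_on_analytic_at) simp
  hence "remove_sings L holomorphic_on UNIV" by (rule analytic_imp_holomorphic)
  moreover have "\<forall>x. F1 x \<noteq> 0 \<longrightarrow> remove_sings L x = L x"
    using an remove_sings_at_analytic by blast
  ultimately show ?thesis by (intro exI[of _ "remove_sings L"] conjI) (simp_all only: L_def)
qed

text \<open>The weighted difference of the two sides extends to an entire function by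
  \<open>log_deriv_difference_entire\<close>. It has the two periods, so it is constant by
  Liouville's theorem; since translation by \<eta> changes its sign, the constant is 0.\<close>

theorem LD_proportional:
  assumes F: "F1 holomorphic_on UNIV" "F2 holomorphic_on UNIV" "F1 b \<noteq> 0"
    and G: "G1 holomorphic_on UNIV" "G2 holomorphic_on UNIV" "G1 b' \<noteq> 0"
    and zeros: "\<And>x. F1 x = 0 \<longleftrightarrow> F2 x = 0" "\<And>x. G1 x = 0 \<longleftrightarrow> G2 x = 0"
    and ord: "\<And>a. F1 a = 0 \<Longrightarrow> ord_at m1 F1 a" "\<And>a. F2 a = 0 \<Longrightarrow> ord_at m2 F2 a"
      "\<And>a. G1 a = 0 \<Longrightarrow> ord_at m1 G1 a" "\<And>a. G2 a = 0 \<Longrightarrow> ord_at m2 G2 a"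
    and per1: "\<And>x. LD F1 G1 (x + wa) = LD F1 G1 x" "\<And>x. LD F1 G1 (x + wb) = LD F1 G1 x" "\<And>x. LD F1 G1 (x + \<eta>) = - LD F1 G1 x"
    and per2: "\<And>x. LD F2 G2 (x + wa) = LD F2 G2 x" "\<And>x. LD F2 G2 (x + wb) = LD F2 G2 x" "\<And>x. LD F2 G2 (x + \<eta>) = - LD F2 G2 x"
    and im: "Im (wb / wa) \<noteq> 0"
  shows "of_nat m2 * LD F1 G1 x = of_nat m1 * LD F2 G2 x"
proof -
  define L where "L = (\<lambda>x. of_nat m2 * LD F1 G1 x - of_nat m1 * LD F2 G2 x)"
  obtain eF where eF: "eF holomorphic_on UNIV"
    "\<forall>x. F1 x \<noteq> 0 \<longrightarrow> eF x = of_nat m2 * (deriv F1 x / F1 x) - of_nat m1 * (deriv F2 x / F2 x)"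
  proof -
    have "\<exists>e. e holomorphic_on UNIV \<and> (\<forall>x. F1 x \<noteq> 0 \<longrightarrow> e x = of_nat m2 * (deriv F1 x / F1 x) - of_nat m1 * (deriv F2 x / F2 x))"
      by (rule log_deriv_difference_entire) (fact F zeros ord)+
    thus ?thesis using that by (elim exE conjE)
  qed
  obtain eG where eG: "eG holomorphic_on UNIV"
    "\<forall>x. G1 x \<noteq> 0 \<longrightarrow> eG x = of_nat m2 * (deriv G1 x / G1 x) - of_nat m1 * (deriv G2 x / G2 x)"
  proof -
    have "\<exists>e. e holomorphic_on UNIV \<and> (\<forall>x. G1 x \<noteq> 0 \<longrightarrow> e x = of_nat m2 * (deriv G1 x / G1 x) - of_nat m1 * (deriv G2 x / G2 x))"
      by (rule log_deriv_difference_entire) (fact G zeros ord)+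
    thus ?thesis using that by (elim exE conjE)
  qed
  define e where "e = (\<lambda>x. eF x - eG x)"
  have ehol: "e holomorphic_on UNIV" unfolding e_def by (intro holomorphic_intros eF eG)
  have eL: "e x = L x" if "F1 x \<noteq> 0" "G1 x \<noteq> 0" for x
  proof -
    have *: "LD F G x = deriv F x / F x - deriv G x / G x" if "F x \<noteq> 0" "G x \<noteq> 0" for F G
      using that by (simp add: LD_def LDnum_def field_simps)
    have "F2 x \<noteq> 0" "G2 x \<noteq> 0" using that zeros by auto
    hence "LD F1 G1 x = deriv F1 x / F1 x - deriv G1 x / G1 x" "LD F2 G2 x = deriv F2 x / F2 x - deriv G2 x / G2 x"
      using that * by blast+
    thus ?thesis unfolding e_def L_def eF(2)[rule_format, OF that(1)] eG(2)[rule_format, OF that(2)]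
      by (simp add: ring_distribs)
  qed
  have shift: "(\<lambda>x. H (x + w)) holomorphic_on UNIV" if "H holomorphic_on UNIV" for H :: "complex \<Rightarrow> complex" and w
    using entire_compose_affine[OF that, of 1 w] by simp
  have ev: "\<forall>\<^sub>F x in at 0. F1 (x + w) \<noteq> 0 \<and> G1 (x + w) \<noteq> 0" for w
  proof (rule eventually_conj)
    show "\<forall>\<^sub>F x in at 0. F1 (x + w) \<noteq> 0"
      by (rule entire_eventually_nonzero[OF shift[OF F(1)], where b = "b - w"]) (use F(3) in simp)
    show "\<forall>\<^sub>F x in at 0. G1 (x + w) \<noteq> 0"
      by (rule entire_eventually_nonzero[OF shift[OF G(1)], where b = "b' - w"]) (use G(3) in simp)
  qed
  have e_per: "e (x + w) = c * e x" if "\<And>x. L (x + w) = c * L x" for x w c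
  proof -
    have "e (x + w) - c * e x = 0"
    proof (rule entire_eq_0_at[where F = "\<lambda>x. e (x + w) - c * e x" and a = 0])
      show "\<forall>\<^sub>F x in at 0. e (x + w) - c * e x = 0"
        using ev[of w] ev[of 0] by eventually_elim (simp add: eL that)
    qed (intro holomorphic_intros shift ehol)
    thus ?thesis by simp
  qed
  have e1: "e (x + wa) = e x" "e (x + wb) = e x" "e (x + \<eta>) = - e x" for x
    using e_per[of wa 1] e_per[of wb 1] e_per[of \<eta> "-1"] by (simp_all add: L_def per1 per2)
  have "e x = 0" for x
    using doubly_periodic_entire_constant[OF ehol e1(1,2) im, of "x + \<eta>" x] e1(3)[of x] by simp
  show ?thesis
  proof (cases "F1 x = 0 \<or> G1 x = 0")
    \<comment> \<open>The zero sets of the two quotients agree, so here both logarithmic derivatives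
      are 0 by the convention for division.\<close>
    case True
    thus ?thesis using zeros by (auto simp: LD_def)
  next
    case False
    thus ?thesis using eL[of x] \<open>e x = 0\<close> by (simp add: L_def)
  qed
qed


section \<open>The functions \<open>D\<close> and \<open>Dg\<close>\<close>

text \<open>On the regular locus \<open>du/u = D(x) dx + D(y) dy\<close>, and \<open>dlog ((1 + u) / (1 - u)) = Dg(x + y) d(x + y) - Dg(x - y) d(x - y)\<close>.\<close>

definition D :: "complex \<Rightarrow> complex \<Rightarrow> complex" where "D \<tau> = LD (t1 \<tau>) (t4 \<tau>)"
definition Dg :: "complex \<Rightarrow> complex \<Rightarrow> complex" where "Dg \<tau> = LD (tp \<tau>) (tq \<tau>)"
definition Dnum :: "complex \<Rightarrow> complex \<Rightarrow> complex" where "Dnum \<tau> = LDnum (t1 \<tau>) (t4 \<tau>)"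
definition Dden :: "complex \<Rightarrow> complex \<Rightarrow> complex" where "Dden \<tau> x = t1 \<tau> x * t4 \<tau> x"

lemma D_eq: "D \<tau> x = Dnum \<tau> x / Dden \<tau> x"
  by (simp add: D_def LD_def Dnum_def Dden_def)

lemma Dnum_entire: "Im \<tau> > 0 \<Longrightarrow> Dnum \<tau> holomorphic_on UNIV"
  unfolding Dnum_def by (intro LDnum_holomorphic theta_entire)

lemma Dden_entire: "Im \<tau> > 0 \<Longrightarrow> Dden \<tau> holomorphic_on UNIV"
  unfolding Dden_def[abs_def] by (intro holomorphic_intros theta_entire)

lemma t1_not_identically_0: "Im \<tau> > 0 \<Longrightarrow> \<exists>x. t1 \<tau> x \<noteq> 0"
  using t1_plus_half[of \<tau> 0] t1_t4_no_common_zero[of \<tau> 0]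
  by (intro exI[of _ "cpi * \<tau> / 2"]) auto

lemma Dden_not_identically_0:
  assumes "Im \<tau> > 0" shows "\<exists>x. Dden \<tau> x \<noteq> 0"
proof (rule ccontr)
  assume "\<not> ?thesis"
  hence "t1 \<tau> x * t4 \<tau> x = 0" for x by (auto simp: Dden_def)
  moreover obtain a b where "t1 \<tau> a \<noteq> 0" "t4 \<tau> b \<noteq> 0" using t1_not_identically_0 t4_not_identically_0 assms by blast
  ultimately show False using entire_mult_eq_0[OF theta_entire(1,2), OF assms assms, of a b] by blast
qed

lemma D_plus_pi: "Im \<tau> > 0 \<Longrightarrow> D \<tau> (x + cpi) = D \<tau> x"
  unfolding D_def
  by (rule LD_translate[where E = "\<lambda>_. -1" and c = "-1"]) (auto simp: theta_entire t1_plus_pi t4_plus_pi)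

lemma D_plus_tau: "Im \<tau> > 0 \<Longrightarrow> D \<tau> (x + cpi * \<tau>) = D \<tau> x"
  unfolding D_def
  by (rule LD_translate[where E = "\<lambda>x. - exp (- (\<i> * cpi * \<tau>) - 2 * \<i> * x)" and c = 1])
    (auto simp: theta_entire t1_plus_tau t4_plus_tau intro!: holomorphic_intros)

lemma D_plus_half: "Im \<tau> > 0 \<Longrightarrow> D \<tau> (x + cpi * \<tau> / 2) = - D \<tau> x"
  unfolding D_def
  by (rule LD_translate_swap[where E = "hfac \<tau>"])
    (auto simp: theta_entire t1_plus_half t4_plus_half hfac_def[abs_def] intro!: holomorphic_intros)

lemma Dg_plus_pi: "Im \<tau> > 0 \<Longrightarrow> Dg \<tau> (x + cpi) = - Dg \<tau> x"
  unfolding Dg_def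
  by (rule LD_translate_swap[where E = "\<lambda>_. 1"]) (auto simp: theta_entire tp_plus_pi tq_plus_pi)

lemma Dg_plus_2pi: "Im \<tau> > 0 \<Longrightarrow> Dg \<tau> (x + 2 * cpi) = Dg \<tau> x"
  using Dg_plus_pi[of \<tau> x] Dg_plus_pi[of \<tau> "x + cpi"] by (simp add: algebra_simps)

lemma Dg_plus_tau: "Im \<tau> > 0 \<Longrightarrow> Dg \<tau> (x + cpi * \<tau>) = Dg \<tau> x"
  unfolding Dg_def
  by (rule LD_translate[where E = "\<lambda>x. - exp (- (\<i> * cpi * \<tau> / 2) - \<i> * x)" and c = "-1"])
    (auto simp: theta_entire tp_plus_tau tq_plus_tau intro!: holomorphic_intros)

lemma D_plus_lattice:
  assumes "Im \<tau> > 0"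
  shows "D \<tau> (x + (of_int k * (cpi * \<tau>) + of_int n * cpi)) = D \<tau> x"
  using periodic_int[of "D \<tau>" "cpi" "x + of_int k * (cpi * \<tau>)" n] periodic_int[of "D \<tau>" "cpi * \<tau>" x k]
    D_plus_pi[OF assms] D_plus_tau[OF assms] by (simp add: add.assoc)

lemma D_not_identically_0:
  assumes "Im \<tau> > 0" shows "\<exists>x. Dnum \<tau> x \<noteq> 0"
proof (rule ccontr)
  assume "\<not> ?thesis"
  moreover obtain b where "t4 \<tau> b \<noteq> 0" using t4_not_identically_0 assms by blast
  ultimately obtain c where c: "\<And>x. t1 \<tau> x = c * t4 \<tau> x"
    using LDnum_0_imp_proportional[OF theta_entire(1,2), OF assms assms, of b] by (auto simp: Dnum_def)
  have "t4 \<tau> 0 \<noteq> 0" using t1_t4_no_common_zero[OF assms, of 0] by simp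
  with c[of 0] have "c = 0" by simp
  with c t1_not_identically_0[OF assms] show False by simp
qed

text \<open>If the Wronskian vanished, \<open>tp\<close> and \<open>tq\<close> would be
  proportional, whereas translation by pi \<tau> multiplies them by factors of opposite
  sign.\<close>

lemma Dg_not_identically_0:
  assumes "Im \<tau> > 0" shows "\<exists>x. LDnum (tp \<tau>) (tq \<tau>) x \<noteq> 0"
proof (rule ccontr)
  assume "\<not> ?thesis"
  moreover obtain b where "tq \<tau> b \<noteq> 0" using tq_not_identically_0 assms by blast
  ultimately obtain c where c: "\<And>x. tp \<tau> x = c * tq \<tau> x"
    using LDnum_0_imp_proportional[OF theta_entire(3,4), OF assms assms, of b] by auto
  have "- tp \<tau> x = tp \<tau> x" for x
    using c[of "x + cpi * \<tau>"] c[of x] unfolding tp_plus_tau tq_plus_tau by simp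
  hence "tp \<tau> x = 0" for x by simp
  thus False using tp_not_identically_0[OF assms] by simp
qed

text \<open>All zeros of \<open>t1\<close> are translates of the zero at 0, and those of
  \<open>t4\<close> are translates of these by the half period. The quasi-periodicity factors have
  no zeros, so a single m is the order of all of them, which is the form in which
  \<open>LD_proportional\<close> takes it.\<close>

lemma theta_orders:
  assumes tau: "Im \<tau> > 0"
  shows "\<exists>m>0. (\<forall>a. t1 \<tau> a = 0 \<longrightarrow> ord_at m (t1 \<tau>) a) \<and> (\<forall>a. t4 \<tau> a = 0 \<longrightarrow> ord_at m (t4 \<tau>) a)"
proof -
  have "\<not> t1 \<tau> constant_on UNIV"
    using t1_not_identically_0[OF tau] t1_0[of \<tau>] unfolding constant_on_def by (metis UNIV_I)
  then obtain g r m where m: "0 < m" "0 < r" "g holomorphic_on ball 0 r"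
    "\<And>w. w \<in> ball 0 r \<Longrightarrow> t1 \<tau> w = (w - 0) ^ m * g w" "\<And>w. w \<in> ball 0 r \<Longrightarrow> g w \<noteq> 0"
    using holomorphic_factor_zero_nonconstant[OF theta_entire(1)[OF tau] open_UNIV connected_UNIV UNIV_I t1_0] by metis
  hence o0: "ord_at m (t1 \<tau>) 0" unfolding ord_at_def by blast
  have o1: "ord_at m (t1 \<tau>) a" if a: "t1 \<tau> a = 0" for a
  proof -
    obtain k n where kn: "a = of_int k * (cpi * \<tau>) + of_int n * cpi"
      using a t1_eq_0_iff[OF tau] lat_def by blast
    have "ord_at m (t1 \<tau>) (0 + of_int k * (cpi * \<tau>))"
      by (rule iffD2[OF ord_at_translate_int[of "\<lambda>x. - exp (- (\<i> * cpi * \<tau>) - 2 * \<i> * x)"] o0])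
        (auto simp: t1_plus_tau intro!: holomorphic_intros)
    hence "ord_at m (t1 \<tau>) ((0 + of_int k * (cpi * \<tau>)) + of_int n * cpi)"
      by (rule iffD2[OF ord_at_translate_int[of "\<lambda>x. - 1"], rotated 3]) (auto simp: t1_plus_pi)
    thus ?thesis by (simp add: kn)
  qed
  have "ord_at m (t4 \<tau>) a" if a: "t4 \<tau> a = 0" for a
  proof (rule ord_at_unit_affine[where G = "t1 \<tau>" and \<alpha> = 1 and a = a and \<beta> = "cpi * \<tau> / 2" and E = "\<lambda>x. inverse (hfac \<tau> x)"])
    show "ord_at m (t1 \<tau>) (1 * a + cpi * \<tau> / 2)"
      using o1[of "a + cpi * \<tau> / 2"] t1_plus_half[of \<tau> a] a by simp
    show "t4 \<tau> x = inverse (hfac \<tau> x) * t1 \<tau> (1 * x + cpi * \<tau> / 2)" for x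
      by (simp add: t1_plus_half)
    show "(\<lambda>x. inverse (hfac \<tau> x)) holomorphic_on UNIV"
      unfolding hfac_def by (intro holomorphic_intros) auto
  qed auto
  thus ?thesis using o1 m(1) by blast
qed

section \<open>Behaviour under the modular group\<close>

text \<open>Congruence modulo the subgroup of SL(2, Z) known as Gamma^0(2): these matrices preserve
  the period lattice together with the class of the half period pi \<tau>/2.\<close>

definition modrel :: "complex \<Rightarrow> complex \<Rightarrow> bool" where
  "modrel \<tau> \<tau>' \<longleftrightarrow> (\<exists>a b c d :: int. a * d - b * c = 1 \<and> even b \<and>
     \<tau>' = (of_int a * \<tau> + of_int b) / (of_int c * \<tau> + of_int d))"

lemma moebius_denominator_nonzero:
  assumes "Im \<tau> > 0" "a * d - b * c = (1 :: int)"
  shows "of_int c * \<tau> + of_int d \<noteq> 0"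
proof
  assume "of_int c * \<tau> + of_int d = 0"
  hence "Im (of_int c * \<tau> + of_int d) = 0" "Re (of_int c * \<tau> + of_int d) = 0" by simp_all
  hence "c = 0" "d = 0" using assms(1) by auto
  thus False using assms(2) by simp
qed

lemma Im_moebius:
  fixes a b c d :: int
  shows "Im ((of_int a * \<tau> + of_int b) / (of_int c * \<tau> + of_int d)) =
    of_int (a * d - b * c) * Im \<tau> / (norm (of_int c * \<tau> + of_int d))\<^sup>2"
  by (subst Im_divide) (simp add: cmod_power2 algebra_simps)

text \<open>Division by j = c \<tau> + d maps the lattice of \<tau> onto the lattice of \<tau>', and
  the class of pi \<tau>/2 onto that of pi \<tau>'/2. Hence zeros, periods and the sign change of
  \<open>D \<tau>'\<close> pulled back by x / j are those of \<open>D \<tau>\<close>, and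
  \<open>LD_proportional\<close> applies.\<close>

lemma D_modular:
  assumes tau: "Im \<tau> > 0" and det: "a * d - b * c = (1 :: int)" and b: "even b"
  defines "j \<equiv> of_int c * \<tau> + of_int d"
  defines "\<tau>' \<equiv> (of_int a * \<tau> + of_int b) / j"
  shows "\<exists>\<kappa>. \<kappa> \<noteq> 0 \<and> (\<forall>x. D \<tau>' (x / j) = \<kappa> * D \<tau> x)"
proof -
  have j0: "j \<noteq> 0" unfolding j_def by (rule moebius_denominator_nonzero[OF tau det])
  have tau': "Im \<tau>' > 0"
    unfolding \<tau>'_def j_def Im_moebius det using tau j0 by (simp add: j_def)
  have jt: "\<tau>' * j = of_int a * \<tau> + of_int b" using j0 by (simp add: \<tau>'_def)
  have det': "of_int a * of_int d - of_int b * of_int c = (1 :: complex)"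
    using det by (metis of_int_1 of_int_diff of_int_mult)
  have j1: "1 / j = of_int a - of_int c * \<tau>'"
  proof -
    have "(of_int a - of_int c * \<tau>') * j = of_int a * j - of_int c * (\<tau>' * j)" by (simp add: algebra_simps)
    also have "\<dots> = of_int a * of_int d - of_int b * of_int c" unfolding jt by (simp add: j_def algebra_simps)
    finally show ?thesis using j0 det' by (simp add: field_simps)
  qed
  have j2: "\<tau> / j = of_int d * \<tau>' - of_int b"
  proof -
    have "(of_int d * \<tau>' - of_int b) * j = of_int d * (\<tau>' * j) - of_int b * j" by (simp add: algebra_simps)
    also have "\<dots> = (of_int a * of_int d - of_int b * of_int c) * \<tau>" unfolding jt by (simp add: j_def algebra_simps)
    finally show ?thesis using j0 det' by (simp add: field_simps)
  qed
  have odd: "odd a" "odd d"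
  proof -
    have "odd (a * d)" using det b by (metis dvd_mult2 dvd_diff_right_iff odd_one dvd_diff)
    thus "odd a" "odd d" by auto
  qed
  obtain a' b' d' where abd: "a = 2 * a' + 1" "b = 2 * b'" "d = 2 * d' + 1"
    using odd b by (auto elim!: oddE evenE)
  have lat_iff: "lat \<tau>' (x / j) \<longleftrightarrow> lat \<tau> x" for x
  proof
    assume "lat \<tau>' (x / j)"
    then obtain k n :: int where "x / j = of_int k * (cpi * \<tau>') + of_int n * cpi" by (auto simp: lat_def)
    hence "x = of_int k * cpi * (\<tau>' * j) + of_int n * cpi * j" using j0 by (simp add: field_simps)
    also have "\<dots> = of_int (k * a + n * c) * (cpi * \<tau>) + of_int (k * b + n * d) * cpi"
      unfolding jt by (simp add: j_def algebra_simps)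
    finally show "lat \<tau> x" unfolding lat_def by blast
  next
    assume "lat \<tau> x"
    then obtain k n :: int where "x = of_int k * (cpi * \<tau>) + of_int n * cpi" by (auto simp: lat_def)
    hence "x / j = of_int k * cpi * (\<tau> / j) + of_int n * cpi * (1 / j)" by (simp add: add_divide_distrib)
    also have "\<dots> = of_int (k * d - n * c) * (cpi * \<tau>') + of_int (n * a - k * b) * cpi"
      unfolding j1 j2 by (simp add: algebra_simps)
    finally show "lat \<tau>' (x / j)" unfolding lat_def by blast
  qed
  \<comment> \<open>Multiplied by j, the half period of \<tau>' becomes pi (a \<tau> + b)/2. As a is
    odd and b is even, it differs from pi \<tau>/2 by an element of the lattice of \<tau>.\<close>
  have lat_half: "lat \<tau>' (x / j + cpi * \<tau>' / 2) \<longleftrightarrow> lat \<tau> (x + cpi * \<tau> / 2)" for x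
  proof -
    have "x / j + cpi * \<tau>' / 2 = (x + cpi * (\<tau>' * j) / 2) / j" using j0 by (simp add: field_simps)
    also have "x + cpi * (\<tau>' * j) / 2 = (x + cpi * \<tau> / 2) + (of_int a' * (cpi * \<tau>) + of_int b' * cpi)"
      unfolding jt by (simp add: abd field_simps)
    finally have "lat \<tau>' (x / j + cpi * \<tau>' / 2) \<longleftrightarrow>
      lat \<tau> ((x + cpi * \<tau> / 2) + (of_int a' * (cpi * \<tau>) + of_int b' * cpi))"
      by (simp add: lat_iff)
    thus ?thesis unfolding t1_eq_0_iff[OF tau, symmetric] t1_zero_translate .
  qed
  obtain m1 where m1: "m1 > 0" "\<And>a. t1 \<tau> a = 0 \<Longrightarrow> ord_at m1 (t1 \<tau>) a" "\<And>a. t4 \<tau> a = 0 \<Longrightarrow> ord_at m1 (t4 \<tau>) a"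
    using theta_orders[OF tau] by blast
  obtain m2 where m2: "m2 > 0" "\<And>a. t1 \<tau>' a = 0 \<Longrightarrow> ord_at m2 (t1 \<tau>') a" "\<And>a. t4 \<tau>' a = 0 \<Longrightarrow> ord_at m2 (t4 \<tau>') a"
    using theta_orders[OF tau'] by blast
  define F2 where "F2 = (\<lambda>x. t1 \<tau>' ((1 / j) * x + 0))"
  define G2 where "G2 = (\<lambda>x. t4 \<tau>' ((1 / j) * x + 0))"
  have LD2: "LD F2 G2 x = (1 / j) * D \<tau>' (x / j)" for x
    unfolding F2_def G2_def D_def by (subst LD_affine) (use theta_entire[OF tau'] in auto)
  obtain p q where pq: "t1 \<tau> p \<noteq> 0" "t4 \<tau> q \<noteq> 0" using t1_not_identically_0 t4_not_identically_0 tau by blast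
  have sh: "(x + cpi) / j = x / j + (of_int (- c) * (cpi * \<tau>') + of_int a * cpi)"
    "(x + cpi * \<tau>) / j = x / j + (of_int d * (cpi * \<tau>') + of_int (- b) * cpi)"
    "(x + cpi * \<tau> / 2) / j = (x / j + (of_int d' * (cpi * \<tau>') + of_int (- b') * cpi)) + cpi * \<tau>' / 2" for x
  proof -
    have "(x + cpi) / j = x / j + cpi * (1 / j)" by (simp add: add_divide_distrib)
    thus "(x + cpi) / j = x / j + (of_int (- c) * (cpi * \<tau>') + of_int a * cpi)"
      unfolding j1 by (simp add: algebra_simps)
    have "(x + cpi * \<tau>) / j = x / j + cpi * (\<tau> / j)" by (simp add: add_divide_distrib)
    thus "(x + cpi * \<tau>) / j = x / j + (of_int d * (cpi * \<tau>') + of_int (- b) * cpi)"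
      unfolding j2 by (simp add: algebra_simps)
    have "(x + cpi * \<tau> / 2) / j = x / j + cpi * (\<tau> / j) / 2" by (simp add: add_divide_distrib)
    thus "(x + cpi * \<tau> / 2) / j = (x / j + (of_int d' * (cpi * \<tau>') + of_int (- b') * cpi)) + cpi * \<tau>' / 2"
      unfolding j2 by (simp add: abd field_simps)
  qed
  have aff: "ord_at m (\<lambda>x. H ((1 / j) * x + 0)) a" if "ord_at m H (a / j)" for m H a
    by (rule ord_at_unit_affine[of m H "1 / j" a 0 "\<lambda>_. 1"]) (use that j0 in auto)
  have "of_nat m2 * LD (t1 \<tau>) (t4 \<tau>) x = of_nat m1 * LD F2 G2 x" for x
  proof (rule LD_proportional[where b = p and b' = q and wa = "cpi" and wb = "cpi * \<tau>" and \<eta> = "cpi * \<tau> / 2"])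
    show "F2 holomorphic_on UNIV" "G2 holomorphic_on UNIV"
      unfolding F2_def G2_def by (intro entire_compose_affine theta_entire tau')+
    show "t1 \<tau> x = 0 \<longleftrightarrow> F2 x = 0" for x
      using lat_iff[of x] by (simp add: F2_def t1_eq_0_iff tau tau')
    show "t4 \<tau> x = 0 \<longleftrightarrow> G2 x = 0" for x
      using lat_half[of x] by (simp add: G2_def t4_eq_0_iff tau tau')
    show "ord_at m2 F2 a" if "F2 a = 0" for a
      unfolding F2_def by (rule aff) (use m2 that in \<open>simp add: F2_def\<close>)
    show "ord_at m2 G2 a" if "G2 a = 0" for a
      unfolding G2_def by (rule aff) (use m2 that in \<open>simp add: G2_def\<close>)
    show "LD F2 G2 (x + cpi) = LD F2 G2 x" "LD F2 G2 (x + cpi * \<tau>) = LD F2 G2 x"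
      "LD F2 G2 (x + cpi * \<tau> / 2) = - LD F2 G2 x" for x
      unfolding LD2 sh D_plus_half[OF tau'] D_plus_lattice[OF tau'] by simp_all
    show "LD (t1 \<tau>) (t4 \<tau>) (x + cpi) = LD (t1 \<tau>) (t4 \<tau>) x"
      "LD (t1 \<tau>) (t4 \<tau>) (x + cpi * \<tau>) = LD (t1 \<tau>) (t4 \<tau>) x"
      "LD (t1 \<tau>) (t4 \<tau>) (x + cpi * \<tau> / 2) = - LD (t1 \<tau>) (t4 \<tau>) x" for x
      using D_plus_half[OF tau, of x] D_plus_pi[OF tau, of x] D_plus_tau[OF tau, of x] by (simp_all add: D_def)
    show "Im (cpi * \<tau> / cpi) \<noteq> 0" using tau by simp
  qed (use theta_entire[OF tau] pq m1 in auto)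
  hence "of_nat m2 * D \<tau> x = of_nat m1 * ((1 / j) * D \<tau>' (x / j))" for x
    unfolding LD2 by (simp add: D_def)
  hence "D \<tau>' (x / j) = (of_nat m2 * j / of_nat m1) * D \<tau> x" for x
    using m1(1) j0 by (simp add: field_simps)
  thus ?thesis using m1(1) m2(1) j0 by (intro exI[of _ "of_nat m2 * j / of_nat m1"]) auto
qed

lemma tp_eq_0_iff:
  assumes "Im \<tau> > 0"
  shows "tp \<tau> t = 0 \<longleftrightarrow> (\<exists>k n :: int. t + cpi * \<tau> / 2 = of_int k * (cpi * \<tau>) + of_int n * (2 * cpi))"
proof -
  have "t / 2 + cpi * (\<tau> / 2) / 2 = of_int k * (cpi * (\<tau> / 2)) + of_int n * cpi
    \<longleftrightarrow> t + cpi * \<tau> / 2 = of_int k * (cpi * \<tau>) + of_int n * (2 * cpi)" (is "?a = ?b \<longleftrightarrow> ?c = ?d") for k n :: int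
  proof -
    have "2 * ?a = ?c" "2 * ?b = ?d" by (simp_all add: field_simps)
    thus ?thesis by (metis mult_left_cancel zero_neq_numeral)
  qed
  thus ?thesis unfolding tp_def using assms by (subst t4_eq_0_iff) (simp_all add: lat_def)
qed

text \<open>\<open>Dg \<tau>\<close> has the periods 2 pi and pi \<tau> and changes sign under pi.
  Dividing by -\<tau> turns 2 pi into pi \<tau>', turns pi into the half period pi \<tau>'/2 and
  turns pi \<tau> into -pi, which is the pattern of \<open>D \<tau>'\<close>.\<close>

lemma D_fricke:
  assumes tau: "Im \<tau> > 0"
  defines "\<tau>' \<equiv> - 2 / \<tau>"
  shows "\<exists>\<kappa>. \<kappa> \<noteq> 0 \<and> (\<forall>t. D \<tau>' (- t / \<tau> - cpi / 2) = \<kappa> * Dg \<tau> t)"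
proof -
  have t0: "\<tau> \<noteq> 0" using tau by auto
  have tau': "Im \<tau>' > 0" using tau t0 by (simp add: \<tau>'_def Im_divide cmod_power2 sum_power2_gt_zero_iff)
  \<comment> \<open>The zeros of \<open>tp\<close> form the translate by -pi \<tau>/2 of a lattice.
    The shift by -pi/2 moves this point to 0, a zero of \<open>t1\<close>.\<close>
  define X where "X = (\<lambda>t. (- 1 / \<tau>) * t + (- (cpi / 2)))"
  have X: "X t = - t / \<tau> - cpi / 2" for t by (simp add: X_def)
  have z1: "tp \<tau> t = 0 \<longleftrightarrow> t1 \<tau>' (X t) = 0" for t
  proof
    assume "tp \<tau> t = 0"
    then obtain k n :: int where kn: "t + cpi * \<tau> / 2 = of_int k * (cpi * \<tau>) + of_int n * (2 * cpi)"
      using tp_eq_0_iff[OF tau] by blast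
    have "X t = - (t + cpi * \<tau> / 2) / \<tau>" using t0 by (simp add: X field_simps)
    also have "\<dots> = of_int n * (cpi * \<tau>') + of_int (- k) * cpi"
      unfolding kn using t0 by (simp add: \<tau>'_def field_simps)
    finally show "t1 \<tau>' (X t) = 0" unfolding t1_eq_0_iff[OF tau'] lat_def by blast
  next
    assume "t1 \<tau>' (X t) = 0"
    then obtain k n :: int where kn: "X t = of_int k * (cpi * \<tau>') + of_int n * cpi"
      unfolding t1_eq_0_iff[OF tau'] lat_def by blast
    have "t + cpi * \<tau> / 2 = - \<tau> * X t" using t0 by (simp add: X field_simps)
    also have "\<dots> = of_int (- n) * (cpi * \<tau>) + of_int k * (2 * cpi)"
      unfolding kn using t0 by (simp add: \<tau>'_def field_simps)
    finally show "tp \<tau> t = 0" unfolding tp_eq_0_iff[OF tau] by blast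
  qed
  have Xpi: "X (t + cpi) = X t + cpi * \<tau>' / 2" for t
    using t0 by (simp add: X_def \<tau>'_def field_simps)
  have X2pi: "X (t + 2 * cpi) = X t + cpi * \<tau>'" for t
    using t0 by (simp add: X_def \<tau>'_def field_simps)
  have Xtau: "X (t + cpi * \<tau>) = X t + (of_int 0 * (cpi * \<tau>') + of_int (- 1) * cpi)" for t
    using t0 by (simp add: X_def \<tau>'_def field_simps)
  have z2: "tq \<tau> t = 0 \<longleftrightarrow> t4 \<tau>' (X t) = 0" for t
    using z1[of "t + cpi"] t1_plus_half[of \<tau>' "X t"] by (simp add: tp_plus_pi Xpi)
  have tau2: "Im (\<tau> / 2) > 0" using tau by simp
  obtain m1 where m1: "m1 > 0" "\<And>a. t4 (\<tau> / 2) a = 0 \<Longrightarrow> ord_at m1 (t4 (\<tau> / 2)) a"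
    using theta_orders[OF tau2] by blast
  obtain m2 where m2: "m2 > 0" "\<And>a. t1 \<tau>' a = 0 \<Longrightarrow> ord_at m2 (t1 \<tau>') a" "\<And>a. t4 \<tau>' a = 0 \<Longrightarrow> ord_at m2 (t4 \<tau>') a"
    using theta_orders[OF tau'] by blast
  define F2 where "F2 = (\<lambda>x. t1 \<tau>' (X x))"
  define G2 where "G2 = (\<lambda>x. t4 \<tau>' (X x))"
  have LD2: "LD F2 G2 x = (- 1 / \<tau>) * D \<tau>' (X x)" for x
    unfolding F2_def G2_def D_def X_def by (rule LD_affine) (use theta_entire[OF tau'] in auto)
  obtain p q where pq: "tp \<tau> p \<noteq> 0" "tq \<tau> q \<noteq> 0" using tp_not_identically_0 tq_not_identically_0 tau by blast
  have aff: "ord_at m (\<lambda>x. H (X x)) a" if "ord_at m H (X a)" for m H a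
    unfolding X_def
    by (rule ord_at_unit_affine[of m H "- 1 / \<tau>" a "- (cpi / 2)" "\<lambda>_. 1"]) (use that t0 in \<open>auto simp: X_def\<close>)
  have "of_nat m2 * LD (tp \<tau>) (tq \<tau>) x = of_nat m1 * LD F2 G2 x" for x
  proof (rule LD_proportional[where b = p and b' = q and wa = "2 * cpi" and wb = "cpi * \<tau>" and \<eta> = "cpi"])
    show "F2 holomorphic_on UNIV" "G2 holomorphic_on UNIV"
      unfolding F2_def G2_def X_def by (intro entire_compose_affine theta_entire tau')+
    show "ord_at m2 F2 a" if "F2 a = 0" for a
      unfolding F2_def by (rule aff) (use m2 that in \<open>simp add: F2_def\<close>)
    show "ord_at m2 G2 a" if "G2 a = 0" for a
      unfolding G2_def by (rule aff) (use m2 that in \<open>simp add: G2_def\<close>)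
    show "ord_at m1 (tp \<tau>) a" if "tp \<tau> a = 0" for a
      by (rule ord_at_unit_affine[of m1 "t4 (\<tau> / 2)" "1 / 2" a 0 "\<lambda>_. 1"]) (use m1 that in \<open>auto simp: tp_def\<close>)
    show "ord_at m1 (tq \<tau>) a" if "tq \<tau> a = 0" for a
      by (rule ord_at_unit_affine[of m1 "t4 (\<tau> / 2)" "1 / 2" a "cpi / 2" "\<lambda>_. 1"]) (use m1 that in \<open>auto simp: tq_def\<close>)
    show "LD F2 G2 (x + 2 * cpi) = LD F2 G2 x" "LD F2 G2 (x + cpi * \<tau>) = LD F2 G2 x"
      "LD F2 G2 (x + cpi) = - LD F2 G2 x" for x
      unfolding LD2 Xpi X2pi Xtau D_plus_half[OF tau'] D_plus_lattice[OF tau'] D_plus_tau[OF tau'] by simp_all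
    show "LD (tp \<tau>) (tq \<tau>) (x + 2 * cpi) = LD (tp \<tau>) (tq \<tau>) x"
      "LD (tp \<tau>) (tq \<tau>) (x + cpi * \<tau>) = LD (tp \<tau>) (tq \<tau>) x"
      "LD (tp \<tau>) (tq \<tau>) (x + cpi) = - LD (tp \<tau>) (tq \<tau>) x" for x
      using Dg_plus_2pi[OF tau, of x] Dg_plus_pi[OF tau, of x] Dg_plus_tau[OF tau, of x] by (simp_all add: Dg_def)
    show "Im (cpi * \<tau> / (2 * cpi)) \<noteq> 0" using tau by simp
  qed (use theta_entire[OF tau] pq z1 z2 in \<open>auto simp: F2_def G2_def\<close>)
  hence "of_nat m2 * Dg \<tau> x = of_nat m1 * ((- 1 / \<tau>) * D \<tau>' (X x))" for x
    unfolding LD2 by (simp add: Dg_def)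
  hence "D \<tau>' (X x) = (- of_nat m2 * \<tau> / of_nat m1) * Dg \<tau> x" for x
    using m1(1) t0 by (simp add: field_simps)
  thus ?thesis using m1(1) m2(1) t0 unfolding X by (intro exI[of _ "- of_nat m2 * \<tau> / of_nat m1"]) auto
qed


section \<open>Recovering the modular relation from the periods of \<open>D\<close>\<close>

lemma entire_affine_eventually_nonzero:
  assumes "F holomorphic_on UNIV" "F z \<noteq> (0 :: complex)" "\<alpha> \<noteq> 0"
  shows "\<forall>\<^sub>F x in at p. F (\<alpha> * x + \<beta>) \<noteq> 0"
  by (rule entire_eventually_nonzero[OF entire_compose_affine[OF assms(1)], where b = "(z - \<beta>) / \<alpha>"])
    (use assms in simp)

text \<open>\<open>D(s + w) = \<epsilon> D(s)\<close>, written without denominators to be an identity between entire functions.\<close>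

definition D_scaled :: "complex \<Rightarrow> complex \<Rightarrow> complex \<Rightarrow> bool" where
  "D_scaled \<epsilon> \<tau> w \<longleftrightarrow> (\<forall>s. Dnum \<tau> (s + w) * Dden \<tau> s = \<epsilon> * (Dnum \<tau> s * Dden \<tau> (s + w)))"

lemma D_scaledI:
  assumes tau: "Im \<tau> > 0" and "\<And>s. D \<tau> (s + w) = \<epsilon> * D \<tau> s"
  shows "D_scaled \<epsilon> \<tau> w"
  unfolding D_scaled_def
proof
  fix s
  note ent = Dnum_entire[OF tau] Dden_entire[OF tau]
  note aff = ent[THEN entire_compose_affine, of 1 w, unfolded mult_1_left]
  obtain z where z: "Dden \<tau> z \<noteq> 0" using Dden_not_identically_0[OF tau] by blast
  have "Dnum \<tau> (s + w) * Dden \<tau> s - \<epsilon> * (Dnum \<tau> s * Dden \<tau> (s + w)) = 0"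
  proof (rule entire_eq_0_at[where F = "\<lambda>s. Dnum \<tau> (s + w) * Dden \<tau> s - \<epsilon> * (Dnum \<tau> s * Dden \<tau> (s + w))" and a = 0])
    show "(\<lambda>s. Dnum \<tau> (s + w) * Dden \<tau> s - \<epsilon> * (Dnum \<tau> s * Dden \<tau> (s + w))) holomorphic_on UNIV"
      by (intro holomorphic_intros ent aff)
    have "\<forall>\<^sub>F s in at 0. Dden \<tau> s \<noteq> 0" "\<forall>\<^sub>F s in at 0. Dden \<tau> (s + w) \<noteq> 0"
      using entire_affine_eventually_nonzero[OF ent(2) z, where \<alpha> = 1 and \<beta> = 0 and p = 0]
        entire_affine_eventually_nonzero[OF ent(2) z, where \<alpha> = 1 and \<beta> = w and p = 0] by simp_all
    thus "\<forall>\<^sub>F s in at 0. Dnum \<tau> (s + w) * Dden \<tau> s - \<epsilon> * (Dnum \<tau> s * Dden \<tau> (s + w)) = 0"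
    proof eventually_elim
      case (elim s)
      with assms(2)[of s] show ?case by (simp add: D_eq field_simps)
    qed
  qed
  thus "Dnum \<tau> (s + w) * Dden \<tau> s = \<epsilon> * (Dnum \<tau> s * Dden \<tau> (s + w))" by simp
qed

text \<open>If w is a period of \<open>D\<close>, the quotient of \<open>t1\<close> (s + w) /
  \<open>t4\<close> (s + w) by \<open>t1\<close> s / \<open>t4\<close> s has logarithmic derivative
  0. So F and E are proportional, and at s = 0 this forces \<open>t1\<close> w = 0.\<close>

lemma D_period_in_lattice:
  assumes tau: "Im \<tau> > 0" and per: "D_scaled 1 \<tau> w"
  shows "lat \<tau> w"
proof -
  define F where "F = (\<lambda>s. t1 \<tau> (s + w) * t4 \<tau> s)"
  define E where "E = (\<lambda>s. t4 \<tau> (s + w) * t1 \<tau> s)"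
  note ent = theta_entire[OF tau]
  note aff = ent(1,2)[THEN entire_compose_affine, of 1 w, unfolded mult_1_left]
  have hol: "F holomorphic_on UNIV" "E holomorphic_on UNIV"
    unfolding F_def E_def by (intro holomorphic_intros ent aff)+
  note d = ent(1,2)[THEN entire_field_derivative] aff[THEN entire_field_derivative]
  have dF: "deriv F s = deriv (t1 \<tau>) (s + w) * t4 \<tau> s + deriv (t4 \<tau>) s * t1 \<tau> (s + w)" for s
    unfolding F_def using DERIV_mult[OF d(3) d(2), of s] by (simp add: DERIV_imp_deriv deriv_shift)
  have dE: "deriv E s = deriv (t4 \<tau>) (s + w) * t1 \<tau> s + deriv (t1 \<tau>) s * t4 \<tau> (s + w)" for s
    unfolding E_def using DERIV_mult[OF d(4) d(1), of s] by (simp add: DERIV_imp_deriv deriv_shift)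
  have W: "LDnum F E s = 0" for s
  proof -
    have "LDnum F E s = Dnum \<tau> (s + w) * Dden \<tau> s - Dnum \<tau> s * Dden \<tau> (s + w)"
      unfolding LDnum_def Dnum_def Dden_def dF dE by (simp add: E_def F_def algebra_simps)
    thus ?thesis using per by (simp add: D_scaled_def)
  qed
  obtain z z' where z: "t4 \<tau> z \<noteq> 0" "t1 \<tau> z' \<noteq> 0" using t4_not_identically_0 t1_not_identically_0 tau by blast
  have ev: "\<forall>\<^sub>F s in at 0. t4 \<tau> (1 * s + w) \<noteq> 0" "\<forall>\<^sub>F s in at 0. t1 \<tau> (1 * s + 0) \<noteq> 0"
    using entire_affine_eventually_nonzero ent z by (metis one_neq_zero)+
  have "\<forall>\<^sub>F s in at 0. E s \<noteq> 0" using ev by eventually_elim (simp add: E_def)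
  then obtain s0 where "E s0 \<noteq> 0" using eventually_happens at_neq_bot by blast
  then obtain c where c: "\<And>s. F s = c * E s"
    using LDnum_0_imp_proportional[OF hol _ W] by blast
  have "t1 \<tau> w * t4 \<tau> 0 = 0" using c[of 0] by (simp add: F_def E_def)
  hence "t1 \<tau> w = 0" using t1_t4_no_common_zero[OF tau, of 0] by simp
  thus ?thesis using t1_eq_0_iff[OF tau] by blast
qed

text \<open>The relation D\<tau>'(a t + b) = \<kappa> D\<tau>(t), cleared of denominators for the
  same reason as in \<open>D_scaled\<close>.\<close>

definition D_related :: "complex \<Rightarrow> complex \<Rightarrow> complex \<Rightarrow> complex \<Rightarrow> complex \<Rightarrow> bool" where
  "D_related \<tau> \<tau>' a b \<kappa> \<longleftrightarrow> (\<forall>t. Dnum \<tau>' (a * t + b) * Dden \<tau> t = \<kappa> * (Dnum \<tau> t * Dden \<tau>' (a * t + b)))"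

lemma D_relatedI:
  assumes tau: "Im \<tau> > 0" "Im \<tau>' > 0" and "a \<noteq> 0" and ev: "\<forall>\<^sub>F t in nhds t0. D \<tau>' (a * t + b) = \<kappa> * D \<tau> t"
  shows "D_related \<tau> \<tau>' a b \<kappa>"
  unfolding D_related_def
proof
  fix t
  note ent = Dnum_entire[OF tau(1)] Dden_entire[OF tau(1)]
  note ent' = Dnum_entire[OF tau(2)] Dden_entire[OF tau(2)]
  note aff = ent'[THEN entire_compose_affine, of a b]
  obtain z where z: "Dden \<tau> z \<noteq> 0" using Dden_not_identically_0[OF tau(1)] by blast
  obtain z' where z': "Dden \<tau>' z' \<noteq> 0" using Dden_not_identically_0[OF tau(2)] by blast
  have "Dnum \<tau>' (a * t + b) * Dden \<tau> t - \<kappa> * (Dnum \<tau> t * Dden \<tau>' (a * t + b)) = 0"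
  proof (rule entire_eq_0_at[where F = "\<lambda>t. Dnum \<tau>' (a * t + b) * Dden \<tau> t - \<kappa> * (Dnum \<tau> t * Dden \<tau>' (a * t + b))" and a = t0])
    show "(\<lambda>t. Dnum \<tau>' (a * t + b) * Dden \<tau> t - \<kappa> * (Dnum \<tau> t * Dden \<tau>' (a * t + b))) holomorphic_on UNIV"
      by (intro holomorphic_intros ent aff)
    have "\<forall>\<^sub>F t in at t0. Dden \<tau> t \<noteq> 0" "\<forall>\<^sub>F t in at t0. Dden \<tau>' (a * t + b) \<noteq> 0"
      using entire_eventually_nonzero[OF ent(2) z, of t0]
        entire_affine_eventually_nonzero[OF ent'(2) z' assms(3), where p = t0 and \<beta> = b] by simp_all
    moreover have "\<forall>\<^sub>F t in at t0. D \<tau>' (a * t + b) = \<kappa> * D \<tau> t"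
      using ev by (simp add: eventually_nhds_conv_at)
    ultimately show "\<forall>\<^sub>F t in at t0. Dnum \<tau>' (a * t + b) * Dden \<tau> t - \<kappa> * (Dnum \<tau> t * Dden \<tau>' (a * t + b)) = 0"
      by eventually_elim (simp add: D_eq field_simps)
  qed
  thus "Dnum \<tau>' (a * t + b) * Dden \<tau> t = \<kappa> * (Dnum \<tau> t * Dden \<tau>' (a * t + b))" by simp
qed

lemma D_related_sym:
  assumes "D_related \<tau> \<tau>' a b \<kappa>" "a \<noteq> 0" "\<kappa> \<noteq> 0"
  shows "D_related \<tau>' \<tau> (1 / a) (- b / a) (1 / \<kappa>)"
  unfolding D_related_def
proof
  fix t
  have "a * (1 / a * t + - b / a) + b = t" using assms(2) by (simp add: field_simps)
  with assms(1)[unfolded D_related_def, rule_format, of "1 / a * t + - b / a"]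
  have "Dnum \<tau>' t * Dden \<tau> (1 / a * t + - b / a) = \<kappa> * (Dnum \<tau> (1 / a * t + - b / a) * Dden \<tau>' t)" by simp
  thus "Dnum \<tau> (1 / a * t + - b / a) * Dden \<tau>' t = 1 / \<kappa> * (Dnum \<tau>' t * Dden \<tau> (1 / a * t + - b / a))"
    using assms(3) by simp
qed

text \<open>With s = a t + b, the relation at t and at t + w expresses both values for \<tau>' by
  those for \<tau>. This division is possible for generic s, and the identity theorem gives the
  rest.\<close>

lemma D_scaled_transfer:
  assumes tau: "Im \<tau> > 0" "Im \<tau>' > 0" and rel: "D_related \<tau> \<tau>' a b \<kappa>" "a \<noteq> 0"
    and sc: "D_scaled \<epsilon> \<tau> w"
  shows "D_scaled \<epsilon> \<tau>' (a * w)"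
  unfolding D_scaled_def
proof
  fix s
  note ent' = Dnum_entire[OF tau(2)] Dden_entire[OF tau(2)]
  note aff = ent'[THEN entire_compose_affine, of 1 "a * w", unfolded mult_1_left]
  obtain z where z: "Dden \<tau> z \<noteq> 0" using Dden_not_identically_0[OF tau(1)] by blast
  have "Dnum \<tau>' (s + a * w) * Dden \<tau>' s - \<epsilon> * (Dnum \<tau>' s * Dden \<tau>' (s + a * w)) = 0"
  proof (rule entire_eq_0_at[where F = "\<lambda>s. Dnum \<tau>' (s + a * w) * Dden \<tau>' s - \<epsilon> * (Dnum \<tau>' s * Dden \<tau>' (s + a * w))" and a = 0])
    show "(\<lambda>s. Dnum \<tau>' (s + a * w) * Dden \<tau>' s - \<epsilon> * (Dnum \<tau>' s * Dden \<tau>' (s + a * w))) holomorphic_on UNIV"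
      by (intro holomorphic_intros ent' aff)
    have "\<forall>\<^sub>F s in at 0. Dden \<tau> (1 / a * s + (- b / a)) \<noteq> 0" "\<forall>\<^sub>F s in at 0. Dden \<tau> (1 / a * s + (- b / a + w)) \<noteq> 0"
      by (rule entire_affine_eventually_nonzero[OF Dden_entire[OF tau(1)] z]; use assms(4) in simp)+
    thus "\<forall>\<^sub>F s in at 0. Dnum \<tau>' (s + a * w) * Dden \<tau>' s - \<epsilon> * (Dnum \<tau>' s * Dden \<tau>' (s + a * w)) = 0"
    proof eventually_elim
      case (elim s)
      define t where "t = 1 / a * s + (- b / a)"
      have s: "a * t + b = s" "a * (t + w) + b = s + a * w" using assms(4) by (simp_all add: t_def field_simps)
      have nz: "Dden \<tau> t \<noteq> 0" "Dden \<tau> (t + w) \<noteq> 0" using elim by (simp_all only: t_def add.assoc) simp_all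
      have 1: "Dnum \<tau>' s * Dden \<tau> t = \<kappa> * (Dnum \<tau> t * Dden \<tau>' s)"
        using rel(1)[unfolded D_related_def, rule_format, of t] by (simp add: s)
      have 2: "Dnum \<tau>' (s + a * w) * Dden \<tau> (t + w) = \<kappa> * (Dnum \<tau> (t + w) * Dden \<tau>' (s + a * w))"
        using rel(1)[unfolded D_related_def, rule_format, of "t + w"] by (simp only: s)
      have 3: "Dnum \<tau> (t + w) * Dden \<tau> t = \<epsilon> * (Dnum \<tau> t * Dden \<tau> (t + w))"
        using sc by (simp add: D_scaled_def)
      have "(Dnum \<tau>' (s + a * w) * Dden \<tau>' s - \<epsilon> * (Dnum \<tau>' s * Dden \<tau>' (s + a * w))) * (Dden \<tau> t * Dden \<tau> (t + w))
        = (Dnum \<tau>' (s + a * w) * Dden \<tau> (t + w)) * Dden \<tau>' s * Dden \<tau> t - \<epsilon> * (Dnum \<tau>' s * Dden \<tau> t) * Dden \<tau>' (s + a * w) * Dden \<tau> (t + w)"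
        by (simp add: algebra_simps)
      also have "\<dots> = \<kappa> * Dden \<tau>' (s + a * w) * Dden \<tau>' s * (Dnum \<tau> (t + w) * Dden \<tau> t - \<epsilon> * (Dnum \<tau> t * Dden \<tau> (t + w)))"
        unfolding 1 2 by (simp add: algebra_simps)
      also have "\<dots> = 0" unfolding 3 by simp
      finally show ?case using nz by simp
    qed
  qed
  thus "Dnum \<tau>' (s + a * w) * Dden \<tau>' s = \<epsilon> * (Dnum \<tau>' s * Dden \<tau>' (s + a * w))" by simp
qed

lemma lattice_basis_unique:
  assumes "Im \<tau> \<noteq> 0" "of_int x * \<tau> + of_int y = of_int x' * \<tau> + (of_int y' :: complex)"
  shows "x = x'" "y = y'"
proof -
  have "Im (of_int x * \<tau> + of_int y) = Im (of_int x' * \<tau> + of_int y')" using assms(2) by simp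
  thus "x = x'" using assms(1) by simp
  thus "y = y'" using assms(2) by simp
qed

text \<open>Multiplication by a carries the period lattice of \<open>D \<tau>\<close> onto that of
  \<open>D \<tau>'\<close>, so the basis (\<alpha> \<tau>', \<alpha>) of the former is given by an
  integer matrix (p, q; c, d). Its determinant follows from the inverse base change and positivity
  of imaginary parts, the parity of q from the translation by a half period, which changes the sign
  of both functions.\<close>

theorem D_related_imp_modrel:
  assumes tau: "Im \<tau> > 0" "Im \<tau>' > 0" and rel: "D_related \<tau> \<tau>' a b \<kappa>" and nz: "a \<noteq> 0" "\<kappa> \<noteq> 0"
  shows "modrel \<tau> \<tau>'"
proof -
  define \<alpha> where "\<alpha> = 1 / a"
  have \<alpha>: "a * \<alpha> = 1" using nz by (simp add: \<alpha>_def)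
  have rel': "D_related \<tau>' \<tau> \<alpha> (- b / a) (1 / \<kappa>)" unfolding \<alpha>_def by (rule D_related_sym[OF rel nz])
  have \<alpha>0: "\<alpha> \<noteq> 0" using nz by (simp add: \<alpha>_def)
  have pi: "(cpi :: complex) \<noteq> 0" by simp
  have per: "D_scaled 1 \<sigma> (cpi)" "D_scaled 1 \<sigma> (cpi * \<sigma>)" "D_scaled (-1) \<sigma> (cpi * \<sigma> / 2)" if "Im \<sigma> > 0" for \<sigma>
    using D_plus_pi[OF that] D_plus_tau[OF that] D_plus_half[OF that] by (auto intro!: D_scaledI that)
  have div_pi: "\<exists>k n :: int. z = of_int k * \<sigma> + of_int n" if l: "lat \<sigma> (cpi * z)" for \<sigma> z
  proof -
    obtain k n :: int where "cpi * z = of_int k * (cpi * \<sigma>) + of_int n * cpi" using l unfolding lat_def by blast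
    hence "cpi * z = cpi * (of_int k * \<sigma> + of_int n)" by (simp add: algebra_simps)
    hence "z = of_int k * \<sigma> + of_int n" by (subst (asm) mult_left_cancel[OF pi])
    thus ?thesis by blast
  qed
  have l1: "lat \<tau> (cpi * \<alpha>)" "lat \<tau> (cpi * (\<alpha> * \<tau>'))"
    using D_period_in_lattice[OF tau(1) D_scaled_transfer[OF tau(2,1) rel' \<alpha>0 per(1)[OF tau(2)]]]
      D_period_in_lattice[OF tau(1) D_scaled_transfer[OF tau(2,1) rel' \<alpha>0 per(2)[OF tau(2)]]]
    by (simp_all add: mult_ac)
  have l2: "lat \<tau>' (cpi * a)" "lat \<tau>' (cpi * (a * \<tau>))"
    using D_period_in_lattice[OF tau(2) D_scaled_transfer[OF tau rel nz(1) per(1)[OF tau(1)]]]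
      D_period_in_lattice[OF tau(2) D_scaled_transfer[OF tau rel nz(1) per(2)[OF tau(1)]]]
    by (simp_all add: mult_ac)
  obtain c d where cd: "\<alpha> = of_int c * \<tau> + of_int d" using div_pi[OF l1(1)] by blast
  obtain p q where pq: "\<alpha> * \<tau>' = of_int p * \<tau> + of_int q" using div_pi[OF l1(2)] by blast
  obtain r s where rs: "a = of_int r * \<tau>' + of_int s" using div_pi[OF l2(1)] by blast
  obtain u v where uv: "a * \<tau> = of_int u * \<tau>' + of_int v" using div_pi[OF l2(2)] by blast
  have "of_int 0 * \<tau> + of_int 1 = \<alpha> * a" using \<alpha> by (simp add: mult.commute)
  also have "\<dots> = of_int r * (\<alpha> * \<tau>') + of_int s * \<alpha>" unfolding rs by (simp add: algebra_simps)
  also have "\<dots> = of_int (r * p + s * c) * \<tau> + of_int (r * q + s * d)" unfolding pq by (simp add: cd algebra_simps)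
  finally have e1: "r * p + s * c = 0" "r * q + s * d = 1"
    using lattice_basis_unique[of \<tau> 0 1 "r * p + s * c" "r * q + s * d"] tau by (metis less_irrefl)+
  have "of_int 1 * \<tau> + of_int 0 = \<alpha> * (a * \<tau>)" using \<alpha> by (simp add: mult.commute mult.left_commute)
  also have "\<dots> = of_int u * (\<alpha> * \<tau>') + of_int v * \<alpha>" unfolding uv by (simp add: algebra_simps)
  also have "\<dots> = of_int (u * p + v * c) * \<tau> + of_int (u * q + v * d)" unfolding pq by (simp add: cd algebra_simps)
  finally have e2: "u * p + v * c = 1" "u * q + v * d = 0"
    using lattice_basis_unique[of \<tau> 1 0 "u * p + v * c" "u * q + v * d"] tau by (metis less_irrefl)+
  \<comment> \<open>The two base changes are inverse to each other, so their determinants multiply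
    to 1.\<close>
  have "(u * s - v * r) * (p * d - q * c) = (u * p + v * c) * (r * q + s * d) - (u * q + v * d) * (r * p + s * c)"
    by (simp add: algebra_simps)
  hence "(u * s - v * r) * (p * d - q * c) = 1" unfolding e1 e2 by simp
  hence det1: "p * d - q * c = 1 \<or> p * d - q * c = - 1"
    by (metis mult.commute zmult_eq_1_iff)
  have tau'_eq: "\<tau>' = (of_int p * \<tau> + of_int q) / (of_int c * \<tau> + of_int d)"
    unfolding cd[symmetric] pq[symmetric] using \<alpha>0 by simp
  have "Im \<tau>' = of_int (p * d - q * c) * Im \<tau> / (norm \<alpha>)\<^sup>2"
    unfolding tau'_eq Im_moebius cd ..
  \<comment> \<open>Determinant -1 would send the upper half-plane to the lower one.\<close>
  hence det: "p * d - q * c = 1"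
  proof -
    have "Im \<tau>' > 0" by fact
    moreover have "Im \<tau>' = - (Im \<tau> / (norm \<alpha>)\<^sup>2)" if "p * d - q * c = - 1"
      using \<open>Im \<tau>' = of_int (p * d - q * c) * Im \<tau> / (norm \<alpha>)\<^sup>2\<close> unfolding that by simp
    moreover have "Im \<tau> / (norm \<alpha>)\<^sup>2 > 0" using tau(1) \<alpha>0 by simp
    ultimately show ?thesis using det1 by linarith
  qed
  have "D_scaled (-1) \<tau> (cpi * (\<alpha> * \<tau>') / 2)"
    using D_scaled_transfer[OF tau(2,1) rel' \<alpha>0 per(3)[OF tau(2)]] by (simp add: mult_ac)
  \<comment> \<open>Both summands are translations that change the sign of \<open>D \<tau>\<close>,
    so their sum is a period. In terms of the basis \<tau>, 1 this says that p + 1 and q are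
    even.\<close>
  have "lat \<tau> (cpi * (\<alpha> * \<tau>') / 2 + cpi * \<tau> / 2)"
  proof (rule D_period_in_lattice[OF tau(1)])
    let ?w = "cpi * (\<alpha> * \<tau>') / 2" and ?h = "cpi * \<tau> / 2"
    note ent = Dnum_entire[OF tau(1)] Dden_entire[OF tau(1)]
    note aff = ent[THEN entire_compose_affine, of 1 "?w + ?h", unfolded mult_1_left]
    obtain z where z: "Dden \<tau> z \<noteq> 0" using Dden_not_identically_0[OF tau(1)] by blast
    show "D_scaled 1 \<tau> (?w + ?h)"
      unfolding D_scaled_def
    proof
      fix s
      have "Dnum \<tau> (s + (?w + ?h)) * Dden \<tau> s - (Dnum \<tau> s * Dden \<tau> (s + (?w + ?h))) = 0"
      proof (rule entire_eq_0_at[where F = "\<lambda>s. Dnum \<tau> (s + (?w + ?h)) * Dden \<tau> s - (Dnum \<tau> s * Dden \<tau> (s + (?w + ?h)))" and a = 0])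
        show "(\<lambda>s. Dnum \<tau> (s + (?w + ?h)) * Dden \<tau> s - (Dnum \<tau> s * Dden \<tau> (s + (?w + ?h)))) holomorphic_on UNIV"
          by (intro holomorphic_intros ent aff)
        have "\<forall>\<^sub>F s in at 0. Dden \<tau> (1 * s + ?w) \<noteq> 0"
          by (rule entire_affine_eventually_nonzero[OF ent(2) z]) simp
        thus "\<forall>\<^sub>F s in at 0. Dnum \<tau> (s + (?w + ?h)) * Dden \<tau> s - (Dnum \<tau> s * Dden \<tau> (s + (?w + ?h))) = 0"
        proof eventually_elim
          case (elim s)
          have a1: "Dnum \<tau> (s + ?w) * Dden \<tau> s = (-1) * (Dnum \<tau> s * Dden \<tau> (s + ?w))"
            using \<open>D_scaled (-1) \<tau> ?w\<close> unfolding D_scaled_def by blast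
          have a2: "Dnum \<tau> (s + ?w + ?h) * Dden \<tau> (s + ?w) = (-1) * (Dnum \<tau> (s + ?w) * Dden \<tau> (s + ?w + ?h))"
            using per(3)[OF tau(1)] unfolding D_scaled_def by blast
          have "(Dnum \<tau> (s + ?w + ?h) * Dden \<tau> s - Dnum \<tau> s * Dden \<tau> (s + ?w + ?h)) * Dden \<tau> (s + ?w)
            = (Dnum \<tau> (s + ?w + ?h) * Dden \<tau> (s + ?w)) * Dden \<tau> s - (Dnum \<tau> s * Dden \<tau> (s + ?w)) * Dden \<tau> (s + ?w + ?h)"
            by (simp add: algebra_simps)
          also have "\<dots> = - (Dnum \<tau> (s + ?w) * Dden \<tau> s + Dnum \<tau> s * Dden \<tau> (s + ?w)) * Dden \<tau> (s + ?w + ?h)"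
            unfolding a2 by (simp add: algebra_simps)
          also have "\<dots> = 0" unfolding a1 by simp
          finally show ?case using elim by (simp add: add.assoc)
        qed
      qed
      thus "Dnum \<tau> (s + (?w + ?h)) * Dden \<tau> s = 1 * (Dnum \<tau> s * Dden \<tau> (s + (?w + ?h)))" by simp
    qed
  qed
  hence "lat \<tau> (cpi * ((\<alpha> * \<tau>' + \<tau>) / 2))" by (simp add: field_simps)
  then obtain k n where "(\<alpha> * \<tau>' + \<tau>) / 2 = of_int k * \<tau> + of_int n" using div_pi by blast
  hence "of_int (p + 1) * \<tau> + of_int q = of_int (2 * k) * \<tau> + of_int (2 * n)"
    unfolding pq by (simp add: field_simps)
  hence "q = 2 * n" using lattice_basis_unique(2)[of \<tau> "p + 1" q "2 * k" "2 * n"] tau by auto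
  hence "even q" by simp
  thus ?thesis unfolding modrel_def using det tau'_eq by blast
qed


section \<open>The group \<open>G\<close>\<close>

definition mob :: "int \<Rightarrow> int \<Rightarrow> int \<Rightarrow> int \<Rightarrow> complex \<Rightarrow> complex" where
  "mob a b c d \<tau> = (of_int a * \<tau> + of_int b) / (of_int c * \<tau> + of_int d)"

lemma modrel_mob: "modrel \<tau> \<tau>' \<longleftrightarrow> (\<exists>a b c d. a * d - b * c = 1 \<and> even b \<and> \<tau>' = mob a b c d \<tau>)"
  by (simp add: modrel_def mob_def)

lemma Im_mob_pos:
  assumes "Im \<tau> > 0" "a * d - b * c = 1"
  shows "Im (mob a b c d \<tau>) > 0"
  unfolding mob_def Im_moebius assms(2) using moebius_denominator_nonzero[OF assms] assms(1) by simp

lemma Im_fricke: "Im \<tau> > 0 \<Longrightarrow> Im (- 2 / \<tau>) > 0"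
  by (subst Im_divide) (auto simp: sum_power2_gt_zero_iff intro!: divide_pos_pos)

lemma modrel_Im: "Im \<tau> > 0 \<Longrightarrow> modrel \<tau> \<tau>' \<Longrightarrow> Im \<tau>' > 0"
  unfolding modrel_mob using Im_mob_pos by blast

lemma mob_mob:
  assumes "Im \<tau> > 0" "a * d - b * c = 1"
  shows "mob a' b' c' d' (mob a b c d \<tau>) = mob (a' * a + b' * c) (a' * b + b' * d) (c' * a + d' * c) (c' * b + d' * d) \<tau>"
proof -
  define j where "j = of_int c * \<tau> + of_int d"
  define n where "n = of_int a * \<tau> + of_int b"
  have j: "j \<noteq> 0" unfolding j_def by (rule moebius_denominator_nonzero[OF assms])
  have "mob a' b' c' d' (mob a b c d \<tau>) = ((of_int a' * n + of_int b' * j) / j) / ((of_int c' * n + of_int d' * j) / j)"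
    using j by (simp add: mob_def n_def[symmetric] j_def[symmetric] add_divide_distrib)
  also have "\<dots> = (of_int a' * n + of_int b' * j) / (of_int c' * n + of_int d' * j)" using j by simp
  also have "\<dots> = mob (a' * a + b' * c) (a' * b + b' * d) (c' * a + d' * c) (c' * b + d' * d) \<tau>"
    by (simp add: mob_def n_def j_def algebra_simps)
  finally show ?thesis .
qed

lemma modrel_refl: "modrel \<tau> \<tau>"
  unfolding modrel_mob by (rule exI[of _ 1], rule exI[of _ 0], rule exI[of _ 0], rule exI[of _ 1]) (simp add: mob_def)

lemma modrel_trans:
  assumes tau: "Im \<tau> > 0" and "modrel \<tau> \<tau>'" "modrel \<tau>' \<tau>''"
  shows "modrel \<tau> \<tau>''"
proof -
  obtain a b c d where 1: "a * d - b * c = 1" "even b" "\<tau>' = mob a b c d \<tau>" using assms(2) modrel_mob by blast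
  obtain a' b' c' d' where 2: "a' * d' - b' * c' = 1" "even b'" "\<tau>'' = mob a' b' c' d' \<tau>'" using assms(3) modrel_mob by blast
  have "(a' * a + b' * c) * (c' * b + d' * d) - (a' * b + b' * d) * (c' * a + d' * c) = (a' * d' - b' * c') * (a * d - b * c)"
    by (simp add: algebra_simps)
  hence "(a' * a + b' * c) * (c' * b + d' * d) - (a' * b + b' * d) * (c' * a + d' * c) = 1" using 1 2 by simp
  moreover have "even (a' * b + b' * d)" using 1 2 by simp
  ultimately show ?thesis unfolding modrel_mob using mob_mob[OF tau 1(1)] 1(3) 2(3) by blast
qed

lemma modrel_sym:
  assumes tau: "Im \<tau> > 0" and "modrel \<tau> \<tau>'"
  shows "modrel \<tau>' \<tau>"
proof -
  obtain a b c d where 1: "a * d - b * c = 1" "even b" "\<tau>' = mob a b c d \<tau>" using assms(2) modrel_mob by blast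
  have "mob d (- b) (- c) a \<tau>' = \<tau>"
    unfolding 1(3) mob_mob[OF tau 1(1)] using 1(1) by (simp add: mob_def algebra_simps)
  moreover have "d * a - (- b) * (- c) = 1" using 1 by (simp add: algebra_simps)
  moreover have "even (- b)" using 1 by simp
  ultimately show ?thesis unfolding modrel_mob by metis
qed

text \<open>Conjugation by -2/\<tau> turns the matrix (a, b; c, d) into (d, -2c; -b/2, a). Evenness
  of b makes the new lower left entry an integer, and the new upper right entry is even
  again.\<close>

lemma modrel_fricke:
  assumes tau: "Im \<tau> > 0" and "modrel \<tau> \<tau>'"
  shows "modrel (- 2 / \<tau>) (- 2 / \<tau>')"
proof -
  obtain a b c d where 1: "a * d - b * c = 1" "even b" "\<tau>' = mob a b c d \<tau>" using assms(2) modrel_mob by blast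
  obtain e where e: "b = 2 * e" using 1(2) by (elim evenE)
  have t0: "\<tau> \<noteq> 0" using tau by auto
  define n where "n = of_int a * \<tau> + of_int b"
  have "- 2 / \<tau>' = (- 2 * (of_int c * \<tau> + of_int d)) / n"
    by (simp add: 1(3) mob_def n_def)
  also have "\<dots> = mob d (- 2 * c) (- e) a (- 2 / \<tau>)"
  proof -
    have "mob d (- 2 * c) (- e) a (- 2 / \<tau>) = ((- 2 * (of_int c * \<tau> + of_int d)) / \<tau>) / (n / \<tau>)"
      using t0 unfolding mob_def n_def e by (intro arg_cong2[where f = "(/)"]) (simp_all add: field_simps)
    thus ?thesis using t0 by simp
  qed
  finally have "- 2 / \<tau>' = mob d (- 2 * c) (- e) a (- 2 / \<tau>)" .
  moreover have "d * a - (- 2 * c) * (- e) = 1" using 1(1) by (simp add: e algebra_simps)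
  ultimately show ?thesis unfolding modrel_mob by (metis dvd_triv_left mult_minus_left dvd_minus_iff)
qed

lemma fricke_fricke: "\<tau> \<noteq> 0 \<Longrightarrow> - 2 / (- 2 / \<tau>) = (\<tau> :: complex)"
  by simp

text \<open>The involution -2/\<tau> normalises the group behind \<open>modrel\<close>. Hence
  applying it at most once, before a matrix, already gives the orbits of the extended group.\<close>

definition Grel :: "complex \<Rightarrow> complex \<Rightarrow> bool" where
  "Grel \<tau> \<tau>' \<longleftrightarrow> modrel \<tau> \<tau>' \<or> modrel (- 2 / \<tau>) \<tau>'"

lemma Grel_trans:
  assumes tau: "Im \<tau> > 0" and "Grel \<tau> \<tau>'" "Grel \<tau>' \<tau>''"
  shows "Grel \<tau> \<tau>''"
proof -
  have t0: "\<tau> \<noteq> 0" using tau by auto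
  have f: "Im (- 2 / \<tau>) > 0" by (rule Im_fricke[OF tau])
  have fr: "modrel (- 2 / \<tau>) \<tau>' \<Longrightarrow> modrel \<tau> (- 2 / \<tau>')"
    using modrel_fricke[OF f, of \<tau>'] fricke_fricke[OF t0] by simp
  from assms(2,3) show ?thesis
    unfolding Grel_def
    using modrel_trans[OF tau, of \<tau>' \<tau>''] modrel_trans[OF f, of \<tau>' \<tau>'']
      modrel_trans[OF tau, of "- 2 / \<tau>'" \<tau>''] modrel_trans[OF f, of "- 2 / \<tau>'" \<tau>''] modrel_fricke[OF tau, of \<tau>'] fr
    by blast
qed

lemma Grel_sym:
  assumes tau: "Im \<tau> > 0" and "Grel \<tau> \<tau>'"
  shows "Grel \<tau>' \<tau>"
proof -
  have t0: "\<tau> \<noteq> 0" using tau by auto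
  have f: "Im (- 2 / \<tau>) > 0" by (rule Im_fricke[OF tau])
  show ?thesis
  proof (cases "modrel \<tau> \<tau>'")
    case True
    thus ?thesis using modrel_sym[OF tau] Grel_def by blast
  next
    case False
    hence *: "modrel (- 2 / \<tau>) \<tau>'" using assms(2) Grel_def by blast
    have "modrel \<tau>' (- 2 / \<tau>)" by (rule modrel_sym[OF f *])
    from modrel_fricke[OF modrel_Im[OF f *] this] show ?thesis
      unfolding Grel_def fricke_fricke[OF t0] by blast
  qed
qed

section \<open>Orbits of the group generated by the three automorphisms\<close>

lemma UHP_iff: "\<tau> \<in> upper_half_plane \<longleftrightarrow> Im \<tau> > 0"
  by (simp add: upper_half_plane_def)

abbreviation G_gens :: "(complex \<Rightarrow> complex) set" where
  "G_gens \<equiv> {\<lambda>\<tau>\<in>upper_half_plane. \<tau> + 2, \<lambda>\<tau>\<in>upper_half_plane. \<tau> / (\<tau> + 1), \<lambda>\<tau>\<in>upper_half_plane. - 2 / \<tau>}"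

lemma mob_simps:
  "mob 1 2 0 1 \<tau> = \<tau> + 2" "mob 1 (- 2) 0 1 \<tau> = \<tau> - 2" "mob 1 0 1 1 \<tau> = \<tau> / (\<tau> + 1)" "mob 1 0 (- 1) 1 \<tau> = \<tau> / (1 - \<tau>)"
  by (simp_all add: mob_def)

lemma bij_betw_mob:
  assumes det: "a * d - b * c = 1"
  shows "bij_betw (mob a b c d) upper_half_plane upper_half_plane"
proof (rule bij_betw_byWitness[where f' = "mob d (- b) (- c) a"])
  have det': "d * a - (- b) * (- c) = 1" using det by (simp add: algebra_simps)
  show "\<forall>\<tau>\<in>upper_half_plane. mob d (- b) (- c) a (mob a b c d \<tau>) = \<tau>"
  proof
    fix \<tau> assume "\<tau> \<in> upper_half_plane"
    hence tau: "Im \<tau> > 0" by (simp add: UHP_iff)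
    show "mob d (- b) (- c) a (mob a b c d \<tau>) = \<tau>"
      unfolding mob_mob[OF tau det] using det by (simp add: mob_def algebra_simps)
  qed
  show "\<forall>\<tau>\<in>upper_half_plane. mob a b c d (mob d (- b) (- c) a \<tau>) = \<tau>"
  proof
    fix \<tau> assume "\<tau> \<in> upper_half_plane"
    hence tau: "Im \<tau> > 0" by (simp add: UHP_iff)
    show "mob a b c d (mob d (- b) (- c) a \<tau>) = \<tau>"
      unfolding mob_mob[OF tau det'] using det by (simp add: mob_def algebra_simps)
  qed
  show "mob a b c d ` upper_half_plane \<subseteq> upper_half_plane"
    using Im_mob_pos[OF _ det] by (auto simp: UHP_iff)
  show "mob d (- b) (- c) a ` upper_half_plane \<subseteq> upper_half_plane"
    using Im_mob_pos[OF _ det'] by (auto simp: UHP_iff)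
qed

lemma G_gens_carrier: "G_gens \<subseteq> carrier (BijGroup upper_half_plane)"
proof -
  have "bij_betw (\<lambda>\<tau>. \<tau> + 2) upper_half_plane upper_half_plane"
    using bij_betw_mob[of 1 1 2 0] by (simp add: mob_simps(1) cong: bij_betw_cong)
  moreover have "bij_betw (\<lambda>\<tau>. \<tau> / (\<tau> + 1)) upper_half_plane upper_half_plane"
    using bij_betw_mob[of 1 1 0 1] by (simp add: mob_simps(3) cong: bij_betw_cong)
  moreover have "bij_betw (\<lambda>\<tau>. - 2 / \<tau>) upper_half_plane upper_half_plane"
  proof (rule bij_betw_byWitness[where f' = "\<lambda>\<tau>. - 2 / \<tau>"])
    show "\<forall>\<tau>\<in>upper_half_plane. - 2 / (- 2 / \<tau>) = \<tau>" "\<forall>\<tau>\<in>upper_half_plane. - 2 / (- 2 / \<tau>) = \<tau>"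
      by (simp_all)
    show "(\<lambda>\<tau>. - 2 / \<tau>) ` upper_half_plane \<subseteq> upper_half_plane" "(\<lambda>\<tau>. - 2 / \<tau>) ` upper_half_plane \<subseteq> upper_half_plane"
      using Im_fricke by (auto simp: UHP_iff)
  qed
  ultimately show ?thesis
    unfolding BijGroup_def Bij_def by (auto simp: bij_betw_restrict_eq)
qed

lemma G_mod_carrier: "g \<in> G_mod \<Longrightarrow> g \<in> Bij upper_half_plane"
  using group.generate_in_carrier[OF group_BijGroup G_gens_carrier, of g]
  unfolding G_mod_def by (simp only: BijGroup_def partial_object.simps)

lemma Bij_maps: "g \<in> Bij S \<Longrightarrow> x \<in> S \<Longrightarrow> g x \<in> S"
  unfolding Bij_def by (auto dest: bij_betwE)

lemma G_mod_mult:
  assumes "g \<in> G_mod" "h \<in> G_mod" "\<tau> \<in> upper_half_plane"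
  shows "\<exists>k\<in>G_mod. k \<tau> = g (h \<tau>)"
proof
  show "g \<otimes>\<^bsub>BijGroup upper_half_plane\<^esub> h \<in> G_mod"
    using assms unfolding G_mod_def by (intro generate.eng)
  show "(g \<otimes>\<^bsub>BijGroup upper_half_plane\<^esub> h) \<tau> = g (h \<tau>)"
    using G_mod_carrier[OF assms(1)] G_mod_carrier[OF assms(2)] assms(3)
    by (simp add: BijGroup_def compose_def)
qed

lemma G_mod_inv:
  assumes "g \<in> G_mod" "\<tau> \<in> upper_half_plane"
  shows "\<exists>k\<in>G_mod. k (g \<tau>) = \<tau>"
proof
  show "inv\<^bsub>BijGroup upper_half_plane\<^esub> g \<in> G_mod"
    using group.generate_m_inv_closed[OF group_BijGroup G_gens_carrier] assms(1) unfolding G_mod_def by blast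
  have B: "g \<in> Bij upper_half_plane" by (rule G_mod_carrier[OF assms(1)])
  have "inj_on g upper_half_plane" "g \<tau> \<in> upper_half_plane" using B Bij_maps[OF B assms(2)] by (auto simp: Bij_def bij_betw_def)
  thus "(inv\<^bsub>BijGroup upper_half_plane\<^esub> g) (g \<tau>) = \<tau>"
    using assms(2) by (simp add: inv_BijGroup[OF B] inv_into_f_f)
qed

lemma G_congruent_refl: "\<tau> \<in> upper_half_plane \<Longrightarrow> G_congruent \<tau> \<tau>"
  unfolding G_congruent_def G_mod_def
  by (rule bexI[OF _ generate.one]) (simp add: BijGroup_def)

lemma G_congruent_trans:
  assumes "\<tau> \<in> upper_half_plane" "G_congruent \<tau> \<tau>'" "G_congruent \<tau>' \<tau>''"
  shows "G_congruent \<tau> \<tau>''"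
  using assms G_mod_mult[of _ _ \<tau>] unfolding G_congruent_def by metis

lemma G_congruent_sym:
  assumes "\<tau> \<in> upper_half_plane" "G_congruent \<tau> \<tau>'"
  shows "G_congruent \<tau>' \<tau>"
  using assms G_mod_inv[of _ \<tau>] unfolding G_congruent_def by metis

lemma G_congruent_gens:
  assumes "\<tau> \<in> upper_half_plane"
  shows "G_congruent \<tau> (\<tau> + 2)" "G_congruent \<tau> (\<tau> / (\<tau> + 1))" "G_congruent \<tau> (- 2 / \<tau>)"
proof -
  have *: "G_congruent \<tau> (g \<tau>)" if "g \<in> G_gens" for g
    unfolding G_congruent_def G_mod_def by (rule bexI[of _ g]) (simp, rule generate.incl[OF that])
  show "G_congruent \<tau> (\<tau> + 2)" using *[of "\<lambda>\<tau>\<in>upper_half_plane. \<tau> + 2"] assms by simp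
  show "G_congruent \<tau> (\<tau> / (\<tau> + 1))" using *[of "\<lambda>\<tau>\<in>upper_half_plane. \<tau> / (\<tau> + 1)"] assms by simp
  show "G_congruent \<tau> (- 2 / \<tau>)" using *[of "\<lambda>\<tau>\<in>upper_half_plane. - 2 / \<tau>"] assms by simp
qed

lemma G_congruent_imp_Grel:
  assumes "\<tau> \<in> upper_half_plane" "G_congruent \<tau> \<tau>'"
  shows "Grel \<tau> \<tau>'"
proof -
  have gen: "Grel \<sigma> (h \<sigma>) \<and> h \<sigma> \<in> upper_half_plane" if "h \<in> G_gens" "\<sigma> \<in> upper_half_plane" for h \<sigma>
  proof -
    have s: "Im \<sigma> > 0" using that(2) by (simp add: UHP_iff)
    have "modrel \<sigma> (\<sigma> + 2)"
      unfolding modrel_mob by (rule exI[of _ 1], rule exI[of _ 2], rule exI[of _ 0], rule exI[of _ 1]) (simp add: mob_simps)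
    moreover have "modrel \<sigma> (\<sigma> / (\<sigma> + 1))"
      unfolding modrel_mob by (rule exI[of _ 1], rule exI[of _ 0], rule exI[of _ 1], rule exI[of _ 1]) (simp add: mob_simps)
    moreover have "h \<sigma> \<in> upper_half_plane"
      using Bij_maps[of h upper_half_plane \<sigma>] G_gens_carrier that by (auto simp: BijGroup_def)
    ultimately show ?thesis using that modrel_refl[of "- 2 / \<sigma>"] by (auto simp: Grel_def)
  qed
  have "\<forall>\<sigma>\<in>upper_half_plane. Grel \<sigma> (g \<sigma>) \<and> g \<sigma> \<in> upper_half_plane"
    if "g \<in> generate (BijGroup upper_half_plane) G_gens" for g
    using that
  proof (induction rule: generate.induct)
    case one
    thus ?case by (simp add: BijGroup_def Grel_def modrel_refl)
  next
    case (incl h)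
    thus ?case using gen by blast
  next
    case (inv h)
    show ?case
    proof
      fix \<sigma> assume \<sigma>: "\<sigma> \<in> upper_half_plane"
      have B: "h \<in> Bij upper_half_plane" using inv G_gens_carrier by (auto simp: BijGroup_def)
      define \<rho> where "\<rho> = (inv\<^bsub>BijGroup upper_half_plane\<^esub> h) \<sigma>"
      have "\<rho> = inv_into upper_half_plane h \<sigma>" using \<sigma> by (simp add: \<rho>_def inv_BijGroup[OF B])
      moreover have "h ` upper_half_plane = upper_half_plane" using B by (auto simp: Bij_def bij_betw_def)
      ultimately have r: "\<rho> \<in> upper_half_plane" "h \<rho> = \<sigma>"
        using \<sigma> inv_into_into[of \<sigma> h upper_half_plane] f_inv_into_f[of \<sigma> h upper_half_plane] by auto
      have "Grel \<rho> \<sigma>" using gen[OF inv r(1)] r(2) by simp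
      hence "Grel \<sigma> \<rho>" using Grel_sym r(1) by (simp add: UHP_iff)
      thus "Grel \<sigma> ((inv\<^bsub>BijGroup upper_half_plane\<^esub> h) \<sigma>) \<and> (inv\<^bsub>BijGroup upper_half_plane\<^esub> h) \<sigma> \<in> upper_half_plane"
        using r(1) unfolding \<rho>_def by blast
    qed
  next
    case (eng h1 h2)
    have "h1 \<in> Bij upper_half_plane" "h2 \<in> Bij upper_half_plane"
      using eng.hyps G_mod_carrier by (auto simp: G_mod_def)
    hence m: "(h1 \<otimes>\<^bsub>BijGroup upper_half_plane\<^esub> h2) \<sigma> = h1 (h2 \<sigma>)" if "\<sigma> \<in> upper_half_plane" for \<sigma>
      using that by (simp add: BijGroup_def compose_def)
    show ?case
    proof
      fix \<sigma> assume \<sigma>: "\<sigma> \<in> upper_half_plane"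
      have "Grel \<sigma> (h2 \<sigma>)" "h2 \<sigma> \<in> upper_half_plane" "Grel (h2 \<sigma>) (h1 (h2 \<sigma>))" "h1 (h2 \<sigma>) \<in> upper_half_plane"
        using eng.IH \<sigma> by blast+
      thus "Grel \<sigma> ((h1 \<otimes>\<^bsub>BijGroup upper_half_plane\<^esub> h2) \<sigma>) \<and> (h1 \<otimes>\<^bsub>BijGroup upper_half_plane\<^esub> h2) \<sigma> \<in> upper_half_plane"
        unfolding m[OF \<sigma>] using Grel_trans[of \<sigma>] \<sigma> by (auto simp: UHP_iff)
    qed
  qed
  thus ?thesis using assms unfolding G_congruent_def G_mod_def by blast
qed

lemma G_congruent_unipotent:
  assumes tau: "\<tau> \<in> upper_half_plane"
  shows "G_congruent \<tau> (mob 1 0 n 1 \<tau>)"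
proof -
  have Im: "Im \<tau> > 0" using tau by (simp add: UHP_iff)
  have in_H: "mob 1 0 n 1 \<tau> \<in> upper_half_plane" for n using Im_mob_pos[OF Im, of 1 1 0 n] by (simp add: UHP_iff)
  have step: "mob 1 0 1 1 (mob 1 0 n 1 \<tau>) = mob 1 0 (n + 1) 1 \<tau>" for n
    using mob_mob[OF Im, of 1 1 0 n 1 0 1 1] by (simp add: add.commute)
  have st: "G_congruent (mob 1 0 n 1 \<tau>) (mob 1 0 (n + 1) 1 \<tau>)" for n
    using G_congruent_gens(2)[OF in_H[of n]] step[of n] by (simp add: mob_simps(3))
  show ?thesis
  proof (induction n rule: int_induct[of _ 0])
    case base
    show ?case using G_congruent_refl[OF tau] by (simp add: mob_def)
  next
    case (step1 i)
    thus ?case using G_congruent_trans[OF tau _ st] by blast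
  next
    case (step2 i)
    thus ?case using G_congruent_trans[OF tau _ G_congruent_sym[OF in_H st[of "i - 1"]]] by simp
  qed
qed

text \<open>A Euclidean descent on the right column (b, d): composing with the first two generators
  or their inverses replaces b by b + 2d or b - 2d, or d by d + b or d - b. When b = 0 is reached,
  the matrix is plus or minus a unipotent one.\<close>

lemma modrel_imp_G_congruent_mob:
  assumes tau: "\<tau> \<in> upper_half_plane" and "a * d - b * c = 1" "even b"
  shows "G_congruent \<tau> (mob a b c d \<tau>)"
  using assms(2,3)
proof (induction "nat (\<bar>b\<bar> + \<bar>d\<bar>)" arbitrary: a b c d rule: less_induct)
  case less
  have Im: "Im \<tau> > 0" using tau by (simp add: UHP_iff)
  have in_H: "mob a b c d \<tau> \<in> upper_half_plane" using Im_mob_pos[OF Im less.prems(1)] by (simp add: UHP_iff)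
  have dodd: "odd d"
  proof
    assume "even d"
    hence "even (a * d - b * c)" using less.prems(2) by simp
    thus False using less.prems(1) by simp
  qed
  have cong: "G_congruent \<tau> (mob a b c d \<tau>)"
    if "G_congruent \<tau> \<sigma>" "G_congruent \<sigma> (mob a b c d \<tau>) \<or> G_congruent (mob a b c d \<tau>) \<sigma>" for \<sigma>
    using that G_congruent_trans[OF tau] G_congruent_sym[OF in_H] by blast
  have shifts: "mob 1 2 0 1 (mob a b c d \<tau>) = mob (a + 2 * c) (b + 2 * d) c d \<tau>"
    "mob 1 (- 2) 0 1 (mob a b c d \<tau>) = mob (a - 2 * c) (b - 2 * d) c d \<tau>"
    "mob 1 0 1 1 (mob a b c d \<tau>) = mob a b (c + a) (d + b) \<tau>"
    "mob 1 0 (- 1) 1 (mob a b c d \<tau>) = mob a b (c - a) (d - b) \<tau>"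
    by (simp_all add: mob_mob[OF Im less.prems(1)] add.commute)
  have ret: "mob 1 2 0 1 (mob 1 (- 2) 0 1 (mob a b c d \<tau>)) = mob a b c d \<tau>"
    "mob 1 0 1 1 (mob 1 0 (- 1) 1 (mob a b c d \<tau>)) = mob a b c d \<tau>"
    using in_H by (simp_all add: mob_mob UHP_iff) (simp_all add: mob_def)
  have in_H': "mob 1 (- 2) 0 1 (mob a b c d \<tau>) \<in> upper_half_plane" "mob 1 0 (- 1) 1 (mob a b c d \<tau>) \<in> upper_half_plane"
    using Im_mob_pos in_H by (simp_all add: UHP_iff)
  have g1: "G_congruent (mob a b c d \<tau>) (mob 1 2 0 1 (mob a b c d \<tau>))"
    "G_congruent (mob a b c d \<tau>) (mob 1 0 1 1 (mob a b c d \<tau>))"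
    using G_congruent_gens(1,2)[OF in_H] by (simp_all only: mob_simps)
  have g2: "G_congruent (mob 1 (- 2) 0 1 (mob a b c d \<tau>)) (mob a b c d \<tau>)"
    using G_congruent_gens(1)[OF in_H'(1), folded mob_simps(1)] by (simp only: ret)
  have g3: "G_congruent (mob 1 0 (- 1) 1 (mob a b c d \<tau>)) (mob a b c d \<tau>)"
    using G_congruent_gens(2)[OF in_H'(2), folded mob_simps(3)] by (simp only: ret)
  note g = g1(1)[unfolded shifts] g2[unfolded shifts] g1(2)[unfolded shifts] g3[unfolded shifts]
  have step: ?case if "G_congruent \<sigma> (mob a b c d \<tau>) \<or> G_congruent (mob a b c d \<tau>) \<sigma>" "\<sigma> = mob a' b' c' d' \<tau>"
    "\<bar>b'\<bar> + \<bar>d'\<bar> < \<bar>b\<bar> + \<bar>d\<bar>" "a' * d' - b' * c' = 1" "even b'" for \<sigma> a' b' c' d'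
    using cong[OF _ that(1)] less.hyps[of b' d' a' c'] that(2-5) by simp
  show ?case
  proof (cases "b = 0")
    case True
    hence "a * d = 1" using less.prems(1) by simp
    hence "a = 1 \<and> d = 1 \<or> a = -1 \<and> d = -1" by (metis zmult_eq_1_iff)
    thus ?thesis
    proof
      assume "a = 1 \<and> d = 1"
      thus ?thesis using G_congruent_unipotent[OF tau, of c] True by simp
    next
      assume ad: "a = -1 \<and> d = -1"
      have "mob (-1) 0 c (-1) \<tau> = mob 1 0 (-c) 1 \<tau>"
      proof -
        have "mob (-1) 0 c (-1) \<tau> = (- \<tau>) / (- (of_int (- c) * \<tau> + 1))" by (simp add: mob_def)
        thus ?thesis by (simp only: minus_divide_divide) (simp add: mob_def)
      qed
      thus ?thesis using G_congruent_unipotent[OF tau, of "- c"] True ad by simp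
    qed
  next
    case False
    have d0: "d \<noteq> 0" using dodd by auto
    have ne: "\<bar>b\<bar> \<noteq> \<bar>d\<bar>" using dodd less.prems(2) by (metis abs_eq_iff even_minus)
    have det: "(a + 2 * c) * d - (b + 2 * d) * c = 1" "(a - 2 * c) * d - (b - 2 * d) * c = 1"
      "a * (d + b) - b * (c + a) = 1" "a * (d - b) - b * (c - a) = 1"
      using less.prems(1) by (simp_all add: algebra_simps)
    have ev: "even (b + 2 * d)" "even (b - 2 * d)" using less.prems(2) by auto
    \<comment> \<open>As b is even and d is odd, their absolute values differ. If |b| is the larger
      one, a change by 2d decreases it; if |d| is the larger one, a change by the non-zero b
      decreases it.\<close>
    consider "\<bar>b + 2 * d\<bar> + \<bar>d\<bar> < \<bar>b\<bar> + \<bar>d\<bar>" | "\<bar>b - 2 * d\<bar> + \<bar>d\<bar> < \<bar>b\<bar> + \<bar>d\<bar>"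
      | "\<bar>b\<bar> + \<bar>d + b\<bar> < \<bar>b\<bar> + \<bar>d\<bar>" | "\<bar>b\<bar> + \<bar>d - b\<bar> < \<bar>b\<bar> + \<bar>d\<bar>"
      using ne False d0 by linarith
    thus ?thesis
    proof cases
      case 1
      thus ?thesis using step[OF disjI2[OF g(1)] refl _ det(1) ev(1)] by blast
    next
      case 2
      thus ?thesis using step[OF disjI1[OF g(2)] refl _ det(2) ev(2)] by blast
    next
      case 3
      thus ?thesis using step[OF disjI2[OF g(3)] refl _ det(3) less.prems(2)] by blast
    next
      case 4
      thus ?thesis using step[OF disjI1[OF g(4)] refl _ det(4) less.prems(2)] by blast
    qed
  qed
qed

theorem G_congruent_iff_Grel:
  assumes tau: "\<tau> \<in> upper_half_plane"
  shows "G_congruent \<tau> \<tau>' \<longleftrightarrow> Grel \<tau> \<tau>'"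
proof
  assume "Grel \<tau> \<tau>'"
  moreover have "G_congruent \<tau> \<tau>'" if "modrel \<tau> \<tau>'"
    using that modrel_imp_G_congruent_mob[OF tau] unfolding modrel_mob by blast
  moreover have "G_congruent \<tau> \<tau>'" if "modrel (- 2 / \<tau>) \<tau>'"
  proof -
    have "- 2 / \<tau> \<in> upper_half_plane" using Im_fricke tau by (simp add: UHP_iff)
    hence "G_congruent (- 2 / \<tau>) \<tau>'" using that modrel_imp_G_congruent_mob unfolding modrel_mob by blast
    thus ?thesis using G_congruent_trans[OF tau G_congruent_gens(3)[OF tau]] by blast
  qed
  ultimately show "G_congruent \<tau> \<tau>'" unfolding Grel_def by blast
qed (rule G_congruent_imp_Grel[OF tau])


section \<open>Holomorphic functions of two variables\<close>

lemma has_derivative_dx: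
  fixes u :: "C2 \<Rightarrow> complex"
  assumes "(u has_derivative (\<lambda>h. a * fst h + b * snd h)) (at (x, y))"
  shows "((\<lambda>t. u (t, y)) has_field_derivative a) (at x)"
proof -
  have "((\<lambda>t. u (t, y)) has_derivative (\<lambda>h. a * fst (h, 0::complex) + b * snd (h, 0::complex))) (at x)"
    by (rule has_derivative_compose[of "\<lambda>t. (t, y)" "\<lambda>h. (h, 0)" x UNIV u, OF _ assms])
      (auto intro!: derivative_eq_intros)
  thus ?thesis by (simp add: has_field_derivative_def)
qed

lemma has_derivative_dy:
  fixes u :: "C2 \<Rightarrow> complex"
  assumes "(u has_derivative (\<lambda>h. a * fst h + b * snd h)) (at (x, y))"
  shows "((\<lambda>t. u (x, t)) has_field_derivative b) (at y)"
proof -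
  have "((\<lambda>t. u (x, t)) has_derivative (\<lambda>h. a * fst (0::complex, h) + b * snd (0::complex, h))) (at y)"
    by (rule has_derivative_compose[of "\<lambda>t. (x, t)" "\<lambda>h. (0, h)" y UNIV u, OF _ assms])
      (auto intro!: derivative_eq_intros)
  thus ?thesis by (simp add: has_field_derivative_def)
qed

lemma has_derivative_imp_dx_dy:
  assumes "(u has_derivative (\<lambda>h. a * fst h + b * snd h)) (at p)"
  shows "dx u p = a" "dy u p = b"
  using has_derivative_dx[of u a b "fst p" "snd p"] has_derivative_dy[of u a b "fst p" "snd p"] assms
  by (simp_all add: dx_def dy_def DERIV_imp_deriv)

lemma holo2_onD:
  assumes "holo2_on u U" "p \<in> U"
  shows "(u has_derivative (\<lambda>h. dx u p * fst h + dy u p * snd h)) (at p)"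
proof -
  obtain a b where *: "(u has_derivative (\<lambda>h. a * fst h + b * snd h)) (at p)"
    using assms unfolding holo2_on_def by blast
  show ?thesis using * has_derivative_imp_dx_dy[OF *] by simp
qed

lemma has_derivative_chain2:
  fixes u :: "C2 \<Rightarrow> complex"
  assumes "(u has_derivative (\<lambda>h. a * fst h + b * snd h)) (at (X t, Y t))"
    "(X has_field_derivative x') (at t)" "(Y has_field_derivative y') (at t)"
  shows "((\<lambda>t. u (X t, Y t)) has_field_derivative (a * x' + b * y')) (at t)"
proof -
  have "((\<lambda>t. (X t, Y t)) has_derivative (\<lambda>h. (x' * h, y' * h))) (at t)"
    using assms(2,3) by (intro has_derivative_Pair) (simp_all add: has_field_derivative_def)
  from has_derivative_compose[OF this assms(1)]
  have "((\<lambda>t. u (X t, Y t)) has_derivative (\<lambda>h. a * (x' * h) + b * (y' * h))) (at t)" by simp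
  moreover have "(\<lambda>h. a * (x' * h) + b * (y' * h)) = (*) (a * x' + b * y')" by (auto simp: algebra_simps)
  ultimately show ?thesis by (simp add: has_field_derivative_def)
qed

lemma holo2_on_continuous: "holo2_on u U \<Longrightarrow> continuous_on U u"
  by (intro continuous_at_imp_continuous_on ballI) (rule has_derivative_continuous[OF holo2_onD])

text \<open>A class that is stable under both partial derivatives, up to halving the radius, and
  whose members are jointly differentiable at the centre. The bound B makes the Cauchy estimates in
  one variable uniform in the other.\<close>

definition sep_holo :: "(C2 \<Rightarrow> complex) \<Rightarrow> complex \<Rightarrow> complex \<Rightarrow> real \<Rightarrow> real \<Rightarrow> bool" where
  "sep_holo w x0 y0 r B \<longleftrightarrow> 0 < r \<and>
     (\<forall>y\<in>ball y0 r. (\<lambda>x. w (x, y)) holomorphic_on ball x0 r) \<and>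
     (\<forall>x\<in>ball x0 r. (\<lambda>y. w (x, y)) holomorphic_on ball y0 r) \<and>
     (\<forall>x\<in>ball x0 r. \<forall>y\<in>ball y0 r. norm (w (x, y)) \<le> B)"

lemma sep_holo_swap: "sep_holo w x0 y0 r B \<Longrightarrow> sep_holo (w \<circ> prod.swap) y0 x0 r B"
  unfolding sep_holo_def by auto

lemma dx_swap: "dx (w \<circ> prod.swap) = dy w \<circ> prod.swap" "dy (w \<circ> prod.swap) = dx w \<circ> prod.swap"
  by (auto simp: fun_eq_iff dx_def dy_def)

lemma cball_half: "x \<in> ball x0 (r / 2) \<Longrightarrow> cball x (r / 2) \<subseteq> ball x0 (r :: real)"
proof
  fix z assume "x \<in> ball x0 (r / 2)" "z \<in> cball x (r / 2)"
  thus "z \<in> ball x0 r" using dist_triangle[of x0 z x] by auto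
qed

lemma holomorphic_deriv_bound:
  assumes "f holomorphic_on ball x0 r" "\<And>x. x \<in> ball x0 r \<Longrightarrow> norm (f x) \<le> B" "0 < s" "cball x s \<subseteq> ball x0 r"
  shows "norm ((deriv ^^ n) f x) \<le> fact n * B / s ^ n"
proof (rule Cauchy_inequality[of f x s B n])
  show "f holomorphic_on ball x s" using assms(1,4) ball_subset_cball by (blast intro: holomorphic_on_subset)
  show "continuous_on (cball x s) f"
    using assms(1,4) by (blast intro: holomorphic_on_imp_continuous_on holomorphic_on_subset)
  show "norm (f z) \<le> B" if "norm (x - z) = s" for z
    using assms(2,4) that by (auto simp: dist_norm subset_iff)
qed (use assms in auto)

lemma cball_quarter: "x \<in> ball x0 (r / 2) \<Longrightarrow> h \<in> ball x (r / 4) \<Longrightarrow> cball h (r / 4) \<subseteq> ball x0 (r :: real)"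
proof
  fix z assume "x \<in> ball x0 (r / 2)" "h \<in> ball x (r / 4)" "z \<in> cball h (r / 4)"
  thus "z \<in> ball x0 r"
    using dist_triangle[of x0 z x] dist_triangle[of x z h] by auto
qed


text \<open>A second-order Taylor estimate in which the second derivative is controlled by the
  Cauchy inequality. The constant involves only B and r, whence the uniformity in the other
  variable.\<close>

lemma difference_quotient_bound:
  assumes hol: "f holomorphic_on ball x0 r" and B: "\<And>x. x \<in> ball x0 r \<Longrightarrow> norm (f x) \<le> B"
    and r: "0 < r" and x: "x \<in> ball x0 (r / 2)" and h: "h \<noteq> 0" "norm h < r / 4"
  shows "norm ((f (x + h) - f x) / h - deriv f x) \<le> (2 * B / (r / 4) ^ 2) * norm h"
proof -
  define C where "C = 2 * B / (r / 4) ^ 2"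
  have sub: "ball x (r / 4) \<subseteq> ball x0 r"
    using cball_quarter[OF x] r by (meson centre_in_cball divide_nonneg_pos less_eq_real_def subset_iff zero_less_numeral)
  have "norm ((\<lambda>i. (deriv ^^ i) f) 0 (x + h) - (\<Sum>i\<le>1. (\<lambda>i. (deriv ^^ i) f) i x * (x + h - x) ^ i / fact i)) \<le> C * norm (x + h - x) ^ Suc 1 / fact 1"
  proof (rule complex_Taylor[of "ball x (r / 4)"])
    show "(((deriv ^^ i) f) has_field_derivative (deriv ^^ Suc i) f z) (at z within ball x (r / 4))"
      if "z \<in> ball x (r / 4)" for i z
    proof -
      have "((deriv ^^ i) f) holomorphic_on ball x0 r" by (rule holomorphic_higher_deriv[OF hol]) simp
      from holomorphic_derivI[OF this open_ball, of z] that sub show ?thesis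
        by (simp add: has_field_derivative_at_within subset_iff)
    qed
    show "norm ((deriv ^^ Suc 1) f z) \<le> C" if "z \<in> ball x (r / 4)" for z
      using holomorphic_deriv_bound[OF hol B _ cball_quarter[OF x that], of 2] r by (simp add: C_def numeral_2_eq_2)
  qed (use h r in \<open>auto simp: dist_norm\<close>)
  hence "norm (f (x + h) - f x - deriv f x * h) \<le> C * norm h ^ 2"
    by (simp add: algebra_simps power2_eq_square)
  moreover have "(f (x + h) - f x) / h - deriv f x = (f (x + h) - f x - deriv f x * h) / h"
    using h by (simp add: field_simps)
  ultimately have "norm ((f (x + h) - f x) / h - deriv f x) \<le> C * norm h ^ 2 / norm h"
    using h by (simp add: norm_divide divide_right_mono)
  thus ?thesis using h by (simp add: C_def power2_eq_square)
qed

text \<open>The difference quotients of \<open>w\<close> in the first variable converge uniformly in the second one.\<close>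

lemma sep_holo_dx_deriv:
  assumes sh: "sep_holo w x0 y0 r B" and x: "x \<in> ball x0 (r / 2)"
  obtains g' where "\<And>y. y \<in> ball y0 (r / 2) \<Longrightarrow> ((\<lambda>y. dx w (x, y)) has_field_derivative g' y) (at y)"
    "\<And>y. y \<in> ball y0 (r / 2) \<Longrightarrow> ((\<lambda>t. dy w (t, y)) has_field_derivative g' y) (at x)"
proof -
  have r: "r > 0" and hx: "\<And>y. y \<in> ball y0 r \<Longrightarrow> (\<lambda>x. w (x, y)) holomorphic_on ball x0 r"
    and hy: "\<And>x. x \<in> ball x0 r \<Longrightarrow> (\<lambda>y. w (x, y)) holomorphic_on ball y0 r"
    and B: "\<And>x y. x \<in> ball x0 r \<Longrightarrow> y \<in> ball y0 r \<Longrightarrow> norm (w (x, y)) \<le> B"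
    using sh unfolding sep_holo_def by auto
  define C where "C = 2 * B / (r / 4) ^ 2"
  have sub: "cball y0 (r / 2) \<subseteq> ball y0 r" using r by auto
  have xr: "x \<in> ball x0 r" using x r by auto
  have xh: "x + h \<in> ball x0 r" if "norm h < r / 4" for h
    using x that r dist_triangle[of x0 "x + h" x] by (auto simp: dist_norm)
  have ev: "\<forall>\<^sub>F h in at 0. h \<noteq> 0 \<and> norm h < r / 4"
    unfolding eventually_at by (rule exI[of _ "r / 4"]) (use r in auto)
  \<comment> \<open>Uniform limits of holomorphic functions may be differentiated term by term. The
    same g' is thus the y-derivative of \<open>dx w\<close> and the limit of the difference
    quotients of \<open>dy w\<close>, and this is the equality of the mixed derivatives.\<close>
  obtain g' where g': "\<And>y. y \<in> ball y0 (r / 2) \<Longrightarrow> ((\<lambda>y. dx w (x, y)) has_field_derivative g' y) (at y) \<and>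
      ((\<lambda>h. (dy w (x + h, y) - dy w (x, y)) / h) \<longlongrightarrow> g' y) (at 0)"
  proof (rule has_complex_derivative_uniform_limit[of y0 "r / 2" "\<lambda>h y. (w (x + h, y) - w (x, y)) / h"
        "\<lambda>h y. (dy w (x + h, y) - dy w (x, y)) / h" "at 0" "\<lambda>y. dx w (x, y)"])
    show "\<forall>\<^sub>F h in at 0. continuous_on (cball y0 (r / 2)) (\<lambda>y. (w (x + h, y) - w (x, y)) / h) \<and>
      (\<forall>y\<in>ball y0 (r / 2). ((\<lambda>y. (w (x + h, y) - w (x, y)) / h) has_field_derivative (dy w (x + h, y) - dy w (x, y)) / h) (at y))"
      using ev
    proof eventually_elim
      case (elim h)
      note H = hy[OF xh] hy[OF xr]
      have "continuous_on (cball y0 (r / 2)) (\<lambda>y. w (x + h, y))" "continuous_on (cball y0 (r / 2)) (\<lambda>y. w (x, y))"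
        using H elim sub by (auto intro: holomorphic_on_imp_continuous_on holomorphic_on_subset)
      hence "continuous_on (cball y0 (r / 2)) (\<lambda>y. (w (x + h, y) - w (x, y)) / h)"
        using elim by (intro continuous_intros) auto
      moreover have "((\<lambda>y. (w (x + h, y) - w (x, y)) / h) has_field_derivative (dy w (x + h, y) - dy w (x, y)) / h) (at y)"
        if "y \<in> ball y0 (r / 2)" for y
      proof -
        have y: "y \<in> ball y0 r" using that r by auto
        have "((\<lambda>y. w (x + h, y)) has_field_derivative dy w (x + h, y)) (at y)" "((\<lambda>y. w (x, y)) has_field_derivative dy w (x, y)) (at y)"
          using holomorphic_derivI[OF hy[OF xh] open_ball y] holomorphic_derivI[OF hy[OF xr] open_ball y] elim
          by (simp_all add: dy_def)
        from DERIV_cdivide[OF DERIV_diff[OF this]] show ?thesis .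
      qed
      ultimately show ?case by blast
    qed
    show "uniform_limit (cball y0 (r / 2)) (\<lambda>h y. (w (x + h, y) - w (x, y)) / h) (\<lambda>y. dx w (x, y)) (at 0)"
    proof (rule uniform_limitI)
      fix e :: real assume e: "e > 0"
      have C0: "C \<ge> 0"
      proof -
        have "norm (w (x0, y0)) \<le> B" by (rule B) (use r in auto)
        hence "0 \<le> B" by (rule order_trans[OF norm_ge_zero])
        thus ?thesis by (simp add: C_def)
      qed
      have "\<forall>\<^sub>F h in at 0. norm h < e / (C + 1)"
        unfolding eventually_at by (rule exI[of _ "e / (C + 1)"]) (use e C0 in auto)
      with ev show "\<forall>\<^sub>F h in at 0. \<forall>y\<in>cball y0 (r / 2). dist ((w (x + h, y) - w (x, y)) / h) (dx w (x, y)) < e"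
      proof eventually_elim
        case (elim h)
        show ?case
        proof
          fix y assume "y \<in> cball y0 (r / 2)"
          hence y: "y \<in> ball y0 r" using sub by auto
          have "dist ((w (x + h, y) - w (x, y)) / h) (dx w (x, y)) \<le> C * norm h"
            using difference_quotient_bound[OF hx[OF y] B[OF _ y] r x, of h] elim by (simp add: dist_norm dx_def C_def)
          also have "\<dots> \<le> (C + 1) * norm h" by (simp add: algebra_simps)
          also have "\<dots> < e" using elim C0 by (simp add: field_simps)
          finally show "dist ((w (x + h, y) - w (x, y)) / h) (dx w (x, y)) < e" .
        qed
      qed
    qed
    show "at (0 :: complex) \<noteq> bot" by simp
    show "0 < r / 2" using r by simp
  qed blast
  show ?thesis
  proof (rule that)
    show "((\<lambda>y. dx w (x, y)) has_field_derivative g' y) (at y)" if "y \<in> ball y0 (r / 2)" for y using g' that by blast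
    show "((\<lambda>t. dy w (t, y)) has_field_derivative g' y) (at x)" if "y \<in> ball y0 (r / 2)" for y
      unfolding DERIV_def using g' that by blast
  qed
qed

lemma sep_holo_dx:
  assumes sh: "sep_holo w x0 y0 r B"
  shows "sep_holo (dx w) x0 y0 (r / 2) (2 * B / r)"
proof -
  have r: "r > 0" and hx: "\<And>y. y \<in> ball y0 r \<Longrightarrow> (\<lambda>x. w (x, y)) holomorphic_on ball x0 r"
    and B: "\<And>x y. x \<in> ball x0 r \<Longrightarrow> y \<in> ball y0 r \<Longrightarrow> norm (w (x, y)) \<le> B"
    using sh unfolding sep_holo_def by auto
  have sub: "ball y0 (r / 2) \<subseteq> ball y0 r" "ball x0 (r / 2) \<subseteq> ball x0 r" using r by auto
  have "(\<lambda>x. dx w (x, y)) holomorphic_on ball x0 (r / 2)" if "y \<in> ball y0 (r / 2)" for y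
    using holomorphic_on_subset[OF holomorphic_deriv[OF hx[of y] open_ball] sub(2)] that sub by (auto simp: dx_def)
  moreover have "(\<lambda>y. dx w (x, y)) holomorphic_on ball y0 (r / 2)" if x: "x \<in> ball x0 (r / 2)" for x
  proof (rule sep_holo_dx_deriv[OF sh x])
    fix g' assume "\<And>y. y \<in> ball y0 (r / 2) \<Longrightarrow> ((\<lambda>y. dx w (x, y)) has_field_derivative g' y) (at y)"
    thus ?thesis unfolding holomorphic_on_open[OF open_ball] by blast
  qed
  moreover have "norm (dx w (x, y)) \<le> 2 * B / r" if "x \<in> ball x0 (r / 2)" "y \<in> ball y0 (r / 2)" for x y
  proof -
    have y: "y \<in> ball y0 r" using that sub by auto
    from holomorphic_deriv_bound[OF hx[OF y] B[OF _ y] _ cball_half[OF that(1)], of 1] r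
    show ?thesis by (simp add: dx_def mult.commute)
  qed
  ultimately show ?thesis unfolding sep_holo_def using r by auto
qed

lemma sep_holo_dy: "sep_holo w x0 y0 r B \<Longrightarrow> sep_holo (dy w) x0 y0 (r / 2) (2 * B / r)"
  using sep_holo_swap[OF sep_holo_dx[OF sep_holo_swap]] by (simp add: dx_swap comp_assoc)

lemma sep_holo_mixed:
  assumes "sep_holo w x0 y0 r B"
  shows "dx (dy w) (x0, y0) = dy (dx w) (x0, y0)"
proof -
  have r: "r > 0" using assms by (simp add: sep_holo_def)
  obtain g' where "((\<lambda>y. dx w (x0, y)) has_field_derivative g' y0) (at y0)"
    "((\<lambda>t. dy w (t, y0)) has_field_derivative g' y0) (at x0)"
  proof (rule sep_holo_dx_deriv[OF assms, of x0])
    show "x0 \<in> ball x0 (r / 2)" using r by simp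
    fix g' assume g: "\<And>y. y \<in> ball y0 (r / 2) \<Longrightarrow> ((\<lambda>y. dx w (x0, y)) has_field_derivative g' y) (at y)"
      "\<And>y. y \<in> ball y0 (r / 2) \<Longrightarrow> ((\<lambda>t. dy w (t, y)) has_field_derivative g' y) (at x0)"
    have "y0 \<in> ball y0 (r / 2)" using r by simp
    from g(1)[OF this] g(2)[OF this] show thesis by (rule that[of "\<lambda>_. g' y0"])
  qed
  thus ?thesis unfolding dx_def[of "dy w"] dy_def[of "dx w"] by (simp add: DERIV_imp_deriv)
qed

lemma sep_holo_lipschitz:
  assumes sh: "sep_holo w x0 y0 r B" and x: "x \<in> ball x0 (r / 2)" and y: "y \<in> ball y0 (r / 2)"
  shows "norm (w (x, y) - w (x0, y0)) \<le> (2 * B / r) * norm (x - x0) + (2 * B / r) * norm (y - y0)"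
proof -
  have r: "r > 0" and hx: "\<And>y. y \<in> ball y0 r \<Longrightarrow> (\<lambda>x. w (x, y)) holomorphic_on ball x0 r"
    and hy: "\<And>x. x \<in> ball x0 r \<Longrightarrow> (\<lambda>y. w (x, y)) holomorphic_on ball y0 r"
    using sh unfolding sep_holo_def by auto
  have sub: "ball y0 (r / 2) \<subseteq> ball y0 r" "ball x0 (r / 2) \<subseteq> ball x0 r" using r by auto
  have b1: "norm (dx w (x, y)) \<le> 2 * B / r" "norm (dy w (x, y)) \<le> 2 * B / r"
    if "x \<in> ball x0 (r / 2)" "y \<in> ball y0 (r / 2)" for x y
    using sep_holo_dx[OF sh] sep_holo_dy[OF sh] that unfolding sep_holo_def by auto
  have y0: "y0 \<in> ball y0 (r / 2)" using r by simp
  have x0: "x0 \<in> ball x0 (r / 2)" using r by simp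
  have "norm (w (x, y) - w (x0, y)) \<le> (2 * B / r) * norm (x - x0)"
  proof (rule field_differentiable_bound[of "ball x0 (r / 2)" "\<lambda>x. w (x, y)" "\<lambda>x. dx w (x, y)"])
    show "((\<lambda>x. w (x, y)) has_field_derivative dx w (z, y)) (at z within ball x0 (r / 2))" if "z \<in> ball x0 (r / 2)" for z
      using holomorphic_derivI[OF hx[of y] open_ball, of z] subsetD[OF sub(2) that] subsetD[OF sub(1) y]
      by (simp only: dx_def fst_conv snd_conv)
  qed (use b1 x y x0 in auto)
  moreover have "norm (w (x0, y) - w (x0, y0)) \<le> (2 * B / r) * norm (y - y0)"
  proof (rule field_differentiable_bound[of "ball y0 (r / 2)" "\<lambda>y. w (x0, y)" "\<lambda>y. dy w (x0, y)"])
    show "((\<lambda>y. w (x0, y)) has_field_derivative dy w (x0, z)) (at z within ball y0 (r / 2))" if "z \<in> ball y0 (r / 2)" for z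
      using holomorphic_derivI[OF hy[of x0] open_ball, of z] subsetD[OF sub(1) that] subsetD[OF sub(2) x0]
      by (simp only: dy_def fst_conv snd_conv)
  qed (use b1 x0 y y0 in auto)
  ultimately show ?thesis
    using norm_triangle_ineq[of "w (x, y) - w (x0, y)" "w (x0, y) - w (x0, y0)"] by simp
qed

lemma sep_holo_continuous:
  assumes sh: "sep_holo w x0 y0 r B"
  shows "isCont w (x0, y0)"
proof -
  have r: "r > 0" using sh by (simp add: sep_holo_def)
  have ev: "\<forall>\<^sub>F p in at (x0, y0). p \<in> ball x0 (r / 2) \<times> ball y0 (r / 2)"
    unfolding eventually_at_filter using r
    by (intro eventually_mono[OF eventually_nhds_in_open[of "ball x0 (r / 2) \<times> ball y0 (r / 2)"]] open_Times) auto
  have "((\<lambda>p. w p - w (x0, y0)) \<longlongrightarrow> 0) (at (x0, y0))"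
  proof (rule Lim_null_comparison)
    show "\<forall>\<^sub>F p in at (x0, y0). norm (w p - w (x0, y0)) \<le> (2 * B / r) * norm (fst p - x0) + (2 * B / r) * norm (snd p - y0)"
      using ev
    proof eventually_elim
      case (elim p)
      thus ?case using sep_holo_lipschitz[OF sh, of "fst p" "snd p"] by (cases p) auto
    qed
    have "((\<lambda>p. (2 * B / r) * norm (fst p - x0) + (2 * B / r) * norm (snd p - y0)) \<longlongrightarrow> (2 * B / r) * norm (fst (x0, y0) - x0) + (2 * B / r) * norm (snd (x0, y0) - y0)) (at (x0, y0))"
      by (intro tendsto_intros)
    thus "((\<lambda>p. (2 * B / r) * norm (fst p - x0) + (2 * B / r) * norm (snd p - y0)) \<longlongrightarrow> 0) (at (x0, y0))" by simp
  qed
  hence "(w \<longlongrightarrow> w (x0, y0)) (at (x0, y0))" by (simp add: LIM_zero_iff)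
  thus ?thesis by (simp add: isCont_def)
qed

text \<open>Differentiability in x at the centre and continuity of the derivative in y imply joint
  differentiability; the continuity comes from applying \<open>sep_holo_continuous\<close> to
  \<open>dy w\<close>.\<close>

lemma sep_holo_has_derivative:
  assumes sh: "sep_holo w x0 y0 r B"
  shows "(w has_derivative (\<lambda>h. dx w (x0, y0) * fst h + dy w (x0, y0) * snd h)) (at (x0, y0))"
proof -
  have r: "r > 0" and hx: "\<And>y. y \<in> ball y0 r \<Longrightarrow> (\<lambda>x. w (x, y)) holomorphic_on ball x0 r"
    and hy: "\<And>x. x \<in> ball x0 r \<Longrightarrow> (\<lambda>y. w (x, y)) holomorphic_on ball y0 r"
    using sh unfolding sep_holo_def by auto
  have mult_apply: "blinfun_apply (blinfun_mult_right c) h = h * c" for c h :: complex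
    by (simp add: blinfun_mult_right.rep_eq)
  have "((\<lambda>(x, y). (\<lambda>x y. w (x, y)) x y) has_derivative (\<lambda>(tx, ty). dx w (x0, y0) * tx + blinfun_apply (blinfun_mult_left (dy w (x0, y0))) ty)) (at (x0, y0) within ball x0 r \<times> ball y0 r)"
  proof (rule has_derivative_partialsI[where fy = "\<lambda>x y. blinfun_mult_left (dy w (x, y))"])
    have "((\<lambda>x. w (x, y0)) has_field_derivative dx w (x0, y0)) (at x0)"
      using holomorphic_derivI[OF hx[of y0] open_ball, of x0] r by (simp add: dx_def)
    thus "((\<lambda>x. w (x, y0)) has_derivative (\<lambda>tx. dx w (x0, y0) * tx)) (at x0 within ball x0 r)"
      by (simp add: has_field_derivative_def has_derivative_at_withinI)
    show "((\<lambda>y. w (x, y)) has_derivative blinfun_apply (blinfun_mult_left (dy w (x, y)))) (at y within ball y0 r)"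
      if "x \<in> ball x0 r" "y \<in> ball y0 r" for x y
    proof -
      have "((\<lambda>y. w (x, y)) has_field_derivative dy w (x, y)) (at y)"
        using holomorphic_derivI[OF hy[OF that(1)] open_ball that(2)] by (simp add: dy_def)
      moreover have "blinfun_apply (blinfun_mult_left (dy w (x, y))) = (\<lambda>h. dy w (x, y) * h)"
        by (auto simp: blinfun_mult_left.rep_eq mult.commute)
      ultimately show ?thesis by (simp add: has_field_derivative_def has_derivative_at_withinI)
    qed
    have "continuous (at (x0, y0)) (\<lambda>p. blinfun_mult_left (dy w p))"
      by (intro bounded_linear.continuous[OF bounded_linear_blinfun_mult_left] sep_holo_continuous[OF sep_holo_dy[OF sh]])
    moreover have "(\<lambda>p. blinfun_mult_left (dy w p)) = (\<lambda>(x, y). blinfun_mult_left (dy w (x, y)))" by auto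
    ultimately show "continuous (at (x0, y0) within ball x0 r \<times> ball y0 r) (\<lambda>(x, y). blinfun_mult_left (dy w (x, y)))"
      by (simp add: continuous_at_imp_continuous_at_within)
  qed (use r in auto)
  moreover have "at (x0, y0) within ball x0 r \<times> ball y0 r = at (x0, y0)"
    by (rule at_within_open) (use r in \<open>auto intro: open_Times\<close>)
  moreover have "(\<lambda>(tx, ty). dx w (x0, y0) * tx + blinfun_apply (blinfun_mult_left (dy w (x0, y0))) ty) = (\<lambda>h. dx w (x0, y0) * fst h + dy w (x0, y0) * snd h)"
    by (auto simp: blinfun_mult_left.rep_eq mult.commute)
  moreover have "(\<lambda>(x, y). (\<lambda>x y. w (x, y)) x y) = w" by auto
  ultimately show ?thesis by simp
qed

lemma holo2_on_imp_sep_holo: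
  assumes "holo2_on u U" "open U" "(x0, y0) \<in> U"
  obtains r B where "sep_holo u x0 y0 r B"
proof -
  obtain A B where AB: "open A" "open B" "x0 \<in> A" "y0 \<in> B" "A \<times> B \<subseteq> U"
    using assms(2,3) by (rule open_prod_elim) auto
  obtain r1 where r1: "r1 > 0" "cball x0 r1 \<subseteq> A" using AB open_contains_cball by blast
  obtain r2 where r2: "r2 > 0" "cball y0 r2 \<subseteq> B" using AB open_contains_cball by blast
  define r where "r = min r1 r2"
  have sub: "cball x0 r \<times> cball y0 r \<subseteq> U" using r1 r2 AB(5) unfolding r_def by force
  have "compact (u ` (cball x0 r \<times> cball y0 r))"
    by (intro compact_continuous_image compact_Times compact_cball continuous_on_subset[OF holo2_on_continuous[OF assms(1)] sub])
  then obtain M where M: "\<And>p. p \<in> cball x0 r \<times> cball y0 r \<Longrightarrow> norm (u p) \<le> M"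
    using compact_imp_bounded[of "u ` (cball x0 r \<times> cball y0 r)"] unfolding bounded_iff by blast
  have U: "(x, y) \<in> U" if "x \<in> ball x0 r" "y \<in> ball y0 r" for x y using that sub by auto
  have "sep_holo u x0 y0 r M"
    unfolding sep_holo_def
  proof (intro conjI ballI)
    show "0 < r" using r1 r2 by (simp add: r_def)
    show "(\<lambda>x. u (x, y)) holomorphic_on ball x0 r" if "y \<in> ball y0 r" for y
      unfolding holomorphic_on_open[OF open_ball] using has_derivative_dx[OF holo2_onD[OF assms(1) U[OF _ that]]] by blast
    show "(\<lambda>y. u (x, y)) holomorphic_on ball y0 r" if "x \<in> ball x0 r" for x
      unfolding holomorphic_on_open[OF open_ball] using has_derivative_dy[OF holo2_onD[OF assms(1) U[OF that]]] by blast
    show "norm (u (x, y)) \<le> M" if "x \<in> ball x0 r" "y \<in> ball y0 r" for x y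
      by (rule M) (use that in auto)
  qed
  thus ?thesis by (rule that)
qed

text \<open>A differentiable function is bounded on a small closed bidisc and separately holomorphic
  there, so its partial derivatives are again of the class \<open>sep_holo\<close> and hence
  differentiable at the centre.\<close>

theorem holo2_on_partials:
  assumes "holo2_on u U" "open U"
  shows "holo2_on (dx u) U" "holo2_on (dy u) U" "\<And>p. p \<in> U \<Longrightarrow> dx (dy u) p = dy (dx u) p"
proof -
  have *: "(\<exists>a b. (dx u has_derivative (\<lambda>h. a * fst h + b * snd h)) (at p)) \<and>
      (\<exists>a b. (dy u has_derivative (\<lambda>h. a * fst h + b * snd h)) (at p)) \<and> dx (dy u) p = dy (dx u) p"
    if pU: "p \<in> U" for p
  proof -
    obtain x y where p: "p = (x, y)" by (cases p)
    obtain r B where sh: "sep_holo u x y r B"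
      using holo2_on_imp_sep_holo[OF assms pU[unfolded p]] by blast
    show ?thesis
      using sep_holo_has_derivative[OF sep_holo_dx[OF sh]] sep_holo_has_derivative[OF sep_holo_dy[OF sh]] sep_holo_mixed[OF sh]
      unfolding p by blast
  qed
  show "holo2_on (dx u) U" "holo2_on (dy u) U" unfolding holo2_on_def using * by blast+
  show "dx (dy u) p = dy (dx u) p" if "p \<in> U" for p using * that by blast
qed


section \<open>Germs of holomorphic functions and of foliations\<close>

lemma isCont_eventually:
  fixes f :: "'a :: t2_space \<Rightarrow> 'b :: t2_space"
  assumes "isCont f x" "f x = c" "\<forall>\<^sub>F y in nhds c. P y"
  shows "\<forall>\<^sub>F t in nhds x. P (f t)"
proof -
  have "filterlim f (nhds c) (nhds x)"
    using assms(1,2) unfolding isCont_def tendsto_at_iff_tendsto_nhds by simp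
  thus ?thesis by (rule eventually_compose_filterlim[OF assms(3)])
qed

lemma holo2_atE:
  assumes "holo2_at u p"
  obtains U where "open U" "p \<in> U" "holo2_on u U"
  using assms unfolding holo2_at_def by blast

lemma holo2_at_has_derivative:
  "holo2_at u p \<Longrightarrow> (u has_derivative (\<lambda>h. dx u p * fst h + dy u p * snd h)) (at p)"
  using holo2_onD unfolding holo2_at_def by blast

lemma holo2_at_eventually: "holo2_at u p \<Longrightarrow> \<forall>\<^sub>F z in nhds p. holo2_at u z"
  unfolding holo2_at_def eventually_nhds by blast

lemma holo2_atI:
  assumes "\<forall>\<^sub>F z in nhds p. \<exists>a b. (u has_derivative (\<lambda>h. a * fst h + b * snd h)) (at z)"
  shows "holo2_at u p"
  using assms unfolding holo2_at_def eventually_nhds holo2_on_def by blast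

lemma holo2_at_partials:
  assumes "holo2_at u p"
  shows "holo2_at (dx u) p" "holo2_at (dy u) p" "dx (dy u) p = dy (dx u) p"
proof -
  obtain U where U: "open U" "p \<in> U" "holo2_on u U" using assms by (rule holo2_atE)
  show "holo2_at (dx u) p" "holo2_at (dy u) p" "dx (dy u) p = dy (dx u) p"
    using holo2_on_partials[OF U(3,1)] U(1,2) unfolding holo2_at_def by blast+
qed

lemma holo2_at_isCont: "holo2_at u p \<Longrightarrow> isCont u p"
  using holo2_at_has_derivative has_derivative_continuous by blast

lemma has_derivative_compose2:
  fixes v :: "C2 \<Rightarrow> complex"
  assumes "(v has_derivative (\<lambda>h. a * fst h + b * snd h)) (at (\<psi> p))"
    "((fst \<circ> \<psi>) has_derivative (\<lambda>h. a1 * fst h + b1 * snd h)) (at p)"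
    "((snd \<circ> \<psi>) has_derivative (\<lambda>h. a2 * fst h + b2 * snd h)) (at p)"
  shows "((v \<circ> \<psi>) has_derivative (\<lambda>h. (a * a1 + b * a2) * fst h + (a * b1 + b * b2) * snd h)) (at p)"
proof -
  have "((\<lambda>z. ((fst \<circ> \<psi>) z, (snd \<circ> \<psi>) z)) has_derivative (\<lambda>h. (a1 * fst h + b1 * snd h, a2 * fst h + b2 * snd h))) (at p)"
    by (rule has_derivative_Pair[OF assms(2,3)])
  hence "(\<psi> has_derivative (\<lambda>h. (a1 * fst h + b1 * snd h, a2 * fst h + b2 * snd h))) (at p)" by simp
  from has_derivative_compose[OF this assms(1)]
  have "((v \<circ> \<psi>) has_derivative (\<lambda>h. a * (a1 * fst h + b1 * snd h) + b * (a2 * fst h + b2 * snd h))) (at p)"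
    by (simp add: o_def)
  moreover have "(\<lambda>h. a * (a1 * fst h + b1 * snd h) + b * (a2 * fst h + b2 * snd h)) =
    (\<lambda>h :: C2. (a * a1 + b * a2) * fst h + (a * b1 + b * b2) * snd h)"
    by (auto simp: algebra_simps)
  ultimately show ?thesis by simp
qed

lemma holo2_compose:
  assumes "holo2_at v (\<psi> p)" "holo2_at (fst \<circ> \<psi>) p" "holo2_at (snd \<circ> \<psi>) p"
  shows "holo2_at (v \<circ> \<psi>) p"
    "dx (v \<circ> \<psi>) p = dx v (\<psi> p) * dx (fst \<circ> \<psi>) p + dy v (\<psi> p) * dx (snd \<circ> \<psi>) p"
    "dy (v \<circ> \<psi>) p = dx v (\<psi> p) * dy (fst \<circ> \<psi>) p + dy v (\<psi> p) * dy (snd \<circ> \<psi>) p"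
proof -
  have *: "((v \<circ> \<psi>) has_derivative (\<lambda>h. (dx v (\<psi> z) * dx (fst \<circ> \<psi>) z + dy v (\<psi> z) * dx (snd \<circ> \<psi>) z) * fst h
      + (dx v (\<psi> z) * dy (fst \<circ> \<psi>) z + dy v (\<psi> z) * dy (snd \<circ> \<psi>) z) * snd h)) (at z)"
    if "holo2_at v (\<psi> z)" "holo2_at (fst \<circ> \<psi>) z" "holo2_at (snd \<circ> \<psi>) z" for z
    by (rule has_derivative_compose2[OF that[THEN holo2_at_has_derivative]])
  have cont: "isCont \<psi> p"
    using continuous_Pair[OF holo2_at_isCont[OF assms(2)] holo2_at_isCont[OF assms(3)]] by simp
  have "\<forall>\<^sub>F z in nhds p. holo2_at v (\<psi> z)"
    using filterlim_iff[THEN iffD1, OF cont[unfolded isCont_def tendsto_at_iff_tendsto_nhds]] holo2_at_eventually[OF assms(1)] by blast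
  with holo2_at_eventually[OF assms(2)] holo2_at_eventually[OF assms(3)]
  have "\<forall>\<^sub>F z in nhds p. \<exists>a b. ((v \<circ> \<psi>) has_derivative (\<lambda>h. a * fst h + b * snd h)) (at z)"
    by eventually_elim (use * in blast)
  thus "holo2_at (v \<circ> \<psi>) p" by (rule holo2_atI)
  show "dx (v \<circ> \<psi>) p = dx v (\<psi> p) * dx (fst \<circ> \<psi>) p + dy v (\<psi> p) * dx (snd \<circ> \<psi>) p"
    "dy (v \<circ> \<psi>) p = dx v (\<psi> p) * dy (fst \<circ> \<psi>) p + dy v (\<psi> p) * dy (snd \<circ> \<psi>) p"
    using has_derivative_imp_dx_dy[OF *[OF assms]] by auto
qed

lemma linear_has_derivative:
  "((\<lambda>(x, y). \<alpha> * x + \<beta> * y + c) has_derivative (\<lambda>h. \<alpha> * fst h + \<beta> * snd h)) (at (p :: C2))"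
  unfolding case_prod_unfold by (auto intro!: derivative_eq_intros)

lemma linear_holo2:
  "holo2_at (\<lambda>(x, y). \<alpha> * x + \<beta> * y + c) p" "dx (\<lambda>(x, y). \<alpha> * x + \<beta> * y + c) p = \<alpha>" "dy (\<lambda>(x, y). \<alpha> * x + \<beta> * y + c) p = \<beta>"
  using linear_has_derivative[of \<alpha> \<beta> c] has_derivative_imp_dx_dy[OF linear_has_derivative, of \<alpha> \<beta> c p]
  by (auto intro!: holo2_atI always_eventually)

lemma product_has_derivative:
  assumes "(f has_field_derivative f') (at (fst p))" "(g has_field_derivative g') (at (snd p))"
  shows "((\<lambda>(x, y). f x * g y) has_derivative (\<lambda>h. f' * g (snd p) * fst h + f (fst p) * g' * snd h)) (at (p :: C2))"
proof -
  have "((\<lambda>z. f (fst z)) has_derivative (\<lambda>h. f' * fst h)) (at p)" "((\<lambda>z. g (snd z)) has_derivative (\<lambda>h. g' * snd h)) (at p)"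
    using assms by (auto intro!: has_derivative_compose[of fst fst] has_derivative_compose[of snd snd] bounded_linear_imp_has_derivative
      bounded_linear_fst bounded_linear_snd simp: has_field_derivative_def)
  from has_derivative_mult[OF this] show ?thesis unfolding case_prod_unfold by (simp add: algebra_simps)
qed

lemma same_foliation_iff:
  "same_foliation_at p u v \<longleftrightarrow> (\<exists>U. open U \<and> p \<in> U \<and> (\<forall>z\<in>U. \<forall>w\<in>U. u w = u z \<longleftrightarrow> v w = v z))"
proof -
  have "level_curves u U = level_curves v U \<longleftrightarrow> (\<forall>z\<in>U. \<forall>w\<in>U. u w = u z \<longleftrightarrow> v w = v z)" for U
  proof
    assume eq: "level_curves u U = level_curves v U"
    show "\<forall>z\<in>U. \<forall>w\<in>U. u w = u z \<longleftrightarrow> v w = v z"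
    proof (intro ballI)
      fix z w assume zw: "z \<in> U" "w \<in> U"
      have "{w \<in> U. u w = u z} \<in> level_curves v U" using zw eq unfolding level_curves_def by blast
      then obtain z' where z': "{w \<in> U. u w = u z} = {w \<in> U. v w = v z'}" unfolding level_curves_def by blast
      hence "v z = v z'" using zw by blast
      thus "u w = u z \<longleftrightarrow> v w = v z" using z' zw by auto
    qed
  next
    assume "\<forall>z\<in>U. \<forall>w\<in>U. u w = u z \<longleftrightarrow> v w = v z"
    hence "{w \<in> U. u w = u z} = {w \<in> U. v w = v z}" if "z \<in> U" for z using that by blast
    thus "level_curves u U = level_curves v U" unfolding level_curves_def by (metis (no_types, lifting))
  qed
  thus ?thesis unfolding same_foliation_at_def by blast
qed

text \<open>Restricted to a line \<gamma> through p that is transversal to the leaf, u has a local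
  inverse, and h is w along \<gamma> composed with this inverse. Each z near p shares its leaf with
  a point of \<gamma>, where w takes the same value because the leaves of u and w coincide.\<close>

theorem same_foliation_factor:
  assumes sf: "same_foliation_at p u w" and u: "holo2_at u p" and w: "holo2_at w p"
    and nz: "dx u p \<noteq> 0 \<or> dy u p \<noteq> 0"
  obtains h where "h analytic_on {u p}" "\<forall>\<^sub>F z in nhds p. w z = h (u z)"
proof -
  obtain \<alpha> \<beta> where ab: "dx u p * \<alpha> + dy u p * \<beta> \<noteq> 0"
    using nz by (metis add.left_neutral add.right_neutral mult.right_neutral mult_zero_right)
  obtain U1 where U1: "open U1" "p \<in> U1" "holo2_on u U1" using u by (rule holo2_atE)
  obtain U2 where U2: "open U2" "p \<in> U2" "holo2_on w U2" using w by (rule holo2_atE)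
  obtain U3 where U3: "open U3" "p \<in> U3" "\<And>z z'. z \<in> U3 \<Longrightarrow> z' \<in> U3 \<Longrightarrow> u z' = u z \<longleftrightarrow> w z' = w z"
    using sf unfolding same_foliation_iff by blast
  define U where "U = U1 \<inter> U2 \<inter> U3"
  have U: "open U" "p \<in> U" using U1 U2 U3 by (auto simp: U_def)
  define \<gamma> where "\<gamma> = (\<lambda>t. (fst p + \<alpha> * t, snd p + \<beta> * t))"
  have "isCont \<gamma> 0" unfolding \<gamma>_def by (intro continuous_intros)
  hence "\<forall>\<^sub>F t in nhds 0. \<gamma> t \<in> U"
    unfolding isCont_def tendsto_at_iff_tendsto_nhds using U by (intro topological_tendstoD) (auto simp: \<gamma>_def)
  then obtain r where r: "r > 0" "\<And>t. t \<in> ball (0::complex) r \<Longrightarrow> \<gamma> t \<in> U"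
    unfolding eventually_nhds_metric by (auto simp: dist_commute)
  define f where "f = (\<lambda>t. u (\<gamma> t))"
  have df: "(f has_field_derivative (dx u (\<gamma> t) * \<alpha> + dy u (\<gamma> t) * \<beta>)) (at t)" if "t \<in> ball (0::complex) r" for t
    unfolding f_def \<gamma>_def
    by (rule has_derivative_chain2) (use holo2_onD[OF U1(3)] r(2)[OF that] in \<open>auto simp: U_def \<gamma>_def intro!: derivative_eq_intros\<close>)
  have dw: "((\<lambda>t. w (\<gamma> t)) has_field_derivative (dx w (\<gamma> t) * \<alpha> + dy w (\<gamma> t) * \<beta>)) (at t)" if "t \<in> ball (0::complex) r" for t
    unfolding \<gamma>_def
    by (rule has_derivative_chain2) (use holo2_onD[OF U2(3)] r(2)[OF that] in \<open>auto simp: U_def \<gamma>_def intro!: derivative_eq_intros\<close>)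
  have fhol: "f holomorphic_on ball (0::complex) r" and whol: "(\<lambda>t. w (\<gamma> t)) holomorphic_on ball (0::complex) r"
    unfolding holomorphic_on_open[OF open_ball] using df dw by blast+
  have "deriv f 0 \<noteq> 0" using DERIV_imp_deriv[OF df[of 0]] r ab by (simp add: \<gamma>_def)
  hence f0: "0 \<in> ball (0::complex) r" "deriv f 0 \<noteq> 0" using r by auto
  obtain s where s: "s > 0" "ball (0::complex) s \<subseteq> ball (0::complex) r" "open (f ` ball (0::complex) s)" "inj_on f (ball (0::complex) s)"
    by (rule has_complex_derivative_locally_invertible[OF fhol f0(1) open_ball f0(2)])
  obtain g where g: "g holomorphic_on (f ` ball (0::complex) s)" "\<And>t. t \<in> ball (0::complex) s \<Longrightarrow> g (f t) = t"
    by (rule holomorphic_has_inverse[OF holomorphic_on_subset[OF fhol s(2)] open_ball s(4)]) blast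
  define h where "h = (\<lambda>q. w (\<gamma> (g q)))"
  have up: "u p = f 0" by (simp add: f_def \<gamma>_def)
  have "h holomorphic_on (f ` ball (0::complex) s)"
  proof -
    have "((\<lambda>t. w (\<gamma> t)) \<circ> g) holomorphic_on (f ` ball (0::complex) s)"
      by (rule holomorphic_on_compose_gen[OF g(1) whol]) (use g(2) s(2) in \<open>auto simp del: mem_ball\<close>)
    thus ?thesis by (simp add: h_def o_def)
  qed
  hence "h analytic_on (f ` ball (0::complex) s)" using s(3) by (simp add: analytic_on_open)
  hence "h analytic_on {u p}" by (rule analytic_on_subset) (use s(1) up in auto)
  moreover have "\<forall>\<^sub>F z in nhds p. w z = h (u z)"
  proof -
    have "\<forall>\<^sub>F z in nhds p. u z \<in> f ` ball (0::complex) s"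
      using holo2_at_isCont[OF u] s(1,3) up unfolding isCont_def tendsto_at_iff_tendsto_nhds
      by (intro topological_tendstoD) auto
    moreover have "\<forall>\<^sub>F z in nhds p. z \<in> U" using U by (intro eventually_nhds_in_open)
    ultimately show ?thesis
    proof eventually_elim
      case (elim z)
      then obtain t where t: "t \<in> ball (0::complex) s" "u z = f t" by blast
      have "\<gamma> t \<in> U" using t(1) s(2) r(2) by blast
      hence "w (\<gamma> t) = w z" using U3(3)[of z "\<gamma> t"] elim(2) t(2) by (simp add: U_def f_def)
      thus ?case by (simp add: h_def t(2) g(2)[OF t(1)])
    qed
  qed
  ultimately show ?thesis by (rule that)
qed

lemma factor_partials:
  assumes h: "h analytic_on {u p}" and ev: "\<forall>\<^sub>F z in nhds p. w z = h (u z)" and u: "holo2_at u p"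
  shows "dx w p = deriv h (u p) * dx u p" "dy w p = deriv h (u p) * dy u p"
proof -
  have "(h has_field_derivative deriv h (u p)) (at (u p))"
    using h analytic_on_imp_differentiable_at DERIV_deriv_iff_field_differentiable by blast
  hence "(h has_derivative (*) (deriv h (u p))) (at (u p))" by (simp add: has_field_derivative_def)
  from has_derivative_compose[OF holo2_at_has_derivative[OF u] this]
  have "((\<lambda>z. h (u z)) has_derivative (\<lambda>k. deriv h (u p) * dx u p * fst k + deriv h (u p) * dy u p * snd k)) (at p)"
    by (simp add: algebra_simps)
  note d = this
  have "(w has_derivative (\<lambda>k. deriv h (u p) * dx u p * fst k + deriv h (u p) * dy u p * snd k)) (at p)"
  proof (rule has_derivative_transform_eventually[OF d])
    have ev': "\<forall>\<^sub>F z in nhds p. h (u z) = w z" using ev by eventually_elim simp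
    show "\<forall>\<^sub>F z in at p. h (u z) = w z" using ev' by (simp add: eventually_nhds_conv_at)
    show "h (u p) = w p" using ev' by (rule eventually_nhds_x_imp_x)
  qed simp
  thus "dx w p = deriv h (u p) * dx u p" "dy w p = deriv h (u p) * dy u p"
    by (auto dest: has_derivative_imp_dx_dy)
qed

lemma same_foliationI:
  assumes "isCont lf p" "open K" "lf p \<in> K" "inj_on k1 K" "inj_on k2 K"
    and "\<forall>\<^sub>F z in nhds p. u z = k1 (lf z)" "\<forall>\<^sub>F z in nhds p. v z = k2 (lf z)"
  shows "same_foliation_at p u v"
proof -
  have "\<forall>\<^sub>F z in nhds p. lf z \<in> K"
    using assms(1-3) unfolding isCont_def tendsto_at_iff_tendsto_nhds by (intro topological_tendstoD)
  hence "\<forall>\<^sub>F z in nhds p. lf z \<in> K \<and> u z = k1 (lf z) \<and> v z = k2 (lf z)"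
    using assms(6,7) by eventually_elim auto
  then obtain U where U: "open U" "p \<in> U" "\<And>z. z \<in> U \<Longrightarrow> lf z \<in> K \<and> u z = k1 (lf z) \<and> v z = k2 (lf z)"
    unfolding eventually_nhds by blast
  have "u w = u z \<longleftrightarrow> v w = v z" if "z \<in> U" "w \<in> U" for z w
    using U(3)[OF that(1)] U(3)[OF that(2)] assms(4,5) by (auto dest: inj_onD)
  thus ?thesis unfolding same_foliation_iff using U(1,2) by blast
qed

section \<open>The functions \<open>u\<^sub>\<tau>\<close> and their regular points\<close>

definition ff :: "complex \<Rightarrow> complex \<Rightarrow> complex" where "ff \<tau> x = t1 \<tau> x / t4 \<tau> x"

lemma u_theta_eq: "u_theta \<tau> (x, y) = ff \<tau> x * ff \<tau> y"
  by (simp add: u_theta_def ff_def t1_def t4_def)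

lemma u_theta_eq': "u_theta \<tau> = (\<lambda>(x, y). ff \<tau> x * ff \<tau> y)"
  by (auto simp: u_theta_eq)

lemma ff_has_derivative:
  assumes "Im \<tau> > 0" "t4 \<tau> x \<noteq> 0"
  shows "(ff \<tau> has_field_derivative Dnum \<tau> x / (t4 \<tau> x)\<^sup>2) (at x)"
  using DERIV_divide[OF theta_entire(1,2)[OF assms(1), THEN entire_field_derivative] assms(2)]
  unfolding ff_def[abs_def] Dnum_def LDnum_def power2_eq_square by simp

lemma deriv_ff_eq: "t1 \<tau> x \<noteq> 0 \<Longrightarrow> t4 \<tau> x \<noteq> 0 \<Longrightarrow> Dnum \<tau> x / (t4 \<tau> x)\<^sup>2 = D \<tau> x * ff \<tau> x"
  by (simp add: D_eq Dden_def ff_def power2_eq_square)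

lemma t4_eventually_nonzero:
  assumes "Im \<tau> > 0" "t4 \<tau> x \<noteq> 0"
  shows "\<forall>\<^sub>F x in nhds x. t4 \<tau> x \<noteq> 0"
proof -
  have "isCont (t4 \<tau>) x" using entire_field_derivative[OF theta_entire(2)[OF assms(1)]] DERIV_isCont by blast
  thus ?thesis using assms(2) unfolding isCont_def tendsto_at_iff_tendsto_nhds
    by (auto dest: tendsto_imp_eventually_ne)
qed

lemma eventually_nhds_prodI:
  assumes "\<forall>\<^sub>F x in nhds a. P x" "\<forall>\<^sub>F y in nhds b. Q y"
  shows "\<forall>\<^sub>F z in nhds (a, b). P (fst z) \<and> Q (snd z)"
  unfolding nhds_prod eventually_prod_filter using assms by auto

lemma u_theta_has_derivative:
  assumes "Im \<tau> > 0" "t4 \<tau> x \<noteq> 0" "t4 \<tau> y \<noteq> 0"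
  shows "(u_theta \<tau> has_derivative (\<lambda>h. Dnum \<tau> x / (t4 \<tau> x)\<^sup>2 * ff \<tau> y * fst h + ff \<tau> x * (Dnum \<tau> y / (t4 \<tau> y)\<^sup>2) * snd h)) (at (x, y))"
  unfolding u_theta_eq'
  using product_has_derivative[of "ff \<tau>" "Dnum \<tau> x / (t4 \<tau> x)\<^sup>2" "(x, y)" "ff \<tau>" "Dnum \<tau> y / (t4 \<tau> y)\<^sup>2"]
    ff_has_derivative[OF assms(1,2)] ff_has_derivative[OF assms(1,3)] by (simp only: fst_conv snd_conv)

lemma u_theta_partials:
  assumes "Im \<tau> > 0" "t4 \<tau> x \<noteq> 0" "t4 \<tau> y \<noteq> 0"
  shows "dx (u_theta \<tau>) (x, y) = Dnum \<tau> x / (t4 \<tau> x)\<^sup>2 * ff \<tau> y" "dy (u_theta \<tau>) (x, y) = ff \<tau> x * (Dnum \<tau> y / (t4 \<tau> y)\<^sup>2)"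
  using has_derivative_imp_dx_dy[OF u_theta_has_derivative[OF assms]] by auto

lemma u_theta_holo2:
  assumes "Im \<tau> > 0" "t4 \<tau> x \<noteq> 0" "t4 \<tau> y \<noteq> 0"
  shows "holo2_at (u_theta \<tau>) (x, y)"
proof (rule holo2_atI)
  from eventually_nhds_prodI[OF t4_eventually_nonzero[OF assms(1,2)] t4_eventually_nonzero[OF assms(1,3)]]
  show "\<forall>\<^sub>F z in nhds (x, y). \<exists>a b. (u_theta \<tau> has_derivative (\<lambda>h. a * fst h + b * snd h)) (at z)"
  proof eventually_elim
    case (elim z)
    from u_theta_has_derivative[OF assms(1), of "fst z" "snd z"] elim show ?case unfolding prod.collapse by blast
  qed
qed

lemma holo2_at_swap:
  assumes "holo2_at u (x, y)"
  shows "holo2_at (u \<circ> prod.swap) (y, x)"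
proof -
  have "holo2_at (fst \<circ> prod.swap) (y, x)" "holo2_at (snd \<circ> prod.swap) (y, x)"
    using linear_holo2(1)[of 0 1 0] linear_holo2(1)[of 1 0 0] by (simp_all add: prod.swap_def o_def case_prod_unfold)
  thus ?thesis using holo2_compose(1)[of u prod.swap "(y, x)"] assms by simp
qed

lemma u_theta_swap: "u_theta \<tau> \<circ> prod.swap = u_theta \<tau>"
  by (auto simp: fun_eq_iff u_theta_eq)

text \<open>On the polar set the value of \<open>u_theta\<close> is 0 by convention, so the
  obstruction must come from nearby points: continuity in x would force the limit of
  \<open>u_theta\<close> times \<open>t4\<close> to be 0, although this product equals
  \<open>t1\<close> x times a non-zero constant.\<close>

lemma u_theta_pole:
  assumes tau: "Im \<tau> > 0" and hol: "holo2_at (u_theta \<tau>) (x0, y0)"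
  shows "t4 \<tau> x0 \<noteq> 0"
proof
  assume z: "t4 \<tau> x0 = 0"
  obtain U where U: "open U" "(x0, y0) \<in> U" "holo2_on (u_theta \<tau>) U" using hol by (rule holo2_atE)
  obtain A B where AB: "open A" "open B" "x0 \<in> A" "y0 \<in> B" "A \<times> B \<subseteq> U"
    using U(1,2) by (rule open_prod_elim) auto
  obtain a b where ab: "t1 \<tau> a \<noteq> 0" "t4 \<tau> b \<noteq> 0" using t1_not_identically_0 t4_not_identically_0 tau by blast
  \<comment> \<open>At y0 itself the second factor may be 0 or have a pole; a nearby y1 avoids
    both.\<close>
  have "\<forall>\<^sub>F y in at y0. y \<in> B \<and> t1 \<tau> y \<noteq> 0 \<and> t4 \<tau> y \<noteq> 0"
    using entire_eventually_nonzero[OF theta_entire(1)[OF tau] ab(1), of y0] entire_eventually_nonzero[OF theta_entire(2)[OF tau] ab(2), of y0]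
      eventually_at_in_open'[OF AB(2,4)] by eventually_elim simp
  then obtain y1 where y1: "y1 \<in> B" "t1 \<tau> y1 \<noteq> 0" "t4 \<tau> y1 \<noteq> 0"
    using eventually_happens[of _ "at y0"] by auto
  have t1x0: "t1 \<tau> x0 \<noteq> 0" using t1_t4_no_common_zero[OF tau] z by blast
  have "(x0, y1) \<in> U" using AB y1 by auto
  from has_derivative_dx[OF holo2_onD[OF U(3) this]] have "isCont (\<lambda>x. u_theta \<tau> (x, y1)) x0"
    by (rule DERIV_isCont)
  hence l1: "(\<lambda>x. u_theta \<tau> (x, y1)) \<midarrow>x0\<rightarrow> u_theta \<tau> (x0, y1)" by (simp add: isCont_def)
  have l2: "t4 \<tau> \<midarrow>x0\<rightarrow> t4 \<tau> x0" "t1 \<tau> \<midarrow>x0\<rightarrow> t1 \<tau> x0"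
    using entire_field_derivative[OF theta_entire(1)[OF tau]] entire_field_derivative[OF theta_entire(2)[OF tau]] DERIV_isCont
    unfolding isCont_def[symmetric] by blast+
  have "(\<lambda>x. u_theta \<tau> (x, y1) * t4 \<tau> x) \<midarrow>x0\<rightarrow> u_theta \<tau> (x0, y1) * t4 \<tau> x0" by (intro tendsto_mult l1 l2)
  moreover have "\<forall>\<^sub>F x in at x0. u_theta \<tau> (x, y1) * t4 \<tau> x = t1 \<tau> x * ff \<tau> y1"
    using entire_eventually_nonzero[OF theta_entire(2)[OF tau] ab(2), of x0]
    by eventually_elim (simp add: u_theta_eq ff_def)
  ultimately have "(\<lambda>x. t1 \<tau> x * ff \<tau> y1) \<midarrow>x0\<rightarrow> 0"
    using z by (simp add: tendsto_cong)
  moreover have "(\<lambda>x. t1 \<tau> x * ff \<tau> y1) \<midarrow>x0\<rightarrow> t1 \<tau> x0 * ff \<tau> y1" by (intro tendsto_mult l2 tendsto_const)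
  ultimately have "t1 \<tau> x0 * ff \<tau> y1 = 0" using tendsto_unique[OF at_neq_bot] by blast
  thus False using t1x0 y1 by (simp add: ff_def)
qed

lemma u_theta_holo2_iff:
  assumes tau: "Im \<tau> > 0"
  shows "holo2_at (u_theta \<tau>) (x, y) \<longleftrightarrow> t4 \<tau> x \<noteq> 0 \<and> t4 \<tau> y \<noteq> 0"
  using u_theta_pole[OF tau, of x y] u_theta_pole[OF tau, of y x] holo2_at_swap[of "u_theta \<tau>" x y]
    u_theta_holo2[OF tau, of x y] by (auto simp: u_theta_swap)

text \<open>Where u is finite and non-zero, its partial derivatives are \<open>D \<tau> x\<close>
  and \<open>D \<tau> y\<close> times u. At a zero of one factor of u a partial derivative vanishes,
  which (T) forbids.\<close>

theorem regular_at_iff: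
  assumes tau: "Im \<tau> > 0"
  shows "regular_at (u_theta \<tau>) (x, y) \<longleftrightarrow>
    Dden \<tau> x \<noteq> 0 \<and> Dden \<tau> y \<noteq> 0 \<and> D \<tau> x \<noteq> 0 \<and> D \<tau> y \<noteq> 0 \<and> (D \<tau> x)\<^sup>2 \<noteq> (D \<tau> y)\<^sup>2"
proof (cases "t4 \<tau> x \<noteq> 0 \<and> t4 \<tau> y \<noteq> 0 \<and> t1 \<tau> x \<noteq> 0 \<and> t1 \<tau> y \<noteq> 0")
  case True
  have nz: "ff \<tau> x * ff \<tau> y \<noteq> 0" using True by (simp add: ff_def)
  have d: "dx (u_theta \<tau>) (x, y) = D \<tau> x * (ff \<tau> x * ff \<tau> y)" "dy (u_theta \<tau>) (x, y) = D \<tau> y * (ff \<tau> x * ff \<tau> y)"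
    using u_theta_partials[OF tau, of x y] True deriv_ff_eq[of \<tau> x] deriv_ff_eq[of \<tau> y] by (simp_all add: mult_ac)
  have "(dx (u_theta \<tau>) (x, y))\<^sup>2 - (dy (u_theta \<tau>) (x, y))\<^sup>2 = ((D \<tau> x)\<^sup>2 - (D \<tau> y)\<^sup>2) * (ff \<tau> x * ff \<tau> y)\<^sup>2"
    by (simp add: d algebra_simps power_mult_distrib)
  thus ?thesis unfolding regular_at_def u_theta_holo2_iff[OF tau] cond_T_def Dden_def using True nz d by simp
next
  case False
  have "\<not> regular_at (u_theta \<tau>) (x, y)"
  proof
    assume r: "regular_at (u_theta \<tau>) (x, y)"
    hence t4: "t4 \<tau> x \<noteq> 0" "t4 \<tau> y \<noteq> 0" using u_theta_holo2_iff[OF tau] by (auto simp: regular_at_def)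
    have "ff \<tau> x \<noteq> 0 \<and> ff \<tau> y \<noteq> 0"
      using r u_theta_partials[OF tau t4] by (auto simp: regular_at_def cond_T_def)
    thus False using False t4 by (auto simp: ff_def)
  qed
  thus ?thesis using False by (auto simp: Dden_def)
qed


section \<open>Webs with straight leaves\<close>

lemma local_diffeoD:
  assumes "local_diffeo_at \<psi> p"
  shows "holo2_at (fst \<circ> \<psi>) p" "holo2_at (snd \<circ> \<psi>) p" "isCont \<psi> p" "\<forall>\<^sub>F q in nhds p. local_diffeo_at \<psi> q"
    "dx (fst \<circ> \<psi>) p * dy (snd \<circ> \<psi>) p - dy (fst \<circ> \<psi>) p * dx (snd \<circ> \<psi>) p \<noteq> 0"
proof -
  obtain U V \<xi> where U: "open U" "open V" "p \<in> U" "\<psi> ` U = V" "\<And>z. z \<in> U \<Longrightarrow> \<xi> (\<psi> z) = z"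
    and h: "holo2_on (fst \<circ> \<psi>) U" "holo2_on (snd \<circ> \<psi>) U" "holo2_on (fst \<circ> \<xi>) V" "holo2_on (snd \<circ> \<xi>) V"
    using assms unfolding local_diffeo_at_def by blast
  show X: "holo2_at (fst \<circ> \<psi>) p" and Y: "holo2_at (snd \<circ> \<psi>) p" using U h unfolding holo2_at_def by blast+
  show "isCont \<psi> p"
    using continuous_Pair[OF holo2_at_isCont[OF X] holo2_at_isCont[OF Y]] by simp
  have "local_diffeo_at \<psi> q" if "q \<in> U" for q
    using U h that unfolding local_diffeo_at_def by blast
  moreover have "\<forall>\<^sub>F q in nhds p. q \<in> U" using U by (intro eventually_nhds_in_open)
  ultimately show "\<forall>\<^sub>F q in nhds p. local_diffeo_at \<psi> q" by (auto elim: eventually_mono)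
  show "dx (fst \<circ> \<psi>) p * dy (snd \<circ> \<psi>) p - dy (fst \<circ> \<psi>) p * dx (snd \<circ> \<psi>) p \<noteq> 0"
  proof -
    have psi: "\<psi> p \<in> V" using U by blast
    hence xi: "holo2_at (fst \<circ> \<xi>) (\<psi> p)" "holo2_at (snd \<circ> \<xi>) (\<psi> p)" using U h unfolding holo2_at_def by blast+
    have ev: "\<forall>\<^sub>F z in nhds p. \<xi> (\<psi> z) = z"
      using eventually_nhds_in_open[OF U(1,3)] U(5) by (auto elim: eventually_mono)
    have e1: "dx ((fst \<circ> \<xi>) \<circ> \<psi>) p = 1" "dy ((fst \<circ> \<xi>) \<circ> \<psi>) p = 0" "dx ((snd \<circ> \<xi>) \<circ> \<psi>) p = 0" "dy ((snd \<circ> \<xi>) \<circ> \<psi>) p = 1"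
    proof -
      have "\<forall>\<^sub>F z in at p. \<xi> (\<psi> z) = z" using ev unfolding eventually_nhds_conv_at by blast
      hence ev': "\<forall>\<^sub>F z in at p. fst z = ((fst \<circ> \<xi>) \<circ> \<psi>) z" "\<forall>\<^sub>F z in at p. snd z = ((snd \<circ> \<xi>) \<circ> \<psi>) z"
        by (eventually_elim; simp)+
      have d: "(fst has_derivative (\<lambda>h. 1 * fst h + 0 * snd h)) (at p)" "(snd has_derivative (\<lambda>h. 0 * fst h + 1 * snd h)) (at p)"
        by (auto intro!: derivative_eq_intros)
      have "(((fst \<circ> \<xi>) \<circ> \<psi>) has_derivative (\<lambda>h. 1 * fst h + 0 * snd h)) (at p)"
        by (rule has_derivative_transform_eventually[OF d(1)]) (use ev' U(3,5) in auto)
      moreover have "(((snd \<circ> \<xi>) \<circ> \<psi>) has_derivative (\<lambda>h. 0 * fst h + 1 * snd h)) (at p)"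
        by (rule has_derivative_transform_eventually[OF d(2)]) (use ev' U(3,5) in auto)
      ultimately show "dx ((fst \<circ> \<xi>) \<circ> \<psi>) p = 1" "dy ((fst \<circ> \<xi>) \<circ> \<psi>) p = 0" "dx ((snd \<circ> \<xi>) \<circ> \<psi>) p = 0" "dy ((snd \<circ> \<xi>) \<circ> \<psi>) p = 1"
        using has_derivative_imp_dx_dy by blast+
    qed
    define a b c d where "a = dx (fst \<circ> \<psi>) p" and "b = dy (fst \<circ> \<psi>) p" and "c = dx (snd \<circ> \<psi>) p" and "d = dy (snd \<circ> \<psi>) p"
    define a' b' c' d' where "a' = dx (fst \<circ> \<xi>) (\<psi> p)" and "b' = dy (fst \<circ> \<xi>) (\<psi> p)" and "c' = dx (snd \<circ> \<xi>) (\<psi> p)" and "d' = dy (snd \<circ> \<xi>) (\<psi> p)"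
    have "a' * a + b' * c = 1" "a' * b + b' * d = 0" "c' * a + d' * c = 0" "c' * b + d' * d = 1"
      using e1 holo2_compose(2,3)[OF xi(1) X Y] holo2_compose(2,3)[OF xi(2) X Y]
      by (simp_all add: a_def b_def c_def d_def a'_def b'_def c'_def d'_def)
    moreover have "(a' * d' - b' * c') * (a * d - b * c) = (a' * a + b' * c) * (c' * b + d' * d) - (a' * b + b' * d) * (c' * a + d' * c)"
      by (simp add: algebra_simps)
    ultimately have "(a' * d' - b' * c') * (a * d - b * c) = 1" by simp
    thus ?thesis by (auto simp: a_def b_def c_def d_def)
  qed
qed

text \<open>Level curves of u in W go into affine lines under \<psi>. This is the consequence of
  algebraizability from which the contradiction is derived.\<close>

definition straight_leaves :: "C2 set \<Rightarrow> (C2 \<Rightarrow> C2) \<Rightarrow> (C2 \<Rightarrow> complex) \<Rightarrow> bool" where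
  "straight_leaves W \<psi> u \<longleftrightarrow> (\<forall>z\<in>W. \<exists>\<alpha> \<beta> c. (\<alpha> \<noteq> 0 \<or> \<beta> \<noteq> 0) \<and>
     (\<forall>w\<in>W. u w = u z \<longrightarrow> \<alpha> * fst (\<psi> w) + \<beta> * snd (\<psi> w) + c = 0))"

lemma incidence_chart:
  assumes "\<kappa> \<in> affine_charts" "v \<noteq> 0"
  shows "\<exists>\<alpha> \<beta> c. (\<alpha> \<noteq> 0 \<or> \<beta> \<noteq> 0 \<or> c \<noteq> 0) \<and> (\<forall>w. incidence v (\<kappa> w) = \<alpha> * fst w + \<beta> * snd w + c)"
proof -
  have v: "v $ 1 \<noteq> 0 \<or> v $ 2 \<noteq> 0 \<or> v $ 3 \<noteq> 0"
    using assms(2) by (auto simp: vec_eq_iff forall_3)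
  from assms(1) consider "\<kappa> = (\<lambda>(x, y). vector [x, y, 1])" | "\<kappa> = (\<lambda>(x, y). vector [x, 1, y])" | "\<kappa> = (\<lambda>(x, y). vector [1, x, y])"
    unfolding affine_charts_def by blast
  thus ?thesis
  proof cases
    case 1
    show ?thesis
      by (rule exI[of _ "v $ 1"], rule exI[of _ "v $ 2"], rule exI[of _ "v $ 3"])
        (use v in \<open>auto simp: 1 incidence_def sum_3 vector_3\<close>)
  next
    case 2
    show ?thesis
      by (rule exI[of _ "v $ 1"], rule exI[of _ "v $ 3"], rule exI[of _ "v $ 2"])
        (use v in \<open>auto simp: 2 incidence_def sum_3 vector_3\<close>)
  next
    case 3
    show ?thesis
      by (rule exI[of _ "v $ 2"], rule exI[of _ "v $ 3"], rule exI[of _ "v $ 1"])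
        (use v in \<open>auto simp: 3 incidence_def sum_3 vector_3\<close>)
  qed
qed

lemma algebraizable_imp_straight_leaves:
  assumes "algebraizable_at us p"
  obtains \<psi> W where "open W" "p \<in> W" "\<And>q. q \<in> W \<Longrightarrow> local_diffeo_at \<psi> q"
    "\<And>j. j < length us \<Longrightarrow> straight_leaves W \<psi> (us ! j)"
proof -
  obtain vs q \<psi> where alg: "algebraic_web_at vs q" and psi: "\<psi> p = q" "maps_web_at \<psi> p us vs"
    using assms unfolding algebraizable_at_def equivalent_webs_def by blast
  obtain \<sigma> where diff: "local_diffeo_at \<psi> p" and len: "length us = length vs"
    and \<sigma>: "bij_betw \<sigma> {..<length us} {..<length us}"
    "\<And>j. j < length us \<Longrightarrow> same_foliation_at p (us ! j) (vs ! \<sigma> j \<circ> \<psi>)"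
    using psi(2) unfolding maps_web_at_def by blast
  obtain F \<kappa> Ua L where \<kappa>: "\<kappa> \<in> affine_charts" and Ua: "open Ua" "q \<in> Ua"
    and L': "\<forall>z\<in>Ua. bij_betw (\<lambda>j. proj (L j z)) {..<length vs} (dual_line_meets F (\<kappa> z)) \<and>
      (\<forall>j<length vs. L j z \<noteq> 0 \<and> {w \<in> Ua. (vs ! j) w = (vs ! j) z} = {w \<in> Ua. incidence (L j z) (\<kappa> w) = 0})"
    using alg unfolding algebraic_web_at_def by (elim conjE exE bexE)
  have L: "L j z \<noteq> 0 \<and> {w \<in> Ua. (vs ! j) w = (vs ! j) z} = {w \<in> Ua. incidence (L j z) (\<kappa> w) = 0}"
    if "z \<in> Ua" "j < length vs" for z j
    using L' that by blast
  have "\<forall>j\<in>{..<length us}. \<exists>U. open U \<and> p \<in> U \<and> (\<forall>z\<in>U. \<forall>w\<in>U. (us ! j) w = (us ! j) z \<longleftrightarrow> (vs ! \<sigma> j \<circ> \<psi>) w = (vs ! \<sigma> j \<circ> \<psi>) z)"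
    using \<sigma>(2) unfolding same_foliation_iff by blast
  then obtain Uf where Uf: "\<forall>j\<in>{..<length us}. open (Uf j) \<and> p \<in> Uf j \<and> (\<forall>z\<in>Uf j. \<forall>w\<in>Uf j. (us ! j) w = (us ! j) z \<longleftrightarrow> (vs ! \<sigma> j \<circ> \<psi>) w = (vs ! \<sigma> j \<circ> \<psi>) z)"
    by (rule bchoice[THEN exE])
  have "\<forall>\<^sub>F z in nhds p. \<psi> z \<in> Ua"
    using local_diffeoD(3)[OF diff] Ua psi(1) unfolding isCont_def tendsto_at_iff_tendsto_nhds
    by (intro topological_tendstoD) auto
  moreover have "\<forall>\<^sub>F z in nhds p. \<forall>j\<in>{..<length us}. z \<in> Uf j"
    by (rule eventually_ball_finite) (use Uf in \<open>auto intro!: eventually_nhds_in_open\<close>)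
  moreover note local_diffeoD(4)[OF diff]
  ultimately have "\<forall>\<^sub>F z in nhds p. \<psi> z \<in> Ua \<and> (\<forall>j\<in>{..<length us}. z \<in> Uf j) \<and> local_diffeo_at \<psi> z"
    by eventually_elim blast
  then obtain W where W: "open W" "p \<in> W" "\<And>z. z \<in> W \<Longrightarrow> \<psi> z \<in> Ua \<and> (\<forall>j\<in>{..<length us}. z \<in> Uf j) \<and> local_diffeo_at \<psi> z"
    unfolding eventually_nhds by blast
  show ?thesis
  proof (rule that[OF W(1,2)])
    show "local_diffeo_at \<psi> q" if "q \<in> W" for q using W that by blast
    fix j assume j: "j < length us"
    have sj: "\<sigma> j < length vs" using \<sigma>(1) j len by (auto dest: bij_betwE)
    show "straight_leaves W \<psi> (us ! j)"
      unfolding straight_leaves_def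
    proof
      fix z assume z: "z \<in> W"
      have zU: "\<psi> z \<in> Ua" using W z by blast
      obtain \<alpha> \<beta> c where abc: "\<alpha> \<noteq> 0 \<or> \<beta> \<noteq> 0 \<or> c \<noteq> 0" "\<And>w. incidence (L (\<sigma> j) (\<psi> z)) (\<kappa> w) = \<alpha> * fst w + \<beta> * snd w + c"
        using incidence_chart[OF \<kappa>] L[OF zU sj] by blast
      have line: "\<alpha> * fst (\<psi> w) + \<beta> * snd (\<psi> w) + c = 0" if w: "w \<in> W" "(us ! j) w = (us ! j) z" for w
      proof -
        have "(vs ! \<sigma> j) (\<psi> w) = (vs ! \<sigma> j) (\<psi> z)"
          using Uf W(3)[OF z] W(3)[OF w(1)] j w(2) by auto
        hence "\<psi> w \<in> {w \<in> Ua. (vs ! \<sigma> j) w = (vs ! \<sigma> j) (\<psi> z)}" using W(3)[OF w(1)] by blast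
        hence "incidence (L (\<sigma> j) (\<psi> z)) (\<kappa> (\<psi> w)) = 0" using L[OF zU sj] by blast
        thus ?thesis by (simp add: abc(2))
      qed
      \<comment> \<open>With both coefficients 0 the line would be the one at infinity of the chart,
        but it passes through the point \<psi> z of the chart.\<close>
      have "\<alpha> \<noteq> 0 \<or> \<beta> \<noteq> 0"
        using line[OF z refl] abc(1) by auto
      thus "\<exists>\<alpha> \<beta> c. (\<alpha> \<noteq> 0 \<or> \<beta> \<noteq> 0) \<and> (\<forall>w\<in>W. (us ! j) w = (us ! j) z \<longrightarrow> \<alpha> * fst (\<psi> w) + \<beta> * snd (\<psi> w) + c = 0)"
        using line by blast
    qed
  qed
qed

lemma second_derivative_along_curve:
  fixes X :: "C2 \<Rightarrow> complex"
  assumes X: "holo2_at X (a 0, b 0)"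
    and a: "\<forall>\<^sub>F t in nhds 0. (a has_field_derivative a' t) (at t)" "(a' has_field_derivative a2) (at 0)"
    and b: "\<forall>\<^sub>F t in nhds 0. (b has_field_derivative b' t) (at t)" "(b' has_field_derivative b2) (at 0)"
  shows "\<forall>\<^sub>F t in nhds 0. ((\<lambda>t. X (a t, b t)) has_field_derivative (dx X (a t, b t) * a' t + dy X (a t, b t) * b' t)) (at t)"
    "((\<lambda>t. dx X (a t, b t) * a' t + dy X (a t, b t) * b' t) has_field_derivative
      (dx (dx X) (a 0, b 0) * (a' 0)\<^sup>2 + 2 * dy (dx X) (a 0, b 0) * a' 0 * b' 0 + dy (dy X) (a 0, b 0) * (b' 0)\<^sup>2
        + dx X (a 0, b 0) * a2 + dy X (a 0, b 0) * b2)) (at 0)"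
proof -
  have a0: "(a has_field_derivative a' 0) (at 0)" and b0: "(b has_field_derivative b' 0) (at 0)"
    using a(1) b(1) by (auto dest: eventually_nhds_x_imp_x)
  have "isCont (\<lambda>t. (a t, b t)) 0" by (intro continuous_Pair DERIV_isCont[OF a0] DERIV_isCont[OF b0])
  hence "\<forall>\<^sub>F t in nhds 0. holo2_at X (a t, b t)"
    by (rule isCont_eventually[where f = "\<lambda>t. (a t, b t)" and c = "(a 0, b 0)"]) (use holo2_at_eventually[OF X] in simp_all)
  with a(1) b(1) show "\<forall>\<^sub>F t in nhds 0. ((\<lambda>t. X (a t, b t)) has_field_derivative (dx X (a t, b t) * a' t + dy X (a t, b t) * b' t)) (at t)"
    by eventually_elim (rule has_derivative_chain2[OF holo2_at_has_derivative])
  note p = holo2_at_partials[OF X]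
  have "((\<lambda>t. dx X (a t, b t)) has_field_derivative (dx (dx X) (a 0, b 0) * a' 0 + dy (dx X) (a 0, b 0) * b' 0)) (at 0)"
    "((\<lambda>t. dy X (a t, b t)) has_field_derivative (dx (dy X) (a 0, b 0) * a' 0 + dy (dy X) (a 0, b 0) * b' 0)) (at 0)"
    by (rule has_derivative_chain2[OF holo2_at_has_derivative]; fact p a0 b0)+
  from DERIV_add[OF DERIV_mult[OF this(1) a(2)] DERIV_mult[OF this(2) b(2)]]
  show "((\<lambda>t. dx X (a t, b t) * a' t + dy X (a t, b t) * b' t) has_field_derivative
      (dx (dx X) (a 0, b 0) * (a' 0)\<^sup>2 + 2 * dy (dx X) (a 0, b 0) * a' 0 * b' 0 + dy (dy X) (a 0, b 0) * (b' 0)\<^sup>2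
        + dx X (a 0, b 0) * a2 + dy X (a 0, b 0) * b2)) (at 0)"
    by (rule DERIV_cong) (simp add: p(3) algebra_simps power2_eq_square)
qed

text \<open>Differentiating the equation of the line once and twice shows that velocity and
  acceleration of the image curve are both annihilated by (\<alpha>, \<beta>), so they are linearly
  dependent.\<close>

lemma straight_image_determinant:
  assumes X: "holo2_at X (a 0, b 0)" and Y: "holo2_at Y (a 0, b 0)"
    and a: "\<forall>\<^sub>F t in nhds 0. (a has_field_derivative a' t) (at t)" "(a' has_field_derivative a2) (at 0)"
    and b: "\<forall>\<^sub>F t in nhds 0. (b has_field_derivative b' t) (at t)" "(b' has_field_derivative b2) (at 0)"
    and line: "\<forall>\<^sub>F t in nhds 0. \<alpha> * X (a t, b t) + \<beta> * Y (a t, b t) + c = 0" "\<alpha> \<noteq> 0 \<or> \<beta> \<noteq> 0"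
  defines "V1 \<equiv> \<lambda>Z. dx Z (a 0, b 0) * a' 0 + dy Z (a 0, b 0) * b' 0"
  defines "V2 \<equiv> \<lambda>Z. dx (dx Z) (a 0, b 0) * (a' 0)\<^sup>2 + 2 * dy (dx Z) (a 0, b 0) * a' 0 * b' 0 + dy (dy Z) (a 0, b 0) * (b' 0)\<^sup>2
        + dx Z (a 0, b 0) * a2 + dy Z (a 0, b 0) * b2"
  shows "V1 X * V2 Y - V1 Y * V2 X = 0"
proof -
  define X1 where "X1 = (\<lambda>t. dx X (a t, b t) * a' t + dy X (a t, b t) * b' t)"
  define Y1 where "Y1 = (\<lambda>t. dx Y (a t, b t) * a' t + dy Y (a t, b t) * b' t)"
  note sX = second_derivative_along_curve[OF X a b, folded X1_def] and sY = second_derivative_along_curve[OF Y a b, folded Y1_def]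
  have 1: "\<forall>\<^sub>F t in nhds 0. \<alpha> * X1 t + \<beta> * Y1 t = 0"
    using sX(1) sY(1) iffD2[OF eventually_eventually line(1)]
  proof eventually_elim
    case (elim t)
    have "((\<lambda>t. \<alpha> * X (a t, b t) + \<beta> * Y (a t, b t) + c) has_field_derivative \<alpha> * X1 t + \<beta> * Y1 t) (at t)"
      using elim(1,2) by (auto intro!: derivative_eq_intros simp: X1_def Y1_def)
    moreover have "((\<lambda>t. \<alpha> * X (a t, b t) + \<beta> * Y (a t, b t) + c) has_field_derivative 0) (at t)"
      using DERIV_cong_ev[OF refl elim(3) refl, of 0] by simp
    ultimately show ?case by (rule DERIV_unique)
  qed
  have "((\<lambda>t. \<alpha> * X1 t + \<beta> * Y1 t) has_field_derivative \<alpha> * V2 X + \<beta> * V2 Y) (at 0)"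
    using sX(2) sY(2) by (auto intro!: derivative_eq_intros simp: V2_def)
  moreover have "((\<lambda>t. \<alpha> * X1 t + \<beta> * Y1 t) has_field_derivative 0) (at 0)"
    using DERIV_cong_ev[OF refl 1 refl, of 0] by simp
  ultimately have 2: "\<alpha> * V2 X + \<beta> * V2 Y = 0" by (rule DERIV_unique)
  have 3: "\<alpha> * V1 X + \<beta> * V1 Y = 0" using eventually_nhds_x_imp_x[OF 1] by (simp add: V1_def X1_def Y1_def)
  have "\<alpha> * (V1 X * V2 Y - V1 Y * V2 X) = (\<alpha> * V1 X + \<beta> * V1 Y) * V2 Y - (\<alpha> * V2 X + \<beta> * V2 Y) * V1 Y"
    "\<beta> * (V1 X * V2 Y - V1 Y * V2 X) = (\<alpha> * V2 X + \<beta> * V2 Y) * V1 X - (\<alpha> * V1 X + \<beta> * V1 Y) * V2 X"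
    by (simp_all add: algebra_simps)
  thus ?thesis using line(2) 2 3 by auto
qed

text \<open>The image of a curve of slope \<open>m\<close> and curvature \<open>n\<close> is straight only if \<open>n\<close> times the Jacobian equals a cubic
  polynomial in \<open>m\<close> that depends on the map alone; the four pencils of \<open>\<T>\<^sub>0\<close> give four roots of this cubic (one at infinity).\<close>

lemma cubic_with_four_roots:
  fixes X1 X2 X11 X12 X22 Y1 Y2 Y11 Y12 Y22 m n :: complex
  assumes J: "X1 * Y2 - X2 * Y1 \<noteq> 0"
    and "X1 * Y11 - Y1 * X11 = 0" "X2 * Y22 - Y2 * X22 = 0"
    and p: "(X1 + X2) * (Y11 + 2 * Y12 + Y22) - (Y1 + Y2) * (X11 + 2 * X12 + X22) = 0"
    and q: "(X1 - X2) * (Y11 - 2 * Y12 + Y22) - (Y1 - Y2) * (X11 - 2 * X12 + X22) = 0"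
    and c: "(X1 + X2 * m) * (Y11 + 2 * Y12 * m + Y22 * m\<^sup>2 + Y2 * n) - (Y1 + Y2 * m) * (X11 + 2 * X12 * m + X22 * m\<^sup>2 + X2 * n) = 0"
  shows "n = 0"
proof -
  \<comment> \<open>The two middle coefficients of the cubic in m. The slopes 0 and infinity kill
    the outer coefficients, and the slopes 1 and -1 then give c1 + c2 = 0 and c2 - c1 = 0.\<close>
  define c1 where "c1 = 2 * (X1 * Y12 - Y1 * X12) + (X2 * Y11 - Y2 * X11)"
  define c2 where "c2 = (X1 * Y22 - Y1 * X22) + 2 * (X2 * Y12 - Y2 * X12)"
  have "c1 + c2 = (X1 + X2) * (Y11 + 2 * Y12 + Y22) - (Y1 + Y2) * (X11 + 2 * X12 + X22) - (X1 * Y11 - Y1 * X11) - (X2 * Y22 - Y2 * X22)"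
    by (simp add: c1_def c2_def algebra_simps)
  hence s: "c1 + c2 = 0" using assms by simp
  have "c2 - c1 = (X1 - X2) * (Y11 - 2 * Y12 + Y22) - (Y1 - Y2) * (X11 - 2 * X12 + X22) - (X1 * Y11 - Y1 * X11) + (X2 * Y22 - Y2 * X22)"
    by (simp add: c1_def c2_def algebra_simps)
  hence d: "c2 - c1 = 0" using assms by simp
  have "2 * c1 = (c1 + c2) - (c2 - c1)" "2 * c2 = (c1 + c2) + (c2 - c1)" by (simp_all add: algebra_simps)
  hence c12: "c1 = 0" "c2 = 0" unfolding s d by simp_all
  have "(X1 + X2 * m) * (Y11 + 2 * Y12 * m + Y22 * m\<^sup>2 + Y2 * n) - (Y1 + Y2 * m) * (X11 + 2 * X12 * m + X22 * m\<^sup>2 + X2 * n)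
    = (X1 * Y11 - Y1 * X11) + c1 * m + c2 * m\<^sup>2 + (X2 * Y22 - Y2 * X22) * m ^ 3 + n * (X1 * Y2 - X2 * Y1)"
    by (simp add: c1_def c2_def algebra_simps power2_eq_square power3_eq_cube)
  hence "n * (X1 * Y2 - X2 * Y1) = 0" using assms c12 by simp
  thus ?thesis using J by simp
qed

text \<open>The four leaves of \<open>T0\<close> through q are straight and have straight images, so
  the cubic vanishes identically at q. The straightness of the image of the level curve of u then
  leaves only the term with its second derivative, multiplied by the Jacobian of \<psi>.\<close>

lemma straight_T0_imp_straight:
  assumes W: "open W" "q \<in> W" and diff: "local_diffeo_at \<psi> q"
    and T0: "\<And>j. j < 4 \<Longrightarrow> straight_leaves W \<psi> (T0 ! j)" and u: "straight_leaves W \<psi> u"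
    and b: "b 0 = snd q" "\<forall>\<^sub>F t in nhds 0. (b has_field_derivative b' t) (at t)" "(b' has_field_derivative b2) (at 0)"
    and level: "\<forall>\<^sub>F t in nhds 0. u (fst q + t, b t) = u q"
  shows "b2 = 0"
proof -
  define X where "X = fst \<circ> \<psi>"
  define Y where "Y = snd \<circ> \<psi>"
  have XY: "holo2_at X q" "holo2_at Y q" using local_diffeoD(1,2)[OF diff] by (simp_all add: X_def Y_def)
  have J: "dx X q * dy Y q - dy X q * dx Y q \<noteq> 0" using local_diffeoD(5)[OF diff] by (simp add: X_def Y_def)
  define V1 where "V1 = (\<lambda>k l Z. dx Z q * k + dy Z q * l)"
  define V2 where "V2 = (\<lambda>k l m n Z. dx (dx Z) q * k\<^sup>2 + 2 * dy (dx Z) q * k * l + dy (dy Z) q * l\<^sup>2 + dx Z q * m + dy Z q * n)"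
  have curve: "V1 (a' 0) (c' 0) X * V2 (a' 0) (c' 0) Aa Cc Y - V1 (a' 0) (c' 0) Y * V2 (a' 0) (c' 0) Aa Cc X = 0"
    if st: "straight_leaves W \<psi> v" and a: "a 0 = fst q" "\<forall>\<^sub>F t in nhds 0. (a has_field_derivative a' t) (at t)" "(a' has_field_derivative Aa) (at 0)"
    and c: "c 0 = snd q" "\<forall>\<^sub>F t in nhds 0. (c has_field_derivative c' t) (at t)" "(c' has_field_derivative Cc) (at 0)"
    and lev: "\<forall>\<^sub>F t in nhds 0. v (a t, c t) = v q"
    for v a a' Aa c c' Cc
  proof -
    have q: "(a 0, c 0) = q" using a(1) c(1) by simp
    from bspec[OF st[unfolded straight_leaves_def] W(2)]
    obtain \<alpha> \<beta> e where l: "\<alpha> \<noteq> 0 \<or> \<beta> \<noteq> 0" "\<forall>w\<in>W. v w = v q \<longrightarrow> \<alpha> * fst (\<psi> w) + \<beta> * snd (\<psi> w) + e = 0"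
      by (elim exE conjE)
    have "isCont (\<lambda>t. (a t, c t)) 0"
      by (intro continuous_Pair DERIV_isCont[OF eventually_nhds_x_imp_x[OF a(2)]] DERIV_isCont[OF eventually_nhds_x_imp_x[OF c(2)]])
    hence "\<forall>\<^sub>F t in nhds 0. (a t, c t) \<in> W"
      by (rule isCont_eventually[where f = "\<lambda>t. (a t, c t)" and c = q]) (use W q in \<open>simp_all add: eventually_nhds_in_open\<close>)
    with lev have line: "\<forall>\<^sub>F t in nhds 0. \<alpha> * X (a t, c t) + \<beta> * Y (a t, c t) + e = 0"
      by eventually_elim (use l(2) in \<open>simp add: X_def Y_def\<close>)
    show ?thesis
      using straight_image_determinant[of X a c Y, unfolded q, OF XY a(2,3) c(2,3) line l(1)]
      unfolding V1_def V2_def .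
  qed
  have lin: "\<forall>\<^sub>F t in nhds 0. ((\<lambda>t. k + m * t) has_field_derivative m) (at t)" "((\<lambda>t :: complex. m) has_field_derivative 0) (at 0)" for k m :: complex
    by (auto intro!: derivative_eq_intros always_eventually)
  have l: "V1 m n X * V2 m n 0 0 Y - V1 m n Y * V2 m n 0 0 X = 0"
    if "j < 4" "\<And>t. (T0 ! j) (fst q + m * t, snd q + n * t) = (T0 ! j) q" for j m n
    by (rule curve[OF T0[OF that(1)], where a = "\<lambda>t. fst q + m * t" and c = "\<lambda>t. snd q + n * t" and a' = "\<lambda>_. m" and c' = "\<lambda>_. n" and Aa = 0 and Cc = 0])
      (use lin that(2) in \<open>auto intro!: always_eventually\<close>)
  \<comment> \<open>The velocities (0, 1), (1, 0), (1, -1) and (1, 1) belong to the leaves of x, y,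
    x + y and x - y, in this order, parametrised without acceleration.\<close>
  have l1: "V1 0 1 X * V2 0 1 0 0 Y - V1 0 1 Y * V2 0 1 0 0 X = 0" by (rule l[of 0]) (simp_all add: T0_def case_prod_unfold)
  have l2: "V1 1 0 X * V2 1 0 0 0 Y - V1 1 0 Y * V2 1 0 0 0 X = 0" by (rule l[of 1]) (simp_all add: T0_def case_prod_unfold)
  have l3: "V1 1 (-1) X * V2 1 (-1) 0 0 Y - V1 1 (-1) Y * V2 1 (-1) 0 0 X = 0" by (rule l[of 2]) (simp_all add: T0_def case_prod_unfold)
  have l4: "V1 1 1 X * V2 1 1 0 0 Y - V1 1 1 Y * V2 1 1 0 0 X = 0" by (rule l[of 3]) (simp_all add: T0_def case_prod_unfold)
  have l5: "V1 1 (b' 0) X * V2 1 (b' 0) 0 b2 Y - V1 1 (b' 0) Y * V2 1 (b' 0) 0 b2 X = 0"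
    by (rule curve[OF u, where a = "\<lambda>t. fst q + t" and a' = "\<lambda>_. 1" and Aa = 0 and c = b and c' = b' and Cc = b2])
      (use lin(1)[of "fst q" 1] lin(2)[of 1] b level in auto)
  show ?thesis
  proof (rule cubic_with_four_roots[of "dx X q" "dy Y q" "dy X q" "dx Y q" "dx (dx Y) q" "dx (dx X) q" "dy (dy Y) q" "dy (dy X) q" "dy (dx Y) q" "dy (dx X) q" "b' 0" b2])
    show "dx X q * dx (dx Y) q - dx Y q * dx (dx X) q = 0" using l2 by (simp add: V1_def V2_def)
    show "dy X q * dy (dy Y) q - dy Y q * dy (dy X) q = 0" using l1 by (simp add: V1_def V2_def)
    show "(dx X q + dy X q) * (dx (dx Y) q + 2 * dy (dx Y) q + dy (dy Y) q) - (dx Y q + dy Y q) * (dx (dx X) q + 2 * dy (dx X) q + dy (dy X) q) = 0"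
      using l4 by (simp add: V1_def V2_def)
    show "(dx X q - dy X q) * (dx (dx Y) q - 2 * dy (dx Y) q + dy (dy Y) q) - (dx Y q - dy Y q) * (dx (dx X) q - 2 * dy (dx X) q + dy (dy X) q) = 0"
      using l3 by (simp add: V1_def V2_def)
    show "(dx X q + dy X q * b' 0) * (dx (dx Y) q + 2 * dy (dx Y) q * b' 0 + dy (dy Y) q * (b' 0)\<^sup>2 + dy Y q * b2)
      - (dx Y q + dy Y q * b' 0) * (dx (dx X) q + 2 * dy (dx X) q * b' 0 + dy (dy X) q * (b' 0)\<^sup>2 + dy X q * b2) = 0"
      using l5 by (simp add: V1_def V2_def)
  qed (rule J)
qed


section \<open>The web \<open>\<T>[u\<^sub>\<tau>]\<close> is not algebraizable\<close>

lemma D_has_derivative: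
  assumes tau: "Im \<tau> > 0" and "Dden \<tau> x \<noteq> 0"
  shows "(D \<tau> has_field_derivative LDnum (Dnum \<tau>) (Dden \<tau>) x / (Dden \<tau> x)\<^sup>2) (at x)"
proof -
  have "D \<tau> = (\<lambda>x. Dnum \<tau> x / Dden \<tau> x)" by (simp add: fun_eq_iff D_eq)
  thus ?thesis
    using DERIV_divide[OF Dnum_entire[OF tau, THEN entire_field_derivative] Dden_entire[OF tau, THEN entire_field_derivative] assms(2)]
    unfolding LDnum_def power2_eq_square by simp
qed

lemma regular_at_eventually:
  assumes "regular_at u p"
  shows "\<forall>\<^sub>F z in nhds p. regular_at u z"
proof -
  have u: "holo2_at u p" and T: "cond_T u p" using assms by (auto simp: regular_at_def)
  have "isCont (\<lambda>p. dx u p * dy u p * ((dx u p)\<^sup>2 - (dy u p)\<^sup>2)) p"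
    by (intro continuous_intros holo2_at_isCont holo2_at_partials u)
  hence "\<forall>\<^sub>F z in nhds p. dx u z * dy u z * ((dx u z)\<^sup>2 - (dy u z)\<^sup>2) \<noteq> 0"
    by (rule isCont_eventually[OF _ refl]) (use T in \<open>simp add: cond_T_def t1_space_nhds\<close>)
  with holo2_at_eventually[OF u] show ?thesis
    by eventually_elim (simp add: regular_at_def cond_T_def)
qed

lemma Dden_nonzero_iff: "Dden \<tau> x \<noteq> 0 \<longleftrightarrow> t1 \<tau> x \<noteq> 0 \<and> t4 \<tau> x \<noteq> 0"
  by (simp add: Dden_def)

lemma ff_log_derivative:
  assumes "Im \<tau> > 0" "Dden \<tau> x \<noteq> 0"
  shows "(ff \<tau> has_field_derivative D \<tau> x * ff \<tau> x) (at x)"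
  using ff_has_derivative[of \<tau> x] deriv_ff_eq[of \<tau> x] assms by (simp add: Dden_nonzero_iff)

lemma entire_nonzero_nhds:
  assumes "F holomorphic_on UNIV" "F x \<noteq> (0 :: complex)"
  shows "\<forall>\<^sub>F x in nhds x. F x \<noteq> 0"
proof -
  have "isCont F x" using entire_field_derivative[OF assms(1)] DERIV_isCont by blast
  thus ?thesis using assms(2) unfolding isCont_def tendsto_at_iff_tendsto_nhds
    by (auto dest: tendsto_imp_eventually_ne)
qed

lemma D_nonzero_iff: "D \<tau> x \<noteq> 0 \<longleftrightarrow> Dnum \<tau> x \<noteq> 0 \<and> Dden \<tau> x \<noteq> 0"
  by (simp add: D_eq)

lemma D_nonzero_nhds:
  assumes tau: "Im \<tau> > 0" and "D \<tau> x \<noteq> 0"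
  shows "\<forall>\<^sub>F x in nhds x. D \<tau> x \<noteq> 0"
  using entire_nonzero_nhds[OF Dnum_entire[OF tau], of x] entire_nonzero_nhds[OF Dden_entire[OF tau], of x] assms(2)
  unfolding D_nonzero_iff by (simp add: eventually_conj)

lemma ff_local_inverse:
  assumes tau: "Im \<tau> > 0" and nz: "D \<tau> y \<noteq> 0"
  obtains s g where "s > 0" "open (ff \<tau> ` ball y s)" "g holomorphic_on (ff \<tau> ` ball y s)"
    "\<And>z. z \<in> ball y s \<Longrightarrow> g (ff \<tau> z) = z"
proof -
  have op: "open {y. Dden \<tau> y \<noteq> 0}"
    by (intro open_Collect_neq holomorphic_on_imp_continuous_on Dden_entire[OF tau] continuous_on_const)
  have hol: "ff \<tau> holomorphic_on {y. Dden \<tau> y \<noteq> 0}"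
    unfolding holomorphic_on_open[OF op] using ff_log_derivative[OF tau] by blast
  have y: "y \<in> {y. Dden \<tau> y \<noteq> 0}" using nz D_nonzero_iff by blast
  have "deriv (ff \<tau>) y = D \<tau> y * ff \<tau> y" using ff_log_derivative[OF tau, of y] y by (simp add: DERIV_imp_deriv)
  hence d: "deriv (ff \<tau>) y \<noteq> 0" using nz y by (simp add: ff_def Dden_def)
  obtain s where s: "s > 0" "ball y s \<subseteq> {y. Dden \<tau> y \<noteq> 0}" "open (ff \<tau> ` ball y s)" "inj_on (ff \<tau>) (ball y s)"
    by (rule has_complex_derivative_locally_invertible[OF hol y op d])
  obtain g where "g holomorphic_on (ff \<tau> ` ball y s)" "\<And>z. z \<in> ball y s \<Longrightarrow> g (ff \<tau> z) = z"
    by (rule holomorphic_has_inverse[OF holomorphic_on_subset[OF hol s(2)] open_ball s(4)]) blast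
  with s(1,3) show ?thesis by (rule that)
qed

text \<open>The local inverse of \<open>ff\<close> at y solves for b the equation saying that the
  product of \<open>ff\<close> at x + t and at b t is constant. The slope follows by differentiating
  this equation, as the derivative of \<open>ff\<close> is \<open>D\<close> times
  \<open>ff\<close>.\<close>

lemma level_curve_of_u_theta:
  assumes tau: "Im \<tau> > 0" and nz: "D \<tau> x \<noteq> 0" "D \<tau> y \<noteq> 0"
  obtains b where "b 0 = y" "\<forall>\<^sub>F t in nhds 0. (b has_field_derivative (- D \<tau> (x + t) / D \<tau> (b t))) (at t)"
    "\<forall>\<^sub>F t in nhds 0. u_theta \<tau> (x + t, b t) = u_theta \<tau> (x, y)"
proof -
  obtain s g where s: "s > 0" "open (ff \<tau> ` ball y s)" and g: "g holomorphic_on (ff \<tau> ` ball y s)"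
    "\<And>z. z \<in> ball y s \<Longrightarrow> g (ff \<tau> z) = z"
    using ff_local_inverse[OF tau nz(2)] by blast
  have dx: "Dden \<tau> x \<noteq> 0" and dy: "Dden \<tau> y \<noteq> 0" using nz D_nonzero_iff by blast+
  have fx: "ff \<tau> x \<noteq> 0" using dx by (simp add: ff_def Dden_def)
  define c where "c = ff \<tau> x * ff \<tau> y"
  define k where "k = (\<lambda>t. c / ff \<tau> (x + t))"
  define b where "b = (\<lambda>t. g (k t))"
  have k0: "k 0 = ff \<tau> y" using fx by (simp add: k_def c_def)
  have b0: "b 0 = y" using g(2)[of y] s(1) by (simp add: b_def k0)
  have shift: "\<forall>\<^sub>F t in nhds 0. P (x + t)" if "\<forall>\<^sub>F z in nhds x. P z" for P
  proof (rule eventually_compose_filterlim[OF that])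
    have "isCont (\<lambda>t. x + t) 0" by (intro continuous_intros)
    thus "filterlim (\<lambda>t. x + t) (nhds x) (nhds 0)" unfolding isCont_def tendsto_at_iff_tendsto_nhds by simp
  qed
  have ev_x: "\<forall>\<^sub>F t in nhds 0. Dden \<tau> (x + t) \<noteq> 0"
    by (rule shift[OF entire_nonzero_nhds[OF Dden_entire[OF tau] dx]])
  have kd: "(k has_field_derivative (- c * (D \<tau> (x + t) * ff \<tau> (x + t)) / (ff \<tau> (x + t))\<^sup>2)) (at t)" if "Dden \<tau> (x + t) \<noteq> 0" for t
  proof -
    have f: "((\<lambda>t. ff \<tau> (x + t)) has_field_derivative D \<tau> (x + t) * ff \<tau> (x + t)) (at t)"
      using ff_log_derivative[OF tau that] DERIV_shift[of "ff \<tau>" _ t x] by (simp add: add.commute)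
    have "ff \<tau> (x + t) \<noteq> 0" using that by (simp add: ff_def Dden_def)
    from DERIV_divide[OF DERIV_const[of c] f this] show ?thesis
      unfolding k_def by (rule DERIV_cong) (simp add: power2_eq_square)
  qed
  have kc: "isCont k 0" using kd[of 0] dx by (auto intro: DERIV_isCont)
  have ev_k: "\<forall>\<^sub>F t in nhds 0. k t \<in> ff \<tau> ` ball y s"
    using kc s unfolding isCont_def tendsto_at_iff_tendsto_nhds by (intro topological_tendstoD) (auto simp: k0)
  have bd: "\<exists>B. (b has_field_derivative B) (at t)" if "Dden \<tau> (x + t) \<noteq> 0" "k t \<in> ff \<tau> ` ball y s" for t
    unfolding b_def using DERIV_chain'[OF kd[OF that(1)] holomorphic_derivI[OF g(1) s(2) that(2)]] by blast
  have fb: "ff \<tau> (x + t) * ff \<tau> (b t) = c" if "Dden \<tau> (x + t) \<noteq> 0" "k t \<in> ff \<tau> ` ball y s" for t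
  proof -
    from that(2) obtain z where z: "z \<in> ball y s" "k t = ff \<tau> z" by blast
    have "ff \<tau> (x + t) \<noteq> 0" using that by (simp add: ff_def Dden_def)
    moreover have "ff \<tau> (b t) = k t" using g(2)[OF z(1)] by (simp add: b_def z(2))
    ultimately show ?thesis by (simp add: k_def)
  qed
  have lev: "\<forall>\<^sub>F t in nhds 0. ff \<tau> (x + t) * ff \<tau> (b t) = c"
    using ev_x ev_k by eventually_elim (rule fb)
  have "\<exists>B. (b has_field_derivative B) (at 0)" by (rule bd) (use dx s(1) k0 in auto)
  hence bc: "isCont b 0" using DERIV_isCont by blast
  have ev_y: "\<forall>\<^sub>F t in nhds 0. D \<tau> (b t) \<noteq> 0"
    by (rule isCont_eventually[OF bc b0 D_nonzero_nhds[OF tau nz(2)]])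
  have "\<forall>\<^sub>F t in nhds 0. (b has_field_derivative (- D \<tau> (x + t) / D \<tau> (b t))) (at t)"
    using ev_x ev_k ev_y iffD2[OF eventually_eventually lev]
  proof eventually_elim
    case (elim t)
    obtain B where B: "(b has_field_derivative B) (at t)" using bd elim(1,2) by blast
    have db: "Dden \<tau> (b t) \<noteq> 0" using elim(3) D_nonzero_iff by blast
    have f: "((\<lambda>t. ff \<tau> (x + t)) has_field_derivative D \<tau> (x + t) * ff \<tau> (x + t)) (at t)"
      using ff_log_derivative[OF tau elim(1)] DERIV_shift[of "ff \<tau>" _ t x] by (simp add: add.commute)
    from DERIV_mult[OF f DERIV_chain'[OF B ff_log_derivative[OF tau db]]]
    have "((\<lambda>t. ff \<tau> (x + t) * ff \<tau> (b t)) has_field_derivative (ff \<tau> (x + t) * ff \<tau> (b t)) * (D \<tau> (x + t) + D \<tau> (b t) * B)) (at t)"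
      by (rule DERIV_cong) (simp add: algebra_simps)
    moreover have "((\<lambda>t. ff \<tau> (x + t) * ff \<tau> (b t)) has_field_derivative 0) (at t)"
      using DERIV_cong_ev[OF refl elim(4) refl, of 0] by simp
    ultimately have "(ff \<tau> (x + t) * ff \<tau> (b t)) * (D \<tau> (x + t) + D \<tau> (b t) * B) = 0" by (rule DERIV_unique)
    moreover have "ff \<tau> (x + t) * ff \<tau> (b t) \<noteq> 0" using elim(1) db by (simp add: ff_def Dden_def)
    ultimately have "D \<tau> (x + t) + D \<tau> (b t) * B = 0" by simp
    hence "D \<tau> (b t) * B = - D \<tau> (x + t)" by (simp add: eq_neg_iff_add_eq_0 add.commute)
    hence "B = - D \<tau> (x + t) / D \<tau> (b t)" using elim(3) by (simp add: field_simps)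
    thus ?case using B by simp
  qed
  moreover have "\<forall>\<^sub>F t in nhds 0. u_theta \<tau> (x + t, b t) = u_theta \<tau> (x, y)"
    using lev by eventually_elim (simp add: u_theta_eq c_def)
  ultimately show ?thesis using b0 that by blast
qed

text \<open>Translation by the half period changes the sign of \<open>D\<close>, so a constant value
  would be 0, and \<open>D\<close> is not identically 0.\<close>

lemma D_not_constant:
  assumes tau: "Im \<tau> > 0"
  shows "\<not> (\<forall>x. Dnum \<tau> x = c * Dden \<tau> x)"
proof
  assume c: "\<forall>x. Dnum \<tau> x = c * Dden \<tau> x"
  obtain x where x: "Dden \<tau> x \<noteq> 0" using Dden_not_identically_0[OF tau] by blast
  hence "Dden \<tau> (x + cpi * \<tau> / 2) \<noteq> 0"
    by (simp add: Dden_def t1_plus_half t4_plus_half)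
  hence "D \<tau> (x + cpi * \<tau> / 2) = c" "D \<tau> x = c" using c x by (simp_all add: D_eq)
  hence "c = 0" using D_plus_half[OF tau, of x] by simp
  thus False using c D_not_identically_0[OF tau] by simp
qed

text \<open>If \<open>u\<^sub>\<tau>\<close> had straight level curves, then \<open>D'/D\<^sup>2\<close> would be equal to a constant \<open>k\<close> near \<open>x\<^sub>0\<close> and to
  \<open>-k\<close> near \<open>y\<^sub>0\<close>, hence everywhere to both.\<close>

lemma not_both_Riccati:
  assumes tau: "Im \<tau> > 0"
    and 1: "\<forall>\<^sub>F x in nhds x0. LDnum (Dnum \<tau>) (Dden \<tau>) x = k * (Dnum \<tau> x)\<^sup>2"
    and 2: "\<forall>\<^sub>F x in nhds y0. LDnum (Dnum \<tau>) (Dden \<tau>) x = - k * (Dnum \<tau> x)\<^sup>2"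
  shows False
proof -
  note ent = Dnum_entire[OF tau] Dden_entire[OF tau]
  have a: "LDnum (Dnum \<tau>) (Dden \<tau>) x - c * (Dnum \<tau> x)\<^sup>2 = 0"
    if "\<forall>\<^sub>F x in nhds z. LDnum (Dnum \<tau>) (Dden \<tau>) x = c * (Dnum \<tau> x)\<^sup>2" for c z x
    by (rule entire_eq_0[where F = "\<lambda>x. LDnum (Dnum \<tau>) (Dden \<tau>) x - c * (Dnum \<tau> x)\<^sup>2" and a = z])
      (use that in \<open>auto intro!: holomorphic_intros LDnum_holomorphic ent elim: eventually_mono\<close>)
  obtain z where z: "Dnum \<tau> z \<noteq> 0" using D_not_identically_0[OF tau] by blast
  have "k = 0" using a[OF 1, of z] a[OF 2, of z] z by simp
  hence "LDnum (Dnum \<tau>) (Dden \<tau>) x = 0" for x using a[OF 1, of x] by simp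
  then obtain c where "\<forall>x. Dnum \<tau> x = c * Dden \<tau> x"
    using LDnum_0_imp_proportional[OF ent] Dden_not_identically_0[OF tau] by blast
  thus False using D_not_constant[OF tau] by blast
qed

theorem u_theta_not_algebraizable:
  assumes tau: "Im \<tau> > 0" and reg: "regular_at (u_theta \<tau>) p"
  shows "\<not> algebraizable_at (theta_web \<tau>) p"
proof
  assume "algebraizable_at (theta_web \<tau>) p"
  then obtain \<psi> W where W: "open W" "p \<in> W" "\<And>q. q \<in> W \<Longrightarrow> local_diffeo_at \<psi> q"
    and st: "\<And>j. j < length (theta_web \<tau>) \<Longrightarrow> straight_leaves W \<psi> (theta_web \<tau> ! j)"
    by (rule algebraizable_imp_straight_leaves) blast
  have len: "length (theta_web \<tau>) = 5" by (simp add: T_web_def T0_def)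
  have stT: "straight_leaves W \<psi> (T0 ! j)" if "j < 4" for j
  proof -
    have "length T0 = 4" by (simp add: T0_def)
    thus ?thesis using st[of j] that unfolding len by (simp add: T_web_def nth_append)
  qed
  have stu: "straight_leaves W \<psi> (u_theta \<tau>)"
    using st[of 4] unfolding len by (simp add: T_web_def nth_append T0_def)
  define E where "E = LDnum (Dnum \<tau>) (Dden \<tau>)"
  \<comment> \<open>This is the vanishing of the second derivative of the level curve, with E /
    Dden^2 for the derivative of \<open>D\<close> and all denominators cleared. Divided by the
    squares of \<open>Dnum\<close>, it becomes a sum of a function of x and the same function of
    y.\<close>
  have key: "E x * (Dnum \<tau> y)\<^sup>2 + (Dnum \<tau> x)\<^sup>2 * E y = 0"
    if q: "(x, y) \<in> W" "regular_at (u_theta \<tau>) (x, y)" for x y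
  proof -
    have nz: "D \<tau> x \<noteq> 0" "D \<tau> y \<noteq> 0" "Dden \<tau> x \<noteq> 0" "Dden \<tau> y \<noteq> 0" using q(2) unfolding regular_at_iff[OF tau] by blast+
    obtain b where b: "b 0 = y" "\<forall>\<^sub>F t in nhds 0. (b has_field_derivative (- D \<tau> (x + t) / D \<tau> (b t))) (at t)"
      "\<forall>\<^sub>F t in nhds 0. u_theta \<tau> (x + t, b t) = u_theta \<tau> (x, y)"
      by (rule level_curve_of_u_theta[OF tau nz(1,2)])
    have db: "(b has_field_derivative (- D \<tau> x / D \<tau> y)) (at 0)" using eventually_nhds_x_imp_x[OF b(2)] b(1) by simp
    have d1: "((\<lambda>t. D \<tau> (x + t)) has_field_derivative E x / (Dden \<tau> x)\<^sup>2) (at 0)"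
      using D_has_derivative[OF tau nz(3)] DERIV_shift[of "D \<tau>" _ 0 x] by (simp add: add.commute E_def)
    have d2: "((\<lambda>t. D \<tau> (b t)) has_field_derivative E y / (Dden \<tau> y)\<^sup>2 * (- D \<tau> x / D \<tau> y)) (at 0)"
      by (rule DERIV_cong[OF DERIV_chain'[OF db D_has_derivative[OF tau, of "b 0"]]]) (use nz(4) b(1) in \<open>simp_all add: E_def\<close>)
    define b2 where "b2 = (- (E x / (Dden \<tau> x)\<^sup>2) * D \<tau> y - (- D \<tau> x) * (E y / (Dden \<tau> y)\<^sup>2 * (- D \<tau> x / D \<tau> y))) / (D \<tau> y * D \<tau> y)"
    have "((\<lambda>t. - D \<tau> (x + t) / D \<tau> (b t)) has_field_derivative b2) (at 0)"
      using DERIV_divide[OF DERIV_minus[OF d1] d2] b(1) nz by (simp add: b2_def)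
    hence "b2 = 0"
      by (intro straight_T0_imp_straight[OF W(1) q(1) W(3)[OF q(1)] stT stu, of b "\<lambda>t. - D \<tau> (x + t) / D \<tau> (b t)" b2])
        (use b in simp_all)
    hence *: "(- (E x / (Dden \<tau> x)\<^sup>2) * D \<tau> y - (- D \<tau> x) * (E y / (Dden \<tau> y)\<^sup>2 * (- D \<tau> x / D \<tau> y))) = 0"
      using nz unfolding b2_def by (subst (asm) divide_eq_0_iff) simp
    have "E x / (Dden \<tau> x)\<^sup>2 * D \<tau> y + D \<tau> x * (E y / (Dden \<tau> y)\<^sup>2 * (D \<tau> x / D \<tau> y)) = 0"
      (is "?l = 0")
    proof -
      have "?l = - (- (E x / (Dden \<tau> x)\<^sup>2) * D \<tau> y - (- D \<tau> x) * (E y / (Dden \<tau> y)\<^sup>2 * (- D \<tau> x / D \<tau> y)))" by simp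
      from this[unfolded *] show ?thesis by simp
    qed
    hence "(E x / (Dden \<tau> x)\<^sup>2 * D \<tau> y + D \<tau> x * (E y / (Dden \<tau> y)\<^sup>2 * (D \<tau> x / D \<tau> y))) * D \<tau> y * ((Dden \<tau> x)\<^sup>2 * (Dden \<tau> y)\<^sup>2) = 0"
      by simp
    moreover have "(E x / (Dden \<tau> x)\<^sup>2 * D \<tau> y + D \<tau> x * (E y / (Dden \<tau> y)\<^sup>2 * (D \<tau> x / D \<tau> y))) * D \<tau> y * ((Dden \<tau> x)\<^sup>2 * (Dden \<tau> y)\<^sup>2)
      = E x * (D \<tau> y * Dden \<tau> y)\<^sup>2 + (D \<tau> x * Dden \<tau> x)\<^sup>2 * E y"
      using nz by (simp add: field_simps power2_eq_square)
    moreover have "D \<tau> x * Dden \<tau> x = Dnum \<tau> x" "D \<tau> y * Dden \<tau> y = Dnum \<tau> y" using nz by (simp_all add: D_eq)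
    ultimately show ?thesis by (simp only:)
  qed
  obtain x0 y0 where p: "p = (x0, y0)" by (cases p)
  have "\<forall>\<^sub>F z in nhds (x0, y0). z \<in> W \<and> regular_at (u_theta \<tau>) z"
    using regular_at_eventually[OF reg] eventually_nhds_in_open[OF W(1,2)] unfolding p by eventually_elim blast
  then obtain A B where AB: "\<forall>\<^sub>F x in nhds x0. A x" "\<forall>\<^sub>F y in nhds y0. B y"
    "\<And>x y. A x \<Longrightarrow> B y \<Longrightarrow> (x, y) \<in> W \<and> regular_at (u_theta \<tau>) (x, y)"
    unfolding nhds_prod eventually_prod_filter by auto
  have A0: "A x0" and B0: "B y0" using AB(1,2) eventually_nhds_x_imp_x by blast+
  have n0: "Dnum \<tau> x0 \<noteq> 0" "Dnum \<tau> y0 \<noteq> 0"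
    using AB(3)[OF A0 B0] unfolding regular_at_iff[OF tau] D_nonzero_iff by blast+
  define k where "k = - E y0 / (Dnum \<tau> y0)\<^sup>2"
  have k': "k = E x0 / (Dnum \<tau> x0)\<^sup>2"
    using key[of x0 y0] AB(3)[OF A0 B0] n0 by (simp add: k_def field_simps add_eq_0_iff)
  show False
  proof (rule not_both_Riccati[OF tau])
    show "\<forall>\<^sub>F x in nhds x0. LDnum (Dnum \<tau>) (Dden \<tau>) x = k * (Dnum \<tau> x)\<^sup>2"
      using AB(1)
    proof eventually_elim
      case (elim x)
      have "E x * (Dnum \<tau> y0)\<^sup>2 + (Dnum \<tau> x)\<^sup>2 * E y0 = 0" using key AB(3)[OF elim B0] by blast
      thus ?case using n0 by (simp add: k_def E_def[symmetric] field_simps add_eq_0_iff)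
    qed
    show "\<forall>\<^sub>F x in nhds y0. LDnum (Dnum \<tau>) (Dden \<tau>) x = - k * (Dnum \<tau> x)\<^sup>2"
      using AB(2)
    proof eventually_elim
      case (elim x)
      have "E x0 * (Dnum \<tau> x)\<^sup>2 + (Dnum \<tau> x0)\<^sup>2 * E x = 0" using key AB(3)[OF A0 elim] by blast
      thus ?case using n0 unfolding k' by (simp add: E_def[symmetric] field_simps add_eq_0_iff2)
    qed
  qed
qed


section \<open>Abelian relations of \<open>\<T>[u\<^sub>\<tau>]\<close>\<close>

text \<open>The derivative of \<open>ff\<close> away from the poles. It stays correct at the zeros
  of \<open>ff\<close>, where the product of \<open>D\<close> and \<open>ff\<close> would give
  0.\<close>

definition f1 :: "complex \<Rightarrow> complex \<Rightarrow> complex" where "f1 \<tau> x = Dnum \<tau> x / (t4 \<tau> x)\<^sup>2"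

lemma ff_has_derivative':
  "Im \<tau> > 0 \<Longrightarrow> t4 \<tau> x \<noteq> 0 \<Longrightarrow> (ff \<tau> has_field_derivative f1 \<tau> x) (at x)"
  unfolding f1_def by (rule ff_has_derivative)

lemma t4_analytic_quotient:
  assumes "Im \<tau> > 0" "t4 \<tau> x \<noteq> 0"
  shows "ff \<tau> analytic_on {x}" "f1 \<tau> analytic_on {x}"
proof -
  have op: "open {x. t4 \<tau> x \<noteq> 0}"
    by (intro open_Collect_neq holomorphic_on_imp_continuous_on theta_entire assms continuous_on_const)
  have h: "H holomorphic_on {x. t4 \<tau> x \<noteq> 0}" if "H holomorphic_on UNIV" for H :: "complex \<Rightarrow> complex"
    using that by (rule holomorphic_on_subset) auto
  note ent = h[OF theta_entire(1)[OF assms(1)]] h[OF theta_entire(2)[OF assms(1)]] h[OF Dnum_entire[OF assms(1)]]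
  have "ff \<tau> holomorphic_on {x. t4 \<tau> x \<noteq> 0}"
    unfolding ff_def[abs_def] by (rule holomorphic_on_divide) (use ent in auto)
  thus "ff \<tau> analytic_on {x}" unfolding analytic_at using op assms(2) by blast
  have "f1 \<tau> holomorphic_on {x. t4 \<tau> x \<noteq> 0}"
    unfolding f1_def[abs_def] by (rule holomorphic_on_divide) (use ent in \<open>auto intro!: holomorphic_intros\<close>)
  thus "f1 \<tau> analytic_on {x}" unfolding analytic_at using op assms(2) by blast
qed

definition dl :: "(complex \<Rightarrow> complex) \<Rightarrow> complex \<Rightarrow> complex" where "dl F w = deriv F w / F w"

lemma dl_analytic:
  assumes "F holomorphic_on UNIV" "F x \<noteq> 0"
  shows "dl F analytic_on {x}"
proof -
  have op: "open {x. F x \<noteq> 0}"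
    by (intro open_Collect_neq holomorphic_on_imp_continuous_on assms continuous_on_const)
  have h: "H holomorphic_on {x. F x \<noteq> 0}" if "H holomorphic_on UNIV" for H :: "complex \<Rightarrow> complex"
    using that by (rule holomorphic_on_subset) auto
  have "dl F holomorphic_on {x. F x \<noteq> 0}"
    unfolding dl_def[abs_def] by (rule holomorphic_on_divide) (use h[OF assms(1)] h[OF entire_deriv[OF assms(1)]] in auto)
  thus ?thesis unfolding analytic_at using op assms(2) by blast
qed

lemma product_formula_deriv:
  assumes ent: "F holomorphic_on UNIV" "G holomorphic_on UNIV" "H holomorphic_on UNIV" "K holomorphic_on UNIV"
    and eq: "\<And>x y. F x * F y + e * (G x * G y) = H (x + y) * K (x - y)"
  shows "deriv F x * F y + e * (deriv G x * G y) = deriv H (x + y) * K (x - y) + H (x + y) * deriv K (x - y)"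
    "F x * deriv F y + e * (G x * deriv G y) = deriv H (x + y) * K (x - y) - H (x + y) * deriv K (x - y)"
proof -
  note d = ent[THEN entire_field_derivative]
  have aff: "((\<lambda>t. E (\<alpha> * t + \<beta>)) has_field_derivative \<alpha> * deriv E (\<alpha> * t + \<beta>)) (at t)" if "E holomorphic_on UNIV" for E \<alpha> \<beta> t
    using entire_field_derivative[OF entire_compose_affine[OF that, of \<alpha> \<beta>], of t] by (simp add: deriv_affine[OF that])
  have 1: "((\<lambda>x. F x * F y + e * (G x * G y)) has_field_derivative deriv F x * F y + e * (deriv G x * G y)) (at x)"
    by (intro DERIV_add DERIV_cmult DERIV_cmult_right d)
  have 2: "((\<lambda>x. H (x + y) * K (x - y)) has_field_derivative deriv H (x + y) * K (x - y) + H (x + y) * deriv K (x - y)) (at x)"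
    using DERIV_mult[OF aff[OF ent(3), of 1 y x] aff[OF ent(4), of 1 "- y" x]] by (simp add: algebra_simps)
  show "deriv F x * F y + e * (deriv G x * G y) = deriv H (x + y) * K (x - y) + H (x + y) * deriv K (x - y)"
    by (rule DERIV_unique[OF 1[unfolded eq] 2])
  have 1: "((\<lambda>y. F x * F y + e * (G x * G y)) has_field_derivative F x * deriv F y + e * (G x * deriv G y)) (at y)"
    by (intro DERIV_add DERIV_cmult d)
  have 2: "((\<lambda>y. H (x + y) * K (x - y)) has_field_derivative deriv H (x + y) * K (x - y) - H (x + y) * deriv K (x - y)) (at y)"
    using DERIV_mult[OF aff[OF ent(3), of 1 x y] aff[OF ent(4), of "- 1" x y]] by (simp add: algebra_simps)
  show "F x * deriv F y + e * (G x * deriv G y) = deriv H (x + y) * K (x - y) - H (x + y) * deriv K (x - y)"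
    by (rule DERIV_unique[OF 1[unfolded eq] 2])
qed

text \<open>The product formulas and their two partial derivatives, divided by the product c of the
  values of \<open>t4\<close>. They are kept free of the denominators 1 + u and 1 - u so that they
  can be evaluated where these vanish, as in \<open>reg_nonzero\<close>.\<close>

lemma one_plus_u:
  assumes tau: "Im \<tau> > 0" and nz: "t4 \<tau> x \<noteq> 0" "t4 \<tau> y \<noteq> 0"
  defines "u \<equiv> ff \<tau> x * ff \<tau> y" and "c \<equiv> t4 \<tau> x * t4 \<tau> y"
  shows "(1 + u) * c = tp \<tau> (x + y) * tq \<tau> (x - y)" "(1 - u) * c = tq \<tau> (x + y) * tp \<tau> (x - y)"
    "f1 \<tau> x * ff \<tau> y * c + (1 + u) * deriv (t4 \<tau>) x * t4 \<tau> y = deriv (tp \<tau>) (x + y) * tq \<tau> (x - y) + tp \<tau> (x + y) * deriv (tq \<tau>) (x - y)"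
    "ff \<tau> x * f1 \<tau> y * c + (1 + u) * t4 \<tau> x * deriv (t4 \<tau>) y = deriv (tp \<tau>) (x + y) * tq \<tau> (x - y) - tp \<tau> (x + y) * deriv (tq \<tau>) (x - y)"
    "- (f1 \<tau> x * ff \<tau> y * c) + (1 - u) * deriv (t4 \<tau>) x * t4 \<tau> y = deriv (tq \<tau>) (x + y) * tp \<tau> (x - y) + tq \<tau> (x + y) * deriv (tp \<tau>) (x - y)"
    "- (ff \<tau> x * f1 \<tau> y * c) + (1 - u) * t4 \<tau> x * deriv (t4 \<tau>) y = deriv (tq \<tau>) (x + y) * tp \<tau> (x - y) - tq \<tau> (x + y) * deriv (tp \<tau>) (x - y)"
proof -
  have uc: "u * c = t1 \<tau> x * t1 \<tau> y" using nz by (simp add: u_def c_def ff_def)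
  show "(1 + u) * c = tp \<tau> (x + y) * tq \<tau> (x - y)" "(1 - u) * c = tq \<tau> (x + y) * tp \<tau> (x - y)"
    using theta_product[OF tau, of x y] theta_product'[OF tau, of x y] uc by (simp_all add: c_def algebra_simps)
  have f: "f1 \<tau> x * ff \<tau> y * c = deriv (t1 \<tau>) x * t1 \<tau> y - u * deriv (t4 \<tau>) x * t4 \<tau> y"
    "ff \<tau> x * f1 \<tau> y * c = t1 \<tau> x * deriv (t1 \<tau>) y - u * t4 \<tau> x * deriv (t4 \<tau>) y"
    using nz by (simp_all add: f1_def Dnum_def LDnum_def ff_def c_def u_def power2_eq_square field_simps)
  have p: "t4 \<tau> x * t4 \<tau> y + 1 * (t1 \<tau> x * t1 \<tau> y) = tp \<tau> (x + y) * tq \<tau> (x - y)"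
    "t4 \<tau> x * t4 \<tau> y + - 1 * (t1 \<tau> x * t1 \<tau> y) = tq \<tau> (x + y) * tp \<tau> (x - y)" for x y
    using theta_product[OF tau, of x y] theta_product'[OF tau, of x y] by simp_all
  note ent = theta_entire[OF tau]
  note pd = product_formula_deriv[OF ent(2,1,3,4) p(1), of x y] product_formula_deriv[OF ent(2,1,4,3) p(2), of x y]
  show "f1 \<tau> x * ff \<tau> y * c + (1 + u) * deriv (t4 \<tau>) x * t4 \<tau> y = deriv (tp \<tau>) (x + y) * tq \<tau> (x - y) + tp \<tau> (x + y) * deriv (tq \<tau>) (x - y)"
    "ff \<tau> x * f1 \<tau> y * c + (1 + u) * t4 \<tau> x * deriv (t4 \<tau>) y = deriv (tp \<tau>) (x + y) * tq \<tau> (x - y) - tp \<tau> (x + y) * deriv (tq \<tau>) (x - y)"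
    "- (f1 \<tau> x * ff \<tau> y * c) + (1 - u) * deriv (t4 \<tau>) x * t4 \<tau> y = deriv (tq \<tau>) (x + y) * tp \<tau> (x - y) + tq \<tau> (x + y) * deriv (tp \<tau>) (x - y)"
    "- (ff \<tau> x * f1 \<tau> y * c) + (1 - u) * t4 \<tau> x * deriv (t4 \<tau>) y = deriv (tq \<tau>) (x + y) * tp \<tau> (x - y) - tq \<tau> (x + y) * deriv (tp \<tau>) (x - y)"
    unfolding f pd[symmetric] by (simp_all add: algebra_simps)
qed

lemma u_log_partials:
  assumes tau: "Im \<tau> > 0" and nz: "t4 \<tau> x \<noteq> 0" "t4 \<tau> y \<noteq> 0"
    and N: "tp \<tau> (x + y) \<noteq> 0" "tq \<tau> (x + y) \<noteq> 0" "tp \<tau> (x - y) \<noteq> 0" "tq \<tau> (x - y) \<noteq> 0"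
  defines "u \<equiv> ff \<tau> x * ff \<tau> y"
  shows "1 + u \<noteq> 0" "1 - u \<noteq> 0"
    "- dl (t4 \<tau>) x + (dl (tp \<tau>) (x + y) + dl (tq \<tau>) (x - y)) - (f1 \<tau> x * ff \<tau> y) / (1 + u) = 0"
    "- dl (t4 \<tau>) y + (dl (tp \<tau>) (x + y) - dl (tq \<tau>) (x - y)) - (ff \<tau> x * f1 \<tau> y) / (1 + u) = 0"
    "- dl (t4 \<tau>) x + (dl (tq \<tau>) (x + y) + dl (tp \<tau>) (x - y)) + (f1 \<tau> x * ff \<tau> y) / (1 - u) = 0"
    "- dl (t4 \<tau>) y + (dl (tq \<tau>) (x + y) - dl (tp \<tau>) (x - y)) + (ff \<tau> x * f1 \<tau> y) / (1 - u) = 0"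
proof -
  note I = one_plus_u[OF tau nz, folded u_def]
  show u: "1 + u \<noteq> 0" "1 - u \<noteq> 0" using I(1,2) N by auto
  have log: "- (A / a) + (P / p + Q / q) - d / U = 0"
    if "U * (a * b) = p * q" "d * (a * b) + U * A * b = P * q + p * Q" "a \<noteq> 0" "b \<noteq> 0" "p \<noteq> 0" "q \<noteq> 0" "U \<noteq> 0"
    for A a b P p Q q d U :: complex
  proof -
    have "P / p + Q / q = (P * q + p * Q) / (p * q)" using that(5,6) by (simp add: field_simps)
    also have "\<dots> = (d * (a * b) + U * A * b) / (U * (a * b))" using that by simp
    also have "\<dots> = d / U + A / a" using that(3,4,7) by (simp add: field_simps)
    finally show ?thesis by simp
  qed
  show "- dl (t4 \<tau>) x + (dl (tp \<tau>) (x + y) + dl (tq \<tau>) (x - y)) - (f1 \<tau> x * ff \<tau> y) / (1 + u) = 0"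
    unfolding dl_def by (rule log[of _ _ "t4 \<tau> y"]) (use I nz N u in simp_all)
  have "- dl (t4 \<tau>) y + (dl (tp \<tau>) (x + y) + (- deriv (tq \<tau>) (x - y)) / tq \<tau> (x - y)) - (ff \<tau> x * f1 \<tau> y) / (1 + u) = 0"
    unfolding dl_def by (rule log[of _ _ "t4 \<tau> x"]) (use I nz N u in \<open>simp_all add: mult_ac\<close>)
  thus "- dl (t4 \<tau>) y + (dl (tp \<tau>) (x + y) - dl (tq \<tau>) (x - y)) - (ff \<tau> x * f1 \<tau> y) / (1 + u) = 0" by (simp add: dl_def)
  have "- dl (t4 \<tau>) x + (dl (tq \<tau>) (x + y) + dl (tp \<tau>) (x - y)) - (- (f1 \<tau> x * ff \<tau> y)) / (1 - u) = 0"
    unfolding dl_def by (rule log[of _ _ "t4 \<tau> y"]) (use I nz N u in simp_all)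
  thus "- dl (t4 \<tau>) x + (dl (tq \<tau>) (x + y) + dl (tp \<tau>) (x - y)) + (f1 \<tau> x * ff \<tau> y) / (1 - u) = 0" by simp
  have "- dl (t4 \<tau>) y + (dl (tq \<tau>) (x + y) + (- deriv (tp \<tau>) (x - y)) / tp \<tau> (x - y)) - (- (ff \<tau> x * f1 \<tau> y)) / (1 - u) = 0"
    unfolding dl_def by (rule log[of _ _ "t4 \<tau> x"]) (use I nz N u in \<open>simp_all add: mult_ac\<close>)
  thus "- dl (t4 \<tau>) y + (dl (tq \<tau>) (x + y) - dl (tp \<tau>) (x - y)) + (ff \<tau> x * f1 \<tau> y) / (1 - u) = 0" by (simp add: dl_def)
qed

definition reg :: "complex \<Rightarrow> complex \<Rightarrow> complex \<Rightarrow> bool" where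
  "reg \<tau> x y \<longleftrightarrow> Im \<tau> > 0 \<and> regular_at (u_theta \<tau>) (x, y)"

lemma regD:
  assumes "reg \<tau> x y"
  shows "Im \<tau> > 0" "t4 \<tau> x \<noteq> 0" "t4 \<tau> y \<noteq> 0" "t1 \<tau> x \<noteq> 0" "t1 \<tau> y \<noteq> 0" "D \<tau> x \<noteq> 0" "D \<tau> y \<noteq> 0"
    "f1 \<tau> x = D \<tau> x * ff \<tau> x" "f1 \<tau> y = D \<tau> y * ff \<tau> y" "ff \<tau> x \<noteq> 0" "ff \<tau> y \<noteq> 0"
    "f1 \<tau> x \<noteq> 0" "f1 \<tau> y \<noteq> 0" "(f1 \<tau> x * ff \<tau> y)\<^sup>2 \<noteq> (ff \<tau> x * f1 \<tau> y)\<^sup>2"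
proof -
  show tau: "Im \<tau> > 0" using assms by (simp add: reg_def)
  have r: "Dden \<tau> x \<noteq> 0" "Dden \<tau> y \<noteq> 0" "D \<tau> x \<noteq> 0" "D \<tau> y \<noteq> 0" "(D \<tau> x)\<^sup>2 \<noteq> (D \<tau> y)\<^sup>2"
    using assms regular_at_iff[OF tau] by (auto simp: reg_def)
  show t: "t4 \<tau> x \<noteq> 0" "t4 \<tau> y \<noteq> 0" "t1 \<tau> x \<noteq> 0" "t1 \<tau> y \<noteq> 0" "D \<tau> x \<noteq> 0" "D \<tau> y \<noteq> 0"
    using r by (auto simp: Dden_def)
  show f: "f1 \<tau> x = D \<tau> x * ff \<tau> x" "f1 \<tau> y = D \<tau> y * ff \<tau> y"
    using t deriv_ff_eq unfolding f1_def by auto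
  show n: "ff \<tau> x \<noteq> 0" "ff \<tau> y \<noteq> 0" using t by (auto simp: ff_def)
  show "f1 \<tau> x \<noteq> 0" "f1 \<tau> y \<noteq> 0" using f t n by auto
  have "(f1 \<tau> x * ff \<tau> y)\<^sup>2 = (D \<tau> x)\<^sup>2 * (ff \<tau> x * ff \<tau> y)\<^sup>2" "(ff \<tau> x * f1 \<tau> y)\<^sup>2 = (D \<tau> y)\<^sup>2 * (ff \<tau> x * ff \<tau> y)\<^sup>2"
    by (simp_all add: f power_mult_distrib mult_ac)
  thus "(f1 \<tau> x * ff \<tau> y)\<^sup>2 \<noteq> (ff \<tau> x * f1 \<tau> y)\<^sup>2" using r(5) n by simp
qed

text \<open>If u were -1 or 1, one factor on the right of the product formula would vanish. The
  differentiated formulas then give u_x = u_y or u_x = -u_y, contrary to (T).\<close>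

lemma reg_nonzero:
  assumes r: "reg \<tau> x y"
  shows "tp \<tau> (x + y) \<noteq> 0" "tq \<tau> (x + y) \<noteq> 0" "tp \<tau> (x - y) \<noteq> 0" "tq \<tau> (x - y) \<noteq> 0"
    "1 + ff \<tau> x * ff \<tau> y \<noteq> 0" "1 - ff \<tau> x * ff \<tau> y \<noteq> 0"
proof -
  note R = regD[OF r]
  define u where "u = ff \<tau> x * ff \<tau> y"
  define c where "c = t4 \<tau> x * t4 \<tau> y"
  have c: "c \<noteq> 0" using R by (simp add: c_def)
  note I = one_plus_u[OF R(1-3), folded u_def c_def]
  have no: False if "a * c = b * c \<or> a * c = - (b * c)" "a = f1 \<tau> x * ff \<tau> y" "b = ff \<tau> x * f1 \<tau> y" for a b
  proof -
    have "(a - b) * c = 0 \<or> (a + b) * c = 0" using that(1) by (auto simp: algebra_simps)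
    hence "a = b \<or> a = - b" using c by (simp add: eq_neg_iff_add_eq_0)
    hence "a\<^sup>2 = b\<^sup>2" by (elim disjE) simp_all
    thus False using R(14) that by simp
  qed
  have 1: "1 + u \<noteq> 0"
  proof
    assume z: "1 + u = 0"
    hence "tp \<tau> (x + y) = 0 \<or> tq \<tau> (x - y) = 0" using I(1) by simp
    moreover have "False" if "tp \<tau> (x + y) = 0"
    proof -
      have "f1 \<tau> x * ff \<tau> y * c = ff \<tau> x * f1 \<tau> y * c" using I(3,4) z that by simp
      thus False using no[OF _ refl refl] by simp
    qed
    moreover have "False" if "tq \<tau> (x - y) = 0"
    proof -
      have "f1 \<tau> x * ff \<tau> y * c = - (ff \<tau> x * f1 \<tau> y * c)" using I(3,4) z that by simp
      thus False using no[OF _ refl refl] by simp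
    qed
    ultimately show False by blast
  qed
  have 2: "1 - u \<noteq> 0"
  proof
    assume z: "1 - u = 0"
    hence "tq \<tau> (x + y) = 0 \<or> tp \<tau> (x - y) = 0" using I(2) by simp
    moreover have "False" if "tq \<tau> (x + y) = 0"
    proof -
      have "- (f1 \<tau> x * ff \<tau> y * c) = - (ff \<tau> x * f1 \<tau> y * c)" using I(5,6) z that by simp
      thus False using no[OF _ refl refl] by simp
    qed
    moreover have "False" if "tp \<tau> (x - y) = 0"
    proof -
      have "- (f1 \<tau> x * ff \<tau> y * c) = ff \<tau> x * f1 \<tau> y * c" using I(5,6) z that by simp
      hence "f1 \<tau> x * ff \<tau> y * c = - (ff \<tau> x * f1 \<tau> y * c)" by (metis minus_minus)
      thus False using no[OF _ refl refl] by simp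
    qed
    ultimately show False by blast
  qed
  show "1 + ff \<tau> x * ff \<tau> y \<noteq> 0" "1 - ff \<tau> x * ff \<tau> y \<noteq> 0" using 1 2 by (simp_all add: u_def)
  show "tp \<tau> (x + y) \<noteq> 0" "tq \<tau> (x - y) \<noteq> 0" "tq \<tau> (x + y) \<noteq> 0" "tp \<tau> (x - y) \<noteq> 0"
    using I(1,2) 1 2 c by auto
qed

lemma reg_eventually: "reg \<tau> x y \<Longrightarrow> \<forall>\<^sub>F z in nhds (x, y). reg \<tau> (fst z) (snd z)"
  using regular_at_eventually[of "u_theta \<tau>" "(x, y)"] unfolding reg_def by (auto elim: eventually_mono)

lemma isCont_u: "reg \<tau> x y \<Longrightarrow> isCont (\<lambda>z. ff \<tau> (fst z) * ff \<tau> (snd z)) (x, y)"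
  using holo2_at_isCont[of "u_theta \<tau>" "(x, y)"] unfolding reg_def regular_at_def u_theta_eq' by (simp add: case_prod_beta')

lemma eventually_off_poles:
  assumes r: "reg \<tau> x y"
  shows "\<forall>\<^sub>F w in nhds (ff \<tau> x * ff \<tau> y). w \<noteq> 0 \<and> 1 + w \<noteq> 0 \<and> 1 - w \<noteq> 0"
proof -
  have "open {w :: complex. w \<noteq> 0 \<and> 1 + w \<noteq> 0 \<and> 1 - w \<noteq> 0}"
    by (intro open_Collect_conj open_Collect_neq continuous_intros)
  from eventually_nhds_in_open[OF this, of "ff \<tau> x * ff \<tau> y"] show ?thesis
    using regD[OF r] reg_nonzero[OF r] by simp
qed

text \<open>An abelian relation in terms of functions instead of germs. The components 0 to 3 belong
  to x, y, x + y, x - y and component 4 to u; the two equations are the coefficients of dx and of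
  dy.\<close>

definition AR :: "complex \<Rightarrow> complex \<Rightarrow> complex \<Rightarrow> (nat \<Rightarrow> complex \<Rightarrow> complex) \<Rightarrow> bool" where
  "AR \<tau> x0 y0 \<phi> \<longleftrightarrow>
    \<phi> 0 analytic_on {x0} \<and> \<phi> 1 analytic_on {y0} \<and> \<phi> 2 analytic_on {x0 + y0} \<and> \<phi> 3 analytic_on {x0 - y0} \<and>
    \<phi> 4 analytic_on {ff \<tau> x0 * ff \<tau> y0} \<and>
    (\<forall>\<^sub>F z in nhds (x0, y0).
       \<phi> 0 (fst z) + \<phi> 2 (fst z + snd z) + \<phi> 3 (fst z - snd z) + \<phi> 4 (ff \<tau> (fst z) * ff \<tau> (snd z)) * (f1 \<tau> (fst z) * ff \<tau> (snd z)) = 0 \<and>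
       \<phi> 1 (snd z) + \<phi> 2 (fst z + snd z) - \<phi> 3 (fst z - snd z) + \<phi> 4 (ff \<tau> (fst z) * ff \<tau> (snd z)) * (ff \<tau> (fst z) * f1 \<tau> (snd z)) = 0)"

lemma AR_lin:
  assumes "AR \<tau> x0 y0 \<phi>" "AR \<tau> x0 y0 \<phi>'"
  shows "AR \<tau> x0 y0 (\<lambda>j w. a * \<phi> j w + b * \<phi>' j w)"
proof -
  have "\<forall>\<^sub>F z in nhds (x0, y0).
       (a * \<phi> 0 (fst z) + b * \<phi>' 0 (fst z)) + (a * \<phi> 2 (fst z + snd z) + b * \<phi>' 2 (fst z + snd z)) + (a * \<phi> 3 (fst z - snd z) + b * \<phi>' 3 (fst z - snd z))
       + (a * \<phi> 4 (ff \<tau> (fst z) * ff \<tau> (snd z)) + b * \<phi>' 4 (ff \<tau> (fst z) * ff \<tau> (snd z))) * (f1 \<tau> (fst z) * ff \<tau> (snd z)) = 0 \<and>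
       (a * \<phi> 1 (snd z) + b * \<phi>' 1 (snd z)) + (a * \<phi> 2 (fst z + snd z) + b * \<phi>' 2 (fst z + snd z)) - (a * \<phi> 3 (fst z - snd z) + b * \<phi>' 3 (fst z - snd z))
       + (a * \<phi> 4 (ff \<tau> (fst z) * ff \<tau> (snd z)) + b * \<phi>' 4 (ff \<tau> (fst z) * ff \<tau> (snd z))) * (ff \<tau> (fst z) * f1 \<tau> (snd z)) = 0"
    using assms[unfolded AR_def, THEN conjunct2, THEN conjunct2, THEN conjunct2, THEN conjunct2, THEN conjunct2]
  proof eventually_elim
    case (elim z)
    have lin: "a * A + b * A' + (a * C + b * C') + (a * E + b * E') + (a * F + b * F') * U = 0"
      if "A + C + E + F * U = 0" "A' + C' + E' + F' * U = 0" for A A' C C' E E' F F' U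
    proof -
      have "a * A + b * A' + (a * C + b * C') + (a * E + b * E') + (a * F + b * F') * U = a * (A + C + E + F * U) + b * (A' + C' + E' + F' * U)"
        by (simp add: algebra_simps)
      thus ?thesis unfolding that by simp
    qed
    have lin': "a * B + b * B' + (a * C + b * C') - (a * E + b * E') + (a * F + b * F') * U = 0"
      if "B + C - E + F * U = 0" "B' + C' - E' + F' * U = 0" for B B' C C' E E' F F' U
      using lin[of B C "- E" F U B' C' "- E'" F'] that by (simp add: algebra_simps)
    show ?case by (intro conjI lin lin') (use elim in simp_all)
  qed
  thus ?thesis using assms unfolding AR_def by (auto intro!: analytic_intros)
qed

text \<open>The last three rows are the relations obtained from \<open>du / u\<close>, \<open>d log (1 + u)\<close> and \<open>d log (1 - u)\<close>.\<close>

definition EB :: "complex \<Rightarrow> nat \<Rightarrow> nat \<Rightarrow> complex \<Rightarrow> complex" where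
  "EB \<tau> i j = [[\<lambda>_. 1, \<lambda>_. 1, \<lambda>_. - 1, \<lambda>_. 0, \<lambda>_. 0],
    [\<lambda>_. 1, \<lambda>_. - 1, \<lambda>_. 0, \<lambda>_. - 1, \<lambda>_. 0],
    [\<lambda>t. 2 * t, \<lambda>t. 2 * t, \<lambda>t. - t, \<lambda>t. - t, \<lambda>_. 0],
    [D \<tau>, D \<tau>, \<lambda>_. 0, \<lambda>_. 0, \<lambda>w. - 1 / w],
    [\<lambda>t. - dl (t4 \<tau>) t, \<lambda>t. - dl (t4 \<tau>) t, dl (tp \<tau>), dl (tq \<tau>), \<lambda>w. - 1 / (1 + w)],
    [\<lambda>t. - dl (t4 \<tau>) t, \<lambda>t. - dl (t4 \<tau>) t, dl (tq \<tau>), dl (tp \<tau>), \<lambda>w. 1 / (1 - w)]] ! i ! j"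

lemma D_analytic: "Im \<tau> > 0 \<Longrightarrow> Dden \<tau> x \<noteq> 0 \<Longrightarrow> D \<tau> analytic_on {x}"
proof -
  assume tau: "Im \<tau> > 0" and nz: "Dden \<tau> x \<noteq> 0"
  have op: "open {x. Dden \<tau> x \<noteq> 0}"
    by (intro open_Collect_neq holomorphic_on_imp_continuous_on Dden_entire[OF tau] continuous_on_const)
  have "D \<tau> holomorphic_on {x. Dden \<tau> x \<noteq> 0}"
    unfolding holomorphic_on_open[OF op] using D_has_derivative[OF tau] by blast
  thus ?thesis unfolding analytic_at using op nz by blast
qed

lemma EB_equations:
  assumes r: "reg \<tau> x y" and "i < 6"
  shows "EB \<tau> i 0 x + EB \<tau> i 2 (x + y) + EB \<tau> i 3 (x - y) + EB \<tau> i 4 (ff \<tau> x * ff \<tau> y) * (f1 \<tau> x * ff \<tau> y) = 0"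
    "EB \<tau> i 1 y + EB \<tau> i 2 (x + y) - EB \<tau> i 3 (x - y) + EB \<tau> i 4 (ff \<tau> x * ff \<tau> y) * (ff \<tau> x * f1 \<tau> y) = 0"
proof -
  note R = regD[OF r] and N = reg_nonzero[OF r]
  note e = u_log_partials[OF R(1-3) N(1-4)]
  have i: "i = 0 \<or> i = 1 \<or> i = 2 \<or> i = 3 \<or> i = 4 \<or> i = 5" using assms(2) by auto
  show "EB \<tau> i 0 x + EB \<tau> i 2 (x + y) + EB \<tau> i 3 (x - y) + EB \<tau> i 4 (ff \<tau> x * ff \<tau> y) * (f1 \<tau> x * ff \<tau> y) = 0"
    using i
  proof (elim disjE)
    assume "i = 3"
    thus ?thesis using R by (simp add: EB_def)
  next
    assume "i = 4"
    thus ?thesis using e(3) by (simp add: EB_def algebra_simps)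
  next
    assume "i = 5"
    thus ?thesis using e(5) by (simp add: EB_def algebra_simps)
  qed (simp_all add: EB_def)
  show "EB \<tau> i 1 y + EB \<tau> i 2 (x + y) - EB \<tau> i 3 (x - y) + EB \<tau> i 4 (ff \<tau> x * ff \<tau> y) * (ff \<tau> x * f1 \<tau> y) = 0"
    using i
  proof (elim disjE)
    assume "i = 3"
    thus ?thesis using R by (simp add: EB_def)
  next
    assume "i = 4"
    thus ?thesis using e(4) by (simp add: EB_def algebra_simps)
  next
    assume "i = 5"
    thus ?thesis using e(6) by (simp add: EB_def algebra_simps)
  qed (simp_all add: EB_def)
qed

lemma EB_AR:
  assumes r: "reg \<tau> x y" and "i < 6"
  shows "AR \<tau> x y (EB \<tau> i)"
proof -
  note R = regD[OF r] and N = reg_nonzero[OF r]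
  have i: "i = 0 \<or> i = 1 \<or> i = 2 \<or> i = 3 \<or> i = 4 \<or> i = 5" using assms(2) by auto
  have dx: "Dden \<tau> x \<noteq> 0" "Dden \<tau> y \<noteq> 0" using R by (simp_all add: Dden_def)
  have inv: "(\<lambda>w. - 1 / w) analytic_on {ff \<tau> x * ff \<tau> y}" "(\<lambda>w. - 1 / (1 + w)) analytic_on {ff \<tau> x * ff \<tau> y}" "(\<lambda>w. 1 / (1 - w)) analytic_on {ff \<tau> x * ff \<tau> y}"
    using N R by (auto intro!: analytic_intros)
  note an = D_analytic[OF R(1) dx(1)] D_analytic[OF R(1) dx(2)]
    dl_analytic[OF theta_entire(2)[OF R(1)] R(2)] dl_analytic[OF theta_entire(2)[OF R(1)] R(3)]
    dl_analytic[OF theta_entire(3)[OF R(1)] N(1)] dl_analytic[OF theta_entire(3)[OF R(1)] N(3)]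
    dl_analytic[OF theta_entire(4)[OF R(1)] N(2)] dl_analytic[OF theta_entire(4)[OF R(1)] N(4)]
  have "EB \<tau> i 0 analytic_on {x} \<and> EB \<tau> i 1 analytic_on {y} \<and> EB \<tau> i 2 analytic_on {x + y} \<and> EB \<tau> i 3 analytic_on {x - y} \<and>
    EB \<tau> i 4 analytic_on {ff \<tau> x * ff \<tau> y}"
  proof -
    have "(\<lambda>t. 2 * t :: complex) analytic_on S" "uminus analytic_on (S :: complex set)" for S
      using analytic_on_mult[OF analytic_on_const[of 2] analytic_on_ident, of S] analytic_on_neg[OF analytic_on_ident, of S] by simp_all
    moreover note analytic_on_neg[OF an(3)] analytic_on_neg[OF an(4)]
    ultimately show ?thesis
      using i by (elim disjE) (use an inv in \<open>simp_all add: EB_def\<close>)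
  qed
  moreover have "\<forall>\<^sub>F z in nhds (x, y).
     EB \<tau> i 0 (fst z) + EB \<tau> i 2 (fst z + snd z) + EB \<tau> i 3 (fst z - snd z) + EB \<tau> i 4 (ff \<tau> (fst z) * ff \<tau> (snd z)) * (f1 \<tau> (fst z) * ff \<tau> (snd z)) = 0 \<and>
     EB \<tau> i 1 (snd z) + EB \<tau> i 2 (fst z + snd z) - EB \<tau> i 3 (fst z - snd z) + EB \<tau> i 4 (ff \<tau> (fst z) * ff \<tau> (snd z)) * (ff \<tau> (fst z) * f1 \<tau> (snd z)) = 0"
    using reg_eventually[OF r]
  proof eventually_elim
    case (elim z)
    show ?case using EB_equations[OF elim assms(2)] by blast
  qed
  ultimately show ?thesis unfolding AR_def by blast
qed

lemma AR_zero: "AR \<tau> x y (\<lambda>_ _. 0)"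
  unfolding AR_def by (auto intro!: analytic_intros)

lemma AR_sum:
  assumes "finite I" "\<And>i. i \<in> I \<Longrightarrow> AR \<tau> x y (\<phi> i)"
  shows "AR \<tau> x y (\<lambda>j w. \<Sum>i\<in>I. c i * \<phi> i j w)"
  using assms
proof (induction I rule: finite_induct)
  case empty
  thus ?case using AR_zero by simp
next
  case (insert i I)
  have "AR \<tau> x y (\<lambda>j w. c i * \<phi> i j w + 1 * (\<Sum>i\<in>I. c i * \<phi> i j w))"
    by (rule AR_lin) (use insert in auto)
  thus ?case using insert(1,2) by simp
qed


section \<open>The last component of an abelian relation\<close>

lemma analytic_at_eventually:
  assumes "f analytic_on {a}"
  shows "\<forall>\<^sub>F s in nhds a. f analytic_on {s}" "\<forall>\<^sub>F s in nhds a. (f has_field_derivative deriv f s) (at s)"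
proof -
  obtain S where S: "open S" "a \<in> S" "f holomorphic_on S" using assms analytic_at by blast
  have *: "\<forall>\<^sub>F s in nhds a. s \<in> S" using S eventually_nhds by blast
  show "\<forall>\<^sub>F s in nhds a. f analytic_on {s}" using * by eventually_elim (use S analytic_at in blast)
  show "\<forall>\<^sub>F s in nhds a. (f has_field_derivative deriv f s) (at s)"
    using * by eventually_elim (use S holomorphic_derivI in blast)
qed

text \<open>A relation at one point is a relation at all nearby points. This turns statements about
  jets at the base point into differential equations on a neighbourhood.\<close>

lemma AR_eventually:
  assumes r: "reg \<tau> x y" and AR: "AR \<tau> x y \<phi>"
  shows "\<forall>\<^sub>F z in nhds (x, y). AR \<tau> (fst z) (snd z) \<phi>"
proof -
  note R = regD[OF r]
  note A = AR[unfolded AR_def]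
  note an = A[THEN conjunct1] A[THEN conjunct2, THEN conjunct1] A[THEN conjunct2, THEN conjunct2, THEN conjunct1]
    A[THEN conjunct2, THEN conjunct2, THEN conjunct2, THEN conjunct1] A[THEN conjunct2, THEN conjunct2, THEN conjunct2, THEN conjunct2, THEN conjunct1]
  note eq = A[THEN conjunct2, THEN conjunct2, THEN conjunct2, THEN conjunct2, THEN conjunct2]
  note c = isCont_u[OF r]
  have "\<forall>\<^sub>F z in nhds (x, y). \<phi> 0 analytic_on {fst z}"
    by (rule isCont_eventually[where f = "fst" and P = "\<lambda>w. \<phi> 0 analytic_on {w}", OF _ refl]) (use analytic_at_eventually(1)[OF an(1)] in \<open>auto intro!: continuous_intros\<close>)
  moreover have "\<forall>\<^sub>F z in nhds (x, y). \<phi> 1 analytic_on {snd z}"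
    by (rule isCont_eventually[where f = "snd" and P = "\<lambda>w. \<phi> 1 analytic_on {w}", OF _ refl]) (use analytic_at_eventually(1)[OF an(2)] in \<open>auto intro!: continuous_intros\<close>)
  moreover have "\<forall>\<^sub>F z in nhds (x, y). \<phi> 2 analytic_on {fst z + snd z}"
    by (rule isCont_eventually[where f = "\<lambda>z. fst z + snd z" and P = "\<lambda>w. \<phi> 2 analytic_on {w}", OF _ refl]) (use analytic_at_eventually(1)[OF an(3)] in \<open>auto intro!: continuous_intros\<close>)
  moreover have "\<forall>\<^sub>F z in nhds (x, y). \<phi> 3 analytic_on {fst z - snd z}"
    by (rule isCont_eventually[where f = "\<lambda>z. fst z - snd z" and P = "\<lambda>w. \<phi> 3 analytic_on {w}", OF _ refl]) (use analytic_at_eventually(1)[OF an(4)] in \<open>auto intro!: continuous_intros\<close>)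
  moreover have "\<forall>\<^sub>F z in nhds (x, y). \<phi> 4 analytic_on {ff \<tau> (fst z) * ff \<tau> (snd z)}"
    by (rule isCont_eventually[where P = "\<lambda>w. \<phi> 4 analytic_on {w}", OF c refl]) (use analytic_at_eventually(1)[OF an(5)] in simp)
  moreover note eventually_eventually[THEN iffD2, OF eq]
  ultimately show ?thesis unfolding AR_def
    by eventually_elim simp
qed

text \<open>The mixed derivative of the first equation of \<open>AR\<close> is of the form \<open>p(x + y) + q(x - y)\<close>, whose second
  derivatives in \<open>x\<close> and in \<open>y\<close> agree.  They are compared here through the even parts of its restrictions.\<close>

lemma even_part_second_order:
  fixes g1 g2 :: "complex \<Rightarrow> complex"
  assumes "((\<lambda>t. g1 t / t\<^sup>2) \<longlongrightarrow> c1) (at 0)" "((\<lambda>t. g2 t / t\<^sup>2) \<longlongrightarrow> c2) (at 0)"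
    and "\<forall>\<^sub>F t in nhds 0. g1 t + g1 (- t) = g2 t + g2 (- t)"
  shows "c1 = c2"
proof -
  have m: "filterlim uminus (at (0::complex)) (at 0)"
    using filterlim_at[of uminus 0 UNIV "at (0::complex)"] tendsto_minus[OF tendsto_ident_at[of "0::complex" UNIV]]
    by (auto simp: eventually_at_filter)
  have a: "((\<lambda>t. (g t + g (- t)) / t\<^sup>2) \<longlongrightarrow> c + c) (at 0)" if "((\<lambda>t. g t / t\<^sup>2) \<longlongrightarrow> c) (at 0)"
    for g :: "complex \<Rightarrow> complex" and c
    using tendsto_add[OF that filterlim_compose[OF that m]] by (simp add: add_divide_distrib)
  have "\<forall>\<^sub>F t in at 0. (g1 t + g1 (- t)) / t\<^sup>2 = (g2 t + g2 (- t)) / t\<^sup>2"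
    using assms(3) unfolding eventually_at_filter by eventually_elim simp
  hence "((\<lambda>t. (g2 t + g2 (- t)) / t\<^sup>2) \<longlongrightarrow> c1 + c1) (at 0)"
    by (rule Lim_transform_eventually[OF a[OF assms(1)]])
  from tendsto_unique[OF _ this a[OF assms(2)]] show ?thesis by simp
qed

lemma double_zero_second_order:
  fixes v M :: "complex \<Rightarrow> complex"
  assumes "(v has_field_derivative d) (at x)" "(M \<longlongrightarrow> m) (at x)"
  shows "((\<lambda>t. M (x + t) * (v (x + t) - v x)\<^sup>2 / t\<^sup>2) \<longlongrightarrow> m * d\<^sup>2) (at 0)"
proof -
  have "((\<lambda>t. (v (x + t) - v x) / t) \<longlongrightarrow> d) (at 0)" using assms(1) by (simp add: DERIV_def)
  moreover have "((\<lambda>t. M (x + t)) \<longlongrightarrow> m) (at 0)" using assms(2) by (simp add: LIM_offset_zero_iff)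
  ultimately have "((\<lambda>t. M (x + t) * ((v (x + t) - v x) / t)\<^sup>2) \<longlongrightarrow> m * d\<^sup>2) (at 0)" by (intro tendsto_intros)
  thus ?thesis by (simp add: power_divide)
qed

lemma AR_mixed_derivative:
  assumes r: "reg \<tau> x y" and AR: "AR \<tau> x y \<phi>"
    and \<Psi>: "\<And>s. s \<in> S \<Longrightarrow> s * \<phi> 4 s = \<Psi> s" "open S" "ff \<tau> x * ff \<tau> y \<in> S"
    and d: "(\<Psi> has_field_derivative k) (at (ff \<tau> x * ff \<tau> y))"
  shows "f1 \<tau> x * f1 \<tau> y * k = - deriv (\<phi> 2) (x + y) + deriv (\<phi> 3) (x - y)"
proof -
  note R = regD[OF r]
  note A = AR[unfolded AR_def]
  note eq = A[THEN conjunct2, THEN conjunct2, THEN conjunct2, THEN conjunct2, THEN conjunct2]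
  have dphi: "(\<phi> 2 has_field_derivative deriv (\<phi> 2) (x + y)) (at (x + y))" "(\<phi> 3 has_field_derivative deriv (\<phi> 3) (x - y)) (at (x - y))"
    using A eventually_nhds_x_imp_x[OF analytic_at_eventually(2)] by simp_all
  have ffy: "(ff \<tau> has_field_derivative f1 \<tau> y) (at y)" by (rule ff_has_derivative'[OF R(1,3)])
  have cy: "isCont (\<lambda>t. (x, t)) y" by (intro isCont_Pair continuous_const continuous_ident)
  have cu: "isCont (\<lambda>t. ff \<tau> x * ff \<tau> t) y" using DERIV_isCont[OF ffy] by (intro continuous_intros)
  have "\<forall>\<^sub>F w in nhds (ff \<tau> x * ff \<tau> y). w \<in> S" using \<Psi>(2,3) eventually_nhds by blast
  from isCont_eventually[OF cu refl this] have "\<forall>\<^sub>F t in nhds y. ff \<tau> x * ff \<tau> t \<in> S" .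
  moreover have "\<forall>\<^sub>F t in nhds y. \<phi> 0 x + \<phi> 2 (x + t) + \<phi> 3 (x - t) + \<phi> 4 (ff \<tau> x * ff \<tau> t) * (f1 \<tau> x * ff \<tau> t) = 0"
    using isCont_eventually[OF cy refl eq] by eventually_elim simp
  ultimately have ev: "\<forall>\<^sub>F t in nhds y. \<phi> 0 x + \<phi> 2 (x + t) + \<phi> 3 (x - t) + f1 \<tau> x / ff \<tau> x * \<Psi> (ff \<tau> x * ff \<tau> t) = 0"
  proof eventually_elim
    case (elim t)
    have "f1 \<tau> x / ff \<tau> x * \<Psi> (ff \<tau> x * ff \<tau> t) = \<phi> 4 (ff \<tau> x * ff \<tau> t) * (f1 \<tau> x * ff \<tau> t)"
      unfolding \<Psi>(1)[OF elim(1), symmetric] using R(10) by simp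
    thus ?case using elim(2) by simp
  qed
  have d2: "((\<lambda>t. \<phi> 2 (x + t)) has_field_derivative deriv (\<phi> 2) (x + y)) (at y)"
    using DERIV_chain2[where g = "\<lambda>t. x + t", OF dphi(1) DERIV_add[OF DERIV_const DERIV_ident]] by simp
  have d3: "((\<lambda>t. \<phi> 3 (x - t)) has_field_derivative - deriv (\<phi> 3) (x - y)) (at y)"
    using DERIV_chain2[where g = "\<lambda>t. x - t", OF dphi(2) DERIV_diff[OF DERIV_const DERIV_ident]] by simp
  have d4: "((\<lambda>t. \<Psi> (ff \<tau> x * ff \<tau> t)) has_field_derivative k * (ff \<tau> x * f1 \<tau> y)) (at y)"
    using DERIV_chain2[OF d DERIV_cmult[OF ffy]] by simp
  have "((\<lambda>t. \<phi> 0 x + \<phi> 2 (x + t) + \<phi> 3 (x - t) + f1 \<tau> x / ff \<tau> x * \<Psi> (ff \<tau> x * ff \<tau> t)) has_field_derivative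
    0 + deriv (\<phi> 2) (x + y) + - deriv (\<phi> 3) (x - y) + f1 \<tau> x / ff \<tau> x * (k * (ff \<tau> x * f1 \<tau> y))) (at y)"
    by (intro DERIV_add DERIV_const d2 d3 DERIV_cmult d4)
  moreover have "((\<lambda>t. \<phi> 0 x + \<phi> 2 (x + t) + \<phi> 3 (x - t) + f1 \<tau> x / ff \<tau> x * \<Psi> (ff \<tau> x * ff \<tau> t)) has_field_derivative 0) (at y)"
    unfolding DERIV_cong_ev[OF refl ev refl] by simp
  ultimately have "deriv (\<phi> 2) (x + y) - deriv (\<phi> 3) (x - y) + f1 \<tau> x / ff \<tau> x * (k * (ff \<tau> x * f1 \<tau> y)) = 0"
    using DERIV_unique by fastforce
  moreover have "f1 \<tau> x / ff \<tau> x * (k * (ff \<tau> x * f1 \<tau> y)) = f1 \<tau> x * f1 \<tau> y * k" using R(10) by simp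
  ultimately have "deriv (\<phi> 2) (x + y) - deriv (\<phi> 3) (x - y) + f1 \<tau> x * f1 \<tau> y * k = 0" by simp
  moreover have "w = - p + q" if "p - q + w = 0" for p q w :: complex using that by (simp add: algebra_simps)
  ultimately show ?thesis by blast
qed

lemma AR_cubic_jet:
  assumes r: "reg \<tau> x y" and AR: "AR \<tau> x y \<phi>"
    and H: "H analytic_on {a}" and a: "a = ff \<tau> x * ff \<tau> y"
    and jet: "\<forall>\<^sub>F s in nhds a. s * \<phi> 4 s = (s - a) ^ 3 * H s"
  shows "H a = 0"
proof -
  note R = regD[OF r]
  obtain S where S: "open S" "a \<in> S" "\<And>s. s \<in> S \<Longrightarrow> s * \<phi> 4 s = (s - a) ^ 3 * H s" "\<And>s. s \<in> S \<Longrightarrow> (H has_field_derivative deriv H s) (at s)"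
    using eventually_conj[OF jet analytic_at_eventually(2)[OF H]] unfolding eventually_nhds by blast
  define K where "K = (\<lambda>s. 3 * H s + (s - a) * deriv H s)"
  have dPsi: "((\<lambda>s. (s - a) ^ 3 * H s) has_field_derivative (s - a)\<^sup>2 * K s) (at s)" if "s \<in> S" for s
  proof -
    have "((\<lambda>s. (s - a) ^ 3 * H s) has_field_derivative 3 * (s - a)\<^sup>2 * H s + deriv H s * (s - a) ^ 3) (at s)"
      by (rule DERIV_cong[OF DERIV_mult[OF _ S(4)[OF that]]]) (auto intro!: derivative_eq_intros)
    thus ?thesis by (simp add: K_def power2_eq_square power3_eq_cube algebra_simps)
  qed
  define uu where "uu = (\<lambda>z. ff \<tau> (fst z) * ff \<tau> (snd z))"
  have "isCont uu (x, y)"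
    using holo2_at_isCont[of "u_theta \<tau>" "(x, y)"] r unfolding reg_def regular_at_def u_theta_eq' uu_def by (simp add: case_prod_beta')
  moreover have "\<forall>\<^sub>F w in nhds (uu (x, y)). w \<in> S"
    using S(1,2) a eventually_nhds[of "\<lambda>w. w \<in> S" a] by (auto simp: uu_def)
  ultimately have "\<forall>\<^sub>F z in nhds (x, y). uu z \<in> S" using isCont_eventually by blast
  with reg_eventually[OF r] AR_eventually[OF r AR] have G: "\<forall>\<^sub>F z in nhds (x, y).
     f1 \<tau> (fst z) * f1 \<tau> (snd z) * ((uu z - a)\<^sup>2 * K (uu z)) = - deriv (\<phi> 2) (fst z + snd z) + deriv (\<phi> 3) (fst z - snd z)"
  proof eventually_elim
    case (elim z)
    show ?case
      by (rule AR_mixed_derivative[OF elim(1,2) S(3) S(1)]) (use elim(3) dPsi in \<open>simp_all add: uu_def\<close>)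
  qed
  define G where "G = (\<lambda>z. f1 \<tau> (fst z) * f1 \<tau> (snd z) * ((uu z - a)\<^sup>2 * K (uu z)))"
  have ev: "\<forall>\<^sub>F t in nhds 0. G (x + e * t, y + e' * t) = - deriv (\<phi> 2) (x + y + (e + e') * t) + deriv (\<phi> 3) (x - y + (e - e') * t)" for e e'
  proof -
    have "isCont (\<lambda>t. (x + e * t, y + e' * t)) 0" by (intro isCont_Pair continuous_intros)
    from isCont_eventually[OF this _ G[folded G_def]]
    have *: "\<forall>\<^sub>F t in nhds 0. G (x + e * t, y + e' * t) = - deriv (\<phi> 2) ((x + e * t) + (y + e' * t)) + deriv (\<phi> 3) ((x + e * t) - (y + e' * t))"
      by (simp add: G_def)
    have "(x + e * t) + (y + e' * t) = x + y + (e + e') * t" "(x + e * t) - (y + e' * t) = x - y + (e - e') * t" for t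
      by (simp_all add: algebra_simps)
    thus ?thesis using * by (simp only:)
  qed
  \<comment> \<open>Moving x by t and by -t, or y by t and by -t, produces the same arguments x + y
    + t, x + y - t, x - y + t and x - y - t.\<close>
  have sym: "\<forall>\<^sub>F t in nhds 0. G (x + t, y) + G (x + - t, y) = G (x, y + t) + G (x, y + - t)"
    using ev[of 1 0] ev[of "-1" 0] ev[of 0 1] ev[of 0 "-1"] by eventually_elim simp
  have cK: "isCont K a"
  proof -
    have "isCont H a" using S(2,4) DERIV_isCont by blast
    moreover have "isCont (deriv H) a" using analytic_deriv[OF H] analytic_at_imp_isCont by blast
    ultimately show ?thesis unfolding K_def by (intro continuous_intros)
  qed
  have cf: "isCont (f1 \<tau>) x" "isCont (f1 \<tau>) y" "isCont (ff \<tau>) x" "isCont (ff \<tau>) y"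
    using t4_analytic_quotient[OF R(1,2)] t4_analytic_quotient[OF R(1,3)] analytic_at_imp_isCont by blast+
  note df = ff_has_derivative'[OF R(1,2)] ff_has_derivative'[OF R(1,3)]
  have K1: "isCont (\<lambda>t. K (ff \<tau> t * ff \<tau> y)) x" "isCont (\<lambda>t. K (ff \<tau> x * ff \<tau> t)) y"
    using continuous_at_compose[of x "\<lambda>t. ff \<tau> t * ff \<tau> y" K] continuous_at_compose[of y "\<lambda>t. ff \<tau> x * ff \<tau> t" K] cf cK a
    by (auto simp: o_def intro!: continuous_intros)
  have L1: "((\<lambda>t. f1 \<tau> (x + t) * f1 \<tau> y * K (ff \<tau> (x + t) * ff \<tau> y) * (ff \<tau> (x + t) * ff \<tau> y - ff \<tau> x * ff \<tau> y)\<^sup>2 / t\<^sup>2)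
     \<longlongrightarrow> f1 \<tau> x * f1 \<tau> y * K (ff \<tau> x * ff \<tau> y) * (f1 \<tau> x * ff \<tau> y)\<^sup>2) (at 0)"
    by (rule double_zero_second_order[where M = "\<lambda>t. f1 \<tau> t * f1 \<tau> y * K (ff \<tau> t * ff \<tau> y)" and v = "\<lambda>t. ff \<tau> t * ff \<tau> y"])
      (use DERIV_cmult_right[OF df(1)] cf K1 in \<open>auto simp: isCont_def intro!: tendsto_intros\<close>)
  have L2: "((\<lambda>t. f1 \<tau> x * f1 \<tau> (y + t) * K (ff \<tau> x * ff \<tau> (y + t)) * (ff \<tau> x * ff \<tau> (y + t) - ff \<tau> x * ff \<tau> y)\<^sup>2 / t\<^sup>2)
     \<longlongrightarrow> f1 \<tau> x * f1 \<tau> y * K (ff \<tau> x * ff \<tau> y) * (ff \<tau> x * f1 \<tau> y)\<^sup>2) (at 0)"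
    by (rule double_zero_second_order[where M = "\<lambda>t. f1 \<tau> x * f1 \<tau> t * K (ff \<tau> x * ff \<tau> t)" and v = "\<lambda>t. ff \<tau> x * ff \<tau> t"])
      (use DERIV_cmult[OF df(2)] cf K1 in \<open>auto simp: isCont_def intro!: tendsto_intros\<close>)
  have "f1 \<tau> x * f1 \<tau> y * K a * (f1 \<tau> x * ff \<tau> y)\<^sup>2 = f1 \<tau> x * f1 \<tau> y * K a * (ff \<tau> x * f1 \<tau> y)\<^sup>2"
  proof (rule even_part_second_order[OF _ _ sym])
    show "((\<lambda>t. G (x + t, y) / t\<^sup>2) \<longlongrightarrow> f1 \<tau> x * f1 \<tau> y * K a * (f1 \<tau> x * ff \<tau> y)\<^sup>2) (at 0)"
      using L1 unfolding G_def uu_def a by (simp add: mult_ac)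
    show "((\<lambda>t. G (x, y + t) / t\<^sup>2) \<longlongrightarrow> f1 \<tau> x * f1 \<tau> y * K a * (ff \<tau> x * f1 \<tau> y)\<^sup>2) (at 0)"
      using L2 unfolding G_def uu_def a by (simp add: mult_ac)
  qed
  hence "K a = 0" using R(12-14) by simp
  thus ?thesis by (simp add: K_def)
qed


lemma deriv_quadratic:
  fixes \<alpha> \<beta> \<gamma> :: complex
  shows "deriv (\<lambda>w. \<alpha> + \<beta> * w + \<gamma> * w\<^sup>2) = (\<lambda>w. \<beta> + 2 * \<gamma> * w)" "deriv (\<lambda>w. \<beta> + 2 * \<gamma> * w) = (\<lambda>w. 2 * \<gamma>)"
  by (auto intro!: ext DERIV_imp_deriv derivative_eq_intros)

lemma cubic_jet:
  assumes an: "\<rho> analytic_on {a}" and nz: "(deriv ^^ 3) \<rho> a \<noteq> (0 :: complex)"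
  obtains \<alpha> \<beta> \<gamma> g where "g analytic_on {a}" "g a \<noteq> 0" "\<forall>\<^sub>F w in nhds a. \<rho> w - (\<alpha> + \<beta> * w + \<gamma> * w\<^sup>2) = (w - a) ^ 3 * g w"
proof -
  define \<gamma> where "\<gamma> = deriv (deriv \<rho>) a / 2"
  define \<beta> where "\<beta> = deriv \<rho> a - 2 * \<gamma> * a"
  define \<alpha> where "\<alpha> = \<rho> a - \<beta> * a - \<gamma> * a\<^sup>2"
  define R where "R = (\<lambda>w. \<alpha> + \<beta> * w + \<gamma> * w\<^sup>2)"
  define d where "d = (\<lambda>w. \<rho> w - R w)"
  obtain S where S: "open S" "a \<in> S" "\<rho> holomorphic_on S" using an analytic_at by blast
  have R: "R holomorphic_on S" unfolding R_def by (intro holomorphic_intros)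
  have hd: "(deriv ^^ n) d a = (deriv ^^ n) \<rho> a - (deriv ^^ n) R a" for n
    unfolding d_def by (rule higher_deriv_diff[OF S(3) R S(1,2)])
  have R1: "deriv R = (\<lambda>w. \<beta> + 2 * \<gamma> * w)" and R2: "deriv (deriv R) = (\<lambda>w. 2 * \<gamma>)"
    unfolding R_def deriv_quadratic by (rule refl)+
  have d0: "d a = 0" by (simp add: d_def R_def \<alpha>_def)
  have dnz: "(deriv ^^ 3) d a \<noteq> 0" unfolding hd using nz by (simp add: numeral_3_eq_3 R1 deriv_quadratic)
  have dz: "(deriv ^^ i) d a = 0" if "0 < i" "i < 3" for i
  proof -
    have "i = 1 \<or> i = Suc (Suc 0)" using that by auto
    thus ?thesis unfolding hd by (elim disjE) (simp_all add: R1 deriv_quadratic \<beta>_def \<gamma>_def)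
  qed
  have dh: "d holomorphic_on S" unfolding d_def by (intro holomorphic_intros S R)
  obtain g r where g: "0 < r" "g holomorphic_on ball a r" "\<And>w. w \<in> ball a r \<Longrightarrow> d w - d a = (w - a) ^ 3 * g w"
    "\<And>w. w \<in> ball a r \<Longrightarrow> g w \<noteq> 0"
    by (rule holomorphic_factor_order_of_zero[OF dh S(1,2) _ dnz dz]) (simp, assumption+, blast)
  show ?thesis
  proof (rule that[of g \<alpha> \<beta> \<gamma>])
    show "g analytic_on {a}" using g(1,2) analytic_at[of g a] by (auto intro!: exI[of _ "ball a r"])
    show "g a \<noteq> 0" using g by simp
    have "\<forall>\<^sub>F w in nhds a. w \<in> ball a r" using g(1) by (intro eventually_nhds_in_open) auto
    thus "\<forall>\<^sub>F w in nhds a. \<rho> w - (\<alpha> + \<beta> * w + \<gamma> * w\<^sup>2) = (w - a) ^ 3 * g w"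
    proof eventually_elim
      case (elim w)
      show ?case using g(3)[OF elim] unfolding d0 unfolding d_def R_def by simp
    qed
  qed
qed

lemma third_deriv_0_imp_quadratic:
  assumes an: "\<rho> analytic_on {a}" and z: "\<forall>\<^sub>F w in nhds a. (deriv ^^ 3) \<rho> w = (0 :: complex)"
  obtains \<alpha> \<beta> \<gamma> where "\<forall>\<^sub>F w in nhds a. \<rho> w = \<alpha> + \<beta> * w + \<gamma> * w\<^sup>2"
proof -
  obtain S where S: "open S" "a \<in> S" "\<rho> holomorphic_on S" using an analytic_at by blast
  then obtain r where r: "r > 0" "ball a r \<subseteq> S" using open_contains_ball by blast
  have h: "\<rho> holomorphic_on ball a r" using S(3) r(2) by (rule holomorphic_on_subset)
  have z': "(deriv ^^ n) ((deriv ^^ 3) \<rho>) a = 0" for n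
  proof -
    have "(deriv ^^ n) ((deriv ^^ 3) \<rho>) a = (deriv ^^ n) (\<lambda>_. 0) a" by (rule higher_deriv_cong_ev[OF z refl])
    thus ?thesis by simp
  qed
  have zero: "(deriv ^^ n) \<rho> a = 0" if "n \<notin> {..<3}" for n
  proof -
    have "n = (n - 3) + 3" using that by simp
    hence "(deriv ^^ n) \<rho> a = (deriv ^^ (n - 3)) ((deriv ^^ 3) \<rho>) a" by (metis funpow_add comp_apply)
    thus ?thesis using z' by simp
  qed
  define c where "c = (\<lambda>n. (deriv ^^ n) \<rho> a / fact n)"
  have "\<rho> w = c 0 + c 1 * (w - a) + c 2 * (w - a)\<^sup>2" if w: "w \<in> ball a r" for w
  proof -
    have "(\<lambda>n. (deriv ^^ n) \<rho> a / fact n * (w - a) ^ n) sums (\<Sum>n<3. (deriv ^^ n) \<rho> a / fact n * (w - a) ^ n)"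
      by (rule sums_finite) (use zero in auto)
    with holomorphic_power_series[OF h w] have "\<rho> w = (\<Sum>n<3. (deriv ^^ n) \<rho> a / fact n * (w - a) ^ n)" by (rule sums_unique2)
    thus ?thesis by (simp add: numeral_3_eq_3 numeral_2_eq_2 c_def)
  qed
  moreover have "c 0 + c 1 * (w - a) + c 2 * (w - a)\<^sup>2 = (c 0 - c 1 * a + c 2 * a\<^sup>2) + (c 1 - 2 * c 2 * a) * w + c 2 * w\<^sup>2" for w
    by (simp add: power2_eq_square algebra_simps)
  ultimately have q: "\<rho> w = (c 0 - c 1 * a + c 2 * a\<^sup>2) + (c 1 - 2 * c 2 * a) * w + c 2 * w\<^sup>2" if "w \<in> ball a r" for w
    using that by simp
  have "\<forall>\<^sub>F w in nhds a. w \<in> ball a r" using r(1) by (intro eventually_nhds_in_open) auto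
  hence "\<forall>\<^sub>F w in nhds a. \<rho> w = (c 0 - c 1 * a + c 2 * a\<^sup>2) + (c 1 - 2 * c 2 * a) * w + c 2 * w\<^sup>2"
    by eventually_elim (rule q)
  thus ?thesis by (rule that)
qed

lemma sum_lessThan_6: "(\<Sum>i<6. g i) = g 0 + g 1 + g 2 + g 3 + g 4 + g (5 :: nat)" for g :: "nat \<Rightarrow> complex"
  by (simp add: eval_nat_numeral)

text \<open>The coefficients of \<open>(\<alpha> + \<beta>w + \<gamma>w\<^sup>2) / (w(1 - w\<^sup>2))\<close> with respect to the last components of the relations \<open>EB\<close>.\<close>

definition pfc :: "complex \<Rightarrow> complex \<Rightarrow> complex \<Rightarrow> nat \<Rightarrow> complex" where
  "pfc \<alpha> \<beta> \<gamma> = (!) [0, 0, 0, - \<alpha>, (\<alpha> - \<beta> + \<gamma>) / 2, (\<alpha> + \<beta> + \<gamma>) / 2]"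

lemma EB_partial_fractions:
  fixes w \<alpha> \<beta> \<gamma> :: complex
  assumes "w \<noteq> 0" "1 + w \<noteq> 0" "1 - w \<noteq> 0"
  shows "w * (1 - w\<^sup>2) * (\<Sum>i<6. pfc \<alpha> \<beta> \<gamma> i * EB \<tau> i 4 w) = \<alpha> + \<beta> * w + \<gamma> * w\<^sup>2"
proof -
  define p q where "p = inverse (1 + w)" and "q = inverse (1 - w)"
  have pq: "(1 + w) * p = 1" "(1 - w) * q = 1" using assms by (simp_all add: p_def q_def)
  define A B C where "A = \<alpha>" and "B = (\<alpha> - \<beta> + \<gamma>) / 2" and "C = (\<alpha> + \<beta> + \<gamma>) / 2"
  have s: "(\<Sum>i<6. pfc \<alpha> \<beta> \<gamma> i * EB \<tau> i 4 w) = A / w - B * p + C * q"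
  proof -
    have "pfc \<alpha> \<beta> \<gamma> 0 = 0" "pfc \<alpha> \<beta> \<gamma> 1 = 0" "pfc \<alpha> \<beta> \<gamma> 2 = 0" "pfc \<alpha> \<beta> \<gamma> 3 = - A" "pfc \<alpha> \<beta> \<gamma> 4 = B" "pfc \<alpha> \<beta> \<gamma> 5 = C"
      by (simp_all add: pfc_def A_def B_def C_def)
    moreover have "EB \<tau> 3 4 w = - (1 / w)" "EB \<tau> 4 4 w = - p" "EB \<tau> 5 4 w = q"
      by (simp_all add: EB_def p_def q_def divide_inverse)
    ultimately show ?thesis unfolding sum_lessThan_6 by simp
  qed
  have "w * (1 - w\<^sup>2) * (A / w) = A * (1 - w\<^sup>2)" using assms(1) by simp
  moreover have "w * (1 - w\<^sup>2) * (x * p) = w * (1 - w) * x * ((1 + w) * p)" "w * (1 - w\<^sup>2) * (x * q) = w * (1 + w) * x * ((1 - w) * q)" for x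
    by (simp_all add: power2_eq_square algebra_simps)
  moreover have "w * (1 - w\<^sup>2) * (A / w - B * p + C * q) = w * (1 - w\<^sup>2) * (A / w) - w * (1 - w\<^sup>2) * (B * p) + w * (1 - w\<^sup>2) * (C * q)"
    by (simp only: right_diff_distrib distrib_left)
  ultimately have "w * (1 - w\<^sup>2) * (A / w - B * p + C * q) = A * (1 - w\<^sup>2) - w * (1 - w) * B + w * (1 + w) * C"
    by (simp only: pq mult_1_right mult.assoc)
  also have "\<dots> = A + (C - B) * w + (B + C - A) * w\<^sup>2" by (simp add: power2_eq_square algebra_simps)
  also have "C - B = \<beta>" by (simp add: B_def C_def field_simps)
  also have "B + C - A = \<gamma>" by (simp add: B_def C_def A_def field_simps)
  finally show ?thesis unfolding s by (simp add: A_def)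
qed

lemma AR_diff_EB:
  assumes r: "reg \<tau> x y" and "AR \<tau> x y \<phi>"
  shows "AR \<tau> x y (\<lambda>j w. \<phi> j w - (\<Sum>i<6. c i * EB \<tau> i j w))"
proof -
  have "AR \<tau> x y (\<lambda>j w. \<Sum>i<6. c i * EB \<tau> i j w)" by (rule AR_sum) (use EB_AR[OF r] in auto)
  from AR_lin[OF assms(2) this, of 1 "- 1"] show ?thesis by simp
qed

lemma AR_third_deriv_0:
  assumes r: "reg \<tau> x y" and AR: "AR \<tau> x y \<phi>"
  shows "(deriv ^^ 3) (\<lambda>w. w * (1 - w\<^sup>2) * \<phi> 4 w) (ff \<tau> x * ff \<tau> y) = 0"
proof (rule ccontr)
  define a where "a = ff \<tau> x * ff \<tau> y"
  note R = regD[OF r] and N = reg_nonzero[OF r]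
  assume "(deriv ^^ 3) (\<lambda>w. w * (1 - w\<^sup>2) * \<phi> 4 w) (ff \<tau> x * ff \<tau> y) \<noteq> 0"
  hence nz: "(deriv ^^ 3) (\<lambda>w. w * (1 - w\<^sup>2) * \<phi> 4 w) a \<noteq> 0" by (simp add: a_def)
  have an4: "\<phi> 4 analytic_on {a}" using AR unfolding AR_def a_def by blast
  have an: "(\<lambda>w. w * (1 - w\<^sup>2) * \<phi> 4 w) analytic_on {a}"
    by (intro analytic_intros an4)
  obtain \<alpha> \<beta> \<gamma> g where g: "g analytic_on {a}" "g a \<noteq> 0"
    "\<forall>\<^sub>F w in nhds a. w * (1 - w\<^sup>2) * \<phi> 4 w - (\<alpha> + \<beta> * w + \<gamma> * w\<^sup>2) = (w - a) ^ 3 * g w"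
    by (rule cubic_jet[OF an nz])
  define c where "c = pfc \<alpha> \<beta> \<gamma>"
  define \<phi>' where "\<phi>' = (\<lambda>j w. \<phi> j w - (\<Sum>i<6. c i * EB \<tau> i j w))"
  have AR': "AR \<tau> x y \<phi>'" unfolding \<phi>'_def by (rule AR_diff_EB[OF r AR])
  have a0: "a \<noteq> 0" "1 + a \<noteq> 0" "1 - a \<noteq> 0" using R N by (simp_all add: a_def)
  have sq: "1 - w\<^sup>2 = (1 - w) * (1 + w)" for w :: complex by (simp add: power2_eq_square algebra_simps)
  have H: "(\<lambda>w. g w / (1 - w\<^sup>2)) analytic_on {a}"
    by (intro analytic_intros g(1)) (use a0 sq in auto)
  have "\<forall>\<^sub>F w in nhds a. w \<noteq> 0 \<and> 1 + w \<noteq> 0 \<and> 1 - w \<noteq> 0"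
    unfolding a_def by (rule eventually_off_poles[OF r])
  with g(3) have "\<forall>\<^sub>F w in nhds a. w * \<phi>' 4 w = (w - a) ^ 3 * (g w / (1 - w\<^sup>2))"
  proof eventually_elim
    case (elim w)
    have nz: "w \<noteq> 0" "1 + w \<noteq> 0" "1 - w \<noteq> 0" "1 - w\<^sup>2 \<noteq> 0" using elim(2) sq by auto
    have "(1 - w\<^sup>2) * (w * \<phi>' 4 w) = (w - a) ^ 3 * g w"
    proof -
      have "(1 - w\<^sup>2) * (w * (\<phi> 4 w - X)) = w * (1 - w\<^sup>2) * \<phi> 4 w - w * (1 - w\<^sup>2) * X" for X by (simp add: algebra_simps)
      thus ?thesis unfolding \<phi>'_def using elim(1) EB_partial_fractions[OF nz(1-3), of \<alpha> \<beta> \<gamma> \<tau>] by (simp only: c_def)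
    qed
    hence "w * \<phi>' 4 w = (w - a) ^ 3 * g w / (1 - w\<^sup>2)" using nz(4) nonzero_mult_div_cancel_left by metis
    thus ?case by simp
  qed
  from AR_cubic_jet[OF r AR' H a_def this] show False using g(2) a0 sq by auto
qed

lemma AR_component_4:
  assumes r: "reg \<tau> x y" and AR: "AR \<tau> x y \<phi>"
  obtains c where "\<forall>\<^sub>F w in nhds (ff \<tau> x * ff \<tau> y). \<phi> 4 w = (\<Sum>i<6. c i * EB \<tau> i 4 w)"
proof -
  define a where "a = ff \<tau> x * ff \<tau> y"
  note R = regD[OF r] and N = reg_nonzero[OF r]
  define \<rho> where "\<rho> = (\<lambda>w. w * (1 - w\<^sup>2) * \<phi> 4 w)"
  have an4: "\<phi> 4 analytic_on {a}" using AR unfolding AR_def a_def by blast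
  have an: "\<rho> analytic_on {a}" unfolding \<rho>_def by (intro analytic_intros an4)
  have ev: "\<forall>\<^sub>F z in nhds (x, y). (deriv ^^ 3) \<rho> (ff \<tau> (fst z) * ff \<tau> (snd z)) = 0"
    using reg_eventually[OF r] AR_eventually[OF r AR]
    by eventually_elim (use AR_third_deriv_0 in \<open>simp add: \<rho>_def\<close>)
  obtain s g where s: "s > 0" "open (ff \<tau> ` ball y s)" and g: "g holomorphic_on (ff \<tau> ` ball y s)"
    "\<And>z. z \<in> ball y s \<Longrightarrow> g (ff \<tau> z) = z"
    using ff_local_inverse[OF R(1,7)] by blast
  have fy: "ff \<tau> y \<in> ff \<tau> ` ball y s" using s(1) by simp
  define k where "k = (\<lambda>w. w / ff \<tau> x)"
  have ka: "k a = ff \<tau> y" using R(10) by (simp add: k_def a_def)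
  have ck: "isCont k a" unfolding k_def using R(10) by (intro continuous_intros) auto
  have "isCont g (k a)" unfolding ka using holomorphic_on_imp_continuous_on[OF g(1)] s(2) fy continuous_on_eq_continuous_at by blast
  hence "isCont (\<lambda>w. g (k w)) a" using isCont_o2[OF ck] by blast
  hence c: "isCont (\<lambda>w. (x, g (k w))) a" by (intro isCont_Pair continuous_const)
  have 1: "\<forall>\<^sub>F w in nhds a. (deriv ^^ 3) \<rho> (ff \<tau> x * ff \<tau> (g (k w))) = 0"
    using isCont_eventually[OF c _ ev] g(2)[of y] s(1) by (simp add: ka)
  have 2: "\<forall>\<^sub>F w in nhds a. k w \<in> ff \<tau> ` ball y s"
    by (rule isCont_eventually[OF ck ka eventually_nhds_in_open[OF s(2) fy]])
  have "\<forall>\<^sub>F w in nhds a. (deriv ^^ 3) \<rho> w = 0"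
    using 1 2
  proof eventually_elim
    case (elim w)
    then obtain t where t: "t \<in> ball y s" "k w = ff \<tau> t" by blast
    have "ff \<tau> x * ff \<tau> (g (k w)) = ff \<tau> x * k w" unfolding t(2) g(2)[OF t(1)] ..
    also have "\<dots> = w" using R(10) by (simp add: k_def)
    finally show ?case using elim(1) by simp
  qed
  then obtain \<alpha> \<beta> \<gamma> where q: "\<forall>\<^sub>F w in nhds a. \<rho> w = \<alpha> + \<beta> * w + \<gamma> * w\<^sup>2"
    by (rule third_deriv_0_imp_quadratic[OF an])
  define c where "c = pfc \<alpha> \<beta> \<gamma>"
  have a0: "a \<noteq> 0" "1 + a \<noteq> 0" "1 - a \<noteq> 0" using R N by (simp_all add: a_def)
  have "\<forall>\<^sub>F w in nhds a. w \<noteq> 0 \<and> 1 + w \<noteq> 0 \<and> 1 - w \<noteq> 0"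
    unfolding a_def by (rule eventually_off_poles[OF r])
  with q have "\<forall>\<^sub>F w in nhds a. \<phi> 4 w = (\<Sum>i<6. c i * EB \<tau> i 4 w)"
  proof eventually_elim
    case (elim w)
    have "1 - w\<^sup>2 = (1 - w) * (1 + w)" by (simp add: power2_eq_square algebra_simps)
    hence nz: "w \<noteq> 0" "1 + w \<noteq> 0" "1 - w \<noteq> 0" "w * (1 - w\<^sup>2) \<noteq> 0" using elim(2) by auto
    have "w * (1 - w\<^sup>2) * \<phi> 4 w = w * (1 - w\<^sup>2) * (\<Sum>i<6. c i * EB \<tau> i 4 w)"
      using elim(1) EB_partial_fractions[OF nz(1-3), of \<alpha> \<beta> \<gamma> \<tau>] by (simp only: \<rho>_def c_def)
    thus ?case using nz(4) mult_left_cancel by blast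
  qed
  thus ?thesis unfolding a_def by (rule that)
qed

lemma deriv_const_imp_affine:
  fixes f :: "complex \<Rightarrow> complex"
  assumes "f analytic_on {a}" "\<forall>\<^sub>F s in nhds a. deriv f s = k"
  obtains d where "\<forall>\<^sub>F s in nhds a. f s = k * s + d"
proof -
  obtain S where S: "open S" "a \<in> S" "\<And>s. s \<in> S \<Longrightarrow> deriv f s = k \<and> (f has_field_derivative deriv f s) (at s)"
    using eventually_conj[OF assms(2) analytic_at_eventually(2)[OF assms(1)]] unfolding eventually_nhds by blast
  then obtain r where r: "r > 0" "ball a r \<subseteq> S" using open_contains_ball by blast
  have "\<exists>d. \<forall>s\<in>ball a r. f s - k * s = d"
  proof (rule has_field_derivative_zero_constant)
    fix s assume "s \<in> ball a r"
    hence "s \<in> S" using r(2) by blast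
    from S(3)[OF this] have "(f has_field_derivative k) (at s)" by (elim conjE) (erule subst)
    hence "((\<lambda>s. f s - k * s) has_field_derivative k - k * 1) (at s)" by (intro DERIV_diff DERIV_cmult DERIV_ident)
    thus "((\<lambda>s. f s - k * s) has_field_derivative 0) (at s within ball a r)" by (simp add: has_field_derivative_at_within)
  qed simp
  then obtain d where "\<And>s. s \<in> ball a r \<Longrightarrow> f s = k * s + d" by (metis add.commute diff_eq_eq)
  moreover have "\<forall>\<^sub>F s in nhds a. s \<in> ball a r" using r(1) by (intro eventually_nhds_in_open) auto
  ultimately have "\<forall>\<^sub>F s in nhds a. f s = k * s + d" by (auto elim: eventually_mono)
  thus ?thesis by (rule that)
qed

lemma add_diff_eq_swap: "a - b = c \<Longrightarrow> a = b + (c :: complex)"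
  by (simp add: diff_eq_eq add.commute)

definition AR_pt :: "complex \<Rightarrow> complex \<Rightarrow> complex \<Rightarrow> nat \<Rightarrow> complex" where
  "AR_pt \<tau> x y j = [x, y, x + y, x - y, ff \<tau> x * ff \<tau> y] ! j"

lemma AR_linear_part:
  assumes r: "reg \<tau> x y" and AR: "AR \<tau> x y \<phi>" and z4: "\<forall>\<^sub>F w in nhds (ff \<tau> x * ff \<tau> y). \<phi> 4 w = 0"
  obtains c0 c1 c2 where "\<forall>j<4. \<forall>\<^sub>F w in nhds (AR_pt \<tau> x y j). \<phi> j w = c0 * EB \<tau> 0 j w + c1 * EB \<tau> 1 j w + c2 * EB \<tau> 2 j w"
proof -
  note R = regD[OF r]
  note A = AR[unfolded AR_def]
  note eq = A[THEN conjunct2, THEN conjunct2, THEN conjunct2, THEN conjunct2, THEN conjunct2]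
  have an: "\<phi> 2 analytic_on {x + y}" "\<phi> 3 analytic_on {x - y}" using A by blast+
  note cu = isCont_u[OF r]
  obtain S where S: "open S" "ff \<tau> x * ff \<tau> y \<in> S" "\<And>s. s \<in> S \<Longrightarrow> \<phi> 4 s = 0"
    using z4 unfolding eventually_nhds by blast
  have inS: "\<forall>\<^sub>F z in nhds (x, y). ff \<tau> (fst z) * ff \<tau> (snd z) \<in> S"
    by (rule isCont_eventually[OF cu refl]) (use eventually_nhds_in_open[OF S(1,2)] in simp)
  have ev: "\<forall>\<^sub>F z in nhds (x, y). deriv (\<phi> 2) (fst z + snd z) = deriv (\<phi> 3) (fst z - snd z)"
    using reg_eventually[OF r] AR_eventually[OF r AR] inS
  proof eventually_elim
    case (elim z)
    have "f1 \<tau> (fst z) * f1 \<tau> (snd z) * 0 = - deriv (\<phi> 2) (fst z + snd z) + deriv (\<phi> 3) (fst z - snd z)"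
      by (rule AR_mixed_derivative[OF elim(1,2), where \<Psi> = "\<lambda>_. 0" and S = S]) (use S elim(3) in auto)
    thus ?case by simp
  qed
  have ev0: "\<forall>\<^sub>F z in nhds (x, y). \<phi> 0 (fst z) + \<phi> 2 (fst z + snd z) + \<phi> 3 (fst z - snd z) = 0 \<and> \<phi> 1 (snd z) + \<phi> 2 (fst z + snd z) - \<phi> 3 (fst z - snd z) = 0"
    using eq inS by eventually_elim (use S(3) in simp)
  define \<kappa> where "\<kappa> = deriv (\<phi> 3) (x - y)"
  have "\<forall>\<^sub>F s in nhds (x + y). deriv (\<phi> 2) s = \<kappa>"
  proof -
    have c: "isCont (\<lambda>s. ((s + (x - y)) / 2, (s - (x - y)) / 2)) (x + y)" by (intro isCont_Pair continuous_intros) auto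
    have i: "fst ((s + (x - y)) / 2, (s - (x - y)) / 2) + snd ((s + (x - y)) / 2, (s - (x - y)) / 2) = s"
      "fst ((s + (x - y)) / 2, (s - (x - y)) / 2) - snd ((s + (x - y)) / 2, (s - (x - y)) / 2) = x - y" for s
      by (simp_all add: field_simps)
    show ?thesis using isCont_eventually[OF c _ ev] unfolding i \<kappa>_def by (simp add: field_simps)
  qed
  then obtain d2 where d2: "\<forall>\<^sub>F s in nhds (x + y). \<phi> 2 s = \<kappa> * s + d2"
    by (rule deriv_const_imp_affine[OF an(1)])
  have "\<forall>\<^sub>F s in nhds (x - y). deriv (\<phi> 3) s = \<kappa>"
  proof -
    have c: "isCont (\<lambda>s. (((x + y) + s) / 2, ((x + y) - s) / 2)) (x - y)" by (intro isCont_Pair continuous_intros) auto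
    have i: "fst (((x + y) + s) / 2, ((x + y) - s) / 2) + snd (((x + y) + s) / 2, ((x + y) - s) / 2) = x + y"
      "fst (((x + y) + s) / 2, ((x + y) - s) / 2) - snd (((x + y) + s) / 2, ((x + y) - s) / 2) = s" for s
      by (simp_all add: field_simps)
    have "deriv (\<phi> 2) (x + y) = \<kappa>" unfolding \<kappa>_def using eventually_nhds_x_imp_x[OF ev] by simp
    moreover have "\<forall>\<^sub>F s in nhds (x - y). deriv (\<phi> 2) (x + y) = deriv (\<phi> 3) s"
      using isCont_eventually[OF c _ ev] unfolding i by (simp add: field_simps)
    ultimately show ?thesis by (simp add: eventually_mono)
  qed
  then obtain d3 where d3: "\<forall>\<^sub>F s in nhds (x - y). \<phi> 3 s = \<kappa> * s + d3"
    by (rule deriv_const_imp_affine[OF an(2)])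
  have cx: "isCont (\<lambda>s. (s, y)) x" "isCont (\<lambda>s. s + y) x" "isCont (\<lambda>s. s - y) x" by (intro isCont_Pair continuous_intros)+
  have cy: "isCont (\<lambda>s. (x, s)) y" "isCont (\<lambda>s. x + s) y" "isCont (\<lambda>s. x - s) y" by (intro isCont_Pair continuous_intros)+
  have e0: "\<forall>\<^sub>F s in nhds x. \<phi> 0 s = - 2 * \<kappa> * s - d2 - d3"
    using isCont_eventually[OF cx(1) refl ev0] isCont_eventually[OF cx(2) refl d2] isCont_eventually[OF cx(3) refl d3]
  proof eventually_elim
    case (elim s)
    have "\<phi> 0 s + (\<kappa> * (s + y) + d2) + (\<kappa> * (s - y) + d3) = 0" using elim by simp
    moreover have "p = - 2 * \<kappa> * s - d2 - d3" if "p + (\<kappa> * (s + y) + d2) + (\<kappa> * (s - y) + d3) = 0" for p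
    proof -
      have "p = (p + (\<kappa> * (s + y) + d2) + (\<kappa> * (s - y) + d3)) - 2 * \<kappa> * s - d2 - d3" by (simp add: algebra_simps)
      thus ?thesis unfolding that by simp
    qed
    ultimately show ?case by blast
  qed
  have e1: "\<forall>\<^sub>F s in nhds y. \<phi> 1 s = - 2 * \<kappa> * s - d2 + d3"
    using isCont_eventually[OF cy(1) refl ev0] isCont_eventually[OF cy(2) refl d2] isCont_eventually[OF cy(3) refl d3]
  proof eventually_elim
    case (elim s)
    have "\<phi> 1 s + (\<kappa> * (x + s) + d2) - (\<kappa> * (x - s) + d3) = 0" using elim by simp
    moreover have "p = - 2 * \<kappa> * s - d2 + d3" if "p + (\<kappa> * (x + s) + d2) - (\<kappa> * (x - s) + d3) = 0" for p
    proof -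
      have "p = (p + (\<kappa> * (x + s) + d2) - (\<kappa> * (x - s) + d3)) - 2 * \<kappa> * s - d2 + d3" by (simp add: algebra_simps)
      thus ?thesis unfolding that by simp
    qed
    ultimately show ?case by blast
  qed
  show ?thesis
  proof (rule that[of "- d2" "- d3" "- \<kappa>"], intro allI impI)
    fix j :: nat assume "j < 4"
    hence "j = 0 \<or> j = 1 \<or> j = 2 \<or> j = 3" by auto
    thus "\<forall>\<^sub>F w in nhds (AR_pt \<tau> x y j). \<phi> j w = - d2 * EB \<tau> 0 j w + - d3 * EB \<tau> 1 j w + - \<kappa> * EB \<tau> 2 j w"
    proof (elim disjE)
      assume j: "j = 0"
      show ?thesis using e0 by (auto simp: j AR_pt_def EB_def elim!: eventually_mono)
    next
      assume j: "j = 1"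
      show ?thesis using e1 by (auto simp: j AR_pt_def EB_def elim!: eventually_mono)
    next
      assume j: "j = 2"
      show ?thesis using d2 by (auto simp: j AR_pt_def EB_def elim!: eventually_mono)
    next
      assume j: "j = 3"
      show ?thesis using d3 by (auto simp: j AR_pt_def EB_def elim!: eventually_mono)
    qed
  qed
qed

text \<open>Subtracting the combination found for the last component leaves a relation of
  \<open>T0\<close>, which adds only to the coefficients of the first three rows of
  \<open>EB\<close>; their last components are 0.\<close>

theorem AR_classification:
  assumes r: "reg \<tau> x y" and AR: "AR \<tau> x y \<phi>"
  obtains c where "\<forall>j<5. \<forall>\<^sub>F w in nhds (AR_pt \<tau> x y j). \<phi> j w = (\<Sum>i<6. c i * EB \<tau> i j w)"
proof -
  obtain c where c: "\<forall>\<^sub>F w in nhds (ff \<tau> x * ff \<tau> y). \<phi> 4 w = (\<Sum>i<6. c i * EB \<tau> i 4 w)"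
    by (rule AR_component_4[OF r AR])
  define \<phi>' where "\<phi>' = (\<lambda>j w. \<phi> j w - (\<Sum>i<6. c i * EB \<tau> i j w))"
  have AR': "AR \<tau> x y \<phi>'" unfolding \<phi>'_def by (rule AR_diff_EB[OF r AR])
  have z: "\<forall>\<^sub>F w in nhds (ff \<tau> x * ff \<tau> y). \<phi>' 4 w = 0" using c by eventually_elim (simp add: \<phi>'_def)
  obtain c0 c1 c2 where l: "\<forall>j<4. \<forall>\<^sub>F w in nhds (AR_pt \<tau> x y j). \<phi>' j w = c0 * EB \<tau> 0 j w + c1 * EB \<tau> 1 j w + c2 * EB \<tau> 2 j w"
    by (rule AR_linear_part[OF r AR' z])
  define k where "k = (\<lambda>i. c i + (if i = 0 then c0 else if i = 1 then c1 else if i = 2 then c2 else 0))"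
  have k: "(\<Sum>i<6. k i * EB \<tau> i j w) = (\<Sum>i<6. c i * EB \<tau> i j w) + (c0 * EB \<tau> 0 j w + c1 * EB \<tau> 1 j w + c2 * EB \<tau> 2 j w)" for j w
    unfolding sum_lessThan_6 by (simp add: k_def distrib_right)
  show ?thesis
  proof (rule that[of k], intro allI impI)
    fix j :: nat assume j: "j < 5"
    show "\<forall>\<^sub>F w in nhds (AR_pt \<tau> x y j). \<phi> j w = (\<Sum>i<6. k i * EB \<tau> i j w)"
    proof (cases "j = 4")
      case True
      have "(c0 * EB \<tau> 0 4 w + c1 * EB \<tau> 1 4 w + c2 * EB \<tau> 2 4 w) = 0" for w by (simp add: EB_def)
      thus ?thesis unfolding k True using c by (simp add: AR_pt_def)
    next
      case False
      hence "\<forall>\<^sub>F w in nhds (AR_pt \<tau> x y j). \<phi>' j w = c0 * EB \<tau> 0 j w + c1 * EB \<tau> 1 j w + c2 * EB \<tau> 2 j w" using l j by auto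
      thus ?thesis unfolding k \<phi>'_def
        by eventually_elim (erule add_diff_eq_swap)
    qed
  qed
qed


subsection \<open>The rank\<close>

text \<open>With \<open>lb\<close>, the coefficients of the linear forms x, y, x + y, x - y in the
  order of \<open>T0\<close>. Only the indices 0 to 3 have a meaning.\<close>

definition la :: "nat \<Rightarrow> complex" where "la = (!) [1, 0, 1, 1]"
definition lb :: "nat \<Rightarrow> complex" where "lb = (!) [0, 1, 1, - 1]"

lemma la_lb_simps [simp]: "la 0 = 1" "la (Suc 0) = 0" "la 2 = 1" "la 3 = 1" "lb 0 = 0" "lb (Suc 0) = 1" "lb 2 = 1" "lb 3 = - 1"
  by (simp_all add: la_def lb_def)

lemma less_4_cases: "j < 4 \<Longrightarrow> j = 0 \<or> j = Suc 0 \<or> j = 2 \<or> j = (3 :: nat)" by auto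

lemma less_5_cases: "j < 5 \<Longrightarrow> j = 0 \<or> j = Suc 0 \<or> j = 2 \<or> j = 3 \<or> j = (4 :: nat)" by auto

lemma T_web_nth: "j < 4 \<Longrightarrow> T_web u ! j = (\<lambda>(x, y). la j * x + lb j * y)" "T_web u ! 4 = u"
  by (auto dest!: less_4_cases simp: T_web_def T0_def nth_append)

lemma length_T_web [simp]: "length (T_web u) = 5" by (simp add: T_web_def T0_def)

lemma T0_partials:
  "j < 4 \<Longrightarrow> holo2_at (T_web u ! j) p" "j < 4 \<Longrightarrow> dx (T_web u ! j) p = la j" "j < 4 \<Longrightarrow> dy (T_web u ! j) p = lb j"
  using linear_holo2[of "la j" "lb j" 0 p] by (simp_all add: T_web_nth)

lemma la_lb_transversal: "j < 4 \<Longrightarrow> k < 4 \<Longrightarrow> j \<noteq> k \<Longrightarrow> la j * lb k - lb j * la k \<noteq> 0"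
  by (auto dest!: less_4_cases)

lemma regular_imp_is_web:
  assumes "regular_at u p"
  shows "is_web_at (T_web u) p"
  unfolding is_web_at_def length_T_web
proof (intro conjI allI impI)
  show "3 \<le> (5 :: nat)" by simp
  have h: "holo2_at u p" and T: "dx u p \<noteq> 0" "dy u p \<noteq> 0" "(dx u p)\<^sup>2 \<noteq> (dy u p)\<^sup>2"
    using assms by (auto simp: regular_at_def cond_T_def)
  have "set (T_web u) = {T_web u ! j | j. j < 5}" by (auto simp: in_set_conv_nth)
  moreover have "holo2_at (T_web u ! j) p" if "j < 5" for j
    using that T0_partials(1)[of j u p] h T_web_nth(2)[of u] by (cases "j = 4") auto
  ultimately show "\<forall>u\<in>set (T_web u). holo2_at u p" by auto
  have pm: "dx u p \<noteq> dy u p" "dx u p \<noteq> - dy u p" using T(3) by auto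
  have w4: "la j * dy u p - lb j * dx u p \<noteq> 0" if "j < 4" for j
    using less_4_cases[OF that] T(1,2) pm by (elim disjE) (auto simp: eq_neg_iff_add_eq_0 add.commute)
  show "wedge (T_web u ! j) (T_web u ! k) p \<noteq> 0" if "j < 5" "k < 5" "j \<noteq> k" for j k
  proof -
    consider "j < 4" "k < 4" | "j < 4" "k = 4" | "j = 4" "k < 4" using \<open>j < 5\<close> \<open>k < 5\<close> \<open>j \<noteq> k\<close> by linarith
    thus ?thesis
    proof cases
      case 1
      thus ?thesis using la_lb_transversal \<open>j \<noteq> k\<close> by (simp add: wedge_def T0_partials)
    next
      case 2
      thus ?thesis using w4 by (simp add: wedge_def T0_partials T_web_nth(2))
    next
      case 3
      have "dx u p * lb k - dy u p * la k = - (la k * dy u p - lb k * dx u p)" by simp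
      thus ?thesis using w4[OF 3(2)] 3 unfolding wedge_def by (simp only: T0_partials T_web_nth(2)) simp
    qed
  qed
qed

lemma germ_shift_rel:
  assumes "f analytic_on {c}" "g analytic_on {c}"
  shows "(\<lambda>w. f (c + w)) analytic_on {0}"
    "(\<forall>\<^sub>F w in nhds 0. f (c + w) = g (c + w)) \<longleftrightarrow> (\<forall>\<^sub>F w in nhds c. f w = g w)"
proof -
  have "(f \<circ> (\<lambda>w. c + w)) analytic_on {0}"
    by (rule analytic_on_compose) (use assms in \<open>auto intro!: analytic_intros\<close>)
  thus "(\<lambda>w. f (c + w)) analytic_on {0}" by (simp add: o_def)
  have 1: "\<forall>\<^sub>F w in nhds 0. P (c + w)" if "\<forall>\<^sub>F w in nhds c. P w" for P
    by (rule isCont_eventually[where f = "\<lambda>w. c + w", OF _ _ that]) (auto intro!: continuous_intros)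
  have 2: "\<forall>\<^sub>F w in nhds c. P w" if "\<forall>\<^sub>F w in nhds 0. P (c + w)" for P
    using isCont_eventually[where f = "\<lambda>w. w - c" and x = c and c = 0, OF _ _ that] by (auto intro!: continuous_intros)
  show "(\<forall>\<^sub>F w in nhds 0. f (c + w) = g (c + w)) \<longleftrightarrow> (\<forall>\<^sub>F w in nhds c. f w = g w)"
    using 1[of "\<lambda>w. f w = g w"] 2[of "\<lambda>w. f w = g w"] by (rule iffI[rotated])
qed

lemma germ_at_eq_iff:
  assumes "f analytic_on {c}" "g analytic_on {c}"
  shows "germ_at c f = germ_at c g \<longleftrightarrow> (\<forall>\<^sub>F w in nhds c. f w = g w)"
  using Quotient3_rel[OF Quotient3_holo_germ, of "\<lambda>w. f (c + w)" "\<lambda>w. g (c + w)"] germ_shift_rel[OF assms] germ_shift_rel(1)[OF assms(2,1)]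
  unfolding germ_at_def by simp

lemma germ_at_lin:
  assumes "f analytic_on {c}" "g analytic_on {c}"
  shows "germ_at c (\<lambda>w. a * f w + g w) = scale_germ a (germ_at c f) + germ_at c g"
proof -
  note s = germ_shift_rel(1)[OF assms] germ_shift_rel(1)[OF assms(2,1)]
  have sc: "scale_germ a (germ_at c f) = abs_holo_germ (\<lambda>w. a * f (c + w))"
    unfolding germ_at_def by (rule scale_germ.abs_eq) (use s in simp)
  show ?thesis unfolding sc unfolding germ_at_def
    by (rule plus_holo_germ.abs_eq[symmetric]) (use s in \<open>auto intro!: analytic_intros\<close>)
qed

lemma germ_at_0: "germ_at c (\<lambda>_. 0) = 0" by (simp add: germ_at_def zero_holo_germ.abs_eq)

lemma germ_at_sum:
  assumes "finite I" "\<And>i. i \<in> I \<Longrightarrow> F i analytic_on {c}"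
  shows "germ_at c (\<lambda>w. \<Sum>i\<in>I. a i * F i w) = (\<Sum>i\<in>I. scale_germ (a i) (germ_at c (F i)))"
  using assms
proof (induction I rule: finite_induct)
  case empty
  show ?case by (simp add: germ_at_0)
next
  case (insert i I)
  have "(\<lambda>w. \<Sum>i\<in>I. a i * F i w) analytic_on {c}"
    by (intro analytic_on_sum analytic_on_mult analytic_on_const insert.prems) simp
  thus ?case using insert germ_at_lin[of "F i" c "\<lambda>w. \<Sum>i\<in>I. a i * F i w" "a i"] by simp
qed

lemma sum_at_point: "(\<Sum>i\<in>I. f i) j = (\<Sum>i\<in>I. f i j)" for f :: "'b \<Rightarrow> nat \<Rightarrow> holo_germ"
  by (induction I rule: infinite_finite_induct) auto

lemma AR_analytic:
  assumes "AR \<tau> x y \<phi>" "j < 5"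
  shows "\<phi> j analytic_on {AR_pt \<tau> x y j}"
  using less_5_cases[OF assms(2)] assms(1) unfolding AR_def AR_pt_def by (elim disjE) simp_all

lemma AR_pt_eq: "j < 5 \<Longrightarrow> (theta_web \<tau> ! j) (x, y) = AR_pt \<tau> x y j"
  by (auto dest!: less_5_cases simp: T_web_nth AR_pt_def u_theta_eq)

lemma sum_lessThan_5: "(\<Sum>i<5. g i) = g 0 + g (Suc 0) + g 2 + g 3 + g (4 :: nat)" for g :: "nat \<Rightarrow> complex"
  by (simp add: eval_nat_numeral)

lemma AR_iff:
  assumes r: "reg \<tau> x y"
  shows "AR \<tau> x y \<phi> \<longleftrightarrow> (\<forall>j<5. \<phi> j analytic_on {(theta_web \<tau> ! j) (x, y)}) \<and>
    (\<forall>\<^sub>F z in nhds (x, y). (\<Sum>j<5. \<phi> j ((theta_web \<tau> ! j) z) * dx (theta_web \<tau> ! j) z) = 0 \<and>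
                            (\<Sum>j<5. \<phi> j ((theta_web \<tau> ! j) z) * dy (theta_web \<tau> ! j) z) = 0)"
    (is "_ \<longleftrightarrow> ?A \<and> ?E")
proof -
  have a: "(\<phi> 0 analytic_on {x} \<and> \<phi> 1 analytic_on {y} \<and> \<phi> 2 analytic_on {x + y} \<and> \<phi> 3 analytic_on {x - y} \<and>
    \<phi> 4 analytic_on {ff \<tau> x * ff \<tau> y}) \<longleftrightarrow> ?A" (is "?B \<longleftrightarrow> _")
  proof -
    have "?A \<longleftrightarrow> (\<forall>j<5. \<phi> j analytic_on {AR_pt \<tau> x y j})" by (simp add: AR_pt_eq)
    also have "\<dots> \<longleftrightarrow> ?B"
    proof
      assume h: "\<forall>j<5. \<phi> j analytic_on {AR_pt \<tau> x y j}"
      from h[rule_format, of 0] h[rule_format, of 1] h[rule_format, of 2] h[rule_format, of 3] h[rule_format, of 4]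
      show ?B by (simp add: AR_pt_def)
    next
      assume ?B
      thus "\<forall>j<5. \<phi> j analytic_on {AR_pt \<tau> x y j}" by (auto dest!: less_5_cases simp: AR_pt_def)
    qed
    finally show ?thesis by blast
  qed
  define E where "E = (\<lambda>z. \<phi> 0 (fst z) + \<phi> 2 (fst z + snd z) + \<phi> 3 (fst z - snd z) + \<phi> 4 (ff \<tau> (fst z) * ff \<tau> (snd z)) * (f1 \<tau> (fst z) * ff \<tau> (snd z)) = 0 \<and>
       \<phi> 1 (snd z) + \<phi> 2 (fst z + snd z) - \<phi> 3 (fst z - snd z) + \<phi> 4 (ff \<tau> (fst z) * ff \<tau> (snd z)) * (ff \<tau> (fst z) * f1 \<tau> (snd z)) = 0)"
  define E' where "E' = (\<lambda>z. (\<Sum>j<5. \<phi> j ((theta_web \<tau> ! j) z) * dx (theta_web \<tau> ! j) z) = 0 \<and>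
                            (\<Sum>j<5. \<phi> j ((theta_web \<tau> ! j) z) * dy (theta_web \<tau> ! j) z) = 0)"
  have ev: "\<forall>\<^sub>F z in nhds (x, y). E z \<longleftrightarrow> E' z"
    using reg_eventually[OF r]
  proof eventually_elim
    case (elim z)
    note R = regD[OF elim]
    have u: "dx (u_theta \<tau>) z = f1 \<tau> (fst z) * ff \<tau> (snd z)" "dy (u_theta \<tau>) z = ff \<tau> (fst z) * f1 \<tau> (snd z)" "u_theta \<tau> z = ff \<tau> (fst z) * ff \<tau> (snd z)"
      using u_theta_partials[OF R(1-3)] u_theta_eq[of \<tau> "fst z" "snd z"] by (simp_all add: f1_def)
    have 0: "0 < (4 :: nat)" "Suc 0 < 4" "2 < (4 :: nat)" "3 < (4 :: nat)" by simp_all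
    note t = 0[THEN T0_partials(2)] 0[THEN T0_partials(3)] T_web_nth(2)
    have n: "(theta_web \<tau> ! 0) z = fst z" "(theta_web \<tau> ! Suc 0) z = snd z" "(theta_web \<tau> ! 2) z = fst z + snd z" "(theta_web \<tau> ! 3) z = fst z - snd z"
      by (simp_all add: T_web_nth case_prod_unfold)
    show ?case unfolding E_def E'_def sum_lessThan_5 t u n by (simp add: u)
  qed
  have "eventually E (nhds (x, y)) \<longleftrightarrow> eventually E' (nhds (x, y))" by (rule eventually_cong[OF ev])
  thus ?thesis unfolding a[symmetric] AR_def E_def E'_def by blast
qed

definition EG :: "complex \<Rightarrow> complex \<Rightarrow> complex \<Rightarrow> nat \<Rightarrow> nat \<Rightarrow> holo_germ" where
  "EG \<tau> x y i j = (if j < 5 then germ_at (AR_pt \<tau> x y j) (EB \<tau> i j) else 0)"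

lemma abelian_relations_iff:
  assumes r: "reg \<tau> x y"
  shows "\<Phi> \<in> abelian_relations (theta_web \<tau>) (x, y) \<longleftrightarrow> (\<exists>c. \<Phi> = (\<Sum>i<6. scale_tuple (c i) (EG \<tau> x y i)))"
proof -
  have comb: "(\<Sum>i<6. scale_tuple (c i) (EG \<tau> x y i)) j =
      (if j < 5 then germ_at (AR_pt \<tau> x y j) (\<lambda>w. \<Sum>i<6. c i * EB \<tau> i j w) else 0)" for c j
  proof (cases "j < 5")
    case True
    have "germ_at (AR_pt \<tau> x y j) (\<lambda>w. \<Sum>i<6. c i * EB \<tau> i j w) = (\<Sum>i<6. scale_germ (c i) (germ_at (AR_pt \<tau> x y j) (EB \<tau> i j)))"
      by (rule germ_at_sum) (use AR_analytic[OF EB_AR[OF r] True] in auto)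
    thus ?thesis using True by (simp add: sum_at_point scale_tuple_def EG_def)
  next
    case False
    have "scale_germ a 0 = 0" for a using germ_tuples.scale_zero_right[of a, THEN fun_cong, of 0] by (simp add: scale_tuple_def)
    thus ?thesis using False by (simp add: sum_at_point scale_tuple_def EG_def)
  qed
  have ab: "\<Phi> \<in> abelian_relations (theta_web \<tau>) (x, y) \<longleftrightarrow>
    (\<forall>j\<ge>5. \<Phi> j = 0) \<and> (\<exists>\<phi>. AR \<tau> x y \<phi> \<and> (\<forall>j<5. \<Phi> j = germ_at (AR_pt \<tau> x y j) (\<phi> j)))"
    unfolding abelian_relations_def AR_iff[OF r] by (auto simp: AR_pt_eq)
  show ?thesis
  proof
    assume "\<Phi> \<in> abelian_relations (theta_web \<tau>) (x, y)"
    then obtain \<phi> where z: "\<forall>j\<ge>5. \<Phi> j = 0" and ar: "AR \<tau> x y \<phi>" and g: "\<forall>j<5. \<Phi> j = germ_at (AR_pt \<tau> x y j) (\<phi> j)"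
      unfolding ab by blast
    obtain c where c: "\<forall>j<5. \<forall>\<^sub>F w in nhds (AR_pt \<tau> x y j). \<phi> j w = (\<Sum>i<6. c i * EB \<tau> i j w)"
      by (rule AR_classification[OF r ar])
    have ar': "AR \<tau> x y (\<lambda>j w. \<Sum>i<6. c i * EB \<tau> i j w)" by (rule AR_sum) (use EB_AR[OF r] in auto)
    have "\<Phi> j = (\<Sum>i<6. scale_tuple (c i) (EG \<tau> x y i)) j" for j
      unfolding comb using z g c germ_at_eq_iff[OF AR_analytic[OF ar] AR_analytic[OF ar']] by (cases "j < 5") auto
    thus "\<exists>c. \<Phi> = (\<Sum>i<6. scale_tuple (c i) (EG \<tau> x y i))" by blast
  next
    assume "\<exists>c. \<Phi> = (\<Sum>i<6. scale_tuple (c i) (EG \<tau> x y i))"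
    then obtain c where c: "\<Phi> = (\<Sum>i<6. scale_tuple (c i) (EG \<tau> x y i))" by blast
    have ar': "AR \<tau> x y (\<lambda>j w. \<Sum>i<6. c i * EB \<tau> i j w)" by (rule AR_sum) (use EB_AR[OF r] in auto)
    show "\<Phi> \<in> abelian_relations (theta_web \<tau>) (x, y)"
      unfolding ab unfolding c comb by (intro conjI exI[of _ "\<lambda>j w. \<Sum>i<6. c i * EB \<tau> i j w"] ar') auto
  qed
qed

lemma quadratic_eventually_0:
  fixes \<alpha> \<beta> \<gamma> a :: complex
  assumes ev: "\<forall>\<^sub>F w in nhds a. \<alpha> + \<beta> * w + \<gamma> * w\<^sup>2 = 0"
  shows "\<alpha> = 0" "\<beta> = 0" "\<gamma> = 0"
proof -
  have h: "(deriv ^^ n) (\<lambda>w. \<alpha> + \<beta> * w + \<gamma> * w\<^sup>2) a = 0" for n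
    using higher_deriv_cong_ev[OF ev refl, of n] by simp
  show g: "\<gamma> = 0" using h[of "Suc (Suc 0)"] by (simp add: deriv_quadratic)
  show b: "\<beta> = 0" using h[of "Suc 0"] g by (simp add: deriv_quadratic)
  show "\<alpha> = 0" using h[of 0] g b by simp
qed

text \<open>The last components give a quadratic polynomial that vanishes near a, and its
  coefficients determine those of the three logarithmic relations. The components along x + y and x
  - y are then affine and determine the other three.\<close>

lemma EB_independent:
  assumes r: "reg \<tau> x y" and z: "\<And>j. j < 5 \<Longrightarrow> \<forall>\<^sub>F w in nhds (AR_pt \<tau> x y j). (\<Sum>i<6. c i * EB \<tau> i j w) = 0" and "i < 6"
  shows "c i = 0"
proof -
  define a where "a = ff \<tau> x * ff \<tau> y"
  note R = regD[OF r] and N = reg_nonzero[OF r]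
  have a0: "a \<noteq> 0" "1 + a \<noteq> 0" "1 - a \<noteq> 0" using R N by (simp_all add: a_def)
  have nz: "\<forall>\<^sub>F w in nhds a. w \<noteq> 0 \<and> 1 + w \<noteq> 0 \<and> 1 - w \<noteq> 0"
    unfolding a_def by (rule eventually_off_poles[OF r])
  define \<alpha> \<beta> \<gamma> where "\<alpha> = - c 3" and "\<beta> = c 5 - c 4" and "\<gamma> = c 3 + c 4 + c 5"
  have e: "EB \<tau> i 4 w = 0" if "i = 0 \<or> i = 1 \<or> i = 2" for i w using that by (elim disjE) (simp_all add: EB_def)
  have c: "pfc \<alpha> \<beta> \<gamma> 3 = c 3" "pfc \<alpha> \<beta> \<gamma> 4 = c 4" "pfc \<alpha> \<beta> \<gamma> 5 = c 5"
    by (simp_all add: pfc_def \<alpha>_def \<beta>_def \<gamma>_def field_simps)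
  have s: "(\<Sum>i<6. pfc \<alpha> \<beta> \<gamma> i * EB \<tau> i 4 w) = (\<Sum>i<6. c i * EB \<tau> i 4 w)" for w
    unfolding sum_lessThan_6 c by (simp add: e)
  have "\<forall>\<^sub>F w in nhds a. (\<Sum>i<6. c i * EB \<tau> i 4 w) = 0" using z[of 4] by (simp add: AR_pt_def a_def)
  hence "\<forall>\<^sub>F w in nhds a. \<alpha> + \<beta> * w + \<gamma> * w\<^sup>2 = 0"
    using nz
  proof eventually_elim
    case (elim w)
    thus ?case using EB_partial_fractions[of w \<alpha> \<beta> \<gamma> \<tau>] unfolding s by simp
  qed
  note q = quadratic_eventually_0[OF this]
  have c35: "c 3 = 0" "c 4 = 0" "c 5 = 0" using q unfolding \<alpha>_def \<beta>_def \<gamma>_def by auto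
  have "\<forall>\<^sub>F w in nhds (x + y). - c 0 + - c 2 * w + 0 * w\<^sup>2 = 0"
    using z[of 2] unfolding sum_lessThan_6 c35 by (simp add: AR_pt_def EB_def)
  note q2 = quadratic_eventually_0[OF this]
  have "\<forall>\<^sub>F w in nhds (x - y). - c 1 + - c 2 * w + 0 * w\<^sup>2 = 0"
    using z[of 3] unfolding sum_lessThan_6 c35 by (simp add: AR_pt_def EB_def)
  note q3 = quadratic_eventually_0[OF this]
  have "i = 0 \<or> i = 1 \<or> i = 2 \<or> i = 3 \<or> i = 4 \<or> i = 5" using assms(3) by auto
  thus ?thesis using c35 q2(1,2) q3(1) by auto
qed

lemma EG_independent:
  assumes r: "reg \<tau> x y" and z: "(\<Sum>i<6. scale_tuple (c i) (EG \<tau> x y i)) = 0" and "i < 6"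
  shows "c i = 0"
proof (rule EB_independent[OF r _ assms(3)])
  fix j :: nat assume j: "j < 5"
  have an: "EB \<tau> i j analytic_on {AR_pt \<tau> x y j}" if "i < 6" for i by (rule AR_analytic[OF EB_AR[OF r that] j])
  have "germ_at (AR_pt \<tau> x y j) (\<lambda>w. \<Sum>i<6. c i * EB \<tau> i j w) = (\<Sum>i<6. scale_germ (c i) (germ_at (AR_pt \<tau> x y j) (EB \<tau> i j)))"
    by (rule germ_at_sum) (use an in auto)
  also have "\<dots> = 0" using z[THEN fun_cong, of j] j by (simp add: sum_at_point scale_tuple_def EG_def)
  finally have "germ_at (AR_pt \<tau> x y j) (\<lambda>w. \<Sum>i<6. c i * EB \<tau> i j w) = germ_at (AR_pt \<tau> x y j) (\<lambda>_. 0)" by (simp add: germ_at_0)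
  moreover have "(\<lambda>w. \<Sum>i<6. c i * EB \<tau> i j w) analytic_on {AR_pt \<tau> x y j}"
    by (intro analytic_on_sum analytic_on_mult analytic_on_const an) simp
  ultimately show "\<forall>\<^sub>F w in nhds (AR_pt \<tau> x y j). (\<Sum>i<6. c i * EB \<tau> i j w) = 0"
    using germ_at_eq_iff[of _ _ "\<lambda>_. 0"] by simp
qed

text \<open>The six germ tuples span by \<open>abelian_relations_iff\<close> and are independent by
  \<open>EG_independent\<close>. Since the dimension is read off from the set of these tuples,
  \<open>E\<close> also has to be injective on the six indices.\<close>

lemma web_rank_u_theta:
  assumes r: "reg \<tau> x y"
  shows "web_rank (theta_web \<tau>) (x, y) = 6"
proof -
  define E where "E = EG \<tau> x y"
  define V where "V = abelian_relations (theta_web \<tau>) (x, y)"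
  have V: "\<Phi> \<in> V \<longleftrightarrow> (\<exists>c. \<Phi> = (\<Sum>i<6. scale_tuple (c i) (E i)))" for \<Phi>
    unfolding V_def E_def by (rule abelian_relations_iff[OF r])
  have ind: "c i = 0" if "(\<Sum>i<6. scale_tuple (c i) (E i)) = 0" "i < 6" for c i
    using EG_independent[OF r] that unfolding E_def by blast
  have single: "(\<Sum>i<6. scale_tuple (if i = k then a else 0) (E i)) = scale_tuple a (E k)" if "k < 6" for k a
  proof -
    have "(\<Sum>i<6. scale_tuple (if i = k then a else 0) (E i)) = (\<Sum>i<6. if i = k then scale_tuple a (E i) else 0)"
      by (rule sum.cong) auto
    thus ?thesis using that by simp
  qed
  have inj: "inj_on E {..<6}"
  proof (rule inj_onI, rule ccontr)
    fix i k assume ik: "i \<in> {..<6}" "k \<in> {..<6}" "E i = E k" "i \<noteq> k"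
    define c :: "nat \<Rightarrow> complex" where "c = (\<lambda>l. (if l = i then 1 else 0) + (if l = k then - 1 else 0))"
    have "(\<Sum>l<6. scale_tuple (c l) (E l)) = scale_tuple 1 (E i) + scale_tuple (- 1) (E k)"
      unfolding c_def germ_tuples.scale_left_distrib sum.distrib using single[of i 1] single[of k "- 1"] ik by simp
    also have "\<dots> = 0" using ik(3) by simp
    finally have "c i = 0" using ind ik(1) by blast
    thus False using ik(4) by (simp add: c_def)
  qed
  show ?thesis unfolding web_rank_def V_def[symmetric]
  proof (rule germ_tuples.dim_unique[of "E ` {..<6}"])
    show "E ` {..<6} \<subseteq> V"
    proof
      fix \<Phi> assume "\<Phi> \<in> E ` {..<6}"
      then obtain k where "k < 6" "\<Phi> = E k" by auto
      thus "\<Phi> \<in> V" unfolding V using single[of k 1] by (intro exI[of _ "\<lambda>i. if i = k then 1 else 0"]) simp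
    qed
    show "V \<subseteq> germ_tuples.span (E ` {..<6})"
    proof
      fix \<Phi> assume "\<Phi> \<in> V"
      then obtain c where "\<Phi> = (\<Sum>i<6. scale_tuple (c i) (E i))" unfolding V by blast
      thus "\<Phi> \<in> germ_tuples.span (E ` {..<6})"
        by (simp only:) (rule germ_tuples.span_sum, rule germ_tuples.span_scale, rule germ_tuples.span_base, erule imageI)
    qed
    show "germ_tuples.independent (E ` {..<6})"
    proof (rule germ_tuples.independent_if_scalars_zero)
      fix f \<Phi> assume "(\<Sum>v\<in>E ` {..<6}. scale_tuple (f v) v) = 0" "\<Phi> \<in> E ` {..<6}"
      thus "f \<Phi> = 0" using ind[of "\<lambda>i. f (E i)"] unfolding sum.reindex[OF inj] by (auto simp: o_def)
    qed simp
    show "card (E ` {..<6}) = 6" using card_image[OF inj] by simp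
  qed
qed

theorem u_theta_exceptional:
  assumes tau: "Im \<tau> > 0" and r: "regular_at (u_theta \<tau>) p"
  shows "exceptional_at (theta_web \<tau>) p"
proof -
  have "reg \<tau> (fst p) (snd p)" using assms by (simp add: reg_def)
  from web_rank_u_theta[OF this] have "maximal_rank (theta_web \<tau>) p" by (simp add: maximal_rank_def)
  thus ?thesis unfolding exceptional_at_def using regular_imp_is_web[OF r] u_theta_not_algebraizable[OF tau r] by blast
qed


section \<open>Equivalences between the webs\<close>

subsection \<open>Affine symmetries of \<open>\<T>\<^sub>0\<close>\<close>

lemma affine_symmetry:
  fixes a b e c d f :: complex
  defines "\<phi> \<equiv> (\<lambda>(x, y). (a * x + b * y + e, c * x + d * y + f)) :: C2 \<Rightarrow> C2"
  assumes det: "a * d - b * c \<noteq> 0" and \<sigma>: "bij_betw \<sigma> {..<4} {..<4}"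
    and T0: "\<And>j. j < 4 \<Longrightarrow> \<exists>\<alpha> \<beta>. \<alpha> \<noteq> 0 \<and> (\<forall>z. (T0 ! \<sigma> j) (\<phi> z) = \<alpha> * (T0 ! j) z + \<beta>)"
  shows "\<phi> \<in> Sym_T0" "local_diffeo_at \<phi> p" "j < 4 \<Longrightarrow> same_foliation_at p (T0 ! j) (T0 ! \<sigma> j \<circ> \<phi>)"
proof -
  define \<Delta> where "\<Delta> = a * d - b * c"
  define k where "k = 1 / \<Delta>"
  define \<xi> :: "C2 \<Rightarrow> C2" where
    "\<xi> = (\<lambda>(x, y). (d * k * x + (- b * k) * y + (b * f - d * e) * k, (- c * k) * x + a * k * y + (c * e - a * f) * k))"
  have D: "\<Delta> \<noteq> 0" using det by (simp add: \<Delta>_def)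
  hence k: "\<Delta> * k = 1" by (simp add: k_def)
  have inv: "\<xi> (\<phi> z) = z" "\<phi> (\<xi> z) = z" for z
  proof -
    have 1: "d * k * (a * x + b * y + e) + (- b * k) * (c * x + d * y + f) + (b * f - d * e) * k = \<Delta> * k * x"
      and 2: "(- c * k) * (a * x + b * y + e) + a * k * (c * x + d * y + f) + (c * e - a * f) * k = \<Delta> * k * y"
      and 3: "a * (d * k * x + (- b * k) * y + (b * f - d * e) * k) + b * ((- c * k) * x + a * k * y + (c * e - a * f) * k) + e = \<Delta> * k * x - e * (\<Delta> * k) + e"
      and 4: "c * (d * k * x + (- b * k) * y + (b * f - d * e) * k) + d * ((- c * k) * x + a * k * y + (c * e - a * f) * k) + f = \<Delta> * k * y - f * (\<Delta> * k) + f"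
      for x y
      by (simp_all add: \<Delta>_def algebra_simps)
    show "\<xi> (\<phi> z) = z" by (simp only: \<phi>_def \<xi>_def case_prod_unfold fst_conv snd_conv 1 2 k mult_1_left prod.collapse)
    show "\<phi> (\<xi> z) = z" by (simp only: \<phi>_def \<xi>_def case_prod_unfold fst_conv snd_conv 3 4 k mult_1_left mult_1_right diff_add_cancel prod.collapse)
  qed
  have surj: "\<phi> ` UNIV = UNIV" using inv(2) by (intro surjI)
  have fs: "fst \<circ> \<phi> = (\<lambda>(x, y). a * x + b * y + e)" "snd \<circ> \<phi> = (\<lambda>(x, y). c * x + d * y + f)"
    "fst \<circ> \<xi> = (\<lambda>(x, y). d * k * x + (- b * k) * y + (b * f - d * e) * k)" "snd \<circ> \<xi> = (\<lambda>(x, y). (- c * k) * x + a * k * y + (c * e - a * f) * k)"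
    by (auto simp: \<phi>_def \<xi>_def fun_eq_iff)
  have h: "holo2_on (\<lambda>(x, y). \<alpha> * x + \<beta> * y + \<gamma>) UNIV" for \<alpha> \<beta> \<gamma>
    unfolding holo2_on_def using linear_has_derivative by blast
  show "local_diffeo_at \<phi> p"
    unfolding local_diffeo_at_def
    by (rule exI[of _ UNIV], rule exI[of _ UNIV], rule exI[of _ \<xi>]) (simp only: fs h surj inv open_UNIV UNIV_I simp_thms ball_UNIV)
  have iff: "(T0 ! \<sigma> j) (\<phi> w) = (T0 ! \<sigma> j) (\<phi> z) \<longleftrightarrow> (T0 ! j) w = (T0 ! j) z" if "j < 4" for j z w
  proof -
    obtain \<alpha> \<beta> where "\<alpha> \<noteq> 0" "\<And>z. (T0 ! \<sigma> j) (\<phi> z) = \<alpha> * (T0 ! j) z + \<beta>" using T0[OF \<open>j < 4\<close>] by blast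
    thus ?thesis by simp
  qed
  show "same_foliation_at p (T0 ! j) (T0 ! \<sigma> j \<circ> \<phi>)" if "j < 4" for j
    unfolding same_foliation_iff by (rule exI[of _ UNIV]) (simp add: iff[OF that])
  have lev: "(\<lambda>L. \<phi> ` L) ` level_curves (T0 ! j) UNIV = level_curves (T0 ! \<sigma> j) UNIV" if "j < 4" for j
  proof -
    have im: "\<phi> ` {w. (T0 ! j) w = (T0 ! j) z} = {w. (T0 ! \<sigma> j) w = (T0 ! \<sigma> j) (\<phi> z)}" for z
    proof -
      have "w \<in> \<phi> ` {w. (T0 ! j) w = (T0 ! j) z} \<longleftrightarrow> (T0 ! j) (\<xi> w) = (T0 ! j) z" for w
      proof
        assume "(T0 ! j) (\<xi> w) = (T0 ! j) z"
        thus "w \<in> \<phi> ` {w. (T0 ! j) w = (T0 ! j) z}" by (intro image_eqI[of _ _ "\<xi> w"]) (simp_all add: inv)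
      qed (auto simp: inv)
      thus ?thesis using iff[OF that, of "\<xi> w" z for w] by (auto simp: inv)
    qed
    have "level_curves (T0 ! j) UNIV = range (\<lambda>z. {w. (T0 ! j) w = (T0 ! j) z})" for j by (auto simp: level_curves_def)
    hence "(\<lambda>L. \<phi> ` L) ` level_curves (T0 ! j) UNIV = range (\<lambda>z. {w. (T0 ! \<sigma> j) w = (T0 ! \<sigma> j) (\<phi> z)})"
      by (simp add: image_image im)
    also have "\<dots> = (\<lambda>z. {w. (T0 ! \<sigma> j) w = (T0 ! \<sigma> j) z}) ` (\<phi> ` UNIV)" by (simp only: image_image)
    also have "\<dots> = level_curves (T0 ! \<sigma> j) UNIV" unfolding surj by (auto simp: level_curves_def)
    finally show ?thesis .
  qed
  have pen: "T0_pencils = (\<lambda>j. level_curves (T0 ! j) UNIV) ` {..<4}"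
  proof -
    have "set T0 = (!) T0 ` {..<4}" by (auto simp: T0_def lessThan_Suc eval_nat_numeral)
    thus ?thesis by (simp add: T0_pencils_def image_image)
  qed
  have "(\<lambda>P. (\<lambda>L. \<phi> ` L) ` P) ` T0_pencils = (\<lambda>j. level_curves (T0 ! \<sigma> j) UNIV) ` {..<4}"
    unfolding pen image_image by (rule image_cong) (use lev in auto)
  also have "\<dots> = (\<lambda>j. level_curves (T0 ! j) UNIV) ` (\<sigma> ` {..<4})" by (simp only: image_image)
  also have "\<dots> = T0_pencils" using \<sigma> by (simp add: pen bij_betw_def)
  finally have pencils: "(\<lambda>P. (\<lambda>L. \<phi> ` L) ` P) ` T0_pencils = T0_pencils" .
  define M :: "complex^3^3" where "M = vector [vector [a, b, e], vector [c, d, f], vector [0, 0, 1]]"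
  have "det M = \<Delta>" by (simp add: det_3 M_def \<Delta>_def vector_3 algebra_simps)
  hence inv: "invertible M" using D by (simp add: invertible_det_nz)
  have M: "M *v vector [fst z, snd z, 1] = 1 *s vector [fst (\<phi> z), snd (\<phi> z), 1]" for z
    by (simp add: vec_eq_iff forall_3 matrix_vector_mult_def sum_3 M_def \<phi>_def case_prod_unfold vector_3)
  show "\<phi> \<in> Sym_T0"
    unfolding Sym_T0_def
    by (intro CollectI conjI exI[of _ M] inv allI pencils exI[of _ 1] M) simp
qed

subsection \<open>From proportional differentials to equal foliations\<close>

text \<open>Where du and dv are proportional, v is constant along the level curves of u, so v = h(u)
  near the point. As dv does not vanish there, h has non-zero derivative at u(x0, y0) and is locally
  injective, which makes the level sets equal.\<close>

lemma wedge_0_imp_same_foliation: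
  assumes r: "reg \<tau> x0 y0" and v: "holo2_at v (x0, y0)" and dv: "dy v (x0, y0) \<noteq> 0"
    and w: "\<forall>\<^sub>F z in nhds (x0, y0). wedge (u_theta \<tau>) v z = 0"
  shows "same_foliation_at (x0, y0) (u_theta \<tau>) v"
proof -
  note R = regD[OF r]
  obtain s g where s: "s > 0" "open (ff \<tau> ` ball y0 s)" and g: "g holomorphic_on (ff \<tau> ` ball y0 s)"
    "\<And>z. z \<in> ball y0 s \<Longrightarrow> g (ff \<tau> z) = z"
    using ff_local_inverse[OF R(1,7)] by blast
  define W where "W = ff \<tau> ` ball y0 s"
  have fy: "ff \<tau> y0 \<in> W" using s(1) by (simp add: W_def)
  have gy: "g (ff \<tau> y0) = y0" using g(2) s(1) by simp
  have fg: "ff \<tau> (g w) = w" if "w \<in> W" for w using that g(2) by (auto simp: W_def)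
  have dg: "(g has_field_derivative deriv g w) (at w)" if "w \<in> W" for w
    using holomorphic_derivI[OF g(1) s(2)] that by (simp add: W_def)
  have df: "(ff \<tau> has_field_derivative f1 \<tau> x0) (at x0)" "(ff \<tau> has_field_derivative f1 \<tau> y0) (at y0)"
    by (rule ff_has_derivative'; rule R)+
  \<comment> \<open>For q = (x, y, t) this is the value of \<open>ff\<close> at the second
    coordinate of the point with first coordinate t on the level curve of u through (x, y). A box
    around (x0, y0, x0) keeps the whole curve between the abscissas x and x0 in the good
    region.\<close>
  define Q where "Q = (\<lambda>q :: complex \<times> complex \<times> complex. ff \<tau> (fst q) * ff \<tau> (fst (snd q)) / ff \<tau> (snd (snd q)))"
  have cf: "isCont (ff \<tau>) x0" "isCont (ff \<tau>) y0" using df DERIV_isCont by blast+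
  have cQ: "isCont Q (x0, y0, x0)"
  proof -
    have a: "isCont (\<lambda>q :: complex \<times> complex \<times> complex. ff \<tau> (fst q)) (x0, y0, x0)"
      by (rule isCont_o2[where f = fst and g = "ff \<tau>"]) (use cf isCont_fst[OF continuous_ident] in simp_all)
    have b: "isCont (\<lambda>q :: complex \<times> complex \<times> complex. ff \<tau> (fst (snd q))) (x0, y0, x0)"
      by (rule isCont_o2[where f = "\<lambda>q. fst (snd q)" and g = "ff \<tau>"]) (use cf isCont_fst[OF isCont_snd[OF continuous_ident]] in simp_all)
    have c: "isCont (\<lambda>q :: complex \<times> complex \<times> complex. ff \<tau> (snd (snd q))) (x0, y0, x0)"
      by (rule isCont_o2[where f = "\<lambda>q. snd (snd q)" and g = "ff \<tau>"]) (use cf isCont_snd[OF isCont_snd[OF continuous_ident]] in simp_all)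
    show ?thesis unfolding Q_def by (rule isCont_divide[OF isCont_mult[OF a b] c]) (use R(10) in simp)
  qed
  have Q0: "Q (x0, y0, x0) = ff \<tau> y0" using R(10) by (simp add: Q_def)
  have 1: "\<forall>\<^sub>F q in nhds (x0, y0, x0). Q q \<in> W"
    by (rule isCont_eventually[OF cQ Q0]) (use eventually_nhds_in_open[OF s(2)[folded W_def] fy] in simp)
  have "isCont g (ff \<tau> y0)" using dg[OF fy] DERIV_isCont by blast
  hence "isCont (\<lambda>q. g (Q q)) (x0, y0, x0)" by (intro isCont_o2[OF cQ]) (simp add: Q0)
  hence c2: "isCont (\<lambda>q. (snd (snd q), g (Q q))) (x0, y0, x0)" by (intro isCont_Pair continuous_intros)
  have "\<forall>\<^sub>F z in nhds (x0, y0). reg \<tau> (fst z) (snd z) \<and> holo2_at v z \<and> wedge (u_theta \<tau>) v z = 0"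
    using reg_eventually[OF r] holo2_at_eventually[OF v] w by eventually_elim simp
  from isCont_eventually[OF c2 _ this]
  have 2: "\<forall>\<^sub>F q in nhds (x0, y0, x0). reg \<tau> (snd (snd q)) (g (Q q)) \<and> holo2_at v (snd (snd q), g (Q q)) \<and> wedge (u_theta \<tau>) v (snd (snd q), g (Q q)) = 0"
    by (simp add: Q0 gy)
  obtain \<Omega> where \<Omega>: "open \<Omega>" "(x0, y0, x0) \<in> \<Omega>" "\<And>q. q \<in> \<Omega> \<Longrightarrow> Q q \<in> W"
    "\<And>q. q \<in> \<Omega> \<Longrightarrow> reg \<tau> (snd (snd q)) (g (Q q)) \<and> holo2_at v (snd (snd q), g (Q q)) \<and> wedge (u_theta \<tau>) v (snd (snd q), g (Q q)) = 0"
    using eventually_conj[OF 1 2] unfolding eventually_nhds by blast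
  obtain A BC where A: "open A" "x0 \<in> A" "open BC" "(y0, x0) \<in> BC" "A \<times> BC \<subseteq> \<Omega>"
    using open_prod_def[of \<Omega>, THEN iffD1, rule_format, OF \<Omega>(1,2)] by (elim exE conjE SigmaE2) (rule that)
  obtain B C where B: "open B" "y0 \<in> B" "open C" "x0 \<in> C" "B \<times> C \<subseteq> BC"
    using open_prod_def[of BC, THEN iffD1, rule_format, OF A(3,4)] by (elim exE conjE SigmaE2) (rule that)
  have "open (A \<inter> C)" "x0 \<in> A \<inter> C" using A B by auto
  then obtain r1 where r1: "r1 > 0" "ball x0 r1 \<subseteq> A \<inter> C" using open_contains_ball by blast
  obtain r2 where r2: "r2 > 0" "ball y0 r2 \<subseteq> B \<inter> ball y0 s" 
  proof -
    have "open (B \<inter> ball y0 s)" "y0 \<in> B \<inter> ball y0 s" using B(1,2) s(1) by auto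
    thus ?thesis using that open_contains_ball by blast
  qed
  \<comment> \<open>The value of v at the point of the vertical line through x0 at which u takes the
    value w.\<close>
  define h where "h = (\<lambda>w. v (x0, g (w / ff \<tau> x0)))"
  have vh: "v (x, y) = h (ff \<tau> x * ff \<tau> y)" if xy: "x \<in> ball x0 r1" "y \<in> ball y0 r2" for x y
  proof -
    \<comment> \<open>The graph of b is the level curve of u through (x, y). Constancy of v along it
      is used between t = x and t = x0.\<close>
    define b where "b = (\<lambda>t. g (ff \<tau> x * ff \<tau> y / ff \<tau> t))"
    have "\<exists>k. \<forall>t\<in>ball x0 r1. v (t, b t) = k"
    proof (rule has_field_derivative_zero_constant)
      fix t assume t: "t \<in> ball x0 r1"
      have q: "(x, y, t) \<in> \<Omega>" using xy t r1(2) r2(2) A(5) B(5) by blast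
      have inW: "ff \<tau> x * ff \<tau> y / ff \<tau> t \<in> W" using \<Omega>(3)[OF q] by (simp add: Q_def)
      have rt: "reg \<tau> t (b t)" and vt: "holo2_at v (t, b t)" and wt: "wedge (u_theta \<tau>) v (t, b t) = 0"
        using \<Omega>(4)[OF q] by (simp_all add: Q_def b_def)
      note Rt = regD[OF rt]
      have dft: "(ff \<tau> has_field_derivative f1 \<tau> t) (at t)" by (rule ff_has_derivative'[OF Rt(1,2)])
      have dfb: "(ff \<tau> has_field_derivative f1 \<tau> (b t)) (at (b t))" by (rule ff_has_derivative'[OF Rt(1,3)])
      define d where "d = - f1 \<tau> t * ff \<tau> (b t) / (ff \<tau> t * f1 \<tau> (b t))"
      obtain d' where d': "(b has_field_derivative d') (at t)"
      proof -
        have "(b has_field_derivative deriv g (ff \<tau> x * ff \<tau> y / ff \<tau> t) * ((0 * ff \<tau> t - ff \<tau> x * ff \<tau> y * f1 \<tau> t) / (ff \<tau> t * ff \<tau> t))) (at t)"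
          unfolding b_def by (rule DERIV_chain2[OF dg[OF inW] DERIV_divide[OF DERIV_const dft Rt(10)]])
        thus ?thesis by (rule that)
      qed
      have fb: "ff \<tau> (b t') * ff \<tau> t' = ff \<tau> x * ff \<tau> y" if "t' \<in> ball x0 r1" for t'
      proof -
        have q': "(x, y, t') \<in> \<Omega>" using xy that r1(2) r2(2) A(5) B(5) by blast
        have "reg \<tau> t' (b t')" using \<Omega>(4)[OF q'] by (simp add: Q_def b_def)
        note regD(10)[OF this]
        moreover have "ff \<tau> (b t') = ff \<tau> x * ff \<tau> y / ff \<tau> t'" unfolding b_def by (rule fg) (use \<Omega>(3)[OF q'] in \<open>simp add: Q_def\<close>)
        ultimately show ?thesis by simp
      qed
      have "\<forall>\<^sub>F t' in nhds t. t' \<in> ball x0 r1" by (rule eventually_nhds_in_open) (use t in auto)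
      hence ev: "\<forall>\<^sub>F t' in nhds t. ff \<tau> (b t') * ff \<tau> t' = ff \<tau> x * ff \<tau> y" by eventually_elim (rule fb)
      have "((\<lambda>t'. ff \<tau> (b t') * ff \<tau> t') has_field_derivative (f1 \<tau> (b t) * d') * ff \<tau> t + f1 \<tau> t * ff \<tau> (b t)) (at t)"
        by (rule DERIV_mult[OF DERIV_chain2[OF dfb d'] dft])
      moreover have "((\<lambda>t'. ff \<tau> (b t') * ff \<tau> t') has_field_derivative 0) (at t)"
        unfolding DERIV_cong_ev[OF refl ev refl] by simp
      ultimately have e1: "(f1 \<tau> (b t) * d') * ff \<tau> t + f1 \<tau> t * ff \<tau> (b t) = 0" by (rule DERIV_unique)
      have e2: "(f1 \<tau> t * ff \<tau> (b t)) * dy v (t, b t) = (ff \<tau> t * f1 \<tau> (b t)) * dx v (t, b t)"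
        using wt u_theta_partials[OF Rt(1-3)] by (simp add: wedge_def f1_def)
      have "(ff \<tau> t * f1 \<tau> (b t)) * (dx v (t, b t) + dy v (t, b t) * d') =
         ((f1 \<tau> (b t) * d') * ff \<tau> t + f1 \<tau> t * ff \<tau> (b t)) * dy v (t, b t)"
        using e2 by (simp add: algebra_simps)
      hence z: "dx v (t, b t) + dy v (t, b t) * d' = 0" using e1 Rt(10,13) by simp
      have "((\<lambda>t. (t, b t)) has_derivative (\<lambda>k. (k, d' * k))) (at t)"
        using d' unfolding has_field_derivative_def by (intro has_derivative_Pair has_derivative_ident)
      from has_derivative_compose[OF this holo2_at_has_derivative[OF vt]]
      have "((\<lambda>t. v (t, b t)) has_derivative (\<lambda>k. (dx v (t, b t) + dy v (t, b t) * d') * k)) (at t)"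
        by (simp add: algebra_simps)
      hence "((\<lambda>t. v (t, b t)) has_field_derivative (dx v (t, b t) + dy v (t, b t) * d')) (at t)"
        unfolding has_field_derivative_def .
      hence "((\<lambda>t. v (t, b t)) has_field_derivative 0) (at t)" unfolding z .
      thus "((\<lambda>t. v (t, b t)) has_field_derivative 0) (at t within ball x0 r1)"
        by (rule has_field_derivative_at_within)
    qed simp
    then obtain k where k: "\<And>t. t \<in> ball x0 r1 \<Longrightarrow> v (t, b t) = k" by blast
    have q: "(x, y, x) \<in> \<Omega>" using xy r1(2) r2(2) A(5) B(5) by blast
    have "reg \<tau> x (b x)" using \<Omega>(4)[OF q] by (simp add: Q_def b_def)
    note regD(10)[OF this]
    hence "b x = y" unfolding b_def using g(2)[of y] xy r2(2) by auto
    thus ?thesis using k[of x] k[of x0] xy(1) r1(1) by (simp add: h_def b_def)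
  qed
  define u0 where "u0 = ff \<tau> x0 * ff \<tau> y0"
  have k0: "u0 / ff \<tau> x0 = ff \<tau> y0" using R(10) by (simp add: u0_def)
  obtain U where U: "open U" "(x0, y0) \<in> U" "\<And>z. z \<in> U \<Longrightarrow> holo2_at v z"
    using holo2_at_eventually[OF v] unfolding eventually_nhds by blast
  define S where "S = {w. w / ff \<tau> x0 \<in> W \<and> (x0, g (w / ff \<tau> x0)) \<in> U}"
  have dh: "(h has_field_derivative dy v (x0, g (w / ff \<tau> x0)) * (deriv g (w / ff \<tau> x0) / ff \<tau> x0)) (at w)"
    if "w / ff \<tau> x0 \<in> W" "holo2_at v (x0, g (w / ff \<tau> x0))" for w
  proof -
    have d: "((\<lambda>w. g (w / ff \<tau> x0)) has_field_derivative deriv g (w / ff \<tau> x0) * (1 / ff \<tau> x0)) (at w)"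
      by (rule DERIV_chain2[OF dg[OF that(1)] DERIV_cdivide[OF DERIV_ident]])
    have "((\<lambda>w. (x0, g (w / ff \<tau> x0))) has_derivative (\<lambda>k. (0, deriv g (w / ff \<tau> x0) * (1 / ff \<tau> x0) * k))) (at w)"
      using d unfolding has_field_derivative_def by (intro has_derivative_Pair has_derivative_const)
    from has_derivative_compose[OF this holo2_at_has_derivative[OF that(2)]]
    show ?thesis unfolding h_def has_field_derivative_def by (rule has_derivative_eq_rhs) (simp add: fun_eq_iff)
  qed
  have ck: "isCont (\<lambda>w. w / ff \<tau> x0) u0" using R(10) by (intro continuous_intros) auto
  have "\<forall>\<^sub>F w in nhds u0. w / ff \<tau> x0 \<in> W"
    by (rule isCont_eventually[OF ck k0]) (use eventually_nhds_in_open[OF s(2)[folded W_def] fy] in simp)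
  moreover have "\<forall>\<^sub>F w in nhds u0. (x0, g (w / ff \<tau> x0)) \<in> U"
  proof (rule isCont_eventually[where c = "(x0, y0)"])
    have "isCont g (u0 / ff \<tau> x0)" unfolding k0 by (rule DERIV_isCont[OF dg[OF fy]])
    from isCont_o2[OF ck this] show "isCont (\<lambda>w. (x0, g (w / ff \<tau> x0))) u0" by (intro isCont_Pair continuous_const)
    show "(x0, g (u0 / ff \<tau> x0)) = (x0, y0)" by (simp add: k0 gy)
    show "\<forall>\<^sub>F y in nhds (x0, y0). y \<in> U" using U(1,2) by (rule eventually_nhds_in_open)
  qed
  ultimately have "\<forall>\<^sub>F w in nhds u0. \<exists>d. (h has_field_derivative d) (at w)"
  proof eventually_elim
    case (elim w)
    show ?case using dh[OF elim(1) U(3)[OF elim(2)]] by (rule exI)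
  qed
  then obtain S where S: "open S" "u0 \<in> S" "\<And>w. w \<in> S \<Longrightarrow> \<exists>d. (h has_field_derivative d) (at w)"
    unfolding eventually_nhds by blast
  have hS: "h holomorphic_on S" unfolding holomorphic_on_open[OF S(1)] using S(3) by blast
  have "deriv g (ff \<tau> y0) * f1 \<tau> y0 = 1"
  proof -
    have "((\<lambda>z. g (ff \<tau> z)) has_field_derivative deriv g (ff \<tau> y0) * f1 \<tau> y0) (at y0)" by (rule DERIV_chain2[OF dg[OF fy] df(2)])
    moreover have "((\<lambda>z. g (ff \<tau> z)) has_field_derivative 1) (at y0)"
    proof -
      have "\<forall>\<^sub>F z in nhds y0. z \<in> ball y0 s" by (rule eventually_nhds_in_open) (use s(1) in auto)
      hence "\<forall>\<^sub>F z in nhds y0. g (ff \<tau> z) = z" by eventually_elim (rule g(2))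
      from DERIV_cong_ev[OF refl this refl] show ?thesis by simp
    qed
    ultimately show ?thesis by (rule DERIV_unique)
  qed
  hence "deriv g (ff \<tau> y0) \<noteq> 0" by auto
  moreover have "deriv h u0 = dy v (x0, y0) * (deriv g (ff \<tau> y0) / ff \<tau> x0)"
    using DERIV_imp_deriv[OF dh[of u0]] fy v unfolding k0 gy by simp
  ultimately have "deriv h u0 \<noteq> 0" using dv R(10) by simp
  then obtain \<rho> where \<rho>: "\<rho> > 0" "ball u0 \<rho> \<subseteq> S" "inj_on h (ball u0 \<rho>)"
    by (rule has_complex_derivative_locally_injective[OF hS S(2,1)])
  have cu: "isCont (u_theta \<tau>) (x0, y0)"
    using r holo2_at_isCont unfolding reg_def regular_at_def by blast
  show ?thesis
  proof (rule same_foliationI[OF cu open_ball _ _ \<rho>(3), where ?k1.0 = "\<lambda>w. w"])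
    show "u_theta \<tau> (x0, y0) \<in> ball u0 \<rho>" using \<rho>(1) by (simp add: u_theta_eq u0_def)
    have "\<forall>\<^sub>F z in nhds (x0, y0). z \<in> ball x0 r1 \<times> ball y0 r2"
      by (rule eventually_nhds_in_open) (use r1(1) r2(1) in \<open>auto intro!: open_Times\<close>)
    thus "\<forall>\<^sub>F z in nhds (x0, y0). v z = h (u_theta \<tau> z)"
    proof eventually_elim
      case (elim z)
      thus ?case using vh[of "fst z" "snd z"] u_theta_eq[of \<tau> "fst z" "snd z"] by (simp add: mem_Times_iff)
    qed
  qed auto
qed


subsection \<open>Congruent parameters\<close>

text \<open>The factor k is 1/(1 + u) + 1/(1 - u), the derivative of log((1 + w)/(1 - w)) at w = u.
  It is non-zero because its product with (1 + u)(1 - u) is 2.\<close>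

lemma u_partials_Dg:
  assumes tau: "Im \<tau> > 0" and nz: "t4 \<tau> x \<noteq> 0" "t4 \<tau> y \<noteq> 0"
    and N: "tp \<tau> (x + y) \<noteq> 0" "tq \<tau> (x + y) \<noteq> 0" "tp \<tau> (x - y) \<noteq> 0" "tq \<tau> (x - y) \<noteq> 0"
  obtains k where "k \<noteq> 0" "Dg \<tau> (x + y) - Dg \<tau> (x - y) = k * (f1 \<tau> x * ff \<tau> y)" "Dg \<tau> (x + y) + Dg \<tau> (x - y) = k * (ff \<tau> x * f1 \<tau> y)"
proof -
  note e = u_log_partials[OF tau nz N]
  have Dg: "Dg \<tau> t = dl (tp \<tau>) t - dl (tq \<tau>) t" if "tp \<tau> t \<noteq> 0" "tq \<tau> t \<noteq> 0" for t
    using that by (simp add: Dg_def LD_def LDnum_def dl_def field_simps)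
  define u where "u = ff \<tau> x * ff \<tau> y"
  define k where "k = 1 / (1 + u) + 1 / (1 - u)"
  have u: "1 + u \<noteq> 0" "1 - u \<noteq> 0" using e(1,2) by (simp_all add: u_def)
  have "k * ((1 + u) * (1 - u)) = (1 / (1 + u) * (1 + u)) * (1 - u) + (1 / (1 - u) * (1 - u)) * (1 + u)"
  proof -
    have "(p + q) * ((1 + u) * (1 - u)) = (p * (1 + u)) * (1 - u) + (q * (1 - u)) * (1 + u)" for p q
      by (simp add: algebra_simps)
    thus ?thesis unfolding k_def .
  qed
  also have "\<dots> = 2" using u by simp
  finally have k0: "k \<noteq> 0" by auto
  have kd: "k * d = d / (1 + u) + d / (1 - u)" for d by (simp add: k_def distrib_right)
  show ?thesis
  proof (rule that[OF k0])
    show "Dg \<tau> (x + y) - Dg \<tau> (x - y) = k * (f1 \<tau> x * ff \<tau> y)"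
    proof -
      define p where "p = (f1 \<tau> x * ff \<tau> y) / (1 + u)"
      define q where "q = (f1 \<tau> x * ff \<tau> y) / (1 - u)"
      show ?thesis using e(3,5) unfolding Dg[OF N(1,2)] Dg[OF N(3,4)] kd u_def[symmetric] p_def[symmetric] q_def[symmetric]
        by (simp add: algebra_simps)
    qed
    show "Dg \<tau> (x + y) + Dg \<tau> (x - y) = k * (ff \<tau> x * f1 \<tau> y)"
    proof -
      define p where "p = (ff \<tau> x * f1 \<tau> y) / (1 + u)"
      define q where "q = (ff \<tau> x * f1 \<tau> y) / (1 - u)"
      show ?thesis using e(4,6) unfolding Dg[OF N(1,2)] Dg[OF N(3,4)] kd u_def[symmetric] p_def[symmetric] q_def[symmetric]
        by (simp add: algebra_simps)
    qed
  qed
qed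

lemma reg_Dg:
  assumes r: "reg \<tau> x y"
  shows "Dg \<tau> (x + y) \<noteq> 0" "Dg \<tau> (x - y) \<noteq> 0" "(Dg \<tau> (x + y))\<^sup>2 \<noteq> (Dg \<tau> (x - y))\<^sup>2"
proof -
  note R = regD[OF r]
  obtain k where k: "k \<noteq> 0" "Dg \<tau> (x + y) - Dg \<tau> (x - y) = k * (f1 \<tau> x * ff \<tau> y)" "Dg \<tau> (x + y) + Dg \<tau> (x - y) = k * (ff \<tau> x * f1 \<tau> y)"
    by (rule u_partials_Dg[OF R(1-3) reg_nonzero(1-4)[OF r]])
  define P Q where "P = f1 \<tau> x * ff \<tau> y" and "Q = ff \<tau> x * f1 \<tau> y"
  have PQ: "P \<noteq> 0" "Q \<noteq> 0" "P\<^sup>2 \<noteq> Q\<^sup>2" using R by (simp_all add: P_def Q_def)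
  define A B where "A = Dg \<tau> (x + y)" and "B = Dg \<tau> (x - y)"
  have AB: "A - B = k * P" "A + B = k * Q" using k by (simp_all add: A_def B_def P_def Q_def)
  have "A\<^sup>2 - B\<^sup>2 = (A - B) * (A + B)" by (simp add: power2_eq_square algebra_simps)
  hence "A\<^sup>2 - B\<^sup>2 \<noteq> 0" unfolding AB using k(1) PQ by simp
  thus "(Dg \<tau> (x + y))\<^sup>2 \<noteq> (Dg \<tau> (x - y))\<^sup>2" by (simp add: A_def B_def)
  have pm: "P + Q \<noteq> 0" "Q - P \<noteq> 0"
  proof -
    have "(P + Q) * (P - Q) \<noteq> 0" using PQ(3) by (simp add: power2_eq_square algebra_simps)
    thus "P + Q \<noteq> 0" "Q - P \<noteq> 0" by auto
  qed
  have "2 * A = (A - B) + (A + B)" by simp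
  also have "\<dots> = k * (P + Q)" unfolding AB by (simp add: algebra_simps)
  finally have "A \<noteq> 0" using k(1) pm by auto
  thus "Dg \<tau> (x + y) \<noteq> 0" by (simp add: A_def)
  have "2 * B = (A + B) - (A - B)" by simp
  also have "\<dots> = k * (Q - P)" unfolding AB by (simp add: algebra_simps)
  finally have "B \<noteq> 0" using k(1) pm by auto
  thus "Dg \<tau> (x - y) \<noteq> 0" by (simp add: B_def)
qed

text \<open>Regularity excludes only zeros of entire functions that are not identically 0: x is
  chosen off the zeros of \<open>Dnum\<close> and \<open>Dden\<close>, then y such that
  \<open>D \<tau> y\<close> differs from both signs of \<open>D \<tau> x\<close>, which is possible
  since \<open>D\<close> is not constant.\<close>

lemma exists_reg:
  assumes tau: "Im \<tau> > 0"
  obtains x y where "reg \<tau> x y"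
proof -
  note ent = Dnum_entire[OF tau] Dden_entire[OF tau]
  obtain a b where ab: "Dnum \<tau> a \<noteq> 0" "Dden \<tau> b \<noteq> 0" using D_not_identically_0 Dden_not_identically_0 tau by blast
  have P: "(\<lambda>x. Dnum \<tau> x * Dden \<tau> x) holomorphic_on UNIV" by (intro holomorphic_intros ent)
  have "\<exists>x. Dnum \<tau> x * Dden \<tau> x \<noteq> 0" using entire_mult_eq_0[OF ent _ ab(1), of b] ab(2) by blast
  then obtain x where x: "Dnum \<tau> x * Dden \<tau> x \<noteq> 0" by blast
  define c where "c = D \<tau> x"
  have L: "(\<lambda>x. Dnum \<tau> x - e * Dden \<tau> x) holomorphic_on UNIV" for e by (intro holomorphic_intros ent)
  obtain y1 y2 where y: "Dnum \<tau> y1 - c * Dden \<tau> y1 \<noteq> 0" "Dnum \<tau> y2 - (- c) * Dden \<tau> y2 \<noteq> 0"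
    using D_not_constant[OF tau, of c] D_not_constant[OF tau, of "- c"] unfolding right_minus_eq by blast
  have "\<exists>z. (Dnum \<tau> z - c * Dden \<tau> z) * (Dnum \<tau> z - (- c) * Dden \<tau> z) \<noteq> 0"
    using entire_mult_eq_0[OF L[of c] L[of "- c"] _ y(1), of y2] y(2) by blast
  then obtain z where z: "(Dnum \<tau> z - c * Dden \<tau> z) * (Dnum \<tau> z - (- c) * Dden \<tau> z) \<noteq> 0" by blast
  have LL: "(\<lambda>z. (Dnum \<tau> z - c * Dden \<tau> z) * (Dnum \<tau> z - (- c) * Dden \<tau> z)) holomorphic_on UNIV"
    by (intro holomorphic_on_mult L)
  have "\<exists>y. Dnum \<tau> y * Dden \<tau> y * ((Dnum \<tau> y - c * Dden \<tau> y) * (Dnum \<tau> y - (- c) * Dden \<tau> y)) \<noteq> 0"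
    using entire_mult_eq_0[OF P LL _ x, of z] z by blast
  then obtain y where y: "Dnum \<tau> y * Dden \<tau> y * ((Dnum \<tau> y - c * Dden \<tau> y) * (Dnum \<tau> y - (- c) * Dden \<tau> y)) \<noteq> 0" by blast
  hence dy: "Dden \<tau> y \<noteq> 0" "D \<tau> y \<noteq> 0" by (simp_all add: D_nonzero_iff)
  have n: "Dnum \<tau> y = D \<tau> y * Dden \<tau> y" using dy by (simp add: D_eq)
  have "Dnum \<tau> y - c * Dden \<tau> y = (D \<tau> y - c) * Dden \<tau> y" "Dnum \<tau> y - (- c) * Dden \<tau> y = (D \<tau> y + c) * Dden \<tau> y"
    unfolding n by (simp_all add: algebra_simps)
  hence "(D \<tau> y - c) * (D \<tau> y + c) \<noteq> 0" using y by auto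
  hence "(D \<tau> x)\<^sup>2 \<noteq> (D \<tau> y)\<^sup>2" by (auto simp: c_def power2_eq_square algebra_simps)
  thus ?thesis using that[of x y] x dy unfolding reg_def regular_at_iff[OF tau] by (simp add: D_nonzero_iff tau)
qed

text \<open>The hypothesis \<open>eq\<close> is the proportionality of the two differentials after
  division by the functions themselves, so it is available only off their zeros and poles. The wedge
  product vanishes at the remaining points by continuity along the direction (1, 2);
  \<open>generic\<close> says that the image of this direction is not parallel to a coordinate
  axis.\<close>

lemma affine_equivalence:
  fixes a b e c d f :: complex
  defines "\<phi> \<equiv> (\<lambda>(x, y). (a * x + b * y + e, c * x + d * y + f)) :: C2 \<Rightarrow> C2"
  assumes tau: "Im \<tau> > 0" and tau': "Im \<tau>' > 0"
    and det: "a * d - b * c \<noteq> 0" and generic: "a + 2 * b \<noteq> 0" "c + 2 * d \<noteq> 0" and \<sigma>: "bij_betw \<sigma> {..<4} {..<4}"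
    and T0: "\<And>j. j < 4 \<Longrightarrow> \<exists>\<alpha> \<beta>. \<alpha> \<noteq> 0 \<and> (\<forall>z. (T0 ! \<sigma> j) (\<phi> z) = \<alpha> * (T0 ! j) z + \<beta>)"
    and eq: "\<And>x y. Dden \<tau> x \<noteq> 0 \<Longrightarrow> Dden \<tau> y \<noteq> 0 \<Longrightarrow> tp \<tau> (x + y) \<noteq> 0 \<Longrightarrow> tq \<tau> (x + y) \<noteq> 0 \<Longrightarrow> tp \<tau> (x - y) \<noteq> 0 \<Longrightarrow> tq \<tau> (x - y) \<noteq> 0 \<Longrightarrow>
      (D \<tau>' (a * x + b * y + e) * a + D \<tau>' (c * x + d * y + f) * c) * D \<tau> y = (D \<tau>' (a * x + b * y + e) * b + D \<tau>' (c * x + d * y + f) * d) * D \<tau> x"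
  shows "holo2_at (u_theta \<tau>) p \<Longrightarrow> holo2_at (u_theta \<tau>') (\<phi> p) \<Longrightarrow> wedge (u_theta \<tau>) (u_theta \<tau>' \<circ> \<phi>) p = 0"
    "regular_at (u_theta \<tau>) p \<Longrightarrow> regular_at (u_theta \<tau>') (\<phi> p) \<Longrightarrow> maps_web_at \<phi> p (theta_web \<tau>) (theta_web \<tau>')"
proof -
  have fs: "fst \<circ> \<phi> = (\<lambda>(x, y). a * x + b * y + e)" "snd \<circ> \<phi> = (\<lambda>(x, y). c * x + d * y + f)"
    by (auto simp: \<phi>_def fun_eq_iff)
  have comp: "holo2_at (u_theta \<tau>' \<circ> \<phi>) p"
    "dx (u_theta \<tau>' \<circ> \<phi>) p = dx (u_theta \<tau>') (\<phi> p) * a + dy (u_theta \<tau>') (\<phi> p) * c"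
    "dy (u_theta \<tau>' \<circ> \<phi>) p = dx (u_theta \<tau>') (\<phi> p) * b + dy (u_theta \<tau>') (\<phi> p) * d"
    if "holo2_at (u_theta \<tau>') (\<phi> p)" for p
    using holo2_compose[where \<psi> = \<phi> and p = p, OF that, unfolded fs, OF linear_holo2(1) linear_holo2(1)] by (simp_all only: linear_holo2)
  show W: "wedge (u_theta \<tau>) (u_theta \<tau>' \<circ> \<phi>) p = 0"
    if h: "holo2_at (u_theta \<tau>) p" "holo2_at (u_theta \<tau>') (\<phi> p)" for p
  proof -
    obtain x0 y0 where p: "p = (x0, y0)" by (cases p)
    define X where "X = (\<lambda>x y. a * x + b * y + e)"
    define Y where "Y = (\<lambda>x y. c * x + d * y + f)"
    have ph: "\<phi> (x, y) = (X x y, Y x y)" for x y by (simp add: \<phi>_def X_def Y_def)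
    have t4: "t4 \<tau> x0 \<noteq> 0" "t4 \<tau> y0 \<noteq> 0" "t4 \<tau>' (X x0 y0) \<noteq> 0" "t4 \<tau>' (Y x0 y0) \<noteq> 0"
      using h u_theta_holo2_iff[OF tau] u_theta_holo2_iff[OF tau'] by (auto simp: p ph)
    define V where "V = (\<lambda>x y. f1 \<tau> x * ff \<tau> y * (f1 \<tau>' (X x y) * ff \<tau>' (Y x y) * b + ff \<tau>' (X x y) * f1 \<tau>' (Y x y) * d)
       - ff \<tau> x * f1 \<tau> y * (f1 \<tau>' (X x y) * ff \<tau>' (Y x y) * a + ff \<tau>' (X x y) * f1 \<tau>' (Y x y) * c))"
    have wV: "wedge (u_theta \<tau>) (u_theta \<tau>' \<circ> \<phi>) p = V x0 y0"
      unfolding wedge_def comp[OF h(2)] unfolding p ph u_theta_partials[OF tau t4(1,2)] u_theta_partials[OF tau' t4(3,4)]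
      by (simp add: V_def f1_def)
    have V0: "V x y = 0" if "Dden \<tau> x \<noteq> 0" "Dden \<tau> y \<noteq> 0" "Dden \<tau>' (X x y) \<noteq> 0" "Dden \<tau>' (Y x y) \<noteq> 0"
       "tp \<tau> (x + y) \<noteq> 0" "tq \<tau> (x + y) \<noteq> 0" "tp \<tau> (x - y) \<noteq> 0" "tq \<tau> (x - y) \<noteq> 0" for x y
    proof -
      have f: "f1 \<sigma> z = D \<sigma> z * ff \<sigma> z" if "Dden \<sigma> z \<noteq> 0" for \<sigma> z
        using deriv_ff_eq[of \<sigma> z] that by (simp add: f1_def Dden_def)
      have e: "(D \<tau>' (X x y) * a + D \<tau>' (Y x y) * c) * D \<tau> y = (D \<tau>' (X x y) * b + D \<tau>' (Y x y) * d) * D \<tau> x"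
        unfolding X_def Y_def by (rule eq[OF that(1,2,5-8)])
      have "V x y = ff \<tau> x * ff \<tau> y * (ff \<tau>' (X x y) * ff \<tau>' (Y x y)) *
        ((D \<tau>' (X x y) * b + D \<tau>' (Y x y) * d) * D \<tau> x - (D \<tau>' (X x y) * a + D \<tau>' (Y x y) * c) * D \<tau> y)"
        unfolding V_def f[OF that(1)] f[OF that(2)] f[OF that(3)] f[OF that(4)] by (simp add: algebra_simps)
      thus ?thesis by (simp only: e diff_self mult_zero_right)
    qed
    have gen: "\<forall>\<^sub>F t in at 0. F (m * t + k) \<noteq> 0" if "F holomorphic_on UNIV" "\<exists>z. F z \<noteq> 0" "m \<noteq> 0" for F :: "complex \<Rightarrow> complex" and m k
    proof -
      note prems = that
      obtain z where z: "F z \<noteq> 0" using prems(2) by blast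
      show ?thesis by (rule entire_affine_eventually_nonzero[OF prems(1) z prems(3)])
    qed
    note gD = gen[OF Dden_entire[OF tau] Dden_not_identically_0[OF tau]]
    note gD' = gen[OF Dden_entire[OF tau'] Dden_not_identically_0[OF tau']]
    note gP = gen[OF theta_entire(3)[OF tau] tp_not_identically_0[OF tau]]
    note gQ = gen[OF theta_entire(4)[OF tau] tq_not_identically_0[OF tau]]
    \<comment> \<open>Along this direction x, y, x + y, x - y and both coordinates of the image all
      move with non-zero speed, so for small t \<noteq> 0 all excluded zeros are avoided.\<close>
    have XY: "X (x0 + t) (y0 + 2 * t) = (a + 2 * b) * t + X x0 y0" "Y (x0 + t) (y0 + 2 * t) = (c + 2 * d) * t + Y x0 y0"
      "x0 + t + (y0 + 2 * t) = 3 * t + (x0 + y0)" "x0 + t - (y0 + 2 * t) = - 1 * t + (x0 - y0)" for t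
      by (simp_all add: X_def Y_def algebra_simps)
    have m1: "- 1 \<noteq> (0 :: complex)" by simp
    have ev0: "\<forall>\<^sub>F t in at 0. V (x0 + t) (y0 + 2 * t) = 0"
      using gD[of 1 x0, OF one_neq_zero] gD[of 2 y0, OF zero_neq_numeral[symmetric]] gD'[OF generic(1), of "X x0 y0"] gD'[OF generic(2), of "Y x0 y0"]
        gP[of 3 "x0 + y0", OF zero_neq_numeral[symmetric]] gQ[of 3 "x0 + y0", OF zero_neq_numeral[symmetric]]
        gP[of "- 1" "x0 - y0", OF m1] gQ[of "- 1" "x0 - y0", OF m1]
    proof eventually_elim
      case (elim t)
      have s: "Dden \<tau> (x0 + t) \<noteq> 0" "Dden \<tau> (y0 + 2 * t) \<noteq> 0" using elim(1,2) by (simp_all add: add.commute)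
      show ?case by (rule V0[OF s]) (simp_all only: XY elim not_False_eq_True)
    qed
    have cont: "isCont (\<lambda>t. f1 \<rho> (m * t + k)) 0" "isCont (\<lambda>t. ff \<rho> (m * t + k)) 0" if "Im \<rho> > 0" "t4 \<rho> k \<noteq> 0" for \<rho> m k
    proof -
      have i: "isCont (\<lambda>t. m * t + k) 0" by (intro continuous_intros)
      have "isCont (f1 \<rho>) k" "isCont (ff \<rho>) k" using t4_analytic_quotient[OF that] analytic_at_imp_isCont by blast+
      thus "isCont (\<lambda>t. f1 \<rho> (m * t + k)) 0" "isCont (\<lambda>t. ff \<rho> (m * t + k)) 0"
        using isCont_o2[OF i, of "f1 \<rho>"] isCont_o2[OF i, of "ff \<rho>"] by simp_all
    qed
    have XY': "X (1 * t + x0) (2 * t + y0) = (a + 2 * b) * t + X x0 y0" "Y (1 * t + x0) (2 * t + y0) = (c + 2 * d) * t + Y x0 y0" for t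
      by (simp_all add: X_def Y_def algebra_simps)
    have cV: "isCont (\<lambda>t. V (1 * t + x0) (2 * t + y0)) 0"
      unfolding V_def XY'
      by (intro isCont_diff isCont_mult isCont_add continuous_const cont tau tau' t4)
    hence "((\<lambda>t. V (1 * t + x0) (2 * t + y0)) \<longlongrightarrow> V x0 y0) (at 0)" by (simp add: isCont_def)
    moreover have "((\<lambda>t. V (1 * t + x0) (2 * t + y0)) \<longlongrightarrow> 0) (at 0)"
    proof (rule Lim_transform_eventually[OF tendsto_const])
      show "\<forall>\<^sub>F t in at 0. 0 = V (1 * t + x0) (2 * t + y0)"
        using ev0 by eventually_elim (simp add: add.commute)
    qed
    ultimately have "V x0 y0 = 0" using tendsto_unique[OF at_neq_bot] by blast
    thus ?thesis unfolding wV .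
  qed
  show "maps_web_at \<phi> p (theta_web \<tau>) (theta_web \<tau>')"
    if r: "regular_at (u_theta \<tau>) p" and r': "regular_at (u_theta \<tau>') (\<phi> p)" for p
  proof -
    note sym = affine_symmetry[OF det \<sigma>, where e = e and f = f, folded \<phi>_def, OF T0]
    obtain x0 y0 where p: "p = (x0, y0)" by (cases p)
    have hol: "holo2_at (u_theta \<tau>) p" "holo2_at (u_theta \<tau>') (\<phi> p)" using r r' by (auto simp: regular_at_def)
    have ld: "local_diffeo_at \<phi> p" by (rule sym(2))
    have ev: "\<forall>\<^sub>F z in nhds p. holo2_at (u_theta \<tau>') (\<phi> z)"
      by (rule isCont_eventually[OF local_diffeoD(3)[OF ld] refl holo2_at_eventually[OF hol(2)]])
    have ev_w: "\<forall>\<^sub>F z in nhds p. wedge (u_theta \<tau>) (u_theta \<tau>' \<circ> \<phi>) z = 0"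
      using ev holo2_at_eventually[OF hol(1)] by eventually_elim (rule W)
    have nz: "dx (u_theta \<tau>) p \<noteq> 0" "dy (u_theta \<tau>) p \<noteq> 0" "dx (u_theta \<tau>') (\<phi> p) \<noteq> 0"
      using r r' by (auto simp: regular_at_def cond_T_def)
    have dv: "dy (u_theta \<tau>' \<circ> \<phi>) p \<noteq> 0"
    proof
      assume z: "dy (u_theta \<tau>' \<circ> \<phi>) p = 0"
      hence "dx (u_theta \<tau>' \<circ> \<phi>) p = 0" using W[OF hol] nz(2) by (simp add: wedge_def)
      define P Q where "P = dx (u_theta \<tau>') (\<phi> p)" and "Q = dy (u_theta \<tau>') (\<phi> p)"
      have "P * a + Q * c = 0" "P * b + Q * d = 0"
        using z \<open>dx (u_theta \<tau>' \<circ> \<phi>) p = 0\<close> comp[OF hol(2)] by (simp_all add: P_def Q_def)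
      hence "(P * a + Q * c) * d - (P * b + Q * d) * c = 0" by simp
      hence "P * (a * d - b * c) = 0" by (simp add: algebra_simps)
      thus False using det nz(3) by (simp add: P_def)
    qed
    have sf: "same_foliation_at p (u_theta \<tau>) (u_theta \<tau>' \<circ> \<phi>)"
      using wedge_0_imp_same_foliation[of \<tau> x0 y0 "u_theta \<tau>' \<circ> \<phi>"] comp(1)[OF hol(2)] dv ev_w r tau by (simp add: p reg_def)
    define \<sigma>' where "\<sigma>' = (\<lambda>j. if j < 4 then \<sigma> j else j)"
    have l5: "{..<5} = insert 4 {..<4 :: nat}" by auto
    have s4: "\<sigma> j < 4" if "j < 4" for j using \<sigma> that by (auto simp: bij_betw_def)
    have "bij_betw \<sigma>' {..<4} {..<4}" using bij_betw_cong[of "{..<4}" \<sigma> \<sigma>' "{..<4}"] \<sigma> by (simp add: \<sigma>'_def)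
    moreover have "bij_betw \<sigma>' {4} {4}" by (simp add: \<sigma>'_def bij_betw_def)
    ultimately have "bij_betw \<sigma>' ({4} \<union> {..<4}) ({4} \<union> {..<4})" by (intro bij_betw_combine) auto
    hence bij: "bij_betw \<sigma>' {..<5} {..<5}" unfolding l5 by simp
    have "same_foliation_at p (theta_web \<tau> ! j) (theta_web \<tau>' ! \<sigma>' j \<circ> \<phi>)" if "j < 5" for j
    proof (cases "j < 4")
      case True
      have T: "T_web u ! i = T0 ! i" if "i < 4" for u i
        using that unfolding T_web_def by (subst nth_append) (simp add: T0_def)
      show ?thesis using sym(3)[OF _ True] True s4[OF True] by (simp add: T \<sigma>'_def)
    next
      case False
      hence "j = 4" using that by simp
      thus ?thesis using sf by (simp add: \<sigma>'_def T_web_nth(2))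
    qed
    thus ?thesis unfolding maps_web_at_def length_T_web using ld bij by blast
  qed
qed


lemma D_modrel:
  assumes tau: "Im \<tau> > 0" and "modrel \<tau> \<tau>'"
  obtains j \<kappa> where "j \<noteq> 0" "\<kappa> \<noteq> 0" "\<And>x. D \<tau>' (x / j) = \<kappa> * D \<tau> x"
proof -
  obtain a b c d :: int where abcd: "a * d - b * c = 1" "even b"
    and t: "\<tau>' = (of_int a * \<tau> + of_int b) / (of_int c * \<tau> + of_int d)"
    using assms(2) unfolding modrel_def by blast
  obtain \<kappa> where k: "\<kappa> \<noteq> 0" "\<forall>x. D \<tau>' (x / (of_int c * \<tau> + of_int d)) = \<kappa> * D \<tau> x"
    using D_modular[OF tau abcd] unfolding t[symmetric] by blast
  show ?thesis by (rule that[OF moebius_denominator_nonzero[OF tau abcd(1)] k(1)]) (use k(2) in simp)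
qed

lemma D_Dden_nonzero: "D \<tau> x \<noteq> 0 \<Longrightarrow> Dden \<tau> x \<noteq> 0" by (simp add: D_nonzero_iff)

text \<open>The last clause asserts that \<phi> maps regular points to regular points; with
  \<open>exists_reg\<close> this provides an actual pair of equivalent germs.\<close>

definition web_symmetry :: "complex \<Rightarrow> complex \<Rightarrow> (C2 \<Rightarrow> C2) \<Rightarrow> bool" where
  "web_symmetry \<tau> \<tau>' \<phi> \<longleftrightarrow> \<phi> \<in> Sym_T0 \<and>
     (\<forall>p. holo2_at (u_theta \<tau>) p \<and> holo2_at (u_theta \<tau>') (\<phi> p) \<longrightarrow> wedge (u_theta \<tau>) (u_theta \<tau>' \<circ> \<phi>) p = 0) \<and>
     (\<forall>p. regular_at (u_theta \<tau>) p \<longrightarrow> regular_at (u_theta \<tau>') (\<phi> p) \<and> maps_web_at \<phi> p (theta_web \<tau>) (theta_web \<tau>'))"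

text \<open>For related matrices \<phi> is a homothety, which carries \<open>D \<tau>\<close> to
  \<open>D \<tau>'\<close>. If -2/\<tau> intervenes, \<phi> has x + y and x - y as its coordinates,
  up to affine changes, and exchanges the two pairs of pencils; \<open>Dg \<tau>\<close> then takes
  the place of \<open>D \<tau>\<close>.\<close>

theorem Grel_imp_equivalence:
  assumes tau: "Im \<tau> > 0" and tau': "Im \<tau>' > 0" and G: "Grel \<tau> \<tau>'"
  shows "\<exists>\<phi>. web_symmetry \<tau> \<tau>' \<phi>"
proof (cases "modrel \<tau> \<tau>'")
  case True
  obtain j \<kappa> where j: "j \<noteq> 0" "\<kappa> \<noteq> 0" and D: "\<And>x. D \<tau>' (x / j) = \<kappa> * D \<tau> x" by (rule D_modrel[OF tau True]) blast
  define \<phi> :: "C2 \<Rightarrow> C2" where "\<phi> = (\<lambda>(x, y). (1 / j * x + 0 * y + 0, 0 * x + 1 / j * y + 0))"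
  have D': "D \<tau>' (1 / j * x + 0 * y + 0) = \<kappa> * D \<tau> x" "D \<tau>' (0 * x + 1 / j * y + 0) = \<kappa> * D \<tau> y" for x y
    using D[of x] D[of y] by simp_all
  have det: "1 / j * (1 / j) - 0 * 0 \<noteq> 0" "1 / j + 2 * 0 \<noteq> 0" "0 + 2 * (1 / j) \<noteq> 0" using j by simp_all
  have \<sigma>: "bij_betw (\<lambda>i. i) {..<4} {..<4 :: nat}" by (simp add: bij_betw_def)
  have T0: "\<exists>\<alpha> \<beta>. \<alpha> \<noteq> 0 \<and> (\<forall>z. (T0 ! i) (\<phi> z) = \<alpha> * (T0 ! i) z + \<beta>)" if "i < 4" for i
    using less_4_cases[OF that] j(1)
    by (intro exI[of _ "1 / j"] exI[of _ 0]) (auto simp: T0_def \<phi>_def add_divide_distrib diff_divide_distrib)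
  have eq: "(D \<tau>' (1 / j * x + 0 * y + 0) * (1 / j) + D \<tau>' (0 * x + 1 / j * y + 0) * 0) * D \<tau> y
     = (D \<tau>' (1 / j * x + 0 * y + 0) * 0 + D \<tau>' (0 * x + 1 / j * y + 0) * (1 / j)) * D \<tau> x" for x y
    unfolding D' by simp
  note equiv = affine_equivalence[OF tau tau' det \<sigma>, where e = 0 and f = 0, folded \<phi>_def, OF T0 eq]
  have reg: "regular_at (u_theta \<tau>') (\<phi> p)" if "regular_at (u_theta \<tau>) p" for p
  proof -
    obtain x y where p: "p = (x, y)" by (cases p)
    have ph: "\<phi> p = (1 / j * x + 0 * y + 0, 0 * x + 1 / j * y + 0)" by (simp only: p \<phi>_def case_prod_conv)
    have r: "D \<tau> x \<noteq> 0" "D \<tau> y \<noteq> 0" "(D \<tau> x)\<^sup>2 \<noteq> (D \<tau> y)\<^sup>2"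
      using that unfolding p regular_at_iff[OF tau] by blast+
    have "\<kappa> * D \<tau> x \<noteq> 0" "\<kappa> * D \<tau> y \<noteq> 0" "(\<kappa> * D \<tau> x)\<^sup>2 \<noteq> (\<kappa> * D \<tau> y)\<^sup>2" using r j by (simp_all add: power_mult_distrib)
    hence "D \<tau>' (1 / j * x + 0 * y + 0) \<noteq> 0" "D \<tau>' (0 * x + 1 / j * y + 0) \<noteq> 0"
      "(D \<tau>' (1 / j * x + 0 * y + 0))\<^sup>2 \<noteq> (D \<tau>' (0 * x + 1 / j * y + 0))\<^sup>2" unfolding D' by blast+
    thus ?thesis unfolding ph regular_at_iff[OF tau'] using D_Dden_nonzero by blast
  qed
  have "\<phi> \<in> Sym_T0" using affine_symmetry(1)[OF det(1) \<sigma>, where e = 0 and f = 0, folded \<phi>_def, OF T0] .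
  thus ?thesis unfolding web_symmetry_def using equiv reg by blast
next
  case False
  hence F: "modrel (- 2 / \<tau>) \<tau>'" using G by (simp add: Grel_def)
  have tau2: "Im (- 2 / \<tau>) > 0" by (rule Im_fricke[OF tau])
  obtain j \<kappa>2 where j: "j \<noteq> 0" "\<kappa>2 \<noteq> 0" and D2: "\<And>x. D \<tau>' (x / j) = \<kappa>2 * D (- 2 / \<tau>) x" by (rule D_modrel[OF tau2 F]) blast
  obtain \<kappa>1 where k1: "\<kappa>1 \<noteq> 0" and D1: "\<forall>t. D (- 2 / \<tau>) (- t / \<tau> - cpi / 2) = \<kappa>1 * Dg \<tau> t" using D_fricke[OF tau] by blast
  have t0: "\<tau> \<noteq> 0" using tau by auto
  \<comment> \<open>With b, the slope and offset of the map t \<mapsto> (-t/\<tau> - pi/2)/j, the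
    composition of the substitutions of \<open>D_fricke\<close> and \<open>D_modrel\<close>.\<close>
  define s where "s = - 1 / (\<tau> * j)"
  define b where "b = - cpi / (2 * j)"
  define \<kappa> where "\<kappa> = \<kappa>2 * \<kappa>1"
  have s0: "s \<noteq> 0" using t0 j by (simp add: s_def)
  have k0: "\<kappa> \<noteq> 0" using k1 j by (simp add: \<kappa>_def)
  have Dst: "D \<tau>' (s * t + b) = \<kappa> * Dg \<tau> t" for t
  proof -
    have "s * t + b = (- t / \<tau> - cpi / 2) / j" using t0 j(1) by (simp add: s_def b_def divide_simps)
    thus ?thesis using D2[of "- t / \<tau> - cpi / 2"] D1 by (simp add: \<kappa>_def)
  qed
  \<comment> \<open>In the differential of log((1 + u)/(1 - u)) the term along x - y carries a minus
    sign. The extra s pi, a translation of the argument of \<open>Dg\<close> by pi, supplies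
    it.\<close>
  define f where "f = s * cpi + b"
  define \<phi> :: "C2 \<Rightarrow> C2" where "\<phi> = (\<lambda>(x, y). (s * x + s * y + b, s * x + (- s) * y + f))"
  have D': "D \<tau>' (s * x + s * y + b) = \<kappa> * Dg \<tau> (x + y)" "D \<tau>' (s * x + (- s) * y + f) = - (\<kappa> * Dg \<tau> (x - y))" for x y
  proof -
    show "D \<tau>' (s * x + s * y + b) = \<kappa> * Dg \<tau> (x + y)" using Dst[of "x + y"] by (simp add: algebra_simps)
    have "s * (x - y + cpi) + b = s * x + (- s) * y + f" by (simp add: f_def algebra_simps)
    thus "D \<tau>' (s * x + (- s) * y + f) = - (\<kappa> * Dg \<tau> (x - y))" using Dst[of "x - y + cpi"] Dg_plus_pi[OF tau, of "x - y"] by simp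
  qed
  have det: "s * (- s) - s * s \<noteq> 0" "s + 2 * s \<noteq> 0" "s + 2 * (- s) \<noteq> 0"
  proof -
    have "s * (- s) - s * s = - 2 * (s * s)" "s + 2 * s = 3 * s" "s + 2 * (- s) = - s" by simp_all
    thus "s * (- s) - s * s \<noteq> 0" "s + 2 * s \<noteq> 0" "s + 2 * (- s) \<noteq> 0" using s0 by (simp_all only:) simp_all
  qed
  define \<sigma> :: "nat \<Rightarrow> nat" where "\<sigma> = (!) [2, 3, 0, 1]"
  have \<sigma>s: "\<sigma> 0 = 2" "\<sigma> (Suc 0) = 3" "\<sigma> 2 = 0" "\<sigma> 3 = Suc 0" by (simp_all add: \<sigma>_def)
  have \<sigma>: "bij_betw \<sigma> {..<4} {..<4}"
    by (rule bij_betw_byWitness[where f' = \<sigma>]) (auto dest!: less_4_cases simp: \<sigma>s)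
  have T0: "\<exists>\<alpha> \<beta>. \<alpha> \<noteq> 0 \<and> (\<forall>z. (T0 ! \<sigma> i) (\<phi> z) = \<alpha> * (T0 ! i) z + \<beta>)" if "i < 4" for i
    using less_4_cases[OF that]
  proof (elim disjE)
    assume "i = 0"
    thus ?thesis using s0 by (intro exI[of _ "2 * s"] exI[of _ "b + f"]) (auto simp: T0_def \<phi>_def \<sigma>s algebra_simps)
  next
    assume "i = Suc 0"
    thus ?thesis using s0 by (intro exI[of _ "2 * s"] exI[of _ "b - f"]) (auto simp: T0_def \<phi>_def \<sigma>s algebra_simps)
  next
    assume "i = 2"
    thus ?thesis using s0 by (intro exI[of _ s] exI[of _ b]) (auto simp: T0_def \<phi>_def \<sigma>s algebra_simps)
  next
    assume "i = 3"
    thus ?thesis using s0 by (intro exI[of _ s] exI[of _ f]) (auto simp: T0_def \<phi>_def \<sigma>s algebra_simps)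
  qed
  have eq: "(D \<tau>' (s * x + s * y + b) * s + D \<tau>' (s * x + (- s) * y + f) * s) * D \<tau> y
     = (D \<tau>' (s * x + s * y + b) * s + D \<tau>' (s * x + (- s) * y + f) * (- s)) * D \<tau> x"
    if nz: "Dden \<tau> x \<noteq> 0" "Dden \<tau> y \<noteq> 0" "tp \<tau> (x + y) \<noteq> 0" "tq \<tau> (x + y) \<noteq> 0" "tp \<tau> (x - y) \<noteq> 0" "tq \<tau> (x - y) \<noteq> 0" for x y
  proof -
    have t: "t1 \<tau> x \<noteq> 0" "t4 \<tau> x \<noteq> 0" "t1 \<tau> y \<noteq> 0" "t4 \<tau> y \<noteq> 0" using nz(1,2) by (auto simp: Dden_def)
    obtain k where k: "k \<noteq> 0" "Dg \<tau> (x + y) - Dg \<tau> (x - y) = k * (f1 \<tau> x * ff \<tau> y)" "Dg \<tau> (x + y) + Dg \<tau> (x - y) = k * (ff \<tau> x * f1 \<tau> y)"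
      by (rule u_partials_Dg[OF tau t(2,4) nz(3-6)])
    have ff: "f1 \<tau> x = D \<tau> x * ff \<tau> x" "f1 \<tau> y = D \<tau> y * ff \<tau> y"
      using deriv_ff_eq[OF t(1,2)] deriv_ff_eq[OF t(3,4)] by (simp_all add: f1_def)
    have "(D \<tau>' (s * x + s * y + b) * s + D \<tau>' (s * x + (- s) * y + f) * s) = s * \<kappa> * (Dg \<tau> (x + y) - Dg \<tau> (x - y))"
      "(D \<tau>' (s * x + s * y + b) * s + D \<tau>' (s * x + (- s) * y + f) * (- s)) = s * \<kappa> * (Dg \<tau> (x + y) + Dg \<tau> (x - y))"
      unfolding D' by (simp_all add: algebra_simps)
    thus ?thesis unfolding k ff by simp
  qed
  note equiv = affine_equivalence[OF tau tau' det \<sigma>, where e = b and f = f, folded \<phi>_def, OF T0 eq]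
  have reg: "regular_at (u_theta \<tau>') (\<phi> p)" if "regular_at (u_theta \<tau>) p" for p
  proof -
    obtain x y where p: "p = (x, y)" by (cases p)
    have ph: "\<phi> p = (s * x + s * y + b, s * x + (- s) * y + f)" by (simp only: p \<phi>_def case_prod_conv)
    have r: "reg \<tau> x y" using that tau by (simp add: p reg_def)
    have "\<kappa> * Dg \<tau> (x + y) \<noteq> 0" "- (\<kappa> * Dg \<tau> (x - y)) \<noteq> 0" "(\<kappa> * Dg \<tau> (x + y))\<^sup>2 \<noteq> (- (\<kappa> * Dg \<tau> (x - y)))\<^sup>2"
      using reg_Dg[OF r] k0 by (simp_all add: power_mult_distrib)
    hence "D \<tau>' (s * x + s * y + b) \<noteq> 0" "D \<tau>' (s * x + (- s) * y + f) \<noteq> 0"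
      "(D \<tau>' (s * x + s * y + b))\<^sup>2 \<noteq> (D \<tau>' (s * x + (- s) * y + f))\<^sup>2" unfolding D' by blast+
    thus ?thesis unfolding ph regular_at_iff[OF tau'] using D_Dden_nonzero by blast
  qed
  have "\<phi> \<in> Sym_T0" using affine_symmetry(1)[OF det(1) \<sigma>, where e = b and f = f, folded \<phi>_def, OF T0] .
  thus ?thesis unfolding web_symmetry_def using equiv reg by blast
qed


subsection \<open>Equivalent webs have congruent parameters\<close>

lemma dl_translate:
  assumes ent: "F holomorphic_on UNIV" "G holomorphic_on UNIV" and E: "(E has_field_derivative e * E x) (at x)"
    and FG: "\<And>x. F (x + w) = E x * G x" and nz: "E x \<noteq> 0" "G x \<noteq> 0"
  shows "dl F (x + w) = e + dl G x"
proof -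
  have "((\<lambda>x. F (1 * x + w)) has_field_derivative deriv (\<lambda>x. F (1 * x + w)) x) (at x)"
    by (rule entire_field_derivative[OF entire_compose_affine[OF ent(1)]])
  hence 1: "((\<lambda>x. F (x + w)) has_field_derivative deriv F (x + w)) (at x)"
    unfolding deriv_affine[OF ent(1)] by simp
  have 2: "((\<lambda>x. F (x + w)) has_field_derivative (e * E x) * G x + deriv G x * E x) (at x)"
    unfolding FG by (rule DERIV_mult[OF E entire_field_derivative[OF ent(2)]])
  have "deriv F (x + w) = (e * E x) * G x + deriv G x * E x" by (rule DERIV_unique[OF 1 2])
  thus ?thesis using nz by (simp add: dl_def FG add_divide_distrib)
qed

text \<open>Three translations separate the terms: by 2 pi, which fixes both logarithmic derivatives
  and gives b = 0; by pi \<tau>, which lowers both by i and gives c + d = 0; by pi, which exchanges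
  them and leaves c times their difference.\<close>

lemma log_derivs_independent:
  assumes tau: "Im \<tau> > 0" and ev: "\<forall>\<^sub>F t in nhds t0. a + b * t = c * dl (tp \<tau>) t + d * dl (tq \<tau>) t"
  shows "c = 0" "d = 0"
proof -
  note P = theta_entire(3)[OF tau] and Q = theta_entire(4)[OF tau]
  obtain p q where pq: "tp \<tau> p \<noteq> 0" "tq \<tau> q \<noteq> 0" using tp_not_identically_0 tq_not_identically_0 tau by blast
  define W where "W = (\<lambda>t. (a + b * t) * (tp \<tau> t * tq \<tau> t) - (c * (deriv (tp \<tau>) t * tq \<tau> t) + d * (tp \<tau> t * deriv (tq \<tau>) t)))"
  have WE: "W holomorphic_on UNIV" unfolding W_def
    by (intro holomorphic_on_diff holomorphic_on_mult holomorphic_on_add holomorphic_on_const holomorphic_on_ident P Q entire_deriv)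
  have evat: "\<forall>\<^sub>F t in at t0. a + b * t = c * dl (tp \<tau>) t + d * dl (tq \<tau>) t"
    using ev unfolding eventually_at_filter by eventually_elim simp
  have "\<forall>\<^sub>F t in at t0. W t = 0"
    using evat entire_eventually_nonzero[OF P pq(1), of t0] entire_eventually_nonzero[OF Q pq(2), of t0]
  proof eventually_elim
    case (elim t)
    thus ?case unfolding W_def elim(1) by (simp add: dl_def field_simps)
  qed
  hence W0: "W t = 0" for t by (rule entire_eq_0_at[OF WE])
  have eq: "a + b * t = c * dl (tp \<tau>) t + d * dl (tq \<tau>) t" if "tp \<tau> t \<noteq> 0" "tq \<tau> t \<noteq> 0" for t
    using W0[of t] that by (simp add: W_def dl_def field_simps)
  obtain s where s: "LDnum (tp \<tau>) (tq \<tau>) s \<noteq> 0" using Dg_not_identically_0[OF tau] by blast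
  have PQ: "(\<lambda>x. tp \<tau> x * tq \<tau> x) holomorphic_on UNIV" by (intro holomorphic_on_mult P Q)
  have "\<exists>x. tp \<tau> x * tq \<tau> x \<noteq> 0" using entire_mult_eq_0[OF P Q _ pq(1), of q] pq(2) by blast
  then obtain r where r: "tp \<tau> r * tq \<tau> r \<noteq> 0" by blast
  have "\<exists>t. LDnum (tp \<tau>) (tq \<tau>) t * (tp \<tau> t * tq \<tau> t) \<noteq> 0"
    using entire_mult_eq_0[OF LDnum_holomorphic[OF P Q] PQ _ s, of r] r by blast
  then obtain t where t: "LDnum (tp \<tau>) (tq \<tau>) t \<noteq> 0" "tp \<tau> t \<noteq> 0" "tq \<tau> t \<noteq> 0" by auto
  define G H where "G = dl (tp \<tau>) t" and "H = dl (tq \<tau>) t"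
  have GH: "G \<noteq> H" using t by (simp add: G_def H_def dl_def LDnum_def field_simps)
  have one: "((\<lambda>_. 1) has_field_derivative 0 * 1) (at x)" for x :: complex by simp
  have sh_pi: "dl (tp \<tau>) (t + cpi) = H" "dl (tq \<tau>) (t + cpi) = G"
    using dl_translate[OF P Q one, of "cpi" t] dl_translate[OF Q P one, of "cpi" t] t
    by (simp_all add: tp_plus_pi tq_plus_pi G_def H_def)
  have sh_2pi: "dl (tp \<tau>) (t + 2 * cpi) = G" "dl (tq \<tau>) (t + 2 * cpi) = H"
    using dl_translate[OF P P one, of "2 * cpi" t] dl_translate[OF Q Q one, of "2 * cpi" t] t
    by (simp_all add: tp_plus_2pi tq_plus_2pi G_def H_def)
  have ex: "((\<lambda>x. \<epsilon> * exp (k - \<i> * x)) has_field_derivative - \<i> * (\<epsilon> * exp (k - \<i> * t))) (at t)" for \<epsilon> k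
    by (auto intro!: derivative_eq_intros)
  have "dl (tp \<tau>) (t + cpi * \<tau>) = - \<i> + dl (tp \<tau>) t"
    by (rule dl_translate[OF P P ex[of "- 1" "- (\<i> * cpi * \<tau> / 2)"]]) (use t in \<open>simp_all add: tp_plus_tau\<close>)
  moreover have "dl (tq \<tau>) (t + cpi * \<tau>) = - \<i> + dl (tq \<tau>) t"
    by (rule dl_translate[OF Q Q ex[of 1 "- (\<i> * cpi * \<tau> / 2)"]]) (use t in \<open>simp_all add: tq_plus_tau\<close>)
  ultimately have sh_tau: "dl (tp \<tau>) (t + cpi * \<tau>) = G - \<i>" "dl (tq \<tau>) (t + cpi * \<tau>) = H - \<i>"
    by (simp_all add: G_def H_def)
  have e0: "a + b * t = c * G + d * H" using eq[OF t(2,3)] by (simp add: G_def H_def)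
  have e1: "a + b * (t + 2 * cpi) = c * G + d * H"
    using eq[of "t + 2 * cpi"] t by (simp only: sh_2pi tp_plus_2pi tq_plus_2pi simp_thms)
  have "a + b * (t + 2 * cpi) = (a + b * t) + b * (2 * cpi)" by (simp add: algebra_simps)
  hence "b * (2 * cpi) = 0" using e0 e1 by simp
  hence b: "b = 0" by simp
  have e2: "a = c * H + d * G" using eq[of "t + cpi"] t unfolding sh_pi b by (simp add: tp_plus_pi tq_plus_pi)
  have e3: "a = c * (G - \<i>) + d * (H - \<i>)" using eq[of "t + cpi * \<tau>"] t unfolding sh_tau b by (simp add: tp_plus_tau tq_plus_tau)
  have e0: "a = c * G + d * H" using e0 b by simp
  have "\<i> * (c + d) = (c * G + d * H) - (c * (G - \<i>) + d * (H - \<i>))" by (simp add: algebra_simps)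
  hence "\<i> * (c + d) = 0" using e0 e3 by simp
  hence d: "d = - c" by (simp add: eq_neg_iff_add_eq_0 add.commute)
  have "2 * (c * (G - H)) = (c * G + d * H) - (c * H + d * G)" unfolding d by (simp add: algebra_simps)
  hence "2 * (c * (G - H)) = 0" using e0 e2 by simp
  thus "c = 0" using GH by simp
  thus "d = 0" using d by simp
qed

text \<open>Translation by pi fixes \<open>D\<close> and removes the linear term; the half period
  changes the sign of \<open>D\<close> and then separates it from the constant.\<close>

lemma D_affine_independent:
  assumes tau: "Im \<tau> > 0" and x0: "Dden \<tau> x0 \<noteq> 0" and ev: "\<forall>\<^sub>F t in nhds x0. A + B * t + c * D \<tau> t = 0"
  shows "c = 0"
proof -
  note ent = Dnum_entire[OF tau] Dden_entire[OF tau]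
  define W where "W = (\<lambda>t. (A + B * t) * Dden \<tau> t + c * Dnum \<tau> t)"
  have WE: "W holomorphic_on UNIV" unfolding W_def
    by (intro holomorphic_on_mult holomorphic_on_add holomorphic_on_const holomorphic_on_ident ent)
  have "\<forall>\<^sub>F t in nhds x0. W t = 0"
    using ev entire_nonzero_nhds[OF ent(2) x0]
  proof eventually_elim
    case (elim t)
    have "W t = (A + B * t + c * D \<tau> t) * Dden \<tau> t" using elim(2) by (simp add: W_def D_eq algebra_simps)
    thus ?case unfolding elim(1) by simp
  qed
  hence "\<forall>\<^sub>F t in at x0. W t = 0" unfolding eventually_at_filter by eventually_elim simp
  hence W0: "W t = 0" for t by (rule entire_eq_0_at[OF WE])
  have eq: "A + B * t + c * D \<tau> t = 0" if "D \<tau> t \<noteq> 0" for t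
  proof -
    have nz: "Dden \<tau> t \<noteq> 0" using that by (rule D_Dden_nonzero)
    have "W t = (A + B * t + c * D \<tau> t) * Dden \<tau> t" using nz by (simp add: W_def D_eq algebra_simps)
    thus ?thesis using W0[of t] nz by simp
  qed
  obtain s r where "reg \<tau> s r" by (rule exists_reg[OF tau])
  note Ds = regD(6)[OF this]
  have e0: "A + B * s + c * D \<tau> s = 0" by (rule eq[OF Ds])
  have e1: "A + B * (s + cpi) + c * D \<tau> s = 0" using eq[of "s + cpi"] Ds unfolding D_plus_pi[OF tau] by simp
  have e2: "A + B * (s + cpi * \<tau> / 2) + c * (- D \<tau> s) = 0" using eq[of "s + cpi * \<tau> / 2"] Ds unfolding D_plus_half[OF tau] by simp
  have "A + B * (s + cpi) + c * D \<tau> s = (A + B * s + c * D \<tau> s) + B * cpi" by (simp add: algebra_simps)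
  hence B: "B = 0" unfolding e0 e1 by simp
  have "2 * (c * D \<tau> s) = (A + B * s + c * D \<tau> s) - (A + B * (s + cpi * \<tau> / 2) + c * (- D \<tau> s))" unfolding B by simp
  thus ?thesis unfolding e0 e2 using Ds by simp
qed

text \<open>A vanishing component along x + y or x - y makes the coefficients of the relations from
  1 + u and 1 - u vanish; a vanishing component along x or y then does the same for the one from u.
  No other row of \<open>EB\<close> contributes to component 4.\<close>

lemma AR_two_zero_components:
  assumes r: "reg \<tau> x y" and AR: "AR \<tau> x y \<phi>"
    and j0: "j0 = 0 \<or> j0 = Suc 0" "\<forall>\<^sub>F w in nhds (AR_pt \<tau> x y j0). \<phi> j0 w = 0"
    and j1: "j1 = 2 \<or> j1 = 3" "\<forall>\<^sub>F w in nhds (AR_pt \<tau> x y j1). \<phi> j1 w = 0"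
  shows "\<phi> 4 (ff \<tau> x * ff \<tau> y) = 0"
proof -
  note R = regD[OF r]
  obtain c where c: "\<forall>j<5. \<forall>\<^sub>F w in nhds (AR_pt \<tau> x y j). \<phi> j w = (\<Sum>i<6. c i * EB \<tau> i j w)"
    by (rule AR_classification[OF r AR])
  have "j0 < 5" "j1 < 5" using j0(1) j1(1) by auto
  hence e: "\<forall>\<^sub>F w in nhds (AR_pt \<tau> x y j0). (\<Sum>i<6. c i * EB \<tau> i j0 w) = 0" "\<forall>\<^sub>F w in nhds (AR_pt \<tau> x y j1). (\<Sum>i<6. c i * EB \<tau> i j1 w) = 0"
    using eventually_conj[OF c[rule_format, of j0] j0(2)] eventually_conj[OF c[rule_format, of j1] j1(2)]
    by (auto elim!: eventually_mono)
  have c45: "c 4 = 0 \<and> c 5 = 0"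
    using j1(1)
  proof
    assume j: "j1 = 2"
    have "\<forall>\<^sub>F w in nhds (x + y). c 0 + c 2 * w = c 4 * dl (tp \<tau>) w + c 5 * dl (tq \<tau>) w"
      using e(2) unfolding sum_lessThan_6 j by (simp add: AR_pt_def EB_def) (erule eventually_mono, simp add: algebra_simps)
    from log_derivs_independent[OF R(1) this] show ?thesis by simp
  next
    assume j: "j1 = 3"
    have "\<forall>\<^sub>F w in nhds (x - y). c 1 + c 2 * w = c 5 * dl (tp \<tau>) w + c 4 * dl (tq \<tau>) w"
      using e(2) unfolding sum_lessThan_6 j by (simp add: AR_pt_def EB_def) (erule eventually_mono, simp add: algebra_simps)
    from log_derivs_independent[OF R(1) this] show ?thesis by simp
  qed
  have D: "Dden \<tau> x \<noteq> 0" "Dden \<tau> y \<noteq> 0" using R by (simp_all add: Dden_def)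
  have c3: "c 3 = 0"
    using j0(1)
  proof
    assume j: "j0 = 0"
    have "\<forall>\<^sub>F w in nhds x. (c 0 + c 1) + (2 * c 2) * w + c 3 * D \<tau> w = 0"
      using e(1) unfolding sum_lessThan_6 j by (simp add: AR_pt_def EB_def c45) (erule eventually_mono, simp add: algebra_simps)
    from D_affine_independent[OF R(1) D(1) this] show ?thesis .
  next
    assume j: "j0 = Suc 0"
    have "\<forall>\<^sub>F w in nhds y. (c 0 - c 1) + (2 * c 2) * w + c 3 * D \<tau> w = 0"
      using e(1) unfolding sum_lessThan_6 j by (simp add: AR_pt_def EB_def c45) (erule eventually_mono, simp add: algebra_simps)
    from D_affine_independent[OF R(1) D(2) this] show ?thesis .
  qed
  have "\<forall>\<^sub>F w in nhds (ff \<tau> x * ff \<tau> y). \<phi> 4 w = (\<Sum>i<6. c i * EB \<tau> i 4 w)"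
    using c[rule_format, of 4] by (simp add: AR_pt_def)
  from eventually_nhds_x_imp_x[OF this] show ?thesis
    unfolding sum_lessThan_6 by (simp add: c3 c45 EB_def)
qed

lemma web_factor:
  assumes sf: "same_foliation_at p u w" and u: "holo2_at u p" and w: "holo2_at w p"
    and nz: "dx u p \<noteq> 0 \<or> dy u p \<noteq> 0"
  obtains h where "h analytic_on {u p}" "\<forall>\<^sub>F z in nhds p. w z = h (u z)"
    "\<forall>\<^sub>F z in nhds p. dx w z = deriv h (u z) * dx u z \<and> dy w z = deriv h (u z) * dy u z"
proof -
  obtain h where h: "h analytic_on {u p}" "\<forall>\<^sub>F z in nhds p. w z = h (u z)"
    by (rule same_foliation_factor[OF assms])
  have "\<forall>\<^sub>F z in nhds p. h analytic_on {u z}"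
    by (rule isCont_eventually[OF holo2_at_isCont[OF u] refl analytic_at_eventually(1)[OF h(1)]])
  hence "\<forall>\<^sub>F z in nhds p. dx w z = deriv h (u z) * dx u z \<and> dy w z = deriv h (u z) * dy u z"
    using eventually_eventually[THEN iffD2, OF h(2)] holo2_at_eventually[OF u]
    by eventually_elim (intro conjI factor_partials)
  thus ?thesis by (rule that[OF h])
qed

lemma T0_comp_partials:
  assumes ld: "local_diffeo_at \<psi> z" and k: "k < 4"
  shows "holo2_at (T_web u ! k \<circ> \<psi>) z"
    "dx (T_web u ! k \<circ> \<psi>) z = la k * dx (fst \<circ> \<psi>) z + lb k * dx (snd \<circ> \<psi>) z"
    "dy (T_web u ! k \<circ> \<psi>) z = la k * dy (fst \<circ> \<psi>) z + lb k * dy (snd \<circ> \<psi>) z"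
  using holo2_compose[where v = "T_web u ! k" and \<psi> = \<psi> and p = z, OF T0_partials(1)[OF k] local_diffeoD(1,2)[OF ld]]
  by (simp_all only: T0_partials[OF k])

definition ll :: "nat \<Rightarrow> C2 \<Rightarrow> complex" where "ll i z = la i * fst z + lb i * snd z"

lemma T_web_ll: "i < 4 \<Longrightarrow> T_web u ! i = ll i"
  by (auto simp: T_web_nth ll_def fun_eq_iff)

text \<open>Two different forms \<open>ll i\<close> and \<open>ll j\<close> are linear coordinates,
  so one of them can be moved freely along the line on which the other is fixed.\<close>

lemma pair_eventually:
  assumes ij: "i < 4" "j < 4" "i \<noteq> j" and ev: "\<forall>\<^sub>F z in nhds p. P (ll i z) (ll j z)"
  shows "\<forall>\<^sub>F s in nhds (ll i p). P s (ll j p)"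
proof -
  define k where "k = la i * lb j - lb i * la j"
  have k: "k \<noteq> 0" using la_lb_transversal[OF ij] by (simp add: k_def)
  define g where "g = (\<lambda>s. (fst p + (s - ll i p) / k * lb j, snd p + (s - ll i p) / k * (- la j)))"
  have c: "isCont g (ll i p)" unfolding g_def by (intro isCont_Pair isCont_add isCont_mult isCont_divide isCont_diff continuous_const continuous_ident k)
  have i: "ll i (g s) = s" for s
  proof -
    have "ll i (fst p + q * lb j, snd p + q * (- la j)) = ll i p + q * k" for q by (simp add: ll_def k_def algebra_simps)
    hence "ll i (g s) = ll i p + (s - ll i p) / k * k" by (simp only: g_def)
    thus ?thesis using k by simp
  qed
  have j: "ll j (g s) = ll j p" for s
  proof -
    have "ll j (fst p + q * lb j, snd p + q * (- la j)) = ll j p" for q by (simp add: ll_def algebra_simps)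
    thus ?thesis by (simp only: g_def)
  qed
  have "g (ll i p) = p" by (simp add: g_def)
  from isCont_eventually[OF c this ev] show ?thesis unfolding i j .
qed

text \<open>The last hypothesis says that the cross-ratio of the four directions is -1, the
  directions i0 and i1 being separated harmonically by i2 and i3. In \<open>T0\<close> this happens
  only for the splitting into {x, y} and {x + y, x - y}.\<close>

lemma harmonic_pairs:
  assumes "i0 < 4" "i1 < 4" "i2 < 4" "i3 < 4" "distinct [i0, i1, i2, i3]"
    and "(la i0 * lb i2 - lb i0 * la i2) * (la i1 * lb i3 - lb i1 * la i3) + (la i0 * lb i3 - lb i0 * la i3) * (la i1 * lb i2 - lb i1 * la i2) = 0"
  shows "i0 = 0 \<and> i1 = Suc 0 \<or> i0 = Suc 0 \<and> i1 = 0 \<or> i0 = 2 \<and> i1 = 3 \<or> i0 = 3 \<and> i1 = 2"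
  using less_4_cases[OF assms(1)] less_4_cases[OF assms(2)] less_4_cases[OF assms(3)] less_4_cases[OF assms(4)] assms(5,6)
  by (elim disjE) simp_all


lemma la_lb_nonzero: "i < 4 \<Longrightarrow> la i \<noteq> 0 \<or> lb i \<noteq> 0"
  by (auto dest!: less_4_cases)

lemma jacobian_solve:
  fixes r s :: complex
  assumes "X1 * Y2 - X2 * Y1 \<noteq> 0" "r * X1 + s * Y1 = 0" "r * X2 + s * Y2 = 0"
  shows "r = 0" "s = 0"
proof -
  have "r * (X1 * Y2 - X2 * Y1) = (r * X1 + s * Y1) * Y2 - (r * X2 + s * Y2) * Y1" by (simp add: algebra_simps)
  thus "r = 0" using assms by simp
  have "s * (X1 * Y2 - X2 * Y1) = (r * X2 + s * Y2) * X1 - (r * X1 + s * Y1) * X2" by (simp add: algebra_simps)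
  thus "s = 0" using assms by simp
qed

text \<open>If \<open>\<psi>\<close> sent \<open>\<F>(u\<^sub>\<tau>)\<close> to one of the pencils of \<open>\<T>\<^sub>0\<close>, a linear relation between three
  members of \<open>\<T>\<^sub>0\<close> would pull back to an abelian relation supported on \<open>u\<^sub>\<tau>\<close>, one of \<open>x, y\<close> and one
  of \<open>x + y, x - y\<close>.\<close>

lemma maps_web_fixes_u:
  assumes r: "reg \<tau> x y" and r': "regular_at (u_theta \<tau>') (\<psi> (x, y))" and ld: "local_diffeo_at \<psi> (x, y)"
    and \<sigma>: "bij_betw \<sigma> {..<5} {..<5}"
    and sf: "\<And>j. j < 5 \<Longrightarrow> same_foliation_at (x, y) (theta_web \<tau> ! j) (theta_web \<tau>' ! \<sigma> j \<circ> \<psi>)"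
  shows "\<sigma> 4 = 4"
proof (rule ccontr)
  assume n4: "\<sigma> 4 \<noteq> 4"
  define p where "p = (x, y)"
  define us where "us = theta_web \<tau>"
  define w where "w = (\<lambda>k. theta_web \<tau>' ! k \<circ> \<psi>)"
  note R = regD[OF r]
  have ru: "regular_at (u_theta \<tau>) p" using r by (simp add: reg_def p_def)
  have inj: "\<sigma> i \<noteq> \<sigma> j" if "i < 5" "j < 5" "i \<noteq> j" for i j
    using \<sigma> that by (auto simp: bij_betw_def inj_on_def)
  have lt: "\<sigma> i < 5" if "i < 5" for i using \<sigma> that by (auto simp: bij_betw_def)
  have "4 \<in> \<sigma> ` {..<5}" using \<sigma> by (simp add: bij_betw_def)
  then obtain i0 where i0: "i0 < 5" "\<sigma> i0 = 4" by auto
  \<comment> \<open>The choices avoid the index that \<sigma> sends to 4, so that the images of i1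
    and i2 are pencils of \<open>T0\<close>; one index is taken from each pair.\<close>
  obtain i1 where i1: "i1 = 0 \<or> i1 = Suc 0" "i1 \<noteq> i0" by (cases "i0 = 0") auto
  obtain i2 where i2: "i2 = 2 \<or> i2 = (3 :: nat)" "i2 \<noteq> i0" by (cases "i0 = 2") auto
  have i12: "i1 < 4" "i2 < 4" "i1 \<noteq> i2" "i1 < 5" "i2 < 5" using i1 i2 by auto
  define k k1 k2 where "k = \<sigma> 4" and "k1 = \<sigma> i1" and "k2 = \<sigma> i2"
  have "\<sigma> i1 \<noteq> 4" "\<sigma> i2 \<noteq> 4" using inj[of i1 i0] inj[of i2 i0] i0 i1 i2 i12 by auto
  hence kk: "k < 4" "k1 < 4" "k2 < 4" using lt[of 4] lt[of i1] lt[of i2] n4 i12 by (simp_all add: k_def k1_def k2_def)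
  have kne: "k \<noteq> k1" "k \<noteq> k2" "k1 \<noteq> k2"
    using inj[of 4 i1] inj[of 4 i2] inj[of i1 i2] i12 by (simp_all add: k_def k1_def k2_def)
  have holo_w: "holo2_at (w l) p" if "l < 4" for l unfolding w_def p_def by (rule T0_comp_partials(1)[OF ld that])
  have sf': "same_foliation_at p (us ! j) (w (\<sigma> j))" if "j < 5" for j using sf[OF that] by (simp add: us_def w_def p_def)
  have hu: "holo2_at (us ! 4) p" "dx (us ! 4) p \<noteq> 0 \<or> dy (us ! 4) p \<noteq> 0"
    using ru by (auto simp: us_def T_web_nth(2) regular_at_def cond_T_def)
  have hT: "holo2_at (us ! i) p" "dx (us ! i) p \<noteq> 0 \<or> dy (us ! i) p \<noteq> 0" if "i < 4" for i
    using T0_partials[OF that] la_lb_nonzero[OF that] by (simp_all add: us_def)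
  obtain h where h: "h analytic_on {(us ! 4) p}"
    "\<forall>\<^sub>F z in nhds p. dx (w k) z = deriv h ((us ! 4) z) * dx (us ! 4) z \<and> dy (w k) z = deriv h ((us ! 4) z) * dy (us ! 4) z"
    by (rule web_factor[OF sf'[of 4, folded k_def] hu(1) holo_w[OF kk(1)] hu(2)]) simp_all
  obtain h1 where h1: "h1 analytic_on {(us ! i1) p}"
    "\<forall>\<^sub>F z in nhds p. dx (w k1) z = deriv h1 ((us ! i1) z) * dx (us ! i1) z \<and> dy (w k1) z = deriv h1 ((us ! i1) z) * dy (us ! i1) z"
    by (rule web_factor[OF sf'[OF i12(4), folded k1_def] hT(1)[OF i12(1)] holo_w[OF kk(2)] hT(2)[OF i12(1)]])
  obtain h2 where h2: "h2 analytic_on {(us ! i2) p}"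
    "\<forall>\<^sub>F z in nhds p. dx (w k2) z = deriv h2 ((us ! i2) z) * dx (us ! i2) z \<and> dy (w k2) z = deriv h2 ((us ! i2) z) * dy (us ! i2) z"
    by (rule web_factor[OF sf'[OF i12(5), folded k2_def] hT(1)[OF i12(2)] holo_w[OF kk(3)] hT(2)[OF i12(2)]])
  \<comment> \<open>Minors of the 2 x 3 matrix of coefficients of the forms with indices k, k1, k2:
    with these multipliers the three forms add up to 0.\<close>
  define c where "c = la k1 * lb k2 - lb k1 * la k2"
  define c1 where "c1 = la k2 * lb k - lb k2 * la k"
  define c2 where "c2 = la k * lb k1 - lb k * la k1"
  have c0: "c \<noteq> 0" using la_lb_transversal[OF kk(2,3) kne(3)] by (simp add: c_def)
  have rel: "c * dx (w k) z + c1 * dx (w k1) z + c2 * dx (w k2) z = 0" "c * dy (w k) z + c1 * dy (w k1) z + c2 * dy (w k2) z = 0"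
    if "local_diffeo_at \<psi> z" for z
    unfolding w_def T0_comp_partials[OF that kk(1)] T0_comp_partials[OF that kk(2)] T0_comp_partials[OF that kk(3)]
    by (simp_all add: c_def c1_def c2_def algebra_simps)
  define \<phi> where "\<phi> = (\<lambda>j s. if j = 4 then c * deriv h s else if j = i1 then c1 * deriv h1 s else if j = i2 then c2 * deriv h2 s else 0)"
  have AR: "AR \<tau> x y \<phi>"
    unfolding AR_iff[OF r] us_def[symmetric] p_def[symmetric]
  proof (intro conjI allI impI)
    fix j :: nat assume "j < 5"
    have "(\<lambda>s. a * deriv g s) analytic_on {v}" if "g analytic_on {v}" for a g v
      by (intro analytic_on_mult analytic_on_const analytic_deriv that)
    note an = this[OF h(1), of c] this[OF h1(1), of c1] this[OF h2(1), of c2]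
    show "\<phi> j analytic_on {(us ! j) p}"
      using an by (cases "j = 4"; cases "j = i1"; cases "j = i2") (simp_all add: \<phi>_def)
  next
    have ld': "\<forall>\<^sub>F z in nhds p. local_diffeo_at \<psi> z" using local_diffeoD(4)[OF ld] by (simp add: p_def)
    have s: "(\<Sum>j<5. \<phi> j (v j) * e j) = c * (deriv h (v 4) * e 4) + c1 * (deriv h1 (v i1) * e i1) + c2 * (deriv h2 (v i2) * e i2)" for v e
      using i1(1) i2(1) by (elim disjE) (simp_all add: sum_lessThan_5 \<phi>_def)
    show "\<forall>\<^sub>F z in nhds p. (\<Sum>j<5. \<phi> j ((us ! j) z) * dx (us ! j) z) = 0 \<and> (\<Sum>j<5. \<phi> j ((us ! j) z) * dy (us ! j) z) = 0"
      using ld' h(2) h1(2) h2(2)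
    proof eventually_elim
      case (elim z)
      show ?case unfolding s using rel[OF elim(1)] elim(2-4) by simp
    qed
  qed
  \<comment> \<open>The partners of i1 and i2 in their pairs; the relation has no component along
    them, as \<open>AR_two_zero_components\<close> requires.\<close>
  obtain j0 where j0: "j0 = 0 \<or> j0 = Suc 0" "j0 \<noteq> i1" by (cases "i1 = 0") auto
  obtain j1 where j1: "j1 = 2 \<or> j1 = (3 :: nat)" "j1 \<noteq> i2" by (cases "i2 = 2") auto
  have "\<phi> j0 = (\<lambda>_. 0)" "\<phi> j1 = (\<lambda>_. 0)" using j0 j1 i1(1) i2(1) by (auto simp: \<phi>_def)
  hence "\<phi> 4 (ff \<tau> x * ff \<tau> y) = 0"
    by (intro AR_two_zero_components[OF r AR j0(1) _ j1(1)]) simp_all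
  hence "deriv h ((us ! 4) p) = 0" using c0 by (simp add: \<phi>_def us_def T_web_nth(2) p_def u_theta_eq)
  hence "dx (w k) p = 0" "dy (w k) p = 0" using eventually_nhds_x_imp_x[OF h(2)] by simp_all
  hence "la k = 0 \<and> lb k = 0"
    unfolding w_def p_def T0_comp_partials[OF ld kk(1)] using jacobian_solve[OF local_diffeoD(5)[OF ld]] by blast
  thus False using la_lb_nonzero[OF kk(1)] by blast
qed

text \<open>The logarithmic derivative attached to the i-th pencil: along x and y it is the one that
  describes du / u, along x + y and x - y the one that describes the differential of log((1 + u)/(1
  - u)).\<close>

definition Ed :: "complex \<Rightarrow> nat \<Rightarrow> complex \<Rightarrow> complex" where
  "Ed \<tau> i = (if i < 2 then D \<tau> else Dg \<tau>)"

definition eps :: "nat \<Rightarrow> complex" where "eps = (!) [- 1, 1, - 1, - 1]"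

text \<open>The left-hand sides are the derivatives of log u along the leaves of the pencils i and
  j. On a leaf of pencil i only the coordinate of its partner j varies, so only
  \<open>Ed \<tau> j\<close> survives, up to a factor m common to both directions and the sign
  recorded in \<open>eps\<close>.\<close>

lemma reg_conjugate_directions:
  assumes r: "reg \<tau> x y" and ij: "i = 0 \<and> j = Suc 0 \<or> i = Suc 0 \<and> j = 0 \<or> i = 2 \<and> j = 3 \<or> i = 3 \<and> j = 2"
  obtains m where "m \<noteq> 0" "D \<tau> x * lb i - D \<tau> y * la i = m * (eps i * Ed \<tau> j (ll j (x, y)))"
    "D \<tau> x * lb j - D \<tau> y * la j = m * (eps j * Ed \<tau> i (ll i (x, y)))" "Ed \<tau> i (ll i (x, y)) \<noteq> 0" "Ed \<tau> j (ll j (x, y)) \<noteq> 0"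
proof -
  note R = regD[OF r]
  obtain k where k: "k \<noteq> 0" "Dg \<tau> (x + y) - Dg \<tau> (x - y) = k * (f1 \<tau> x * ff \<tau> y)" "Dg \<tau> (x + y) + Dg \<tau> (x - y) = k * (ff \<tau> x * f1 \<tau> y)"
    by (rule u_partials_Dg[OF R(1-3) reg_nonzero(1-4)[OF r]])
  define l where "l = k * (ff \<tau> x * ff \<tau> y)"
  have l: "l \<noteq> 0" using k R by (simp add: l_def)
  define A B where "A = Dg \<tau> (x + y)" and "B = Dg \<tau> (x - y)"
  have AB: "A - B = l * D \<tau> x" "A + B = l * D \<tau> y" using k R(8,9) by (simp_all add: A_def B_def l_def mult_ac)
  have "l * (D \<tau> x - D \<tau> y) = (A - B) - (A + B)" "l * (- D \<tau> x - D \<tau> y) = - ((A - B) + (A + B))"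
    unfolding AB by (simp_all add: algebra_simps)
  hence "l * (D \<tau> x - D \<tau> y) = - 2 * B" "l * (- D \<tau> x - D \<tau> y) = - 2 * A" by simp_all
  moreover have "d = 2 / l * (- b)" if "l * d = - 2 * b" for d b
  proof -
    have "d = l * d / l" using l by simp
    thus ?thesis unfolding that by simp
  qed
  ultimately have AB': "D \<tau> x - D \<tau> y = 2 / l * (- B)" "- D \<tau> x - D \<tau> y = 2 / l * (- A)" by blast+
  have nz: "A \<noteq> 0" "B \<noteq> 0" using reg_Dg[OF r] by (simp_all add: A_def B_def)
  have E: "Ed \<tau> 0 (ll 0 (x, y)) = D \<tau> x" "Ed \<tau> (Suc 0) (ll (Suc 0) (x, y)) = D \<tau> y" "Ed \<tau> 2 (ll 2 (x, y)) = A" "Ed \<tau> 3 (ll 3 (x, y)) = B"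
    by (simp_all add: Ed_def ll_def A_def B_def)
  have e: "eps 0 = - 1" "eps (Suc 0) = 1" "eps 2 = - 1" "eps 3 = - 1" by (simp_all add: eps_def)
  show ?thesis
  proof (cases "i < 2")
    case True
    show ?thesis by (rule that[of 1]) (use ij True R(6,7) in \<open>auto simp: E e\<close>)
  next
    case False
    hence ij': "i = 2 \<and> j = 3 \<or> i = 3 \<and> j = 2" using ij by auto
    show ?thesis
      by (rule that[of "2 / l"]) (use ij' l nz AB' in \<open>auto simp: E e\<close>)
  qed
qed

text \<open>For i < 2 this is \<open>D_related_imp_modrel\<close>. Otherwise \<open>D_fricke\<close>
  rewrites \<open>Dg \<tau>\<close> as \<open>D\<close> for the parameter -2/\<tau>, and the same
  theorem applies to that parameter.\<close>

lemma D_proportional_imp_Grel: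
  assumes tau: "Im \<tau> > 0" and tau': "Im \<tau>' > 0" and "a \<noteq> 0" "K \<noteq> 0"
    and ev: "\<forall>\<^sub>F s in nhds s0. D \<tau>' (a * s + b) = K * Ed \<tau> i s"
  shows "Grel \<tau> \<tau>'"
proof (cases "i < 2")
  case True
  have "D_related \<tau> \<tau>' a b K" by (rule D_relatedI[OF tau tau' assms(3)]) (use ev True in \<open>simp add: Ed_def\<close>)
  from D_related_imp_modrel[OF tau tau' this assms(3,4)] show ?thesis by (simp add: Grel_def)
next
  case False
  have tau2: "Im (- 2 / \<tau>) > 0" by (rule Im_fricke[OF tau])
  obtain \<kappa> where k: "\<kappa> \<noteq> 0" and D1: "\<forall>t. D (- 2 / \<tau>) (- t / \<tau> - cpi / 2) = \<kappa> * Dg \<tau> t" using D_fricke[OF tau] by blast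
  have t0: "\<tau> \<noteq> 0" using tau by auto
  define g where "g = (\<lambda>r. - \<tau> * r - \<tau> * (cpi / 2))"
  have g: "- g r / \<tau> - cpi / 2 = r" for r
  proof -
    have "g r = \<tau> * (- r - cpi / 2)" by (simp add: g_def algebra_simps)
    thus ?thesis using t0 by simp
  qed
  have Dg: "Dg \<tau> (g r) = D (- 2 / \<tau>) r / \<kappa>" for r using D1[rule_format, of "g r"] k unfolding g by simp
  have c: "isCont g (- s0 / \<tau> - cpi / 2)" unfolding g_def by (intro continuous_intros)
  have "g (- s0 / \<tau> - cpi / 2) = s0" using t0 by (simp add: g_def right_diff_distrib)
  from isCont_eventually[OF c this ev]
  have "\<forall>\<^sub>F r in nhds (- s0 / \<tau> - cpi / 2). D \<tau>' ((- a * \<tau>) * r + (b - a * \<tau> * (cpi / 2))) = K / \<kappa> * D (- 2 / \<tau>) r"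
  proof eventually_elim
    case (elim r)
    have e: "(- a * \<tau>) * r + (b - a * \<tau> * (cpi / 2)) = a * g r + b" by (simp add: g_def algebra_simps)
    show ?case unfolding e using elim False by (simp add: Ed_def Dg)
  qed
  from D_relatedI[OF tau2 tau' _ this] have "D_related (- 2 / \<tau>) \<tau>' (- a * \<tau>) (b - a * \<tau> * (cpi / 2)) (K / \<kappa>)"
    using assms(3) t0 by simp
  from D_related_imp_modrel[OF tau2 tau' this] have "modrel (- 2 / \<tau>) \<tau>'" using assms(3,4) t0 k by simp
  thus ?thesis by (simp add: Grel_def)
qed

text \<open>The components of \<psi> depend on one pencil each, and so do their sum and difference;
  this forces them to be affine and the two pencils to form a harmonic pair. Comparing du with the
  pull-back of du' along the leaves of this pair then gives an equation with separated
  variables.\<close>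

theorem equivalent_imp_Grel:
  assumes tau: "Im \<tau> > 0" and tau': "Im \<tau>' > 0" and rp: "regular_at (u_theta \<tau>) p" and rp': "regular_at (u_theta \<tau>') p'"
    and eq: "equivalent_webs (theta_web \<tau>) p (theta_web \<tau>') p'"
  shows "Grel \<tau> \<tau>'"
proof -
  obtain \<psi> \<sigma> where \<psi>: "\<psi> p = p'" and ld: "local_diffeo_at \<psi> p" and \<sigma>: "bij_betw \<sigma> {..<5} {..<5}"
    and sf: "\<And>j. j < 5 \<Longrightarrow> same_foliation_at p (theta_web \<tau> ! j) (theta_web \<tau>' ! \<sigma> j \<circ> \<psi>)"
    using eq unfolding equivalent_webs_def maps_web_at_def length_T_web by blast
  obtain x0 y0 where p: "p = (x0, y0)" by (cases p)
  have r: "reg \<tau> x0 y0" using rp tau by (simp add: p reg_def)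
  have \<sigma>4: "\<sigma> 4 = 4"
    by (rule maps_web_fixes_u[OF r _ _ \<sigma>]) (use rp' ld sf in \<open>simp_all add: \<psi>[unfolded p] p\<close>)
  have ex: "\<exists>i<4. \<sigma> i = k" if "k < 4" for k
  proof -
    have "k \<in> \<sigma> ` {..<5}" using \<sigma> that by (simp add: bij_betw_def)
    then obtain i where "i < 5" "\<sigma> i = k" by auto
    moreover have "i \<noteq> 4" using \<open>\<sigma> i = k\<close> that \<sigma>4 by auto
    ultimately show ?thesis by (intro exI[of _ i]) simp
  qed
  obtain i0 where i0: "i0 < 4" "\<sigma> i0 = 0" using ex[of 0] by auto
  obtain i1 where i1: "i1 < 4" "\<sigma> i1 = Suc 0" using ex[of "Suc 0"] by auto
  obtain i2 where i2: "i2 < 4" "\<sigma> i2 = 2" using ex[of 2] by auto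
  obtain i3 where i3: "i3 < 4" "\<sigma> i3 = 3" using ex[of 3] by auto
  have dist: "distinct [i0, i1, i2, i3]" using i0 i1 i2 i3 by auto
  define X Y where "X = fst \<circ> \<psi>" and "Y = snd \<circ> \<psi>"
  have fac: "\<exists>h. h analytic_on {ll i p} \<and> (\<forall>\<^sub>F z in nhds p. (theta_web \<tau>' ! k \<circ> \<psi>) z = h (ll i z)) \<and>
      (\<forall>\<^sub>F z in nhds p. la k * dx X z + lb k * dx Y z = deriv h (ll i z) * la i \<and> la k * dy X z + lb k * dy Y z = deriv h (ll i z) * lb i)"
    if i: "i < 4" "\<sigma> i = k" and k: "k < 4" for i k
  proof -
    have s: "same_foliation_at p (theta_web \<tau> ! i) (theta_web \<tau>' ! k \<circ> \<psi>)" using sf[of i] i by simp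
    have nz: "dx (theta_web \<tau> ! i) p \<noteq> 0 \<or> dy (theta_web \<tau> ! i) p \<noteq> 0" using T0_partials[OF i(1)] la_lb_nonzero[OF i(1)] by simp
    obtain h where h: "h analytic_on {(theta_web \<tau> ! i) p}" "\<forall>\<^sub>F z in nhds p. (theta_web \<tau>' ! k \<circ> \<psi>) z = h ((theta_web \<tau> ! i) z)"
      "\<forall>\<^sub>F z in nhds p. dx (theta_web \<tau>' ! k \<circ> \<psi>) z = deriv h ((theta_web \<tau> ! i) z) * dx (theta_web \<tau> ! i) z \<and>
         dy (theta_web \<tau>' ! k \<circ> \<psi>) z = deriv h ((theta_web \<tau> ! i) z) * dy (theta_web \<tau> ! i) z"
      by (rule web_factor[OF s T0_partials(1)[OF i(1)] T0_comp_partials(1)[OF ld k] nz])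
    have "\<forall>\<^sub>F z in nhds p. la k * dx X z + lb k * dx Y z = deriv h (ll i z) * la i \<and> la k * dy X z + lb k * dy Y z = deriv h (ll i z) * lb i"
      using h(3) local_diffeoD(4)[OF ld]
    proof eventually_elim
      case (elim z)
      show ?case using elim(1) unfolding T0_comp_partials[OF elim(2) k] T0_partials[OF i(1)] X_def Y_def unfolding T_web_ll[OF i(1)] .
    qed
    thus ?thesis using h(1,2) unfolding T_web_ll[OF i(1)] by blast
  qed
  obtain h0 where h0: "h0 analytic_on {ll i0 p}" "\<forall>\<^sub>F z in nhds p. X z = h0 (ll i0 z)"
    "\<forall>\<^sub>F z in nhds p. dx X z = deriv h0 (ll i0 z) * la i0 \<and> dy X z = deriv h0 (ll i0 z) * lb i0"
    using fac[OF i0] by (auto simp: T_web_ll ll_def[of 0] X_def)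
  obtain h1 where h1: "h1 analytic_on {ll i1 p}" "\<forall>\<^sub>F z in nhds p. Y z = h1 (ll i1 z)"
    "\<forall>\<^sub>F z in nhds p. dx Y z = deriv h1 (ll i1 z) * la i1 \<and> dy Y z = deriv h1 (ll i1 z) * lb i1"
    using fac[OF i1] by (auto simp: T_web_ll ll_def[of "Suc 0"] Y_def)
  obtain h2 where h2: "\<forall>\<^sub>F z in nhds p. dx X z + dx Y z = deriv h2 (ll i2 z) * la i2 \<and> dy X z + dy Y z = deriv h2 (ll i2 z) * lb i2"
    using fac[OF i2] by auto
  obtain h3 where h3: "\<forall>\<^sub>F z in nhds p. dx X z - dx Y z = deriv h3 (ll i3 z) * la i3 \<and> dy X z - dy Y z = deriv h3 (ll i3 z) * lb i3"
    using fac[OF i3] by auto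
  define W where "W = (\<lambda>i j. la i * lb j - lb i * la j)"
  \<comment> \<open>The differential of X + Y is proportional to that of the form with index i2, so
    the determinant with the latter eliminates h2; in the same way X - Y and i3 eliminate
    h3.\<close>
  have rel: "\<forall>\<^sub>F z in nhds p. deriv h0 (ll i0 z) * W i0 i2 + deriv h1 (ll i1 z) * W i1 i2 = 0 \<and>
     deriv h0 (ll i0 z) * W i0 i3 - deriv h1 (ll i1 z) * W i1 i3 = 0"
    using h0(3) h1(3) h2 h3
  proof eventually_elim
    case (elim z)
    define \<alpha> \<beta> where "\<alpha> = deriv h0 (ll i0 z)" and "\<beta> = deriv h1 (ll i1 z)"
    have "\<alpha> * W i0 i2 + \<beta> * W i1 i2 = (\<alpha> * la i0 + \<beta> * la i1) * lb i2 - (\<alpha> * lb i0 + \<beta> * lb i1) * la i2"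
      "\<alpha> * W i0 i3 - \<beta> * W i1 i3 = (\<alpha> * la i0 - \<beta> * la i1) * lb i3 - (\<alpha> * lb i0 - \<beta> * lb i1) * la i3"
      by (simp_all add: W_def algebra_simps)
    moreover have "\<alpha> * la i0 + \<beta> * la i1 = deriv h2 (ll i2 z) * la i2" "\<alpha> * lb i0 + \<beta> * lb i1 = deriv h2 (ll i2 z) * lb i2"
      "\<alpha> * la i0 - \<beta> * la i1 = deriv h3 (ll i3 z) * la i3" "\<alpha> * lb i0 - \<beta> * lb i1 = deriv h3 (ll i3 z) * lb i3"
      using elim by (simp_all add: \<alpha>_def \<beta>_def)
    ultimately show ?case unfolding \<alpha>_def[symmetric] \<beta>_def[symmetric] by simp
  qed
  define a where "a = deriv h0 (ll i0 p)"
  define a' where "a' = deriv h1 (ll i1 p)"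
  have J: "dx X p * dy Y p - dy X p * dx Y p \<noteq> 0" using local_diffeoD(5)[OF ld] by (simp add: X_def Y_def)
  have nz: "a \<noteq> 0" "a' \<noteq> 0"
    using J eventually_nhds_x_imp_x[OF h0(3)] eventually_nhds_x_imp_x[OF h1(3)] by (auto simp: a_def a'_def)
  have Wnz: "W i0 i2 \<noteq> 0" "W i1 i2 \<noteq> 0" "i0 \<noteq> i1" "i1 \<noteq> i0"
    using la_lb_transversal i0 i1 i2 dist by (simp_all add: W_def)
  have pairs: "i0 = 0 \<and> i1 = Suc 0 \<or> i0 = Suc 0 \<and> i1 = 0 \<or> i0 = 2 \<and> i1 = 3 \<or> i0 = 3 \<and> i1 = 2"
  proof (rule harmonic_pairs[OF i0(1) i1(1) i2(1) i3(1) dist], unfold W_def[symmetric, THEN fun_cong, THEN fun_cong])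
    have e: "a * W i0 i2 + a' * W i1 i2 = 0" "a * W i0 i3 - a' * W i1 i3 = 0"
      using eventually_nhds_x_imp_x[OF rel] by (simp_all add: a_def a'_def)
    have "a * a' * (W i0 i2 * W i1 i3 + W i0 i3 * W i1 i2)
       = (a * W i0 i2 + a' * W i1 i2) * (a' * W i1 i3) + (a * W i0 i3 - a' * W i1 i3) * (a' * W i1 i2)"
      by (simp add: algebra_simps)
    thus "W i0 i2 * W i1 i3 + W i0 i3 * W i1 i2 = 0" unfolding e using nz by simp
  qed
  have rel': "\<forall>\<^sub>F z in nhds p. deriv h0 (ll i0 z) * W i0 i2 + deriv h1 (ll i1 z) * W i1 i2 = 0"
    using rel by eventually_elim simp
  \<comment> \<open>The relation is a sum of a function of \<open>ll i0\<close> and a function of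
    \<open>ll i1\<close>. Fixing the second coordinate shows that the first summand is
    constant.\<close>
  have c0: "\<forall>\<^sub>F s in nhds (ll i0 p). deriv h0 s = a"
    using pair_eventually[OF i0(1) i1(1) Wnz(3), where P = "\<lambda>s t. deriv h0 s * W i0 i2 + deriv h1 t * W i1 i2 = 0", OF rel']
  proof eventually_elim
    case (elim s)
    have "(deriv h0 s - a) * W i0 i2 = (deriv h0 s * W i0 i2 + deriv h1 (ll i1 p) * W i1 i2) - (a * W i0 i2 + deriv h1 (ll i1 p) * W i1 i2)"
      by (simp add: algebra_simps)
    also have "\<dots> = 0" using elim eventually_nhds_x_imp_x[OF rel'] by (simp add: a_def)
    finally show ?case using Wnz by simp
  qed
  have rel'': "\<forall>\<^sub>F z in nhds p. (\<lambda>t s. deriv h0 s * W i0 i2 + deriv h1 t * W i1 i2 = 0) (ll i1 z) (ll i0 z)"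
    using rel' by simp
  have c1: "\<forall>\<^sub>F s in nhds (ll i1 p). deriv h1 s = a'"
    using pair_eventually[OF i1(1) i0(1) Wnz(4) rel'']
  proof eventually_elim
    case (elim s)
    have "(deriv h1 s - a') * W i1 i2 = (deriv h0 (ll i0 p) * W i0 i2 + deriv h1 s * W i1 i2) - (deriv h0 (ll i0 p) * W i0 i2 + a' * W i1 i2)"
      by (simp add: algebra_simps)
    also have "\<dots> = 0" using elim eventually_nhds_x_imp_x[OF rel'] by (simp add: a'_def)
    finally show ?case using Wnz by simp
  qed
  obtain b where b: "\<forall>\<^sub>F s in nhds (ll i0 p). h0 s = a * s + b" by (rule deriv_const_imp_affine[OF h0(1) c0])
  obtain b' where b': "\<forall>\<^sub>F s in nhds (ll i1 p). h1 s = a' * s + b'" by (rule deriv_const_imp_affine[OF h1(1) c1])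
  have cl: "isCont (ll i) p" for i unfolding ll_def by (intro continuous_intros)
  define v where "v = u_theta \<tau>' \<circ> \<psi>"
  have hv: "holo2_at v p"
    unfolding v_def by (rule holo2_compose(1)) (use rp' \<psi> local_diffeoD[OF ld] in \<open>simp_all add: regular_at_def\<close>)
  have sfu: "same_foliation_at p (u_theta \<tau>) v" using sf[of 4] by (simp add: T_web_nth(2) \<sigma>4 v_def)
  have hu: "holo2_at (u_theta \<tau>) p" "dx (u_theta \<tau>) p \<noteq> 0 \<or> dy (u_theta \<tau>) p \<noteq> 0"
    using rp by (auto simp: regular_at_def cond_T_def)
  obtain h4 where h4: "\<forall>\<^sub>F z in nhds p. dx v z = deriv h4 (u_theta \<tau> z) * dx (u_theta \<tau>) z \<and> dy v z = deriv h4 (u_theta \<tau> z) * dy (u_theta \<tau>) z"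
    by (rule web_factor[OF sfu hu(1) hv hu(2)])
  have r'ev: "\<forall>\<^sub>F z in nhds p. regular_at (u_theta \<tau>') (\<psi> z)"
    by (rule isCont_eventually[OF local_diffeoD(3)[OF ld] \<psi> regular_at_eventually[OF rp']])
  have rev: "\<forall>\<^sub>F z in nhds p. reg \<tau> (fst z) (snd z)" using reg_eventually[OF r] by (simp add: p)
  \<comment> \<open>The proportionality of the two differentials, with s and t the coordinates along
    the pencils i0 and i1. After division, one side depends on s alone and the other on t
    alone.\<close>
  define P where "P = (\<lambda>s t. D \<tau>' (a * s + b) \<noteq> 0 \<and> D \<tau>' (a' * t + b') \<noteq> 0 \<and> Ed \<tau> i1 t \<noteq> 0 \<and> 
     a * D \<tau>' (a * s + b) * (eps i0 * Ed \<tau> i1 t) = - (a' * D \<tau>' (a' * t + b') * (eps i1 * Ed \<tau> i0 s)))"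
  have Pev: "\<forall>\<^sub>F z in nhds p. P (ll i0 z) (ll i1 z)"
    using h0(2,3) h1(2,3) isCont_eventually[OF cl refl b] isCont_eventually[OF cl refl b'] isCont_eventually[OF cl refl c0] isCont_eventually[OF cl refl c1]
      h4 r'ev rev local_diffeoD(4)[OF ld]
  proof eventually_elim
    case (elim z)
    obtain x y where z: "z = (x, y)" by (cases z)
    define X0 Y0 where "X0 = a * ll i0 z + b" and "Y0 = a' * ll i1 z + b'"
    have XY: "X z = X0" "Y z = Y0" using elim by (simp_all add: X0_def Y0_def)
    have \<psi>z: "\<psi> z = (X0, Y0)" using XY by (simp add: X_def Y_def prod_eq_iff)
    have rz: "reg \<tau> x y" using elim by (simp add: z)
    have r': "reg \<tau>' X0 Y0" using elim tau' by (simp add: reg_def \<psi>z)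
    note R = regD[OF rz] and R' = regD[OF r']
    have d: "dx X z = a * la i0" "dy X z = a * lb i0" "dx Y z = a' * la i1" "dy Y z = a' * lb i1" using elim by simp_all
    have ld: "local_diffeo_at \<psi> z" using elim by simp
    have hu': "holo2_at (u_theta \<tau>') (\<psi> z)" using elim by (simp add: regular_at_def)
    define M where "M = ff \<tau>' X0 * ff \<tau>' Y0"
    have M: "M \<noteq> 0" using R' by (simp add: M_def)
    have u': "dx (u_theta \<tau>') (\<psi> z) = M * D \<tau>' X0" "dy (u_theta \<tau>') (\<psi> z) = M * D \<tau>' Y0"
      unfolding \<psi>z u_theta_partials[OF R'(1-3)] using R'(8,9) by (simp_all add: f1_def M_def)
    define N where "N = ff \<tau> x * ff \<tau> y"
    have N: "N \<noteq> 0" using R by (simp add: N_def)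
    have u: "dx (u_theta \<tau>) z = N * D \<tau> x" "dy (u_theta \<tau>) z = N * D \<tau> y"
      unfolding z u_theta_partials[OF R(1-3)] using R(8,9) by (simp_all add: f1_def N_def)
    note hc = holo2_compose(2,3)[where v = "u_theta \<tau>'" and \<psi> = \<psi> and p = z, OF hu' local_diffeoD(1,2)[OF ld], folded X_def Y_def v_def, unfolded u' d]
    have "dx (u_theta \<tau>) z * dy v z = dy (u_theta \<tau>) z * dx v z" using elim by simp
    hence "N * M * (D \<tau> x * (a * D \<tau>' X0 * lb i0 + a' * D \<tau>' Y0 * lb i1)) = N * M * (D \<tau> y * (a * D \<tau>' X0 * la i0 + a' * D \<tau>' Y0 * la i1))"
      unfolding u hc by (simp add: algebra_simps)
    hence e: "D \<tau> x * (a * D \<tau>' X0 * lb i0 + a' * D \<tau>' Y0 * lb i1) = D \<tau> y * (a * D \<tau>' X0 * la i0 + a' * D \<tau>' Y0 * la i1)"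
      using M N by simp
    obtain m where m: "m \<noteq> 0" "D \<tau> x * lb i0 - D \<tau> y * la i0 = m * (eps i0 * Ed \<tau> i1 (ll i1 (x, y)))"
      "D \<tau> x * lb i1 - D \<tau> y * la i1 = m * (eps i1 * Ed \<tau> i0 (ll i0 (x, y)))" "Ed \<tau> i0 (ll i0 (x, y)) \<noteq> 0" "Ed \<tau> i1 (ll i1 (x, y)) \<noteq> 0"
      by (rule reg_conjugate_directions[OF rz pairs])
    have "a * D \<tau>' X0 * (D \<tau> x * lb i0 - D \<tau> y * la i0) + a' * D \<tau>' Y0 * (D \<tau> x * lb i1 - D \<tau> y * la i1)
      = D \<tau> x * (a * D \<tau>' X0 * lb i0 + a' * D \<tau>' Y0 * lb i1) - D \<tau> y * (a * D \<tau>' X0 * la i0 + a' * D \<tau>' Y0 * la i1)"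
      by (simp add: algebra_simps)
    hence "a * D \<tau>' X0 * (D \<tau> x * lb i0 - D \<tau> y * la i0) + a' * D \<tau>' Y0 * (D \<tau> x * lb i1 - D \<tau> y * la i1) = 0" unfolding e by simp
    hence "m * (a * D \<tau>' X0 * (eps i0 * Ed \<tau> i1 (ll i1 z)) + a' * D \<tau>' Y0 * (eps i1 * Ed \<tau> i0 (ll i0 z))) = 0"
      unfolding m(2,3) by (simp add: z algebra_simps)
    hence "a * D \<tau>' X0 * (eps i0 * Ed \<tau> i1 (ll i1 z)) = - (a' * D \<tau>' Y0 * (eps i1 * Ed \<tau> i0 (ll i0 z)))"
      using m(1) by (simp add: eq_neg_iff_add_eq_0)
    thus ?case using R'(6,7) m(5) unfolding P_def X0_def Y0_def by (simp add: z)
  qed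
  \<comment> \<open>With t frozen at its value at p, the separated equation becomes the
    proportionality of \<open>D \<tau>'\<close> and \<open>Ed \<tau> i0\<close> with the constant
    K.\<close>
  define t where "t = ll i1 p"
  have P0: "P (ll i0 p) t" unfolding t_def by (rule eventually_nhds_x_imp_x[OF Pev])
  define K where "K = - (a' * D \<tau>' (a' * t + b') * eps i1) / (a * eps i0 * Ed \<tau> i1 t)"
  have eps: "eps i0 \<noteq> 0" "eps i1 \<noteq> 0" using pairs by (auto simp: eps_def)
  have K: "K \<noteq> 0" using P0 nz eps by (simp add: P_def K_def)
  have "\<forall>\<^sub>F s in nhds (ll i0 p). D \<tau>' (a * s + b) = K * Ed \<tau> i0 s"
    using pair_eventually[OF i0(1) i1(1) Wnz(3), of P, OF Pev]
  proof eventually_elim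
    case (elim s)
    have q: "a * eps i0 * Ed \<tau> i1 t \<noteq> 0" using P0 nz eps by (simp add: P_def)
    have "D \<tau>' (a * s + b) * (a * eps i0 * Ed \<tau> i1 t) = - (a' * D \<tau>' (a' * t + b') * eps i1) * Ed \<tau> i0 s"
      using elim unfolding P_def t_def by (simp add: mult_ac)
    moreover have "d = e * f / q" if "d * q = e * f" "q \<noteq> 0" for d e f q :: complex
      unfolding that(1)[symmetric] using that(2) by simp
    ultimately have "D \<tau>' (a * s + b) = (- (a' * D \<tau>' (a' * t + b') * eps i1) * Ed \<tau> i0 s) / (a * eps i0 * Ed \<tau> i1 t)"
      using q by blast
    thus ?case by (simp add: K_def)
  qed
  from D_proportional_imp_Grel[OF tau tau' nz(1) K this] show ?thesis .
qed

theorem mainTheorem1: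
  shows
    "(\<forall>\<tau>\<in>upper_half_plane. \<forall>p.
        regular_at (u_theta \<tau>) p \<longrightarrow> exceptional_at (T_web (u_theta \<tau>)) p)
     \<and>
     (\<forall>\<tau>\<in>upper_half_plane. \<forall>\<tau>'\<in>upper_half_plane.
        ((\<exists>p p'. regular_at (u_theta \<tau>) p \<and> regular_at (u_theta \<tau>') p' \<and>
                 equivalent_webs (T_web (u_theta \<tau>)) p (T_web (u_theta \<tau>')) p')
           \<longleftrightarrow> G_congruent \<tau> \<tau>')
        \<and>
        (G_congruent \<tau> \<tau>' \<longrightarrow>
           (\<exists>\<phi>\<in>Sym_T0.
              (\<forall>p. holo2_at (u_theta \<tau>) p \<and> holo2_at (u_theta \<tau>') (\<phi> p) \<longrightarrow>
                   wedge (u_theta \<tau>) (u_theta \<tau>' \<circ> \<phi>) p = 0) \<and>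
              (\<forall>p. regular_at (u_theta \<tau>) p \<and> regular_at (u_theta \<tau>') (\<phi> p) \<longrightarrow>
                   maps_web_at \<phi> p (T_web (u_theta \<tau>)) (T_web (u_theta \<tau>')))))
        \<and>
        (\<forall>p p'. regular_at (u_theta \<tau>) p \<and> regular_at (u_theta \<tau>') p' \<and>
                equivalent_webs (T_web (u_theta \<tau>)) p (T_web (u_theta \<tau>')) p'
           \<longrightarrow> G_congruent \<tau> \<tau>'))"
proof (intro conjI ballI allI impI)
  fix \<tau> p assume "\<tau> \<in> upper_half_plane" "regular_at (u_theta \<tau>) p"
  thus "exceptional_at (theta_web \<tau>) p" by (simp add: u_theta_exceptional UHP_iff)
next
  fix \<tau> \<tau>' assume tau: "\<tau> \<in> upper_half_plane" "\<tau>' \<in> upper_half_plane"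
  hence im: "Im \<tau> > 0" "Im \<tau>' > 0" by (simp_all add: UHP_iff)
  show only_if: "G_congruent \<tau> \<tau>'" if "regular_at (u_theta \<tau>) p \<and> regular_at (u_theta \<tau>') p' \<and>
      equivalent_webs (theta_web \<tau>) p (theta_web \<tau>') p'" for p p'
    unfolding G_congruent_iff_Grel[OF tau(1)] using equivalent_imp_Grel[OF im] that by blast
  have if_part: "\<exists>\<phi>. web_symmetry \<tau> \<tau>' \<phi>" if "G_congruent \<tau> \<tau>'"
    by (rule Grel_imp_equivalence[OF im that[unfolded G_congruent_iff_Grel[OF tau(1)]]])
  show "\<exists>\<phi>\<in>Sym_T0. (\<forall>p. holo2_at (u_theta \<tau>) p \<and> holo2_at (u_theta \<tau>') (\<phi> p) \<longrightarrow> wedge (u_theta \<tau>) (u_theta \<tau>' \<circ> \<phi>) p = 0) \<and>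
     (\<forall>p. regular_at (u_theta \<tau>) p \<and> regular_at (u_theta \<tau>') (\<phi> p) \<longrightarrow> maps_web_at \<phi> p (theta_web \<tau>) (theta_web \<tau>'))"
    if "G_congruent \<tau> \<tau>'"
    using if_part[OF that] unfolding web_symmetry_def by blast
  show "(\<exists>p p'. regular_at (u_theta \<tau>) p \<and> regular_at (u_theta \<tau>') p' \<and>
      equivalent_webs (theta_web \<tau>) p (theta_web \<tau>') p') \<longleftrightarrow> G_congruent \<tau> \<tau>'"
  proof
    assume "\<exists>p p'. regular_at (u_theta \<tau>) p \<and> regular_at (u_theta \<tau>') p' \<and> equivalent_webs (theta_web \<tau>) p (theta_web \<tau>') p'"
    thus "G_congruent \<tau> \<tau>'" using only_if by (elim exE)
  next
    assume "G_congruent \<tau> \<tau>'"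
    then obtain \<phi> where \<phi>: "web_symmetry \<tau> \<tau>' \<phi>" using if_part by blast
    \<comment> \<open>The relation between parameters yields equivalent germs only if there is a
      regular point at which to take them; its image under \<phi> is again regular.\<close>
    obtain x y where "reg \<tau> x y" by (rule exists_reg[OF im(1)])
    hence r: "regular_at (u_theta \<tau>) (x, y)" by (simp add: reg_def)
    hence r': "regular_at (u_theta \<tau>') (\<phi> (x, y))" using \<phi> by (simp add: web_symmetry_def)
    have "equivalent_webs (theta_web \<tau>) (x, y) (theta_web \<tau>') (\<phi> (x, y))"
      unfolding equivalent_webs_def using \<phi> r by (intro exI[of _ \<phi>]) (simp add: web_symmetry_def)
    thus "\<exists>p p'. regular_at (u_theta \<tau>) p \<and> regular_at (u_theta \<tau>') p' \<and>
      equivalent_webs (theta_web \<tau>) p (theta_web \<tau>') p'" using r r' by (intro exI conjI)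
  qed
qed

end
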